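(* Let $\varepsilon_n\searrow0$ and let $\{w_n\}\subset L^2(\mathbb{T}^2)$ be functions with vanishing mean in $x_1$ and $\partial_1w_n\in L^2(\mathbb{T}^2)$, such that $$w_n\to w\quad\text{in }L^3(\mathbb{T}^2)$$ for some $w\in(BV\cap L^\infty)(\mathbb{T}^2)$. Then $$\liminf_{n\to\infty}\mathcal{E}_{\varepsilon_n}(w_n)\ \ge\ \int_{J_w}\frac{|w^+-w^-|^3}{12\sqrt{1+\frac14(w^++w^-)^2}}\,d\mathcal{H}^1.$$
   Context: $\mathbb{T}^2=[0,1)^2$ is the flat torus with Lebesgue measure; functions are real valued and 1-periodic in each variable. Fourier coefficients $\widehat f(k)$ are indexed by $k=(k_1,k_2)\in(2\pi\mathbb{Z})^2$. A periodic distribution $f$ on $\mathbb{T}^2$ has vanishing mean in $x_1$ if $\widehat f(k)=0$ for all $k\in(2\pi\mathbb{Z})^2$ with $k_1=0$ (for integrable functions: $\int_0^1 f(x_1,x_2)\,dx_1=0$ for a.e. $x_2$). For such $f$, $|\partial_1|^{-1}f$ is defined by $\widehat{|\partial_1|^{-1}f}(k)=|k_1|^{-1}\widehat f(k)$ for $k_1\ne0$ (and $0$ for $k_1=0$). For $v\in L^2(\mathbb{T}^2)$ with vanishing mean in $x_1$ and $\varepsilon>0$, put $\eta_v=\partial_2v-\partial_1\tfrac12v^2$ (a distribution with vanishing mean in $x_1$) and $$\mathcal{E}_\varepsilon(v)=\frac12\int_{\mathbb{T}^2}\frac1\varepsilon(|\partial_1|^{-1}\eta_v)^2+\varepsilon(\partial_1v)^2\,dx\in[0,\infty],$$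 equal to $+\infty$ if $|\partial_1|^{-1}\eta_v$ or $\partial_1v$ is not in $L^2(\mathbb{T}^2)$. For $w\in BV(\mathbb{T}^2)$, $J_w$ denotes the ($\mathcal{H}^1$-rectifiable) jump set of $w$, $w^\pm$ the traces of $w$ on the two sides of $J_w$, and $\mathcal{H}^1$ the one-dimensional Hausdorff measure. *)

theory Defs
  imports "HOL-Analysis.Analysis"
begin

section \<open>Functions and test functions on the flat torus\<close>

text \<open>Functions on the torus are functions on the plane that are 1-periodic in each variable;
  integrals are taken over the fundamental domain. Almost-everywhere classes are
  handled by working with (everywhere periodic, Lebesgue measurable) representatives.\<close>

definition unit_square :: "(real \<times> real) set" where
  "unit_square = {0..<1} \<times> {0..<1}"

abbreviation torus :: "(real \<times> real) measure" where
  "torus \<equiv> lebesgue_on unit_square"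

definition periodic :: "(real \<times> real \<Rightarrow> 'b) \<Rightarrow> bool" where
  "periodic f \<longleftrightarrow> (\<forall>x y. f (x + 1, y) = f (x, y) \<and> f (x, y + 1) = f (x, y))"

definition Lp_torus :: "nat \<Rightarrow> (real \<times> real \<Rightarrow> real) \<Rightarrow> bool" where
  "Lp_torus p f \<longleftrightarrow> periodic f \<and> f \<in> borel_measurable torus \<and> integrable torus (\<lambda>x. \<bar>f x\<bar> ^ p)"

definition Linf_torus :: "(real \<times> real \<Rightarrow> real) \<Rightarrow> bool" where
  "Linf_torus f \<longleftrightarrow> periodic f \<and> f \<in> borel_measurable torus \<and> (\<exists>M. AE x in torus. \<bar>f x\<bar> \<le> M)"

text \<open>The \<open>p\<close>-th power of the \<open>L\<^sup>p\<close> distance tends to 0.\<close>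

definition tendsto_Lp_torus :: "nat \<Rightarrow> (nat \<Rightarrow> real \<times> real \<Rightarrow> real) \<Rightarrow> (real \<times> real \<Rightarrow> real) \<Rightarrow> bool" where
  "tendsto_Lp_torus p f g \<longleftrightarrow> (\<forall>n. Lp_torus p (f n)) \<and> Lp_torus p g \<and>
     (\<lambda>n. \<integral>x. \<bar>f n x - g x\<bar> ^ p \<partial>torus) \<longlonglongrightarrow> 0"

definition pd1 :: "(real \<times> real \<Rightarrow> 'b::real_normed_vector) \<Rightarrow> real \<times> real \<Rightarrow> 'b" where
  "pd1 f = (\<lambda>(x, y). vector_derivative (\<lambda>t. f (t, y)) (at x))"

definition pd2 :: "(real \<times> real \<Rightarrow> 'b::real_normed_vector) \<Rightarrow> real \<times> real \<Rightarrow> 'b" where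
  "pd2 f = (\<lambda>(x, y). vector_derivative (\<lambda>t. f (x, t)) (at y))"

primrec Ck_plane :: "nat \<Rightarrow> (real \<times> real \<Rightarrow> 'b::real_normed_vector) \<Rightarrow> bool" where
  "Ck_plane 0 f \<longleftrightarrow> continuous_on UNIV f"
| "Ck_plane (Suc k) f \<longleftrightarrow> f differentiable_on UNIV \<and> Ck_plane k (pd1 f) \<and> Ck_plane k (pd2 f)"

definition test_functions :: "(real \<times> real \<Rightarrow> 'b::real_normed_vector) set" where
  "test_functions = {\<phi>. periodic \<phi> \<and> (\<forall>k. Ck_plane k \<phi>)}"


section \<open>Periodic distributions\<close>

text \<open>A periodic distribution is a functional on the complex-valued test functions (only its values
  on \<^term>\<open>test_functions\<close> matter). All distributions below are built from integrable functions
  by the operations that follow, so linearity and continuity need not be imposed.\<close>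

type_synonym pdistr = "(real \<times> real \<Rightarrow> complex) \<Rightarrow> complex"

definition distr_of :: "(real \<times> real \<Rightarrow> real) \<Rightarrow> pdistr" where
  "distr_of f \<phi> = (\<integral>x. of_real (f x) * \<phi> x \<partial>torus)"

definition distr_pd1 :: "pdistr \<Rightarrow> pdistr" where
  "distr_pd1 T \<phi> = - T (pd1 \<phi>)"

definition distr_pd2 :: "pdistr \<Rightarrow> pdistr" where
  "distr_pd2 T \<phi> = - T (pd2 \<phi>)"

definition freqs :: "(real \<times> real) set" where
  "freqs = {(2 * pi * of_int m, 2 * pi * of_int n) | m n :: int. True}"

definition fourier :: "pdistr \<Rightarrow> real \<times> real \<Rightarrow> complex" where
  "fourier T k = T (\<lambda>x. cis (- (k \<bullet> x)))"

definition vanishing_mean1 :: "pdistr \<Rightarrow> bool" where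
  "vanishing_mean1 T \<longleftrightarrow> (\<forall>k\<in>freqs. fst k = 0 \<longrightarrow> fourier T k = 0)"

text \<open>\<open>is_inv_abs_pd1 T S\<close> says that \<open>S\<close> is the distribution \<open>|\<partial>\<^sub>1|\<^sup>-\<^sup>1 T\<close>; a periodic distribution is
  determined by its Fourier coefficients.\<close>

definition is_inv_abs_pd1 :: "pdistr \<Rightarrow> pdistr \<Rightarrow> bool" where
  "is_inv_abs_pd1 T S \<longleftrightarrow> (\<forall>k\<in>freqs. fourier S k =
     (if fst k = 0 then 0 else of_real (inverse \<bar>fst k\<bar>) * fourier T k))"

definition is_weak_pd1 :: "(real \<times> real \<Rightarrow> real) \<Rightarrow> (real \<times> real \<Rightarrow> real) \<Rightarrow> bool" where
  "is_weak_pd1 v h \<longleftrightarrow> (\<forall>\<phi>\<in>test_functions. distr_pd1 (distr_of v) \<phi> = distr_of h \<phi>)"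


section \<open>The energy\<close>

definition eta :: "(real \<times> real \<Rightarrow> real) \<Rightarrow> pdistr" where
  "eta v \<phi> = distr_pd2 (distr_of v) \<phi> - distr_pd1 (distr_of (\<lambda>x. 1/2 * (v x)\<^sup>2)) \<phi>"

definition inv_abs_pd1_eta_in_L2 :: "(real \<times> real \<Rightarrow> real) \<Rightarrow> (real \<times> real \<Rightarrow> real) \<Rightarrow> bool" where
  "inv_abs_pd1_eta_in_L2 v g \<longleftrightarrow> Lp_torus 2 g \<and> is_inv_abs_pd1 (eta v) (distr_of g)"

definition weak_pd1_in_L2 :: "(real \<times> real \<Rightarrow> real) \<Rightarrow> (real \<times> real \<Rightarrow> real) \<Rightarrow> bool" where
  "weak_pd1_in_L2 v h \<longleftrightarrow> Lp_torus 2 h \<and> is_weak_pd1 v h"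

text \<open>The chosen \<open>g\<close> and \<open>h\<close> are unique up to null sets.\<close>

definition energy :: "real \<Rightarrow> (real \<times> real \<Rightarrow> real) \<Rightarrow> ennreal" where
  "energy \<epsilon> v =
     (if (\<exists>g. inv_abs_pd1_eta_in_L2 v g) \<and> (\<exists>h. weak_pd1_in_L2 v h) then
        (let g = (SOME g. inv_abs_pd1_eta_in_L2 v g); h = (SOME h. weak_pd1_in_L2 v h)
         in ennreal (1/2 * (\<integral>x. 1/\<epsilon> * (g x)\<^sup>2 + \<epsilon> * (h x)\<^sup>2 \<partial>torus)))
      else \<infinity>)"


section \<open>Functions of bounded variation and their jump sets\<close>

text \<open>The value at \<open>\<phi> = 0\<close> is 0, so truncating negative values by \<^term>\<open>ennreal\<close> is harmless.\<close>

definition total_variation :: "(real \<times> real \<Rightarrow> real) \<Rightarrow> ennreal" where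
  "total_variation w =
     (SUP (\<phi>1, \<phi>2) \<in> {(\<phi>1, \<phi>2). \<phi>1 \<in> test_functions \<and> \<phi>2 \<in> test_functions \<and>
                              (\<forall>x. (\<phi>1 x)\<^sup>2 + (\<phi>2 x)\<^sup>2 \<le> 1)}.
        ennreal (\<integral>x. w x * (pd1 \<phi>1 x + pd2 \<phi>2 x) \<partial>torus))"

definition BV_torus :: "(real \<times> real \<Rightarrow> real) \<Rightarrow> bool" where
  "BV_torus w \<longleftrightarrow> Lp_torus 1 w \<and> total_variation w < \<infinity>"

definition half_ball :: "real \<times> real \<Rightarrow> real \<Rightarrow> real \<times> real \<Rightarrow> (real \<times> real) set" where
  "half_ball x r \<nu> = {y \<in> ball x r. (y - x) \<bullet> \<nu> > 0}"

definition one_sided_approx_limit ::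
  "(real \<times> real \<Rightarrow> real) \<Rightarrow> real \<times> real \<Rightarrow> real \<times> real \<Rightarrow> real \<Rightarrow> bool" where
  "one_sided_approx_limit w x \<nu> a \<longleftrightarrow>
     ((\<lambda>r. (\<integral>\<^sup>+y\<in>half_ball x r \<nu>. ennreal \<bar>w y - a\<bar> \<partial>lebesgue) / emeasure lebesgue (half_ball x r \<nu>))
        \<longlongrightarrow> 0) (at_right 0)"

definition are_traces :: "(real \<times> real \<Rightarrow> real) \<Rightarrow> real \<times> real \<Rightarrow> real \<times> real \<Rightarrow> real \<Rightarrow> real \<Rightarrow> bool" where
  "are_traces w x \<nu> a b \<longleftrightarrow> norm \<nu> = 1 \<and> a \<noteq> b \<and>
     one_sided_approx_limit w x \<nu> a \<and> one_sided_approx_limit w x (- \<nu>) b"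

definition jump_set :: "(real \<times> real \<Rightarrow> real) \<Rightarrow> (real \<times> real) set" where
  "jump_set w = {x \<in> unit_square. \<exists>\<nu> a b. are_traces w x \<nu> a b}"

text \<open>The normal is determined up to its sign, a change of which swaps the two traces; the traces
  are therefore only used in expressions that are symmetric in them.\<close>

definition jump_normal :: "(real \<times> real \<Rightarrow> real) \<Rightarrow> real \<times> real \<Rightarrow> real \<times> real" where
  "jump_normal w x = (SOME \<nu>. \<exists>a b. are_traces w x \<nu> a b)"

definition trace_plus :: "(real \<times> real \<Rightarrow> real) \<Rightarrow> real \<times> real \<Rightarrow> real" where
  "trace_plus w x = (THE a. one_sided_approx_limit w x (jump_normal w x) a)"

definition trace_minus :: "(real \<times> real \<Rightarrow> real) \<Rightarrow> real \<times> real \<Rightarrow> real" where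
  "trace_minus w x = (THE b. one_sided_approx_limit w x (- jump_normal w x) b)"


section \<open>One-dimensional Hausdorff measure\<close>

definition hausdorff1_pre :: "real \<Rightarrow> 'a::metric_space set \<Rightarrow> ennreal" where
  "hausdorff1_pre \<delta> A =
     (INF C \<in> {C :: nat \<Rightarrow> 'a set. A \<subseteq> (\<Union>i. C i) \<and> (\<forall>i. bounded (C i) \<and> diameter (C i) \<le> \<delta>)}.
        \<Sum>i. ennreal (diameter (C i)))"

definition hausdorff1_outer :: "'a::metric_space set \<Rightarrow> ennreal" where
  "hausdorff1_outer A = (SUP \<delta>\<in>{0<..}. hausdorff1_pre \<delta> A)"

definition hausdorff1 :: "'a::metric_space measure" where
  "hausdorff1 = measure_of UNIV (lambda_system UNIV UNIV hausdorff1_outer) hausdorff1_outer"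

text \<open>\<^const>\<open>measure_of\<close> yields the zero measure unless its arguments form a measure space; the
  following facts show that they do.\<close>

lemma hausdorff1_pre_eq_outer_measure:
  fixes A :: "'a::metric_space set"
  assumes "\<delta> > 0"
  shows "hausdorff1_pre \<delta> A = outer_measure UNIV
     (\<lambda>C. if bounded C \<and> diameter C \<le> \<delta> then ennreal (diameter C) else \<infinity>) A"
    (is "_ = outer_measure UNIV ?f A")
proof (rule antisym)
  show "hausdorff1_pre \<delta> A \<le> outer_measure UNIV ?f A"
    unfolding outer_measure_def
  proof (rule INF_greatest, clarsimp)
    fix C :: "nat \<Rightarrow> 'a set" assume C: "disjoint_family C" "A \<subseteq> (\<Union>i. C i)"
    show "hausdorff1_pre \<delta> A \<le> (\<Sum>i. ?f (C i))"
    proof (cases "\<forall>i. bounded (C i) \<and> diameter (C i) \<le> \<delta>")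
      case True
      then have "hausdorff1_pre \<delta> A \<le> (\<Sum>i. ennreal (diameter (C i)))"
        unfolding hausdorff1_pre_def using C by (intro INF_lower) auto
      with True show ?thesis by simp
    next
      case False
      then obtain i where "\<not> (bounded (C i) \<and> diameter (C i) \<le> \<delta>)" by blast
      then have i: "?f (C i) = \<infinity>" by simp
      define F where "F = (\<lambda>i. ?f (C i))"
      have "F i \<le> suminf F"
        using sum_le_suminf[OF summableI, of "{i}" F] by simp
      moreover have "F i = top" using i unfolding F_def by simp
      ultimately have "suminf F = top" by (simp add: top_unique)
      then show ?thesis unfolding F_def by (metis top_greatest)
    qed
  qed
next
  show "outer_measure UNIV ?f A \<le> hausdorff1_pre \<delta> A"
    unfolding hausdorff1_pre_def
  proof (rule INF_greatest, clarsimp)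
    fix C :: "nat \<Rightarrow> 'a set"
    assume C: "A \<subseteq> (\<Union>i. C i)" "\<forall>i. bounded (C i) \<and> diameter (C i) \<le> \<delta>"
    have sub: "disjointed C i \<subseteq> C i" for i by (rule disjointed_subset)
    have dia: "diameter (disjointed C i) \<le> diameter (C i)" for i
      using C sub by (simp add: diameter_subset)
    have fin: "bounded (disjointed C i) \<and> diameter (disjointed C i) \<le> \<delta>" for i
      using C dia[of i] sub[of i] by (meson bounded_subset order_trans)
    have "outer_measure UNIV ?f A \<le> (\<Sum>i. ?f (disjointed C i))"
      unfolding outer_measure_def
      by (rule INF_lower) (use C in \<open>auto simp: disjoint_family_disjointed UN_disjointed_eq\<close>)
    also have "\<dots> \<le> (\<Sum>i. ennreal (diameter (C i)))"
      by (intro suminf_le allI summableI) (use fin dia in \<open>simp add: ennreal_leI\<close>)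
    finally show "outer_measure UNIV ?f A \<le> (\<Sum>i. ennreal (diameter (C i)))" .
  qed
qed

lemma outer_measure_space_hausdorff1_pre:
  assumes "\<delta> > 0"
  shows "outer_measure_space UNIV (hausdorff1_pre \<delta> :: 'a::metric_space set \<Rightarrow> ennreal)"
proof -
  let ?f = "\<lambda>C::'a set. if bounded C \<and> diameter C \<le> \<delta> then ennreal (diameter C) else \<infinity>"
  interpret sigma_algebra UNIV "UNIV :: 'a set set"
    using sigma_algebra_Pow[of UNIV] by simp
  have pos: "positive UNIV ?f"
    using assms by (simp add: positive_def)
  have inc: "increasing UNIV ?f"
    unfolding increasing_def
  proof (intro ballI impI)
    fix A B :: "'a set" assume "A \<subseteq> B"
    show "?f A \<le> ?f B"
    proof (cases "bounded B \<and> diameter B \<le> \<delta>")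
      case True
      then have "bounded A" "diameter A \<le> diameter B"
        using \<open>A \<subseteq> B\<close> bounded_subset diameter_subset by blast+
      with True show ?thesis by (simp add: ennreal_leI)
    next
      case False
      then have "?f B = \<infinity>" by auto
      then show ?thesis by (metis infinity_ennreal_def top_greatest)
    qed
  qed
  have "outer_measure_space UNIV (outer_measure UNIV ?f)"
    using outer_measure_space_outer_measure[OF pos inc] by simp
  moreover have "hausdorff1_pre \<delta> = outer_measure UNIV ?f"
    using hausdorff1_pre_eq_outer_measure[OF assms] by auto
  ultimately show ?thesis by simp
qed

lemma outer_measure_space_hausdorff1:
  "outer_measure_space UNIV (hausdorff1_outer :: 'a::metric_space set \<Rightarrow> ennreal)"
  unfolding outer_measure_space_def
proof (intro conjI)
  note oms = outer_measure_space_hausdorff1_pre[where 'a = 'a, unfolded outer_measure_space_def]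
  have ge: "hausdorff1_pre \<delta> A \<le> hausdorff1_outer A" if "\<delta> > 0" for \<delta> and A :: "'a set"
    unfolding hausdorff1_outer_def using that by (intro SUP_upper) auto
  show "positive UNIV (hausdorff1_outer :: 'a set \<Rightarrow> ennreal)"
  proof -
    have "hausdorff1_pre \<delta> ({} :: 'a set) = 0" if "\<delta> > 0" for \<delta>
      using oms[OF that] by (simp add: positive_def)
    then have "hausdorff1_outer ({} :: 'a set) \<le> 0"
      unfolding hausdorff1_outer_def by (intro SUP_least) simp
    then show ?thesis
      by (simp add: positive_def)
  qed
  show "increasing UNIV (hausdorff1_outer :: 'a set \<Rightarrow> ennreal)"
    unfolding increasing_def
  proof (intro ballI impI)
    fix A B :: "'a set" assume "A \<subseteq> B"
    then have "hausdorff1_pre \<delta> A \<le> hausdorff1_pre \<delta> B" if "\<delta> > 0" for \<delta>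
      using oms[OF that] by (simp add: increasing_def)
    then show "hausdorff1_outer A \<le> hausdorff1_outer B"
      unfolding hausdorff1_outer_def by (intro SUP_subset_mono) auto
  qed
  show "countably_subadditive UNIV (hausdorff1_outer :: 'a set \<Rightarrow> ennreal)"
    unfolding countably_subadditive_def
  proof (intro allI impI)
    fix A :: "nat \<Rightarrow> 'a set" assume A: "range A \<subseteq> UNIV" "disjoint_family A" "(\<Union>i. A i) \<in> UNIV"
    show "hausdorff1_outer (\<Union>i. A i) \<le> (\<Sum>i. hausdorff1_outer (A i))"
      unfolding hausdorff1_outer_def[of "\<Union>i. A i"]
    proof (rule SUP_least)
      fix \<delta> :: real assume "\<delta> \<in> {0<..}"
      then have d: "\<delta> > 0" by simp
      have "hausdorff1_pre \<delta> (\<Union>i. A i) \<le> (\<Sum>i. hausdorff1_pre \<delta> (A i))"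
        using oms[OF d] A unfolding countably_subadditive_def by blast
      also have "\<dots> \<le> (\<Sum>i. hausdorff1_outer (A i))"
        by (intro suminf_le allI summableI ge d)
      finally show "hausdorff1_pre \<delta> (\<Union>i. A i) \<le> (\<Sum>i. hausdorff1_outer (A i))" .
    qed
  qed
qed

lemma measure_space_hausdorff1:
  "measure_space UNIV (lambda_system UNIV UNIV hausdorff1_outer)
     (hausdorff1_outer :: 'a::metric_space set \<Rightarrow> ennreal)"
proof -
  interpret sigma_algebra UNIV "UNIV :: 'a set set"
    using sigma_algebra_Pow[of UNIV] by simp
  show ?thesis by (rule caratheodory_lemma[OF outer_measure_space_hausdorff1])
qed

lemma sets_hausdorff1:
  "sets (hausdorff1 :: 'a::metric_space measure) = lambda_system UNIV UNIV hausdorff1_outer"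
proof -
  have "sigma_algebra (UNIV :: 'a set) (lambda_system UNIV UNIV hausdorff1_outer)"
    using measure_space_hausdorff1 unfolding measure_space_def by blast
  then show ?thesis
    unfolding hausdorff1_def by (rule sigma_algebra.sets_measure_of_eq)
qed

lemma emeasure_hausdorff1:
  assumes "A \<in> sets (hausdorff1 :: 'a::metric_space measure)"
  shows "emeasure hausdorff1 A = hausdorff1_outer A"
  unfolding hausdorff1_def
proof (rule emeasure_measure_of_sigma)
  show "A \<in> lambda_system UNIV UNIV hausdorff1_outer"
    using assms by (simp add: sets_hausdorff1)
qed (use measure_space_hausdorff1 in \<open>auto simp: measure_space_def\<close>)

end

theory Submission
  imports Defs
begin

text \<open>Put \<open>g = |\<partial>\<^sub>1|\<^sup>-\<^sup>1 \<eta>\<^sub>v\<close>. Multiplying \<open>\<partial>\<^sub>2 v - \<partial>\<^sub>1 (v\<^sup>2/2) = |\<partial>\<^sub>1| g\<close> by \<open>v\<close> gives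
  the production \<open>\<partial>\<^sub>2 (v\<^sup>2/2) - \<partial>\<^sub>1 (v\<^sup>3/3)\<close> of the single entropy \<open>v\<^sup>2/2\<close>. Since \<open>|\<partial>\<^sub>1|\<close> is \<open>\<partial>\<^sub>1\<close> composed with the
  Hilbert transform, an \<open>L\<^sup>2\<close> isometry, integration by parts and the arithmetic-geometric mean
  inequality bound this production, tested with \<open>|\<phi>| \<le> 1\<close>, by the energy up to terms that vanish
  with \<open>\<epsilon>\<close>. In the limit \<open>w\<close> solves Burgers' equation and its entropy production has mass at most
  \<open>liminf \<E>\<close>. Blowing up at a jump point, the Rankine--Hugoniot condition fixes the direction of the jump,
  and the entropy production there has density \<open>|w\<^sup>+ - w\<^sup>-|\<^sup>3 / (12 sqrt (1 + (w\<^sup>+ + w\<^sup>-)\<^sup>2/4))\<close> per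
  unit length. A Vitali covering by disjoint balls turns this pointwise density into the integral
  over the jump set.\<close>

section \<open>One-dimensional Hausdorff measure\<close>

text \<open>A single entropy suffices because its second derivative is 1: the weighted inequality
  for the product of \<open>h\<close> with the Hilbert transform of \<open>g\<close> then reproduces
  the energy with constant exactly 1. The \<open>wn\<close> are not assumed bounded, so
  \<open>t^2/2\<close> is replaced by an entropy with bounded derivative that agrees with it on the
  range of the limit. Mollification does not commute with the product \<open>v * h\<close>; since no
  derivative falls on the resulting error, it is enough that it vanishes in L^1. The 12 comes from
  \<open>(a^3 - b^3)/3 - (a^2 - b^2)/2 * (a + b)/2 = (a - b)^3/12\<close>, the square root from
  normalising \<open>(1, (a + b)/2)\<close>. Test functions close to indicators of balls see the
  chord \<open>2 * r\<close>, which is also the diameter counted by the Hausdorff measure, so no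
  constant is lost. Signs are chosen ball by ball, so that productions of either sign add up. Jump
  points on the edge of the unit square become interior points after shifting the fundamental
  domain. The integral is a supremum over simple functions; their level sets are shrunk to compact
  sets, which disjoint open sets can separate.\<close>

lemma hausdorff1_outer_mono: "A \<subseteq> B \<Longrightarrow> hausdorff1_outer A \<le> hausdorff1_outer B"
  using outer_measure_space_hausdorff1 by (auto simp: outer_measure_space_def increasing_def)

lemma hausdorff1_outer_empty [simp]: "hausdorff1_outer {} = 0"
  using outer_measure_space_hausdorff1 by (auto simp: outer_measure_space_def positive_def)

text \<open>\<open>countably_subadditive\<close> speaks of disjoint families only;
  \<open>disjointed\<close> reduces the general case to it.\<close>

lemma hausdorff1_outer_UN_le:
  fixes A :: "nat \<Rightarrow> 'a::metric_space set"
  shows "hausdorff1_outer (\<Union>i. A i) \<le> (\<Sum>i. hausdorff1_outer (A i))"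
proof -
  have "hausdorff1_outer (\<Union>i. A i) = hausdorff1_outer (\<Union>i. disjointed A i)"
    by (simp add: UN_disjointed_eq)
  also have "\<dots> \<le> (\<Sum>i. hausdorff1_outer (disjointed A i))"
    using outer_measure_space_hausdorff1[where 'a='a]
    unfolding outer_measure_space_def countably_subadditive_def
    by (auto simp: disjoint_family_disjointed)
  also have "\<dots> \<le> (\<Sum>i. hausdorff1_outer (A i))"
    by (intro suminf_le summableI hausdorff1_outer_mono disjointed_subset)
  finally show ?thesis .
qed

lemma hausdorff1_outer_Un_le:
  fixes A B :: "'a::metric_space set"
  shows "hausdorff1_outer (A \<union> B) \<le> hausdorff1_outer A + hausdorff1_outer B"
proof -
  define C where "C = (\<lambda>i::nat. if i = 0 then A else if i = 1 then B else {})"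
  have "A \<union> B = (\<Union>i. C i)" by (auto simp: C_def split: if_splits)
  then have "hausdorff1_outer (A \<union> B) \<le> (\<Sum>i. hausdorff1_outer (C i))"
    using hausdorff1_outer_UN_le[of C] by simp
  also have "\<dots> = (\<Sum>i<2. hausdorff1_outer (C i))"
    by (rule suminf_finite) (auto simp: C_def)
  also have "\<dots> = hausdorff1_outer A + hausdorff1_outer B"
    by (simp add: C_def numeral_2_eq_2)
  finally show ?thesis .
qed

lemma hausdorff1_pre_le_outer: "\<delta> > 0 \<Longrightarrow> hausdorff1_pre \<delta> A \<le> hausdorff1_outer A"
  unfolding hausdorff1_outer_def by (intro SUP_upper) auto

lemma hausdorff1_pre_le:
  assumes "A \<subseteq> (\<Union>i. C i)" "\<And>i. bounded (C i) \<and> diameter (C i) \<le> \<delta>"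
  shows "hausdorff1_pre \<delta> A \<le> (\<Sum>i. ennreal (diameter (C i)))"
  unfolding hausdorff1_pre_def using assms by (intro INF_lower) auto

lemma hausdorff1_pre_antimono:
  "\<delta> \<le> \<delta>' \<Longrightarrow> hausdorff1_pre \<delta>' A \<le> hausdorff1_pre \<delta> A"
  unfolding hausdorff1_pre_def
  by (intro INF_superset_mono) (auto intro: order_trans)

text \<open>The premeasure grows as the scale shrinks, so only scales below a threshold matter for
  the supremum.\<close>

lemma hausdorff1_outer_leI:
  assumes "\<And>\<delta>. 0 < \<delta> \<Longrightarrow> \<delta> < d \<Longrightarrow> hausdorff1_pre \<delta> A \<le> c" "d > 0"
  shows "hausdorff1_outer A \<le> c"
  unfolding hausdorff1_outer_def
proof (rule SUP_least)
  fix \<delta> :: real assume "\<delta> \<in> {0<..}"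
  then have "hausdorff1_pre \<delta> A \<le> hausdorff1_pre (min \<delta> (d/2)) A"
    by (intro hausdorff1_pre_antimono) auto
  also have "\<dots> \<le> c" using \<open>\<delta> \<in> {0<..}\<close> \<open>d > 0\<close> by (intro assms(1)) auto
  finally show "hausdorff1_pre \<delta> A \<le> c" .
qed

text \<open>A covering set of diameter less than \<open>d\<close> cannot meet both \<open>A\<close>
  and \<open>B\<close>, so every covering of the union splits into a covering of \<open>A\<close>
  and one of \<open>B\<close> without counting any set twice.\<close>

lemma hausdorff1_pre_separated:
  fixes A B :: "'a::metric_space set"
  assumes sep: "\<And>x y. x \<in> A \<Longrightarrow> y \<in> B \<Longrightarrow> d \<le> dist x y" and "\<delta> < d" "\<delta> > 0"
  shows "hausdorff1_pre \<delta> A + hausdorff1_pre \<delta> B \<le> hausdorff1_pre \<delta> (A \<union> B)"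
  unfolding hausdorff1_pre_def[of _ "A \<union> B"]
proof (rule INF_greatest, clarsimp)
  fix C :: "nat \<Rightarrow> 'a set"
  assume C: "A \<subseteq> (\<Union>i. C i)" "B \<subseteq> (\<Union>i. C i)" "\<forall>i. bounded (C i) \<and> diameter (C i) \<le> \<delta>"
  have b: "bounded (C i \<inter> S) \<and> diameter (C i \<inter> S) \<le> diameter (C i)" for i S
    using C by (auto intro: bounded_subset diameter_subset)
  have b': "bounded (C i \<inter> S) \<and> diameter (C i \<inter> S) \<le> \<delta>" for i S
    using b C(3) order_trans by blast
  have hA: "hausdorff1_pre \<delta> A \<le> (\<Sum>i. ennreal (diameter (C i \<inter> A)))"
    using C(1,2) b' by (intro hausdorff1_pre_le) auto
  have hB: "hausdorff1_pre \<delta> B \<le> (\<Sum>i. ennreal (diameter (C i \<inter> B)))"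
    using C(1,2) b' by (intro hausdorff1_pre_le) auto
  note add_mono[OF hA hB]
  also have "(\<Sum>i. ennreal (diameter (C i \<inter> A))) + (\<Sum>i. ennreal (diameter (C i \<inter> B)))
      = (\<Sum>i. ennreal (diameter (C i \<inter> A)) + ennreal (diameter (C i \<inter> B)))"
    by (intro suminf_add summableI)
  also have "\<dots> \<le> (\<Sum>i. ennreal (diameter (C i)))"
  proof (intro suminf_le summableI)
    fix i
    have "C i \<inter> A = {} \<or> C i \<inter> B = {}"
    proof (rule ccontr)
      assume "\<not> ?thesis"
      then obtain x y where xy: "x \<in> C i" "x \<in> A" "y \<in> C i" "y \<in> B" by blast
      then have "dist x y \<le> diameter (C i)" using C by (intro diameter_bounded_bound) auto
      with C sep[OF xy(2,4)] \<open>\<delta> < d\<close> show False by (smt (verit))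
    qed
    then show "ennreal (diameter (C i \<inter> A)) + ennreal (diameter (C i \<inter> B)) \<le> ennreal (diameter (C i))"
      using b[of i A] b[of i B] by (auto simp: ennreal_leI)
  qed
  finally show "hausdorff1_pre \<delta> A + hausdorff1_pre \<delta> B \<le> (\<Sum>i. ennreal (diameter (C i)))" .
qed

lemma hausdorff1_outer_separated:
  fixes A B :: "'a::metric_space set"
  assumes sep: "\<And>x y. x \<in> A \<Longrightarrow> y \<in> B \<Longrightarrow> d \<le> dist x y" and "d > 0"
  shows "hausdorff1_outer A + hausdorff1_outer B \<le> hausdorff1_outer (A \<union> B)"
proof -
  have *: "hausdorff1_pre \<delta> A + hausdorff1_pre \<delta>' B \<le> hausdorff1_outer (A \<union> B)"
    if "\<delta> > 0" "\<delta>' > 0" for \<delta> \<delta>'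
  proof -
    \<comment> \<open>The two suprema are taken independently, so a common scale below both is
      needed; \<open>d/2\<close> keeps it below the separation.\<close>
    let ?e = "min (min \<delta> \<delta>') (d/2)"
    have "hausdorff1_pre \<delta> A + hausdorff1_pre \<delta>' B \<le> hausdorff1_pre ?e A + hausdorff1_pre ?e B"
      by (intro add_mono hausdorff1_pre_antimono) auto
    also have "\<dots> \<le> hausdorff1_pre ?e (A \<union> B)"
      using assms that by (intro hausdorff1_pre_separated[OF sep]) auto
    also have "\<dots> \<le> hausdorff1_outer (A \<union> B)"
      using that \<open>d > 0\<close> by (intro hausdorff1_pre_le_outer) auto
    finally show ?thesis .
  qed
  have ne: "{0::real<..} \<noteq> {}" by (metis greaterThan_iff empty_iff zero_less_one)
  have "hausdorff1_pre \<delta> A + hausdorff1_outer B \<le> hausdorff1_outer (A \<union> B)" if "\<delta> > 0" for \<delta>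
    unfolding hausdorff1_outer_def[of B] ennreal_SUP_add_right[OF ne]
    by (rule SUP_least) (use * that in simp)
  then show ?thesis
    unfolding hausdorff1_outer_def[of A] ennreal_SUP_add_left[OF ne, symmetric]
    by (intro SUP_least) simp
qed

text \<open>Meant for every second ring around a closed set. The gaps shrink as the rings approach
  the set, hence \<open>d\<close> depends on the index and only its positivity is required.\<close>

lemma hausdorff1_outer_sum_separated:
  fixes R :: "nat \<Rightarrow> 'a::metric_space set"
  assumes sep: "\<And>n x y. x \<in> (\<Union>i<n. R i) \<Longrightarrow> y \<in> R n \<Longrightarrow> d n \<le> dist x y" and d: "\<And>n. d n > 0"
  shows "(\<Sum>i<n. hausdorff1_outer (R i)) \<le> hausdorff1_outer (\<Union>i<n. R i)"
proof (induction n)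
  case (Suc n)
  have "(\<Sum>i<Suc n. hausdorff1_outer (R i)) \<le> hausdorff1_outer (\<Union>i<n. R i) + hausdorff1_outer (R n)"
    using Suc by (simp add: add_right_mono)
  also have "\<dots> \<le> hausdorff1_outer ((\<Union>i<n. R i) \<union> R n)"
    by (rule hausdorff1_outer_separated[OF sep d])
  also have "(\<Union>i<n. R i) \<union> R n = (\<Union>i<Suc n. R i)"
    by (auto simp: lessThan_Suc)
  finally show ?case .
qed simp

lemma suminf_ennreal_tail_tendsto_0:
  fixes f :: "nat \<Rightarrow> ennreal"
  assumes "(\<Sum>i. f i) \<noteq> \<infinity>"
  shows "(\<lambda>n. \<Sum>i. f (i + n)) \<longlonglongrightarrow> 0"
proof -
  define g where "g i = enn2real (f i)" for i
  have "f i \<noteq> \<infinity>" for i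
    using sum_le_suminf[OF summableI, of "{i}" f] assms by (auto simp: top_unique)
  then have fg: "f i = ennreal (g i)" for i by (simp add: g_def less_top)
  have g: "summable g" "\<And>i. g i \<ge> 0"
    using assms unfolding fg by (auto simp: g_def intro!: summable_suminf_not_top)
  have "(\<lambda>n. ennreal (\<Sum>i. g (i + n))) \<longlonglongrightarrow> ennreal 0"
    by (intro tendsto_ennrealI suminf_exist_split2 g)
  moreover have "(\<Sum>i. f (i + n)) = ennreal (\<Sum>i. g (i + n))" for n
    unfolding fg using g by (intro suminf_ennreal2 summable_ignore_initial_segment) auto
  ultimately show ?thesis by simp
qed

text \<open>Caratheodory's criterion: rings around \<open>F\<close> that are not adjacent have positive distance, so
  their measures are summable.\<close>

lemma closed_in_lambda_system_hausdorff1: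
  fixes F :: "'a::metric_space set"
  assumes "closed F"
  shows "F \<in> lambda_system UNIV UNIV hausdorff1_outer"
proof -
  have le: "hausdorff1_outer (F \<inter> X) + hausdorff1_outer ((UNIV - F) \<inter> X) \<le> hausdorff1_outer X"
    if ne: "F \<noteq> {}" and fin: "hausdorff1_outer X < \<infinity>" for X
  proof -
    define D where "D n = {x \<in> X. 1 / real (Suc n) \<le> infdist x F}" for n
    define R where "R n = {x \<in> X. 1 / real (Suc (Suc n)) \<le> infdist x F \<and> infdist x F < 1 / real (Suc n)}" for n
    have sepR: "1 / real (Suc (Suc m)) - 1 / real (Suc n) \<le> dist x y"
      if "x \<in> R m" "y \<in> R n" for x y m n
      using that infdist_triangle[of x F y] by (auto simp: R_def)
    have anti: "1 / real (Suc n) \<le> 1 / real (Suc m)" if "m \<le> n" for m n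
      using that by (simp add: frac_le)
    have sub: "(\<Sum>i<n. hausdorff1_outer (R (2 * i + k))) \<le> hausdorff1_outer X" for k n
    proof -
      have "(\<Sum>i<n. hausdorff1_outer (R (2 * i + k))) \<le> hausdorff1_outer (\<Union>i<n. R (2 * i + k))"
      proof (rule hausdorff1_outer_sum_separated)
        fix n x y assume xy: "x \<in> (\<Union>i<n. R (2 * i + k))" "y \<in> R (2 * n + k)"
        then obtain i where i: "i < n" "x \<in> R (2 * i + k)" by auto
        then have "1 / real (2 * n + k) \<le> 1 / real (Suc (Suc (2 * i + k)))"
          by (intro frac_le) auto
        \<comment> \<open>As \<open>i < n\<close>, the point \<open>x\<close> has distance at least
          \<open>1/(2n+k)\<close> from \<open>F\<close>, while \<open>y\<close> is closer than
          \<open>1/(2n+k+1)\<close>. The value 1 serves \<open>2n+k = 0\<close>: there the union is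
          empty, and division by zero would make the gap negative.\<close>
        then show "(if 2 * n + k = 0 then 1 else 1 / real (2 * n + k) - 1 / real (Suc (2 * n + k))) \<le> dist x y"
          using sepR[OF i(2) xy(2)] i by auto
      qed (simp add: frac_less2)
      also have "\<dots> \<le> hausdorff1_outer X"
        by (intro hausdorff1_outer_mono) (auto simp: R_def)
      finally show ?thesis .
    qed
    have summ: "(\<Sum>i. hausdorff1_outer (R i)) \<noteq> \<infinity>"
    proof -
      have "(\<Sum>i<n. hausdorff1_outer (R i)) \<le> 2 * hausdorff1_outer X" for n
      proof -
        have "(\<Sum>i<n. hausdorff1_outer (R i)) \<le> (\<Sum>i<2*n. hausdorff1_outer (R i))"
          by (intro sum_mono2) auto
        also have "\<dots> = (\<Sum>i<n. hausdorff1_outer (R (2*i+0))) + (\<Sum>i<n. hausdorff1_outer (R (2*i+1)))"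
          by (induction n) (auto simp: algebra_simps)
        also have "\<dots> \<le> hausdorff1_outer X + hausdorff1_outer X"
          by (intro add_mono sub)
        finally show ?thesis by (simp add: mult_2)
      qed
      then have "(\<Sum>i. hausdorff1_outer (R i)) \<le> 2 * hausdorff1_outer X"
        by (intro suminf_le_const summableI) auto
      also have "\<dots> < \<infinity>" using fin by (simp add: ennreal_mult_less_top)
      finally show ?thesis by simp
    qed
    have "hausdorff1_outer (F \<inter> X) + hausdorff1_outer ((UNIV - F) \<inter> X)
        \<le> hausdorff1_outer X + (\<Sum>i. hausdorff1_outer (R (i + n)))" for n
    proof -
      have "(UNIV - F) \<inter> X \<subseteq> D n \<union> (\<Union>i. R (i + n))"
      proof
        fix x assume x: "x \<in> (UNIV - F) \<inter> X"
        then have pos: "infdist x F > 0"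
          using assms ne in_closed_iff_infdist_zero[of F x] infdist_nonneg[of x F] by (auto simp: less_le)
        show "x \<in> D n \<union> (\<Union>i. R (i + n))"
        proof (cases "x \<in> D n")
          case False
          obtain m0 where "1 / real (Suc m0) < infdist x F"
            using pos by (metis nat_approx_posE)
          then have ex: "\<exists>m. 1 / real (Suc m) \<le> infdist x F" by (auto intro: less_imp_le)
          \<comment> \<open>The first index whose threshold is at most the distance of
            \<open>x\<close> from \<open>F\<close>. It exceeds \<open>n\<close> because
            \<open>x\<close> is not in \<open>D n\<close>, and \<open>x\<close> lies in the ring
            whose index is one less.\<close>
          define m where "m = (LEAST m. 1 / real (Suc m) \<le> infdist x F)"
          have m: "1 / real (Suc m) \<le> infdist x F" unfolding m_def using ex by (rule LeastI_ex)
          have mn: "m > n"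
            using False x m anti[of m n] unfolding D_def by (metis (mono_tags, lifting) IntD2 mem_Collect_eq not_less order_trans)
          then obtain p where p: "m = Suc p" by (cases m) auto
          then have "\<not> 1 / real (Suc p) \<le> infdist x F"
            using not_less_Least[of p] unfolding m_def by (metis lessI)
          then have "x \<in> R p" using m p x by (auto simp: R_def)
          moreover have "p = (p - n) + n" using mn p by auto
          ultimately show ?thesis by (metis UN_I UNIV_I UnI2)
        qed simp
      qed
      then have "hausdorff1_outer ((UNIV - F) \<inter> X) \<le> hausdorff1_outer (D n \<union> (\<Union>i. R (i + n)))"
        by (rule hausdorff1_outer_mono)
      also have "\<dots> \<le> hausdorff1_outer (D n) + (\<Sum>i. hausdorff1_outer (R (i + n)))"
        by (rule order_trans[OF hausdorff1_outer_Un_le add_left_mono[OF hausdorff1_outer_UN_le]])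
      finally have "hausdorff1_outer (F \<inter> X) + hausdorff1_outer ((UNIV - F) \<inter> X) \<le>
         hausdorff1_outer (F \<inter> X) + hausdorff1_outer (D n) + (\<Sum>i. hausdorff1_outer (R (i + n)))"
        by (simp add: add.assoc add_left_mono)
      also have "hausdorff1_outer (F \<inter> X) + hausdorff1_outer (D n) \<le> hausdorff1_outer (F \<inter> X \<union> D n)"
      proof (rule hausdorff1_outer_separated)
        fix x y assume "x \<in> F \<inter> X" "y \<in> D n"
        then show "1 / real (Suc n) \<le> dist x y"
          using infdist_le[of x F y] by (auto simp: D_def dist_commute)
      qed simp
      also have "\<dots> \<le> hausdorff1_outer X"
        by (intro hausdorff1_outer_mono) (auto simp: D_def)
      finally show ?thesis by (simp add: add_right_mono)
    qed
    moreover have "(\<lambda>n. hausdorff1_outer X + (\<Sum>i. hausdorff1_outer (R (i + n)))) \<longlonglongrightarrow> hausdorff1_outer X + 0"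
      by (intro tendsto_add tendsto_const suminf_ennreal_tail_tendsto_0 summ)
    ultimately show ?thesis
      by (intro LIMSEQ_le_const[of _ "hausdorff1_outer X"]) auto
  qed
  have "hausdorff1_outer (F \<inter> X) + hausdorff1_outer ((UNIV - F) \<inter> X) = hausdorff1_outer X" for X
  proof (rule antisym)
    show "hausdorff1_outer (F \<inter> X) + hausdorff1_outer ((UNIV - F) \<inter> X) \<le> hausdorff1_outer X"
    proof (cases "F = {} \<or> hausdorff1_outer X = \<infinity>")
      case False
      then show ?thesis using le[of X] by (simp add: less_top)
    qed auto
    have "X = (F \<inter> X) \<union> ((UNIV - F) \<inter> X)" by auto
    then show "hausdorff1_outer X \<le> hausdorff1_outer (F \<inter> X) + hausdorff1_outer ((UNIV - F) \<inter> X)"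
      using hausdorff1_outer_Un_le by metis
  qed
  then show ?thesis
    by (auto simp: lambda_system_def)
qed

lemma borel_subset_sets_hausdorff1:
  "sets (borel :: 'a::metric_space measure) \<subseteq> sets hausdorff1"
proof -
  have "sets (borel :: 'a measure) = sigma_sets UNIV (Collect closed)"
    by (simp add: borel_eq_closed)
  also have "\<dots> \<subseteq> sets (hausdorff1 :: 'a measure)"
    using sets.sigma_sets_subset[of "Collect closed" "hausdorff1 :: 'a measure"]
      closed_in_lambda_system_hausdorff1 
    by (auto simp: sets_hausdorff1 hausdorff1_def space_measure_of_conv)
  finally show ?thesis .
qed

text \<open>Passing to closures leaves diameters unchanged, so almost optimal coverings at the
  scales \<open>1/(n+1)\<close> may be taken closed. The intersection of their unions is Borel and
  is covered at each scale with the same sums.\<close>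

lemma hausdorff1_borel_hull:
  fixes A :: "'a::metric_space set"
  assumes "hausdorff1_outer A < \<infinity>"
  obtains G where "G \<in> sets borel" "A \<subseteq> G" "hausdorff1_outer G = hausdorff1_outer A"
proof -
  have "\<exists>C :: nat \<Rightarrow> 'a set. A \<subseteq> (\<Union>i. C i) \<and> (\<forall>i. bounded (C i) \<and> diameter (C i) \<le> 1 / Suc n) \<and>
      (\<Sum>i. ennreal (diameter (C i))) < hausdorff1_outer A + ennreal (1 / Suc n)" for n
  proof -
    have "hausdorff1_pre (1 / Suc n) A \<le> hausdorff1_outer A" by (rule hausdorff1_pre_le_outer) simp
    also have "\<dots> < hausdorff1_outer A + ennreal (1 / Suc n)"
      using assms by (cases "hausdorff1_outer A") (auto simp flip: ennreal_plus intro!: ennreal_lessI add_nonneg_pos)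
    finally show ?thesis unfolding hausdorff1_pre_def INF_less_iff by auto
  qed
  then obtain C :: "nat \<Rightarrow> nat \<Rightarrow> 'a set" where
    C: "\<And>n. A \<subseteq> (\<Union>i. C n i)" "\<And>n i. bounded (C n i) \<and> diameter (C n i) \<le> 1 / Suc n"
      "\<And>n. (\<Sum>i. ennreal (diameter (C n i))) < hausdorff1_outer A + ennreal (1 / Suc n)"
    by metis
  define G where "G = (\<Inter>n. \<Union>i. closure (C n i))"
  show ?thesis
  proof
    show "G \<in> sets borel" unfolding G_def by measurable
    show "A \<subseteq> G" unfolding G_def
    proof (rule INT_greatest)
      fix n
      have "(\<Union>i. C n i) \<subseteq> (\<Union>i. closure (C n i))"
        by (intro UN_mono closure_subset) auto
      with C(1)[of n] show "A \<subseteq> (\<Union>i. closure (C n i))" by (rule order_trans)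
    qed
    then have "hausdorff1_outer A \<le> hausdorff1_outer G" by (rule hausdorff1_outer_mono)
    moreover have "hausdorff1_outer G \<le> hausdorff1_outer A"
    proof (rule hausdorff1_outer_leI[where d=1])
      fix \<delta> :: real assume "0 < \<delta>" 
      have *: "hausdorff1_pre \<delta> G \<le> hausdorff1_outer A + ennreal (1 / Suc n)" if "1 / Suc n \<le> \<delta>" for n
      proof -
        have "hausdorff1_pre \<delta> G \<le> (\<Sum>i. ennreal (diameter (closure (C n i))))"
        proof (rule hausdorff1_pre_le)
          show "bounded (closure (C n i)) \<and> diameter (closure (C n i)) \<le> \<delta>" for i
            using C(2)[of n i] that by (auto simp: diameter_closure)
        qed (auto simp: G_def)
        also have "\<dots> = (\<Sum>i. ennreal (diameter (C n i)))"
          using C(2)[of n] by (simp add: diameter_closure)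
        finally show ?thesis using C(3)[of n] by simp
      qed
      have "(\<lambda>n. hausdorff1_outer A + ennreal (1 / Suc n)) \<longlonglongrightarrow> hausdorff1_outer A + ennreal 0"
        by (intro tendsto_add tendsto_const tendsto_ennrealI LIMSEQ_Suc lim_1_over_n)
      moreover
      have "\<exists>N. \<forall>n\<ge>N. 1 / real (Suc n) \<le> \<delta>"
      proof -
        obtain N where N: "1 / real (Suc N) < \<delta>" using \<open>0 < \<delta>\<close> by (metis nat_approx_posE)
        have "1 / real (Suc n) \<le> 1 / real (Suc N)" if "n \<ge> N" for n using that by (simp add: frac_le)
        with N show ?thesis by (meson less_imp_le order_trans)
      qed
      then obtain N where "\<forall>n\<ge>N. 1 / real (Suc n) \<le> \<delta>" by blast
      then have "\<exists>N. \<forall>n\<ge>N. hausdorff1_pre \<delta> G \<le> hausdorff1_outer A + ennreal (1 / Suc n)"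
        using * by blast
      ultimately have "hausdorff1_pre \<delta> G \<le> hausdorff1_outer A + ennreal 0"
        by (rule LIMSEQ_le_const)
      then show "hausdorff1_pre \<delta> G \<le> hausdorff1_outer A" by simp
    qed simp
    ultimately show "hausdorff1_outer G = hausdorff1_outer A" by simp
  qed
qed

lemma space_hausdorff1 [simp]: "space hausdorff1 = UNIV"
  by (simp add: hausdorff1_def space_measure_of_conv)

text \<open>Inner regularity is a fact about finite Borel measures, while \<open>hausdorff1\<close>
  is far from finite and \<open>A\<close> is only Caratheodory measurable. Hence \<open>A\<close> is
  first replaced by a Borel subset \<open>B\<close> of full measure, and the measure is then
  restricted to \<open>B\<close>.\<close>

lemma hausdorff1_inner_compact:
  fixes A :: "'a::euclidean_space set"
  assumes A: "A \<in> sets hausdorff1" and fin: "emeasure hausdorff1 A < \<infinity>" and "e > 0"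
  obtains K where "compact K" "K \<subseteq> A" "emeasure hausdorff1 A \<le> emeasure hausdorff1 K + ennreal e"
proof -
  note bs = subsetD[OF borel_subset_sets_hausdorff1]
  have finA: "hausdorff1_outer A < \<infinity>" using fin A by (simp add: emeasure_hausdorff1)
  obtain G where G: "G \<in> sets borel" "A \<subseteq> G" "hausdorff1_outer G = hausdorff1_outer A"
    by (rule hausdorff1_borel_hull[OF finA])
  have GA: "emeasure hausdorff1 (G - A) = 0"
    using emeasure_Diff[of hausdorff1 A G] G A fin bs[OF G(1)]
    by (auto simp: emeasure_hausdorff1)
  then have "hausdorff1_outer (G - A) = 0"
    using emeasure_hausdorff1[of "G - A"] A bs[OF G(1)] by auto
  \<comment> \<open>A Borel null set containing what the hull has in excess of \<open>A\<close>;
    removing it from the hull leaves a Borel subset of \<open>A\<close>.\<close>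
  then obtain Z where Z: "Z \<in> sets borel" "G - A \<subseteq> Z" "hausdorff1_outer Z = 0"
    using hausdorff1_borel_hull[of "G - A"] by auto
  define B where "B = G - Z"
  have B: "B \<in> sets borel" "B \<subseteq> A" using G Z by (auto simp: B_def)
  have AB: "emeasure hausdorff1 A \<le> emeasure hausdorff1 B"
  proof -
    have "emeasure hausdorff1 A \<le> emeasure hausdorff1 (B \<union> Z)"
      using G B bs[OF Z(1)] bs[OF G(1)] by (intro emeasure_mono) (auto simp: B_def)
    also have "\<dots> \<le> emeasure hausdorff1 B + emeasure hausdorff1 Z"
      using bs[OF B(1)] bs[OF Z(1)] by (intro emeasure_subadditive) auto
    also have "emeasure hausdorff1 Z = 0" using Z bs[OF Z(1)] by (simp add: emeasure_hausdorff1)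
    finally show ?thesis by simp
  qed
  have finB: "emeasure hausdorff1 B < \<infinity>"
    using fin emeasure_mono[OF B(2) A] by (simp add: order_le_less_trans)
  define M where "M = measure_of UNIV (sets borel) (\<lambda>X. emeasure hausdorff1 (B \<inter> X))"
  have sM: "sets M = sets borel" unfolding M_def by (rule sigma_algebra.sets_measure_of_eq) (metis sets.sigma_algebra_axioms space_borel)
  have eM: "emeasure M X = emeasure hausdorff1 (B \<inter> X)" if X: "X \<in> sets borel" for X
    unfolding M_def
  proof (rule emeasure_measure_of_sigma)
    show "sigma_algebra UNIV (sets (borel::'a measure))" by (metis sets.sigma_algebra_axioms space_borel)
    show "positive (sets borel) (\<lambda>X. emeasure hausdorff1 (B \<inter> X))" by (simp add: positive_def)
    show "countably_additive (sets borel) (\<lambda>X. emeasure hausdorff1 (B \<inter> X))"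
    proof (rule countably_additiveI)
      fix X :: "nat \<Rightarrow> 'a set" assume X: "range X \<subseteq> sets borel" "disjoint_family X"
      have "(\<Sum>i. emeasure hausdorff1 (B \<inter> X i)) = emeasure hausdorff1 (\<Union>i. B \<inter> X i)"
      proof (rule suminf_emeasure)
        show "range (\<lambda>i. B \<inter> X i) \<subseteq> sets hausdorff1"
          using X bs B by auto
        show "disjoint_family (\<lambda>i. B \<inter> X i)" using X by (auto simp: disjoint_family_on_def)
      qed
      then show "(\<Sum>i. emeasure hausdorff1 (B \<inter> X i)) = emeasure hausdorff1 (B \<inter> (\<Union>i. X i))"
        by simp
    qed
  qed (rule X)
  have "emeasure M (space M) \<noteq> \<infinity>"
    using eM[of UNIV] finB sets_eq_imp_space_eq[OF sM] by simp
  then have inner: "emeasure M B = (SUP K \<in> {K. K \<subseteq> B \<and> compact K}. emeasure M K)"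
    using sM B by (intro inner_regular) auto
  show ?thesis
  \<comment> \<open>Subtraction in \<open>ennreal\<close> stops at 0, so
    \<open>emeasure M B - ennreal e\<close> is strictly below \<open>emeasure M B\<close> only when
    the latter is positive. A set \<open>B\<close> of measure at most \<open>e\<close> is served by
    the empty compact set.\<close>
  proof (cases "emeasure hausdorff1 B \<le> ennreal e")
    case True
    then show ?thesis using AB by (intro that[of "{}"]) auto
  next
    case False
    then have "emeasure M B - ennreal e < emeasure M B"
      using eM[of B] B finB \<open>e > 0\<close>
      by (cases "emeasure hausdorff1 B") (auto simp: ennreal_minus intro!: ennreal_lessI)
    then obtain K where K: "K \<subseteq> B" "compact K" "emeasure M B - ennreal e < emeasure M K"
      unfolding inner less_SUP_iff by auto
    have "emeasure M K \<le> emeasure hausdorff1 K"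
      using K bs[of K] by (subst eM) (auto simp: compact_imp_closed borel_closed intro: emeasure_mono)
    have "emeasure M B \<le> ennreal e + emeasure M K"
      using less_imp_le[OF K(3)] by (simp add: ennreal_minus_le_iff)
    then have "emeasure hausdorff1 B \<le> ennreal e + emeasure M K"
      using eM[of B] B(1) by simp
    also have "\<dots> \<le> ennreal e + emeasure hausdorff1 K"
      by (intro add_left_mono \<open>emeasure M K \<le> _\<close>)
    finally show ?thesis
      using K B order_trans[OF AB] by (intro that[of K]) (auto simp: add.commute)
  qed
qed

section \<open>Shifted unit squares and integration by parts on them\<close>

definition sq :: "real \<Rightarrow> (real \<times> real) set" where
  "sq s = {-s..<1-s} \<times> {-s..<1-s}"

lemma unit_square_eq_sq: "unit_square = sq 0"
  by (simp add: unit_square_def sq_def)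

abbreviation csq :: "real \<Rightarrow> (real \<times> real) set" where
  "csq s \<equiv> cbox (-s, -s) (1 - s, 1 - s)"

lemma sq_subset_csq: "sq s \<subseteq> csq s"
  by (auto simp: sq_def)

lemma sets_borel_sq [measurable, simp]: "sq s \<in> sets borel"
  unfolding sq_def borel_prod[symmetric] by measurable

lemma sets_lebesgue_sq [simp]: "sq s \<in> sets lebesgue"
  by simp

lemma negligible_csq_diff: "negligible (csq s - sq s)"
proof (rule negligible_subset)
  show "negligible (frontier (csq s))"
    by (intro negligible_convex_frontier convex_box)
  show "csq s - sq s \<subseteq> frontier (csq s)"
    by (auto simp: frontier_def interior_cbox box_prod sq_def)
qed

lemma lmeasurable_sq [simp]: "sq s \<in> lmeasurable"
  by (rule bounded_set_imp_lmeasurable) (auto intro: bounded_subset[OF bounded_cbox sq_subset_csq])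

lemma measure_sq [simp]: "measure lebesgue (sq s) = 1"
proof -
  have "measure lebesgue (csq s) = measure lebesgue (sq s)"
  proof (rule measure_negligible_symdiff)
    show "negligible (sym_diff (sq s) (csq s))"
      using negligible_csq_diff[of s] sq_subset_csq[of s] by (simp add: Diff_eq_empty_iff[THEN iffD2])
  qed simp
  then show ?thesis by (simp add: content_Pair)
qed

lemma finite_measure_sq: "finite_measure (lebesgue_on (sq s))"
  by (rule finite_measure_lebesgue_on) simp

lemma measure_lebesgue_on_sq [simp]: "measure (lebesgue_on (sq s)) (sq s) = 1"
  by (subst measure_restrict_space) auto

lemma continuous_integrable_sq:
  fixes f :: "real \<times> real \<Rightarrow> 'b::euclidean_space"
  assumes "continuous_on UNIV f"
  shows "integrable (lebesgue_on (sq s)) f"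
    and "integral\<^sup>L (lebesgue_on (sq s)) f = integral (csq s) f"
proof -
  have "compact (f ` csq s)"
    using assms by (intro compact_continuous_image compact_cbox) (auto intro: continuous_on_subset)
  then obtain B where B: "\<And>x. x \<in> csq s \<Longrightarrow> norm (f x) \<le> B"
    by (meson bounded_iff compact_imp_bounded imageI)
  show *: "integrable (lebesgue_on (sq s)) f"
  proof (rule finite_measure.integrable_const_bound[OF finite_measure_sq, where B=B])
    show "AE x in lebesgue_on (sq s). norm (f x) \<le> B"
      using B sq_subset_csq by (intro AE_I2) auto
    show "f \<in> borel_measurable (lebesgue_on (sq s))"
      using assms by (intro continuous_imp_measurable_on_sets_lebesgue) (auto intro: continuous_on_subset)
  qed
  have "integral\<^sup>L (lebesgue_on (sq s)) f = integral (sq s) f"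
    by (rule lebesgue_integral_eq_integral[OF *]) simp
  also have "\<dots> = integral (csq s) f"
  proof (rule integral_spike_set)
    show "negligible {x \<in> sq s - csq s. f x \<noteq> 0}"
      using sq_subset_csq[of s] by (simp add: Diff_eq_empty_iff[THEN iffD2])
    show "negligible {x \<in> csq s - sq s. f x \<noteq> 0}"
      by (rule negligible_subset[OF negligible_csq_diff]) auto
  qed
  finally show "integral\<^sup>L (lebesgue_on (sq s)) f = integral (csq s) f" .
qed

text \<open>By the fundamental theorem of calculus each line integral is a difference of values on
  opposite edges. The edge condition covers two uses: periodic functions, and products with a cutoff
  that vanishes on the edges.\<close>

lemma integral_pd1_eq_0:
  fixes F F1 :: "real \<times> real \<Rightarrow> 'b::euclidean_space"
  assumes cont: "continuous_on UNIV F1"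
    and deriv: "\<And>x y. ((\<lambda>t. F (t, y)) has_vector_derivative F1 (x, y)) (at x)"
    and bd: "\<And>y. F (1 - s, y) = F (- s, y)"
  shows "integral\<^sup>L (lebesgue_on (sq s)) F1 = 0"
proof -
  have "integral (cbox (-s) (1-s)) (\<lambda>x. F1 (x, y)) = 0" for y
  proof -
    have "((\<lambda>x. F1 (x, y)) has_integral (F (1 - s, y) - F (- s, y))) {-s..1-s}"
      by (rule fundamental_theorem_of_calculus)
        (auto intro: has_vector_derivative_at_within deriv)
    then show ?thesis using bd by (simp add: integral_unique)
  qed
  moreover have "integral (csq s) F1 = 
      integral (cbox (-s) (1-s)) (\<lambda>x. integral (cbox (-s) (1-s)) (\<lambda>y. F1 (x, y)))"
    by (rule integral_prod_continuous) (auto intro: continuous_on_subset[OF cont])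
  \<comment> \<open>The derivative is in the outer variable, so the order of integration has to be
    exchanged before the inner integral vanishes.\<close>
  moreover have "\<dots> = integral (cbox (-s) (1-s)) (\<lambda>y. integral (cbox (-s) (1-s)) (\<lambda>x. F1 (x, y)))"
    using integral_swap_continuous[of "-s" "-s" "1-s" "1-s" "\<lambda>x y. F1 (x, y)"] 
      continuous_on_subset[OF cont] by (auto simp: case_prod_eta)
  ultimately show ?thesis using continuous_integrable_sq(2)[OF cont] by simp
qed

lemma integral_pd2_eq_0:
  fixes F F2 :: "real \<times> real \<Rightarrow> 'b::euclidean_space"
  assumes cont: "continuous_on UNIV F2"
    and deriv: "\<And>x y. ((\<lambda>t. F (x, t)) has_vector_derivative F2 (x, y)) (at y)"
    and bd: "\<And>x. F (x, 1 - s) = F (x, - s)"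
  shows "integral\<^sup>L (lebesgue_on (sq s)) F2 = 0"
proof -
  have "integral (cbox (-s) (1-s)) (\<lambda>y. F2 (x, y)) = 0" for x
  proof -
    have "((\<lambda>y. F2 (x, y)) has_integral (F (x, 1 - s) - F (x, - s))) {-s..1-s}"
      by (rule fundamental_theorem_of_calculus)
        (auto intro: has_vector_derivative_at_within deriv)
    then show ?thesis using bd by (simp add: integral_unique)
  qed
  moreover have "integral (csq s) F2 = 
      integral (cbox (-s) (1-s)) (\<lambda>x. integral (cbox (-s) (1-s)) (\<lambda>y. F2 (x, y)))"
    by (rule integral_prod_continuous) (auto intro: continuous_on_subset[OF cont])
  ultimately show ?thesis using continuous_integrable_sq(2)[OF cont] by simp
qed

section \<open>Characters and Fejer means\<close>

definition ee :: "int \<Rightarrow> int \<Rightarrow> real \<times> real \<Rightarrow> complex" where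
  "ee j l x = cis (2 * pi * (of_int j * fst x + of_int l * snd x))"

lemma norm_ee [simp]: "norm (ee j l x) = 1"
  by (simp add: ee_def)

lemma ee_0 [simp]: "ee 0 0 x = 1"
  by (simp add: ee_def)

lemma ee_add: "ee (j + j') (l + l') x = ee j l x * ee j' l' x"
  by (simp add: ee_def cis_mult algebra_simps)

lemma ee_diff: "ee j l (x - y) = ee j l x * ee (-j) (-l) y"
  by (simp add: ee_def cis_mult algebra_simps)

lemma cnj_ee: "cnj (ee j l x) = ee (-j) (-l) x"
  by (simp add: ee_def cis_cnj algebra_simps)

lemma continuous_on_ee [continuous_intros]: "continuous_on S (ee j l)"
  unfolding ee_def[abs_def] cis_conv_exp by (intro continuous_intros)

lemma ee_shift: "ee j l (x + 1, y) = ee j l (x, y)" "ee j l (x, y + 1) = ee j l (x, y)"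
proof -
  have "cis (2 * pi * of_int k) = 1" for k by (simp add: cis_multiple_2pi)
  then have "cis (a + 2 * pi * of_int k) = cis a" for a k
    by (simp add: cis_mult[symmetric])
  note * = this
  show "ee j l (x + 1, y) = ee j l (x, y)"
    using *[of "2 * pi * (of_int j * x + of_int l * y)" j] by (simp add: ee_def algebra_simps)
  show "ee j l (x, y + 1) = ee j l (x, y)"
    using *[of "2 * pi * (of_int j * x + of_int l * y)" l] by (simp add: ee_def algebra_simps)
qed

lemma periodic_ee: "periodic (ee j l)"
  by (simp add: periodic_def ee_shift)

lemma ee_deriv1: "((\<lambda>t. ee j l (t, y)) has_vector_derivative (complex_of_real (2 * pi * of_int j) * \<i>) * ee j l (x, y)) (at x)"
  unfolding ee_def cis_conv_exp
  by (auto intro!: derivative_eq_intros simp: has_vector_derivative_complex_iff Re_exp Im_exp scaleR_conv_of_real)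

lemma ee_deriv2: "((\<lambda>t. ee j l (x, t)) has_vector_derivative (complex_of_real (2 * pi * of_int l) * \<i>) * ee j l (x, y)) (at y)"
  unfolding ee_def cis_conv_exp
  by (auto intro!: derivative_eq_intros simp: has_vector_derivative_complex_iff Re_exp Im_exp scaleR_conv_of_real)

lemma periodic_shift_edge:
  assumes "periodic f"
  shows "f (1 - s, y) = f (- s, y)" "f (x, 1 - s) = f (x, - s)"
proof -
  show "f (1 - s, y) = f (- s, y)" using assms unfolding periodic_def by (metis add.commute diff_conv_add_uminus)
  show "f (x, 1 - s) = f (x, - s)" using assms unfolding periodic_def by (metis add.commute diff_conv_add_uminus)
qed

text \<open>A nontrivial character is a nonzero multiple of its own derivative in one of the
  variables, and periodicity matches the opposite edges of every shifted square.\<close>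

lemma integral_ee: "integral\<^sup>L (lebesgue_on (sq s)) (ee j l) = (if j = 0 \<and> l = 0 then 1 else 0)"
proof -
  consider "j = 0 \<and> l = 0" | "j \<noteq> 0" | "l \<noteq> 0" by blast
  then show ?thesis
  proof cases
    case 2
    have "integral\<^sup>L (lebesgue_on (sq s)) (\<lambda>x. (complex_of_real (2 * pi * of_int j) * \<i>) * ee j l x) = 0"
      by (rule integral_pd1_eq_0[where F="ee j l"])
        (rule ee_deriv1 periodic_shift_edge[OF periodic_ee] | intro continuous_intros)+
    with 2 show ?thesis by simp
  next
    case 3
    have "integral\<^sup>L (lebesgue_on (sq s)) (\<lambda>x. (complex_of_real (2 * pi * of_int l) * \<i>) * ee j l x) = 0"
      by (rule integral_pd2_eq_0[where F="ee j l"])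
        (rule ee_deriv2 periodic_shift_edge[OF periodic_ee] | intro continuous_intros)+
    with 3 show ?thesis by simp
  qed (simp add: ee_def[abs_def])
qed

definition fc :: "(real \<times> real \<Rightarrow> real) \<Rightarrow> int \<Rightarrow> int \<Rightarrow> complex" where
  "fc f j l = (\<integral>x. of_real (f x) * ee (-j) (-l) x \<partial>torus)"

text \<open>The Fejer kernel as a squared modulus, which makes positivity immediate; its triangular
  Fourier coefficients are recovered in \<open>fejer_sum\<close>. At \<open>N = 0\<close> the value
  is 0.\<close>

definition fejer :: "nat \<Rightarrow> real \<Rightarrow> real" where
  "fejer N t = (cmod (\<Sum>a<N. cis (2 * pi * of_nat a * t)))\<^sup>2 / N"

lemma fejer_nonneg: "fejer N t \<ge> 0"
  by (simp add: fejer_def)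

lemma sum_int_interval_Suc:
  fixes G :: "int \<Rightarrow> 'a::comm_monoid_add"
  shows "(\<Sum>j\<in>{- int (Suc N)<..<int (Suc N)}. G j) = G 0 + (\<Sum>a<N. G (int a - int N) + G (int N - int a))"
proof -
  have "{- int (Suc N)<..<int (Suc N)} = insert 0 ((\<lambda>a. int a - int N) ` {..<N} \<union> (\<lambda>a. int N - int a) ` {..<N})"
    (is "?A = insert 0 (?B \<union> ?C)")
  proof (intro equalityI subsetI)
    fix j assume "j \<in> ?A"
    moreover have "j \<in> ?B" if "j < 0" "j \<ge> - int N"
      using that by (intro image_eqI[where x="nat (j + int N)"]) auto
    moreover have "j \<in> ?C" if "j > 0" "j \<le> int N"
      using that by (intro image_eqI[where x="nat (int N - j)"]) auto
    ultimately show "j \<in> insert 0 (?B \<union> ?C)"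
      by (cases "j < 0"; cases "j > 0") auto
  qed auto
  moreover have "?B \<inter> ?C = {}" "0 \<notin> ?B" "0 \<notin> ?C" by auto
  moreover have "sum G ?B = (\<Sum>a<N. G (int a - int N))" "sum G ?C = (\<Sum>a<N. G (int N - int a))"
    by (auto simp: sum.reindex inj_on_def)
  ultimately show ?thesis
    by (simp add: sum.union_disjoint sum.distrib)
qed

text \<open>Going from \<open>N\<close> to \<open>N + 1\<close> adds one row and one column to the
  square of pairs, and their differences run through every integer of modulus at most
  \<open>N\<close> exactly once. Each multiplicity therefore rises by one.\<close>

lemma sum_diff_multiplicity:
  fixes G :: "int \<Rightarrow> complex"
  shows "(\<Sum>a<N. \<Sum>b<N. G (int a - int b)) = (\<Sum>j\<in>{-int N<..<int N}. of_int (int N - \<bar>j\<bar>) * G j)"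
proof (induction N)
  case (Suc N)
  have "(\<Sum>a<Suc N. \<Sum>b<Suc N. G (int a - int b)) =
     (\<Sum>a<N. \<Sum>b<N. G (int a - int b)) + (G 0 + (\<Sum>a<N. G (int a - int N) + G (int N - int a)))"
    by (simp add: sum.distrib algebra_simps)
  also have "\<dots> = (\<Sum>j\<in>{-int N<..<int N}. of_int (int N - \<bar>j\<bar>) * G j) + (\<Sum>j\<in>{- int (Suc N)<..<int (Suc N)}. G j)"
    unfolding Suc sum_int_interval_Suc ..
  \<comment> \<open>The two frequencies gained have modulus \<open>N\<close> and hence weight
    0.\<close>
  also have "(\<Sum>j\<in>{-int N<..<int N}. of_int (int N - \<bar>j\<bar>) * G j)
      = (\<Sum>j\<in>{-int (Suc N)<..<int (Suc N)}. of_int (int N - \<bar>j\<bar>) * G j)"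
  proof (rule sum.mono_neutral_left)
    show "\<forall>i\<in>{- int (Suc N)<..<int (Suc N)} - {- int N<..<int N}. of_int (int N - \<bar>i\<bar>) * G i = 0"
    proof
      fix i assume "i \<in> {- int (Suc N)<..<int (Suc N)} - {- int N<..<int N}"
      then have "int N - \<bar>i\<bar> = 0" by auto
      then show "of_int (int N - \<bar>i\<bar>) * G i = 0" by simp
    qed
  qed auto
  finally show ?case
    by (simp add: sum.distrib[symmetric] algebra_simps)
qed simp

lemma fejer_sum:
  assumes "N > 0"
  shows "complex_of_real (fejer N t) =
    (\<Sum>j\<in>{-int N<..<int N}. of_real (1 - \<bar>of_int j\<bar> / N) * cis (2 * pi * of_int j * t))"
proof -
  let ?S = "\<Sum>a<N. cis (2 * pi * of_nat a * t)"
  have "complex_of_real ((cmod ?S)\<^sup>2) = ?S * cnj ?S"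
    by (rule complex_norm_square)
  also have "\<dots> = (\<Sum>a<N. \<Sum>b<N. cis (2 * pi * of_int (int a - int b) * t))"
    by (simp add: sum_product cis_cnj cis_mult algebra_simps)
  also have "\<dots> = (\<Sum>j\<in>{-int N<..<int N}. of_int (int N - \<bar>j\<bar>) * cis (2 * pi * of_int j * t))"
    by (rule sum_diff_multiplicity)
  also have "\<dots> = (\<Sum>j\<in>{-int N<..<int N}. of_real N * (of_real (1 - \<bar>of_int j\<bar> / N) * cis (2 * pi * of_int j * t)))"
  proof (rule sum.cong)
    fix j
    have "real_of_int (int N - \<bar>j\<bar>) = real N * (1 - \<bar>of_int j\<bar> / N)"
      using assms by (simp add: right_diff_distrib)
    then have "of_int (int N - \<bar>j\<bar>) = complex_of_real (real N * (1 - \<bar>of_int j\<bar> / N))"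
      by (metis of_real_of_int_eq)
    then show "of_int (int N - \<bar>j\<bar>) * cis (2 * pi * of_int j * t) =
        of_real N * (of_real (1 - \<bar>of_int j\<bar> / N) * cis (2 * pi * of_int j * t))"
      by (simp only: of_real_mult mult.assoc)
  qed simp
  finally have "complex_of_real ((cmod ?S)\<^sup>2) = of_real N * (\<Sum>j\<in>{-int N<..<int N}.
      of_real (1 - \<bar>of_int j\<bar> / N) * cis (2 * pi * of_int j * t))"
    by (simp only: sum_distrib_left)
  then show ?thesis
    using assms unfolding fejer_def of_real_divide by (simp only: nonzero_mult_div_cancel_left of_real_eq_0_iff of_nat_eq_0_iff)
qed

definition J :: "nat \<Rightarrow> (int \<times> int) set" where
  "J N = {-int N<..<int N} \<times> {-int N<..<int N}"

definition cN :: "nat \<Rightarrow> int \<Rightarrow> int \<Rightarrow> real" where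
  "cN N j l = (1 - \<bar>of_int j\<bar> / N) * (1 - \<bar>of_int l\<bar> / N)"

definition K :: "nat \<Rightarrow> real \<times> real \<Rightarrow> real" where
  "K N x = fejer N (fst x) * fejer N (snd x)"

lemma finite_J [simp]: "finite (J N)" by (simp add: J_def)

lemma K_nonneg: "K N x \<ge> 0"
  by (simp add: K_def fejer_nonneg)

lemma K_sum:
  assumes "N > 0"
  shows "complex_of_real (K N x) = (\<Sum>(j, l)\<in>J N. of_real (cN N j l) * ee j l x)"
  unfolding K_def of_real_mult fejer_sum[OF assms] sum_product sum.cartesian_product J_def
  by (intro sum.cong) (auto simp: cN_def ee_def cis_mult[symmetric] algebra_simps)

lemma continuous_on_K [continuous_intros]: "continuous_on S (K N)"
  unfolding K_def[abs_def] fejer_def cis_conv_exp divide_inverse by (intro continuous_intros)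

text \<open>Convolution with a product of Fejer kernels. It is a positive averaging operator, which
  yields Jensen's inequality and convergence, and its values are trigonometric polynomials, so that
  derivatives and the Hilbert transform act on finitely many coefficients.\<close>

definition PN :: "nat \<Rightarrow> (real \<times> real \<Rightarrow> real) \<Rightarrow> real \<times> real \<Rightarrow> real" where
  "PN N f x = (\<integral>y. K N (x - y) * f y \<partial>torus)"

lemma integrable_ee_mult:
  assumes "integrable torus f"
  shows "integrable torus (\<lambda>x. complex_of_real (f x) * ee j l x)"
proof (rule Bochner_Integration.integrable_bound[of _ "f"])
  have [measurable]: "ee j l \<in> borel_measurable torus"
    by (metis continuous_integrable_sq(1) continuous_on_ee unit_square_eq_sq borel_measurable_integrable)
  show "(\<lambda>x. complex_of_real (f x) * ee j l x) \<in> borel_measurable torus"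
    using assms by measurable
qed (use assms in \<open>auto simp: norm_mult\<close>)

lemma integrable_K_mult:
  assumes "integrable torus f"
  shows "integrable torus (\<lambda>y. K N (x - y) * f y)"
proof -
  have c: "continuous_on UNIV (\<lambda>y. K N (x - y))"
    by (intro continuous_on_compose2[OF continuous_on_K[of UNIV]] continuous_intros) auto
  then have "bounded ((\<lambda>y. K N (x - y)) ` csq 0)"
    by (intro compact_imp_bounded compact_continuous_image) (auto intro: continuous_on_subset)
  then obtain B where B: "\<And>y. y \<in> csq 0 \<Longrightarrow> \<bar>K N (x - y)\<bar> \<le> B"
    by (auto simp: bounded_iff)
  have [measurable]: "(\<lambda>y. K N (x - y)) \<in> borel_measurable torus"
    using continuous_integrable_sq(1)[OF c, of 0] unit_square_eq_sq by auto
  show ?thesis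
  proof (rule Bochner_Integration.integrable_bound[of _ "\<lambda>y. B * f y"])
    show "(\<lambda>y. K N (x - y) * f y) \<in> borel_measurable torus" using assms by measurable
    show "AE y in torus. norm (K N (x - y) * f y) \<le> norm (B * f y)"
    proof (rule AE_I2)
      fix y assume "y \<in> space torus"
      then have "y \<in> csq 0" using sq_subset_csq[of 0] unit_square_eq_sq by auto
      then have "\<bar>K N (x - y)\<bar> \<le> \<bar>B\<bar>" using B by fastforce
      then show "norm (K N (x - y) * f y) \<le> norm (B * f y)"
        by (simp add: abs_mult mult_right_mono)
    qed
  qed (use assms in simp)
qed

lemma PN_sum:
  assumes "integrable torus f" "N > 0"
  shows "complex_of_real (PN N f x) = (\<Sum>(j, l)\<in>J N. of_real (cN N j l) * fc f j l * ee j l x)"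
proof -
  have "complex_of_real (PN N f x) = (\<integral>y. complex_of_real (K N (x - y) * f y) \<partial>torus)"
    unfolding PN_def by (simp del: of_real_mult)
  also have "\<dots> = (\<integral>y. (\<Sum>k\<in>J N. (of_real (cN N (fst k) (snd k)) * ee (fst k) (snd k) x) * (of_real (f y) * ee (- fst k) (- snd k) y)) \<partial>torus)"
    unfolding of_real_mult K_sum[OF assms(2)] sum_distrib_right
    by (intro Bochner_Integration.integral_cong) (auto simp: ee_diff algebra_simps case_prod_unfold intro!: sum.cong)
  also have "\<dots> = (\<Sum>k\<in>J N. (of_real (cN N (fst k) (snd k)) * ee (fst k) (snd k) x) * fc f (fst k) (snd k))"
    unfolding fc_def
    by (subst Bochner_Integration.integral_sum) (auto intro!: integrable_ee_mult assms)
  finally show ?thesis by (simp add: case_prod_unfold algebra_simps)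
qed

lemma integrable_torus_const [simp]: "integrable torus (\<lambda>_. c::real)"
  using finite_measure.integrable_const[OF finite_measure_sq[of 0]] by (simp add: unit_square_eq_sq)

lemma fc_const: "fc (\<lambda>_. c) j l = (if j = 0 \<and> l = 0 then of_real c else 0)"
  unfolding fc_def using integral_ee[of 0 "-j" "-l"] by (simp add: unit_square_eq_sq)

lemma zero_in_J: "N > 0 \<Longrightarrow> (0, 0) \<in> J N" by (simp add: J_def)

lemma PN_const:
  assumes "N > 0" shows "PN N (\<lambda>_. c) x = c"
proof -
  have "complex_of_real (PN N (\<lambda>_. c) x) = (\<Sum>k\<in>J N. if k = (0, 0) then of_real c else 0)"
    unfolding PN_sum[OF integrable_torus_const assms]
  proof (intro sum.cong refl)
    fix k assume "k \<in> J N"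
    show "(case k of (j, l) \<Rightarrow> of_real (cN N j l) * fc (\<lambda>_. c) j l * ee j l x) = (if k = (0, 0) then of_real c else 0)"
      by (cases k; cases "k = (0, 0)") (auto simp: fc_const cN_def)
  qed
  also have "\<dots> = of_real c" using zero_in_J[OF assms] by simp
  finally show ?thesis by (simp del: of_real_eq_iff add: of_real_eq_iff[symmetric, where 'a=complex])
qed

lemma PN_diff:
  assumes "integrable torus f" "integrable torus g"
  shows "PN N (\<lambda>y. f y - g y) x = PN N f x - PN N g x"
  unfolding PN_def right_diff_distrib
  by (rule Bochner_Integration.integral_diff) (intro integrable_K_mult assms)+

lemma PN_add:
  assumes "integrable torus f" "integrable torus g"
  shows "PN N (\<lambda>y. f y + g y) x = PN N f x + PN N g x"
  unfolding PN_def distrib_left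
  by (rule Bochner_Integration.integral_add) (intro integrable_K_mult assms)+

lemma PN_mult: "PN N (\<lambda>y. c * f y) x = c * PN N f x"
  unfolding PN_def by (simp add: mult.left_commute)

lemma PN_mono:
  assumes "integrable torus f" "integrable torus g" "\<And>y. y \<in> unit_square \<Longrightarrow> f y \<le> g y"
  shows "PN N f x \<le> PN N g x"
  unfolding PN_def
  by (intro integral_mono integrable_K_mult assms) (auto intro!: mult_left_mono K_nonneg assms)

lemma abs_PN_le:
  assumes "integrable torus f"
  shows "\<bar>PN N f x\<bar> \<le> PN N (\<lambda>y. \<bar>f y\<bar>) x"
  unfolding PN_def
  by (rule order_trans[OF integral_abs_bound]) (simp add: abs_mult K_nonneg)

text \<open>Jensen's inequality for the probability density \<open>K N\<close>: apply
  \<open>PN\<close> to the nonnegative function \<open>(f y - m)^2\<close>, where \<open>m\<close>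
  is the mean of \<open>f\<close> itself.\<close>

lemma PN_square_le:
  assumes f: "integrable torus f" and f2: "integrable torus (\<lambda>y. (f y)\<^sup>2)" and "N > 0"
  shows "(PN N f x)\<^sup>2 \<le> PN N (\<lambda>y. (f y)\<^sup>2) x"
proof -
  let ?m = "PN N f x"
  have i: "integrable torus (\<lambda>y. (f y)\<^sup>2 - (2 * ?m) * f y)" using f f2 by simp
  have "0 \<le> PN N (\<lambda>y. (f y - ?m)\<^sup>2) x"
    unfolding PN_def by (intro integral_nonneg_AE AE_I2) (simp add: K_nonneg)
  also have "(\<lambda>y. (f y - ?m)\<^sup>2) = (\<lambda>y. ((f y)\<^sup>2 - (2 * ?m) * f y) + ?m\<^sup>2)"
    by (auto simp: power2_eq_square algebra_simps)
  also have "PN N \<dots> x = PN N (\<lambda>y. (f y)\<^sup>2) x - 2 * ?m * ?m + ?m\<^sup>2"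
    using f f2 by (simp add: PN_add[OF i] PN_diff PN_mult PN_const[OF \<open>N > 0\<close>])
  finally show ?thesis by (simp add: power2_eq_square)
qed

lemma continuous_on_sum_ee [continuous_intros]: "continuous_on S (\<lambda>x. \<Sum>(j, l)\<in>J N. A j l * ee j l x)"
  unfolding case_prod_unfold by (intro continuous_intros)

lemma continuous_on_PN:
  assumes "integrable torus f" "N > 0"
  shows "continuous_on S (PN N f)"
proof -
  have "continuous_on S (\<lambda>x. Re (complex_of_real (PN N f x)))"
    unfolding PN_sum[OF assms] by (intro continuous_intros)
  then show ?thesis by simp
qed

lemma periodic_PN:
  assumes "integrable torus f" "N > 0"
  shows "periodic (PN N f)"
proof -
  have "complex_of_real (PN N f (x + 1, y)) = of_real (PN N f (x, y))"
    "complex_of_real (PN N f (x, y + 1)) = of_real (PN N f (x, y))" for x y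
    unfolding PN_sum[OF assms] by (simp_all only: ee_shift)
  then show ?thesis by (simp add: periodic_def)
qed

lemma integrable_PN:
  assumes "integrable torus f" "N > 0"
  shows "integrable torus (PN N f)"
  using continuous_integrable_sq(1)[OF continuous_on_PN[OF assms], of 0] by (simp add: unit_square_eq_sq)

lemma integral_PN:
  assumes "integrable torus f" "N > 0"
  shows "(\<integral>x. PN N f x \<partial>torus) = (\<integral>x. f x \<partial>torus)"
proof -
  have ie: "integrable torus (ee j l)" for j l
    using continuous_integrable_sq(1)[OF continuous_on_ee, of 0] by (simp add: unit_square_eq_sq)
  have "complex_of_real (\<integral>x. PN N f x \<partial>torus) = (\<integral>x. of_real (PN N f x) \<partial>torus)"
    by simp
  also have "\<dots> = (\<Sum>k\<in>J N. of_real (cN N (fst k) (snd k)) * fc f (fst k) (snd k) * (\<integral>x. ee (fst k) (snd k) x \<partial>torus))"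
    unfolding PN_sum[OF assms] case_prod_unfold
    by (subst Bochner_Integration.integral_sum) (auto intro!: ie)
  also have "\<dots> = (\<Sum>k\<in>J N. if k = (0, 0) then fc f 0 0 else 0)"
    unfolding unit_square_eq_sq integral_ee
  proof (intro sum.cong refl)
    fix k :: "int \<times> int"
    show "of_real (cN N (fst k) (snd k)) * fc f (fst k) (snd k) * (if fst k = 0 \<and> snd k = 0 then 1 else 0)
        = (if k = (0, 0) then fc f 0 0 else 0)"
      by (cases k; cases "k = (0, 0)") (auto simp: cN_def)
  qed
  also have "\<dots> = fc f 0 0" using zero_in_J[OF assms(2)] by simp
  also have "\<dots> = complex_of_real (\<integral>x. f x \<partial>torus)" unfolding fc_def by simp
  finally show ?thesis by (simp del: of_real_eq_iff add: of_real_eq_iff[symmetric, where 'a=complex])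
qed

section \<open>Convergence of the Fejer means\<close>

lemma integrable_PN_test:
  "integrable torus (ee j l)"
  using continuous_integrable_sq(1)[OF continuous_on_ee, of 0] by (simp add: unit_square_eq_sq)

text \<open>Korovkin's test functions: the squared sine is a smooth periodic substitute for the
  squared distance and equals \<open>1/2 - 1/2 * cos\<close>. The kernel multiplies frequency one by
  \<open>1 - 1/N\<close>, which leaves \<open>1/(2N)\<close>.\<close>

lemma PN_korovkin:
  assumes "N > 0"
  shows "PN N (\<lambda>y. (sin (pi * (fst x - fst y)))\<^sup>2) x = 1 / (2 * real N)"
    and "PN N (\<lambda>y. (sin (pi * (snd x - snd y)))\<^sup>2) x = 1 / (2 * real N)"
proof -
  have sin2: "(sin (pi * t))\<^sup>2 = 1/2 - 1/2 * cos (2 * pi * t)" for t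
    using cos_double_sin[of "pi * t"] by (simp add: mult.assoc field_simps)
  have int1: "(\<integral>y. complex_of_real (K N (x - y)) * ee p q (x - y) \<partial>torus) = of_real (1 - 1 / N)"
    if pq: "(p, q) \<in> {(1, 0), (0, 1)}" for p q
  proof -
    have "(\<integral>y. complex_of_real (K N (x - y)) * ee p q (x - y) \<partial>torus) =
      (\<integral>y. (\<Sum>k\<in>J N. (of_real (cN N (fst k) (snd k)) * ee (fst k + p) (snd k + q) x) * ee (- (fst k + p)) (- (snd k + q)) y) \<partial>torus)"
    proof (intro Bochner_Integration.integral_cong refl)
      fix y
      have "complex_of_real (K N (x - y)) * ee p q (x - y) = (\<Sum>k\<in>J N. of_real (cN N (fst k) (snd k)) * (ee (fst k) (snd k) (x - y) * ee p q (x - y)))"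
        unfolding K_sum[OF assms] sum_distrib_right by (simp add: case_prod_unfold mult.assoc)
      then show "complex_of_real (K N (x - y)) * ee p q (x - y) = (\<Sum>k\<in>J N. (of_real (cN N (fst k) (snd k)) * ee (fst k + p) (snd k + q) x) * ee (- (fst k + p)) (- (snd k + q)) y)"
        by (simp only: ee_add[symmetric]) (simp only: ee_diff mult.assoc)
    qed
    also have "\<dots> = (\<Sum>k\<in>J N. (of_real (cN N (fst k) (snd k)) * ee (fst k + p) (snd k + q) x) * (\<integral>y. ee (- (fst k + p)) (- (snd k + q)) y \<partial>torus))"
      by (subst Bochner_Integration.integral_sum) (auto intro!: integrable_PN_test)
    also have "\<dots> = (\<Sum>k\<in>J N. if k = (-p, -q) then of_real (1 - 1 / N) else 0)"
      unfolding unit_square_eq_sq integral_ee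
    proof (intro sum.cong refl)
      fix k :: "int \<times> int"
      show "(of_real (cN N (fst k) (snd k)) * ee (fst k + p) (snd k + q) x) * (if - (fst k + p) = 0 \<and> - (snd k + q) = 0 then 1 else 0)
          = (if k = (-p, -q) then of_real (1 - 1 / N) else 0)"
        using pq by (cases k; cases "k = (-p, -q)") (auto simp: cN_def)
    qed
    also have "\<dots> = of_real (1 - 1 / N)"
    \<comment> \<open>For \<open>N = 1\<close> the frequency falls outside \<open>J N\<close>, so
      the sum is 0, in agreement with \<open>1 - 1/N = 0\<close>.\<close>
    proof (cases "N = 1")
      case False
      then have "(-p, -q) \<in> J N" using pq assms by (auto simp: J_def)
      then show ?thesis by simp
    qed simp
    finally show ?thesis .
  qed
  have main: "PN N (\<lambda>y. 1/2 - 1/2 * Re (ee p q (x - y))) x = 1 / (2 * real N)"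
    if pq: "(p, q) \<in> {(1, 0), (0, 1)}" for p q
  proof -
    have c: "continuous_on UNIV (\<lambda>y. ee p q (x - y))"
      by (intro continuous_on_compose2[OF continuous_on_ee[of UNIV]] continuous_intros) auto
    then have i: "integrable torus (\<lambda>y. Re (ee p q (x - y)))"
      unfolding unit_square_eq_sq by (intro continuous_integrable_sq continuous_on_Re)
    have c': "continuous_on UNIV (\<lambda>y. complex_of_real (K N (x - y)) * ee p q (x - y))"
      by (intro continuous_on_mult c continuous_on_of_real continuous_on_compose2[OF continuous_on_K[of UNIV]] continuous_intros) auto
    then have ic: "integrable torus (\<lambda>y. complex_of_real (K N (x - y)) * ee p q (x - y))"
      using continuous_integrable_sq(1)[OF c', of 0] unit_square_eq_sq by auto
    have "PN N (\<lambda>y. Re (ee p q (x - y))) x = (\<integral>y. Re (complex_of_real (K N (x - y)) * ee p q (x - y)) \<partial>torus)"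
      unfolding PN_def by simp
    also have "\<dots> = Re (\<integral>y. complex_of_real (K N (x - y)) * ee p q (x - y) \<partial>torus)"
      using ic by (rule integral_Re)
    also have "\<dots> = 1 - 1 / N" unfolding int1[OF pq] by (simp only: Re_complex_of_real)
    finally have "PN N (\<lambda>y. Re (ee p q (x - y))) x = 1 - 1 / N" .
    note eq = this
    have i': "integrable torus (\<lambda>y. 1/2 * Re (ee p q (x - y)))" using i by simp
    have "PN N (\<lambda>y. 1/2 - 1/2 * Re (ee p q (x - y))) x = 1/2 - 1/2 * (1 - 1 / N)"
      by (simp only: PN_diff[OF integrable_torus_const i'] PN_const[OF assms] PN_mult eq)
    then show ?thesis by (simp add: field_simps)
  qed
  show "PN N (\<lambda>y. (sin (pi * (fst x - fst y)))\<^sup>2) x = 1 / (2 * real N)"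
    using main[of 1 0] by (simp add: sin2 ee_def)
  show "PN N (\<lambda>y. (sin (pi * (snd x - snd y)))\<^sup>2) x = 1 / (2 * real N)"
    using main[of 0 1] by (simp add: sin2 ee_def)
qed

lemma sin_pi_eq_0_cases:
  assumes "sin (pi * t) = 0" "-1 \<le> t" "t \<le> 1"
  shows "t = -1 \<or> t = 0 \<or> t = 1"
proof -
  obtain i :: int where "pi * t = of_int i * pi" using assms(1) by (auto simp: sin_zero_iff_int2)
  then have t: "t = of_int i" by simp
  then have "-1 \<le> i" "i \<le> 1" using assms by linarith+
  then have "i = -1 \<or> i = 0 \<or> i = 1" by linarith
  with t show ?thesis by auto
qed

text \<open>By compactness the sine distance is bounded below on the pairs where \<open>g\<close>
  varies by at least \<open>e\<close>, provided that it has no zero there. It does vanish for points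
  identified on the torus, and the boundary condition on \<open>g\<close> makes these
  harmless.\<close>

lemma korovkin_modulus:
  fixes g :: "real \<times> real \<Rightarrow> real"
  assumes g: "continuous_on UNIV g" and bd: "\<And>x. x \<in> csq 0 - box (0, 0) (1, 1) \<Longrightarrow> g x = 0" and "e > 0"
  obtains C where "C \<ge> 0" "\<And>x y. x \<in> csq 0 \<Longrightarrow> y \<in> csq 0 \<Longrightarrow>
    \<bar>g y - g x\<bar> \<le> e + C * ((sin (pi * (fst x - fst y)))\<^sup>2 + (sin (pi * (snd x - snd y)))\<^sup>2)"
proof -
  let ?h = "\<lambda>z. (sin (pi * (fst (fst z) - fst (snd z))))\<^sup>2 + (sin (pi * (snd (fst z) - snd (snd z))))\<^sup>2"
  define A where "A = {z \<in> csq 0 \<times> csq 0. e \<le> \<bar>g (snd z) - g (fst z)\<bar>}"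
  have cg1: "continuous_on S (\<lambda>z. g (fst z))" for S :: "((real \<times> real) \<times> (real \<times> real)) set"
    by (intro continuous_on_compose2[OF g] continuous_intros) auto
  have cg2: "continuous_on S (\<lambda>z. g (snd z))" for S :: "((real \<times> real) \<times> (real \<times> real)) set"
    by (intro continuous_on_compose2[OF g] continuous_intros) auto
  have "closed {z. e \<le> \<bar>g (snd z) - g (fst z)\<bar>}"
    by (intro closed_Collect_le continuous_intros cg1 cg2)
  then have "compact A"
    unfolding A_def Collect_conj_eq by (simp add: compact_Int_closed compact_Times Collect_mem_eq)
  have pos: "?h z > 0" if "z \<in> A" for z
  proof (rule ccontr)
    assume "\<not> ?h z > 0"
    then have 0: "sin (pi * (fst (fst z) - fst (snd z))) = 0" "sin (pi * (snd (fst z) - snd (snd z))) = 0"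
      by (smt (verit) zero_le_power2 zero_eq_power2)+
    obtain x1 x2 y1 y2 where z: "z = ((x1, x2), (y1, y2))" by (metis prod.collapse)
    have b: "0 \<le> x1" "x1 \<le> 1" "0 \<le> x2" "x2 \<le> 1" "0 \<le> y1" "y1 \<le> 1" "0 \<le> y2" "y2 \<le> 1"
      using that by (auto simp: A_def z)
    have "x1 - y1 = -1 \<or> x1 - y1 = 0 \<or> x1 - y1 = 1" "x2 - y2 = -1 \<or> x2 - y2 = 0 \<or> x2 - y2 = 1"
      using 0 b sin_pi_eq_0_cases[of "x1 - y1"] sin_pi_eq_0_cases[of "x2 - y2"] by (auto simp: z)
    \<comment> \<open>If some coordinates differ by exactly 1, one is 0 and the other 1, so both
      points lie on the boundary of the square.\<close>
    then have "(x1, x2) = (y1, y2) \<or> ((x1, x2) \<notin> box (0,0) (1,1) \<and> (y1, y2) \<notin> box (0,0) (1,1))"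
      using b by (auto simp: box_prod)
    then have "g (x1, x2) = g (y1, y2)"
      using bd b by (auto simp: cbox_Pair_eq)
    then show False using that \<open>e > 0\<close> by (auto simp: A_def z)
  qed
  have "compact (g ` csq 0)"
    by (intro compact_continuous_image compact_cbox continuous_on_subset[OF g]) auto
  then obtain B where B: "\<And>x. x \<in> csq 0 \<Longrightarrow> \<bar>g x\<bar> \<le> B"
    by (metis bounded_iff compact_imp_bounded imageI real_norm_def)
  obtain m where m: "m > 0" "\<And>z. z \<in> A \<Longrightarrow> m \<le> ?h z"
  proof (cases "A = {}")
    case False
    have "continuous_on A ?h" by (intro continuous_intros)
    then have "\<exists>z0\<in>A. \<forall>z\<in>A. ?h z0 \<le> ?h z"
      by (rule continuous_attains_inf[OF \<open>compact A\<close> False])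
    then obtain z0 where z0: "z0 \<in> A" "\<And>z. z \<in> A \<Longrightarrow> ?h z0 \<le> ?h z" by blast
    show ?thesis using pos[OF z0(1)] z0(2) by (rule that)
  qed (use that[of 1] in auto)
  show ?thesis
  proof (rule that[of "2 * \<bar>B\<bar> / m"])
    show "2 * \<bar>B\<bar> / m \<ge> 0" using m by simp
    fix x y :: "real \<times> real" assume xy: "x \<in> csq 0" "y \<in> csq 0"
    show "\<bar>g y - g x\<bar> \<le> e + 2 * \<bar>B\<bar> / m * ((sin (pi * (fst x - fst y)))\<^sup>2 + (sin (pi * (snd x - snd y)))\<^sup>2)"
    proof (cases "(x, y) \<in> A")
      case True
      have "\<bar>g y - g x\<bar> \<le> 2 * \<bar>B\<bar>" using B[OF xy(1)] B[OF xy(2)] by linarith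
      also have "2 * \<bar>B\<bar> = 2 * \<bar>B\<bar> / m * m" using m by simp
      also have "\<dots> \<le> 2 * \<bar>B\<bar> / m * ?h (x, y)" using m True by (intro mult_left_mono) auto
      finally show ?thesis using \<open>e > 0\<close> by simp
    next
      case False
      then have "\<bar>g y - g x\<bar> < e" using xy by (auto simp: A_def)
      moreover have "0 \<le> 2 * \<bar>B\<bar> / m * ((sin (pi * (fst x - fst y)))\<^sup>2 + (sin (pi * (snd x - snd y)))\<^sup>2)"
        using m by (intro mult_nonneg_nonneg) auto
      ultimately show ?thesis by linarith
    qed
  qed
qed

text \<open>Positivity of \<open>PN\<close> carries the modulus of \<open>korovkin_modulus\<close>
  over to the means, and the two test functions contribute \<open>C/N\<close> in total.\<close>

lemma PN_uniform:
  fixes g :: "real \<times> real \<Rightarrow> real"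
  assumes g: "continuous_on UNIV g" and bd: "\<And>x. x \<in> csq 0 - box (0, 0) (1, 1) \<Longrightarrow> g x = 0" and "e > 0"
  shows "\<forall>\<^sub>F N in sequentially. \<forall>x\<in>unit_square. \<bar>PN N g x - g x\<bar> \<le> e"
proof -
  obtain C where C: "C \<ge> 0" "\<And>x y. x \<in> csq 0 \<Longrightarrow> y \<in> csq 0 \<Longrightarrow>
    \<bar>g y - g x\<bar> \<le> e/2 + C * ((sin (pi * (fst x - fst y)))\<^sup>2 + (sin (pi * (snd x - snd y)))\<^sup>2)"
    using korovkin_modulus[OF g bd, of "e/2"] \<open>e > 0\<close> by auto
  have sub: "unit_square \<subseteq> csq 0" using sq_subset_csq[of 0] by (simp add: unit_square_eq_sq)
  have ig: "integrable torus g"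
    using continuous_integrable_sq(1)[OF g, of 0] by (simp add: unit_square_eq_sq)
  have bound: "\<bar>PN N g x - g x\<bar> \<le> e/2 + C * (1 / N)" if "N > 0" "x \<in> unit_square" for N x
  proof -
    let ?s1 = "\<lambda>y. (sin (pi * (fst x - fst y)))\<^sup>2" and ?s2 = "\<lambda>y. (sin (pi * (snd x - snd y)))\<^sup>2"
    have i: "integrable torus ?s1" "integrable torus ?s2"
      unfolding unit_square_eq_sq by (intro continuous_integrable_sq continuous_intros)+
    have "\<bar>PN N g x - g x\<bar> = \<bar>PN N (\<lambda>y. g y - g x) x\<bar>"
      using ig that by (simp add: PN_diff PN_const)
    also have "\<dots> \<le> PN N (\<lambda>y. \<bar>g y - g x\<bar>) x"
      using ig by (intro abs_PN_le) auto
    also have "\<dots> \<le> PN N (\<lambda>y. e/2 + C * (?s1 y + ?s2 y)) x"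
      using ig i that sub by (intro PN_mono C) auto
    also have "\<dots> = e/2 + C * (1 / (2 * real N) + 1 / (2 * real N))"
      using i that by (simp add: PN_add PN_mult PN_const PN_korovkin)
    also have "\<dots> = e/2 + C * (1 / N)" by simp
    finally show ?thesis .
  qed
  have "(\<lambda>N. e/2 + C * (1 / N)) \<longlonglongrightarrow> e/2 + C * 0"
    by (intro tendsto_intros lim_1_over_n)
  then have "\<forall>\<^sub>F N in sequentially. e/2 + C * (1 / N) < e"
    by (rule order_tendstoD(2)) (use \<open>e > 0\<close> in simp)
  then show ?thesis
    using eventually_gt_at_top[of 0]
  proof eventually_elim
    case (elim N)
    then show ?case using bound[of N] by (meson less_imp_le order_trans)
  qed
qed

text \<open>The library's notion \<^const>\<open>measurable_on\<close> supplies continuous functions converging almost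
  everywhere; truncation and a cutoff at the boundary make them converge in \<open>L\<^sup>p\<close>.\<close>

lemma continuous_approx_bounded:
  fixes f :: "real \<times> real \<Rightarrow> real"
  assumes f: "f \<in> borel_measurable torus" and B: "\<And>x. \<bar>f x\<bar> \<le> B" and "p > 0" "e > 0"
  obtains g where "continuous_on UNIV g" "\<And>x. x \<in> csq 0 - box (0, 0) (1, 1) \<Longrightarrow> g x = 0"
    "(\<integral>x. \<bar>f x - g x\<bar> ^ p \<partial>torus) < e"
proof -
  have "f measurable_on unit_square"
    using f by (simp add: measurable_on_iff_borel_measurable unit_square_eq_sq)
  then obtain Z G where Z: "negligible Z" and G: "\<And>n. continuous_on UNIV (G n)"
    and lim: "\<And>x. x \<notin> Z \<Longrightarrow> (\<lambda>n. G n x) \<longlonglongrightarrow> (if x \<in> unit_square then f x else 0)"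
    unfolding measurable_on_def by blast
  \<comment> \<open>Inside the open square both factors \<open>t * (1 - t)\<close> are positive, so
    the clipped multiples eventually equal 1; on the boundary one of them is 0 for every
    \<open>n\<close>.\<close>
  define chi where "chi n x = max 0 (min 1 (real n * (fst x * (1 - fst x)))) * max 0 (min 1 (real n * (snd x * (1 - snd x))))" for n :: nat and x :: "real \<times> real"
  define g where "g n x = chi n x * max (-B) (min B (G n x))" for n x
  have cont: "continuous_on UNIV (g n)" for n
    unfolding g_def chi_def by (intro continuous_intros G)
  have m1: "(\<lambda>n. max 0 (min 1 (real n * c))) \<longlonglongrightarrow> 1" if "c > 0" for c :: real
  proof (rule tendsto_eventually)
    obtain n0 :: nat where "1 / c < real n0" using reals_Archimedean2 by blast
    then have "1 \<le> real n * c" if "n \<ge> n0" for n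
      using that \<open>c > 0\<close> by (smt (verit) divide_less_eq mult_right_mono of_nat_mono mult.commute)
    then show "\<forall>\<^sub>F n in sequentially. max 0 (min 1 (real n * c)) = 1"
      by (auto simp: eventually_sequentially intro!: exI[of _ n0])
  qed
  have negf: "negligible (csq 0 - box (0,0) (1,1))"
  proof (rule negligible_subset)
    show "negligible (frontier (csq 0))" by (intro negligible_convex_frontier convex_box)
    show "csq 0 - box (0, 0) (1, 1) \<subseteq> frontier (csq 0)" by (auto simp: frontier_def interior_cbox)
  qed
  have usub: "unit_square \<subseteq> csq 0" using sq_subset_csq[of 0] by (simp add: unit_square_eq_sq)
  have neg: "negligible (Z \<union> (csq 0 - box (0,0) (1,1)))"
    using Z negf by (rule negligible_Un)
  have ae: "AE x in torus. x \<notin> Z \<union> (csq 0 - box (0,0) (1,1))"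
    using neg unfolding negligible_iff_null_sets
    by (subst AE_restrict_space_iff) (auto simp: unit_square_eq_sq dest: AE_not_in)
  have limg: "AE x in torus. (\<lambda>n. \<bar>f x - g n x\<bar> ^ p) \<longlonglongrightarrow> 0"
    using ae AE_space
  proof eventually_elim
    case (elim x)
    then have x: "x \<notin> Z" "x \<in> box (0,0) (1,1)" "x \<in> unit_square" using usub by auto
    have pos: "0 < fst x * (1 - fst x)" "0 < snd x * (1 - snd x)"
      using x(2) by (cases x; simp add: box_prod)+
    have "(\<lambda>n. chi n x) \<longlonglongrightarrow> 1 * 1"
      unfolding chi_def by (rule tendsto_mult[OF m1[OF pos(1)] m1[OF pos(2)]])
    moreover have "(\<lambda>n. max (-B) (min B (G n x))) \<longlonglongrightarrow> max (-B) (min B (f x))"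
      using lim[OF x(1)] x(3) by (intro tendsto_intros) auto
    ultimately have "(\<lambda>n. g n x) \<longlonglongrightarrow> 1 * 1 * max (-B) (min B (f x))"
      unfolding g_def by (rule tendsto_mult)
    moreover have "max (-B) (min B (f x)) = f x" using B[of x] by auto
    ultimately have "(\<lambda>n. \<bar>f x - g n x\<bar> ^ p) \<longlonglongrightarrow> \<bar>f x - f x\<bar> ^ p"
      by (intro tendsto_intros) simp
    then show ?case using \<open>p > 0\<close> by (simp add: power_0_left)
  qed
  have B0: "B \<ge> 0" using B[of "(0, 0)"] by linarith
  have chi01: "0 \<le> chi n x \<and> chi n x \<le> 1" for n x
    unfolding chi_def by (auto intro!: mult_le_one mult_nonneg_nonneg)
  have gB: "\<bar>g n x\<bar> \<le> B" for n x
  proof -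
    have "\<bar>g n x\<bar> = chi n x * \<bar>max (-B) (min B (G n x))\<bar>" using chi01 by (simp add: g_def abs_mult)
    also have "\<dots> \<le> 1 * B" using chi01 B0 by (intro mult_mono) auto
    finally show ?thesis by simp
  qed
  have meas: "g n \<in> borel_measurable torus" for n
    using continuous_integrable_sq(1)[OF cont, of 0] by (auto simp: unit_square_eq_sq)
  have "(\<lambda>n. \<integral>x. \<bar>f x - g n x\<bar> ^ p \<partial>torus) \<longlonglongrightarrow> (\<integral>x. 0 \<partial>torus)"
  proof (rule integral_dominated_convergence[where w="\<lambda>_. (2 * B) ^ p"])
    show "AE x in torus. norm (\<bar>f x - g n x\<bar> ^ p) \<le> (2 * B) ^ p" for n
    proof (rule AE_I2)
      fix x
      have "\<bar>f x - g n x\<bar> \<le> 2 * B" using B[of x] gB[of n x] by linarith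
      then have "\<bar>f x - g n x\<bar> ^ p \<le> (2 * B) ^ p" by (intro power_mono) auto
      then show "norm (\<bar>f x - g n x\<bar> ^ p) \<le> (2 * B) ^ p"
        by (simp only: real_norm_def power_abs abs_idempotent)
    qed
  qed (use f meas limg in \<open>auto intro: borel_measurable_power\<close>)
  then have "\<forall>\<^sub>F n in sequentially. (\<integral>x. \<bar>f x - g n x\<bar> ^ p \<partial>torus) < e"
    using \<open>e > 0\<close> by (intro order_tendstoD) auto
  then obtain n where "(\<integral>x. \<bar>f x - g n x\<bar> ^ p \<partial>torus) < e"
    by (auto simp: eventually_sequentially)
  moreover have "g n x = 0" if "x \<in> csq 0 - box (0, 0) (1, 1)" for x
    using that by (cases x) (auto simp: g_def chi_def box_prod cbox_Pair_eq)
  ultimately show ?thesis using that cont by blast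
qed

lemma power_add_le_2: "p = 1 \<or> p = 2 \<Longrightarrow> \<bar>a + b\<bar> ^ p \<le> 2 * (\<bar>a\<bar> ^ p + \<bar>b :: real\<bar> ^ p)"
  using sum_squares_bound[of a b] by (auto simp: power2_eq_square algebra_simps)

lemma continuous_approx:
  fixes f :: "real \<times> real \<Rightarrow> real"
  assumes f: "f \<in> borel_measurable torus" "integrable torus (\<lambda>x. \<bar>f x\<bar> ^ p)" and p: "p = 1 \<or> p = 2" and "e > 0"
  obtains g where "continuous_on UNIV g" "\<And>x. x \<in> csq 0 - box (0, 0) (1, 1) \<Longrightarrow> g x = 0"
    "(\<integral>x. \<bar>f x - g x\<bar> ^ p \<partial>torus) < e"
proof -
  have p0: "p > 0" using p by auto
  define t where "t n x = max (- real n) (min (real n) (f x))" for n x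
  have meast: "t n \<in> borel_measurable torus" for n unfolding t_def using f(1) by measurable
  have tf: "\<bar>f x - t n x\<bar> \<le> \<bar>f x\<bar>" for n x by (auto simp: t_def)
  have tn: "\<bar>t n x\<bar> \<le> real n" for n x by (auto simp: t_def)
  have dom: "\<bar>f x - t n x\<bar> ^ p \<le> \<bar>f x\<bar> ^ p" for n x by (intro power_mono tf) auto
  have "(\<lambda>n. \<integral>x. \<bar>f x - t n x\<bar> ^ p \<partial>torus) \<longlonglongrightarrow> (\<integral>x. 0 \<partial>torus)"
  proof (rule integral_dominated_convergence[where w="\<lambda>x. \<bar>f x\<bar> ^ p"])
    show "AE x in torus. (\<lambda>n. \<bar>f x - t n x\<bar> ^ p) \<longlonglongrightarrow> 0"
    proof (rule AE_I2, rule tendsto_eventually)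
      fix x
      obtain n0 :: nat where "\<bar>f x\<bar> < real n0" using reals_Archimedean2 by blast
      then have "\<bar>f x - t n x\<bar> ^ p = 0" if "n \<ge> n0" for n
        using that p0 by (auto simp: t_def min_def max_def)
      then show "\<forall>\<^sub>F n in sequentially. \<bar>f x - t n x\<bar> ^ p = 0"
        by (auto simp: eventually_sequentially intro!: exI[of _ n0])
    qed
  qed (use f meast dom in \<open>auto intro: borel_measurable_power\<close>)
  \<comment> \<open>Two errors below \<open>e / 4\<close>, doubled by \<open>power_add_le_2\<close>,
    add up to less than \<open>e\<close>.\<close>
  then have "\<forall>\<^sub>F n in sequentially. (\<integral>x. \<bar>f x - t n x\<bar> ^ p \<partial>torus) < e / 4"
    using \<open>e > 0\<close> by (intro order_tendstoD) auto
  then obtain n where n: "(\<integral>x. \<bar>f x - t n x\<bar> ^ p \<partial>torus) < e / 4"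
    by (auto simp: eventually_sequentially)
  obtain g where g: "continuous_on UNIV g" "\<And>x. x \<in> csq 0 - box (0, 0) (1, 1) \<Longrightarrow> g x = 0"
    "(\<integral>x. \<bar>t n x - g x\<bar> ^ p \<partial>torus) < e / 4"
    using continuous_approx_bounded[OF meast tn p0, of "e/4" n] \<open>e > 0\<close> by auto
  have mg: "g \<in> borel_measurable torus"
    using continuous_integrable_sq(1)[OF g(1), of 0] by (auto simp: unit_square_eq_sq)
  have i1: "integrable torus (\<lambda>x. \<bar>f x - t n x\<bar> ^ p)"
    using f dom by (intro Bochner_Integration.integrable_bound[OF f(2)]) (use meast in auto)
  have i2: "integrable torus (\<lambda>x. \<bar>t n x - g x\<bar> ^ p)"
  proof -
    obtain B where B: "\<And>x. x \<in> csq 0 \<Longrightarrow> \<bar>g x\<bar> \<le> B"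
      using compact_continuous_image[OF continuous_on_subset[OF g(1)] compact_cbox[of "(-0,-0)" "(1-0,1-0)"]]
      by (metis bounded_iff compact_imp_bounded imageI real_norm_def subset_UNIV)
    show ?thesis
    proof (rule finite_measure.integrable_const_bound[OF finite_measure_sq[of 0], folded unit_square_eq_sq])
      show "AE x in torus. norm (\<bar>t n x - g x\<bar> ^ p) \<le> (real n + B) ^ p"
      proof (rule AE_I2)
        fix x assume "x \<in> space torus"
        then have "x \<in> csq 0" using sq_subset_csq[of 0] by (auto simp: unit_square_eq_sq)
        then have "\<bar>t n x - g x\<bar> \<le> real n + B" using B[of x] tn[of n x] by linarith
        then show "norm (\<bar>t n x - g x\<bar> ^ p) \<le> (real n + B) ^ p" by (simp add: power_mono)
      qed
    qed (use meast mg in auto)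
  qed
  have "(\<integral>x. \<bar>f x - g x\<bar> ^ p \<partial>torus) \<le> (\<integral>x. 2 * (\<bar>f x - t n x\<bar> ^ p + \<bar>t n x - g x\<bar> ^ p) \<partial>torus)"
  proof (rule integral_mono_AE')
    show "integrable torus (\<lambda>x. 2 * (\<bar>f x - t n x\<bar> ^ p + \<bar>t n x - g x\<bar> ^ p))"
      using i1 i2 by auto
    show "AE x in torus. \<bar>f x - g x\<bar> ^ p \<le> 2 * (\<bar>f x - t n x\<bar> ^ p + \<bar>t n x - g x\<bar> ^ p)"
    proof (rule AE_I2)
      fix x
      show "\<bar>f x - g x\<bar> ^ p \<le> 2 * (\<bar>f x - t n x\<bar> ^ p + \<bar>t n x - g x\<bar> ^ p)"
        using power_add_le_2[OF p, of "f x - t n x" "t n x - g x"] by simp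
    qed
  qed auto
  also have "\<dots> < e" using i1 i2 n g(3) by simp
  finally show ?thesis using that g by blast
qed

lemma integrable_of_Lp:
  assumes f: "f \<in> borel_measurable torus" "integrable torus (\<lambda>x. \<bar>f x\<bar> ^ p)" and p: "p \<ge> 1"
  shows "integrable torus (f :: _ \<Rightarrow> real)"
proof (rule Bochner_Integration.integrable_bound[of _ "\<lambda>x. 1 + \<bar>f x\<bar> ^ p"])
  show "AE x in torus. norm (f x) \<le> norm (1 + \<bar>f x\<bar> ^ p)"
  proof (rule AE_I2)
    fix x
    have "\<bar>f x\<bar> \<le> 1 + \<bar>f x\<bar> ^ p"
    proof (cases "\<bar>f x\<bar> \<le> 1")
      case False
      then have "\<bar>f x\<bar> ^ 1 \<le> \<bar>f x\<bar> ^ p" using p by (intro power_increasing) auto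
      then show ?thesis by simp
    qed (simp add: add_increasing2)
    then show "norm (f x) \<le> norm (1 + \<bar>f x\<bar> ^ p)" by simp
  qed
qed (use f in auto)

lemma abs_PN_power_le:
  assumes "integrable torus f" "integrable torus (\<lambda>x. \<bar>f x\<bar> ^ p)" "p = 1 \<or> p = 2" "N > 0"
  shows "\<bar>PN N f x\<bar> ^ p \<le> PN N (\<lambda>y. \<bar>f y\<bar> ^ p) x"
  using assms abs_PN_le[of f N x] PN_square_le[of f N x] by auto

text \<open>Density argument: by Jensen's inequality and preservation of the mean,
  \<open>PN N\<close> does not increase the L^p norm, so it suffices to have uniform convergence for
  a continuous \<open>g\<close> close to \<open>f\<close>.\<close>

lemma PN_tendsto:
  assumes f: "f \<in> borel_measurable torus" "integrable torus (\<lambda>x. \<bar>f x\<bar> ^ p)" and p: "p = 1 \<or> p = 2"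
  shows "(\<lambda>N. \<integral>x. \<bar>PN N f x - f x\<bar> ^ p \<partial>torus) \<longlonglongrightarrow> 0"
proof (rule LIMSEQ_I)
  fix e :: real assume "e > 0"
  have p1: "p \<ge> 1" using p by auto
  have fi: "integrable torus f" by (rule integrable_of_Lp[OF f p1])
  \<comment> \<open>The final bound is \<open>4 * d + 4 * d + 2 * d\<close>, below \<open>e\<close>
    for this choice; \<open>d\<close> at most 1 allows \<open>d ^ p\<close> to be replaced by
    \<open>d\<close>.\<close>
  define d where "d = min 1 (e / 24)"
  have d: "d > 0" "d \<le> 1" "d \<le> e / 24" using \<open>e > 0\<close> by (auto simp: d_def)
  obtain g where g: "continuous_on UNIV g" "\<And>x. x \<in> csq 0 - box (0, 0) (1, 1) \<Longrightarrow> g x = 0"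
    "(\<integral>x. \<bar>f x - g x\<bar> ^ p \<partial>torus) < d"
    using continuous_approx[OF f p \<open>d > 0\<close>] by auto
  have gi: "integrable torus g"
    using continuous_integrable_sq(1)[OF g(1), of 0] by (simp add: unit_square_eq_sq)
  have gpi: "integrable torus (\<lambda>x. \<bar>g x\<bar> ^ p)"
    unfolding unit_square_eq_sq by (intro continuous_integrable_sq continuous_intros g)
  have fgp: "integrable torus (\<lambda>x. \<bar>f x - g x\<bar> ^ p)"
  proof (rule Bochner_Integration.integrable_bound[of _ "\<lambda>x. 2 * (\<bar>f x\<bar> ^ p + \<bar>g x\<bar> ^ p)"])
    show "AE x in torus. norm (\<bar>f x - g x\<bar> ^ p) \<le> norm (2 * (\<bar>f x\<bar> ^ p + \<bar>g x\<bar> ^ p))"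
    proof (rule AE_I2)
      fix x
      show "norm (\<bar>f x - g x\<bar> ^ p) \<le> norm (2 * (\<bar>f x\<bar> ^ p + \<bar>g x\<bar> ^ p))"
        using power_add_le_2[OF p, of "f x" "- g x"] by simp
    qed
  qed (use f gpi fi gi in auto)
  have fg: "integrable torus (\<lambda>x. f x - g x)" using fi gi by auto
  have "\<forall>\<^sub>F N in sequentially. (\<forall>x\<in>unit_square. \<bar>PN N g x - g x\<bar> \<le> d) \<and> N > 0"
    using PN_uniform[OF g(1,2) d(1)] eventually_gt_at_top[of 0] by (rule eventually_conj)
  then obtain N0 where N0: "\<And>N. N \<ge> N0 \<Longrightarrow> (\<forall>x\<in>unit_square. \<bar>PN N g x - g x\<bar> \<le> d) \<and> N > 0"
    by (auto simp: eventually_sequentially)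
  show "\<exists>N0. \<forall>N\<ge>N0. norm ((\<integral>x. \<bar>PN N f x - f x\<bar> ^ p \<partial>torus) - 0) < e"
  proof (intro exI allI impI)
    fix N assume N: "N \<ge> N0"
    then have N1: "N > 0" using N0 by blast
    let ?R = "\<lambda>x. 4 * PN N (\<lambda>y. \<bar>f y - g y\<bar> ^ p) x + (4 * d + 2 * \<bar>f x - g x\<bar> ^ p)"
    have le: "\<bar>PN N f x - f x\<bar> ^ p \<le> ?R x" if x: "x \<in> unit_square" for x
    proof -
      have "\<bar>PN N f x - f x\<bar> ^ p = \<bar>(PN N (\<lambda>y. f y - g y) x + (PN N g x - g x)) + (g x - f x)\<bar> ^ p"
        using fi gi by (simp add: PN_diff)
      also have "\<dots> \<le> 2 * (\<bar>PN N (\<lambda>y. f y - g y) x + (PN N g x - g x)\<bar> ^ p + \<bar>g x - f x\<bar> ^ p)"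
        by (rule power_add_le_2[OF p])
      also have "\<bar>PN N (\<lambda>y. f y - g y) x + (PN N g x - g x)\<bar> ^ p \<le>
          2 * (\<bar>PN N (\<lambda>y. f y - g y) x\<bar> ^ p + \<bar>PN N g x - g x\<bar> ^ p)"
        by (rule power_add_le_2[OF p])
      also have "\<bar>PN N (\<lambda>y. f y - g y) x\<bar> ^ p \<le> PN N (\<lambda>y. \<bar>f y - g y\<bar> ^ p) x"
        by (rule abs_PN_power_le[OF fg fgp p N1])
      also have "\<bar>PN N g x - g x\<bar> ^ p \<le> d"
      proof -
        have "\<bar>PN N g x - g x\<bar> ^ p \<le> d ^ p" using N0[OF N] x by (intro power_mono) auto
        also have "\<dots> \<le> d ^ 1" using d p1 by (intro power_decreasing) auto
        finally show ?thesis by simp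
      qed
      finally show ?thesis by (simp add: abs_minus_commute algebra_simps)
    qed
    have iR: "integrable torus ?R"
      using integrable_PN[OF fgp N1] fgp by auto
    have "(\<integral>x. \<bar>PN N f x - f x\<bar> ^ p \<partial>torus) \<le> (\<integral>x. ?R x \<partial>torus)"
    proof (rule integral_mono_AE'[OF iR])
      show "AE x in torus. \<bar>PN N f x - f x\<bar> ^ p \<le> ?R x" using le by (intro AE_I2) simp
      show "AE x in torus. 0 \<le> ?R x"
        using le by (intro AE_I2 order_trans[OF _ le]) auto
    qed
    also have "\<dots> = 4 * (\<integral>x. PN N (\<lambda>y. \<bar>f y - g y\<bar> ^ p) x \<partial>torus) + (\<integral>x. 4 * d + 2 * \<bar>f x - g x\<bar> ^ p \<partial>torus)"
      using integrable_PN[OF fgp N1] fgp by (subst Bochner_Integration.integral_add) auto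
    also have "(\<integral>x. 4 * d + 2 * \<bar>f x - g x\<bar> ^ p \<partial>torus) = 4 * d + 2 * (\<integral>x. \<bar>f x - g x\<bar> ^ p \<partial>torus)"
      using fgp measure_lebesgue_on_sq[of 0] finite_measure.integrable_const[OF finite_measure_sq[of 0]]
      by (subst Bochner_Integration.integral_add) (auto simp: unit_square_eq_sq)
    also have "4 * (\<integral>x. PN N (\<lambda>y. \<bar>f y - g y\<bar> ^ p) x \<partial>torus) + (4 * d + 2 * (\<integral>x. \<bar>f x - g x\<bar> ^ p \<partial>torus)) < e"
      unfolding integral_PN[OF fgp N1] using g(3) d by linarith
    finally show "norm ((\<integral>x. \<bar>PN N f x - f x\<bar> ^ p \<partial>torus) - 0) < e"
      by (simp add: abs_of_nonneg integral_nonneg)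
  qed
qed

section \<open>Periodic functions and the choice of the fundamental domain\<close>

lemma distr_lebesgue_translation:
  fixes t :: "'a::euclidean_space"
  shows "distr lebesgue lebesgue ((+) t) = lebesgue"
proof -
  have eq: "(\<lambda>x. t + (\<Sum>j\<in>Basis. (1 * (x \<bullet> j)) *\<^sub>R j)) = (+) t"
    by (auto simp: euclidean_representation)
  have "lebesgue = density (distr lebesgue lebesgue ((+) t)) (\<lambda>_. 1)"
    using lebesgue_affine_euclidean[of "\<lambda>_. 1" t] unfolding eq by simp
  then show ?thesis by (simp add: density_1)
qed

lemma nn_integral_lebesgue_translation:
  fixes t :: "'a::euclidean_space"
  assumes "f \<in> borel_measurable lebesgue"
  shows "(\<integral>\<^sup>+x. f (t + x) \<partial>lebesgue) = (\<integral>\<^sup>+x. f x \<partial>lebesgue)"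
proof -
  have [measurable]: "(+) t \<in> lebesgue \<rightarrow>\<^sub>M lebesgue"
    using lebesgue_affine_measurable[of "\<lambda>_. 1" t] by (simp add: euclidean_representation)
  have "(\<integral>\<^sup>+x. f x \<partial>lebesgue) = (\<integral>\<^sup>+x. f x \<partial>distr lebesgue lebesgue ((+) t))"
    by (simp only: distr_lebesgue_translation)
  also have "\<dots> = (\<integral>\<^sup>+x. f (t + x) \<partial>lebesgue)"
    using assms by (subst nn_integral_distr) auto
  finally show ?thesis by simp
qed

lemma periodic_int:
  assumes "periodic f"
  shows "f (x + of_int m, y + of_int n) = f (x, y)"
proof -
  have 1: "f (x + of_int m, y) = f (x, y)" for x y and m :: int
  proof (induction m rule: int_induct[where k=0])
    case (step1 i)
    then show ?case using assms unfolding periodic_def by (metis add.assoc of_int_1 of_int_add)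
  next
    case (step2 i)
    have "x + of_int i = (x + of_int (i - 1)) + 1" by simp
    then show ?case using assms step2 unfolding periodic_def by metis
  qed simp
  have 2: "f (x, y + of_int m) = f (x, y)" for x y and m :: int
  proof (induction m rule: int_induct[where k=0])
    case (step1 i)
    then show ?case using assms unfolding periodic_def by (metis add.assoc of_int_1 of_int_add)
  next
    case (step2 i)
    have "y + of_int i = (y + of_int (i - 1)) + 1" by simp
    then show ?case using assms step2 unfolding periodic_def by metis
  qed simp
  show ?thesis using 1 2 by simp
qed

text \<open>Each preimage is a countable union of integer translates of its part in the unit
  square.\<close>

lemma periodic_borel_measurable_lebesgue:
  fixes f :: "real \<times> real \<Rightarrow> 'b::topological_space"
  assumes per: "periodic f" and f: "f \<in> borel_measurable torus"
  shows "f \<in> borel_measurable lebesgue"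
proof (rule measurableI)
  fix B :: "'b set" assume B: "B \<in> sets borel"
  have "f -` B \<inter> unit_square \<in> sets torus"
    using measurable_sets[OF f B] by simp
  then have A: "f -` B \<inter> unit_square \<in> sets lebesgue"
    by (subst (asm) sets_restrict_space_iff) (auto simp: unit_square_eq_sq)
  have "f -` B = (\<Union>(m, n)\<in>(UNIV :: (int \<times> int) set). (+) (of_int m, of_int n) ` (f -` B \<inter> unit_square))"
  proof (intro equalityI subsetI)
    fix z assume z: "z \<in> f -` B"
    let ?m = "\<lfloor>fst z\<rfloor>" and ?n = "\<lfloor>snd z\<rfloor>"
    let ?u = "(frac (fst z), frac (snd z))"
    have eq: "z = (of_int ?m, of_int ?n) + ?u"
      by (cases z) (simp add: frac_def)
    have "f ?u = f z"
      using periodic_int[OF per, of "fst ?u" ?m "snd ?u" ?n] by (cases z) (simp add: frac_def)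
    then have "?u \<in> f -` B \<inter> unit_square"
      using z by (auto simp: unit_square_def frac_lt_1)
    then show "z \<in> (\<Union>(m, n)\<in>(UNIV :: (int \<times> int) set). (+) (of_int m, of_int n) ` (f -` B \<inter> unit_square))"
      using eq by blast
  next
    fix z assume "z \<in> (\<Union>(m, n)\<in>(UNIV :: (int \<times> int) set). (+) (of_int m, of_int n) ` (f -` B \<inter> unit_square))"
    then obtain m n u where u: "u \<in> f -` B" "z = (of_int m, of_int n) + u" by auto
    then have "f z = f u"
      using periodic_int[OF per, of "fst u" m "snd u" n] by (cases u) (simp add: add.commute)
    with u show "z \<in> f -` B" by simp
  qed
  also have "\<dots> \<in> sets lebesgue"
    by (intro sets.countable_UN'') (auto intro: lebesgue_sets_translation[OF A])
  finally show "f -` B \<inter> space lebesgue \<in> sets lebesgue" by simp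
qed simp

text \<open>The shifted square is cut into four pieces, each of which one of the translations by 0
  or 1 in each coordinate moves into the unit square; there the pieces fit together again.\<close>

lemma nn_integral_periodic_sq:
  fixes f :: "real \<times> real \<Rightarrow> ennreal"
  assumes per: "periodic f" and f: "f \<in> borel_measurable lebesgue" and s: "0 \<le> s" "s \<le> 1"
  shows "(\<integral>\<^sup>+x\<in>sq s. f x \<partial>lebesgue) = (\<integral>\<^sup>+x\<in>unit_square. f x \<partial>lebesgue)"
proof -
  let ?I = "{(0, 0), (0, 1), (1, 0), (1, 1)} :: (int \<times> int) set"
  define t :: "int \<times> int \<Rightarrow> real \<times> real" where "t k = (of_int (fst k), of_int (snd k))" for k
  define A where "A k = {x. x \<in> sq s \<and> t k + x \<in> unit_square}" for k
  define B where "B k = {x. x \<in> unit_square \<and> x - t k \<in> sq s}" for k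
  have [measurable]: "B k \<in> sets lebesgue" for k
  proof -
    have "B k = unit_square \<inter> (+) (t k) ` sq s"
      by (auto simp: B_def image_iff algebra_simps) (metis add.commute diff_add_cancel)
    then show ?thesis using lebesgue_sets_translation[of "sq s" "t k"]
      by (simp add: unit_square_eq_sq sets.Int)
  qed
  have [measurable]: "A k \<in> sets lebesgue" for k
  proof -
    have "A k = sq s \<inter> (+) (- t k) ` unit_square"
      by (auto simp: A_def image_iff algebra_simps)
    then show ?thesis using lebesgue_sets_translation[of "sq 0" "- t k"]
      by (simp add: unit_square_eq_sq sets.Int)
  qed
  have sumI: "(\<Sum>k\<in>?I. F k) = F (0, 0) + F (0, 1) + F (1, 0) + F (1, 1)" for F :: "_ \<Rightarrow> ennreal"
    by (simp add: add.assoc)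
  have sumA: "indicator (sq s) x = (\<Sum>k\<in>?I. indicator (A k) x :: ennreal)" for x
    unfolding sumI using s by (cases x) (auto simp: A_def t_def sq_def unit_square_def split: split_indicator)
  have sumB: "indicator unit_square x = (\<Sum>k\<in>?I. indicator (B k) x :: ennreal)" for x
  proof (cases "x \<in> unit_square")
    case True
    obtain a b where x: "x = (a, b)" by (cases x)
    have ab: "0 \<le> a" "a < 1" "0 \<le> b" "b < 1" using True by (auto simp: x unit_square_def)
    show ?thesis
      unfolding sumI using s ab
      by (cases "a < 1 - s"; cases "b < 1 - s") (simp_all add: x B_def t_def sq_def unit_square_def indicator_def)
  qed (simp add: sumI B_def)
  have shift: "(\<integral>\<^sup>+x. f x * indicator (A k) x \<partial>lebesgue) = (\<integral>\<^sup>+x. f x * indicator (B k) x \<partial>lebesgue)" for k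
  proof -
    have "(\<integral>\<^sup>+x. f x * indicator (B k) x \<partial>lebesgue) = (\<integral>\<^sup>+x. f (t k + x) * indicator (B k) (t k + x) \<partial>lebesgue)"
      using f by (subst nn_integral_lebesgue_translation) auto
    also have "\<dots> = (\<integral>\<^sup>+x. f x * indicator (A k) x \<partial>lebesgue)"
    proof (rule nn_integral_cong)
      fix x :: "real \<times> real"
      have "f (t k + x) = f x"
        using periodic_int[OF per, of "fst x" "fst k" "snd x" "snd k"] by (cases x) (simp add: t_def add.commute)
      moreover have "t k + x \<in> B k \<longleftrightarrow> x \<in> A k" by (auto simp: A_def B_def)
      ultimately show "f (t k + x) * indicator (B k) (t k + x) = f x * indicator (A k) x"
        by (simp add: indicator_def)
    qed
    finally show ?thesis by simp
  qed
  have "(\<integral>\<^sup>+x\<in>sq s. f x \<partial>lebesgue) = (\<Sum>k\<in>?I. (\<integral>\<^sup>+x. f x * indicator (A k) x \<partial>lebesgue))"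
    unfolding sumA sum_distrib_left using f by (intro nn_integral_sum) auto
  also have "\<dots> = (\<integral>\<^sup>+x\<in>unit_square. f x \<partial>lebesgue)"
    unfolding shift sumB sum_distrib_left using f by (intro nn_integral_sum[symmetric]) auto
  finally show ?thesis .
qed

lemma periodic_integral_sq:
  fixes f :: "real \<times> real \<Rightarrow> real"
  assumes per: "periodic f" and f: "integrable torus f" and nonneg: "\<And>x. f x \<ge> 0" and s: "0 \<le> s" "s \<le> 1"
  shows "integrable (lebesgue_on (sq s)) f"
    and "integral\<^sup>L (lebesgue_on (sq s)) f = integral\<^sup>L torus f"
proof -
  have m: "f \<in> borel_measurable lebesgue"
    using f by (intro periodic_borel_measurable_lebesgue[OF per]) auto
  have mS: "f \<in> borel_measurable (lebesgue_on (sq r))" for r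
    by (rule measurable_restrict_space1[OF m])
  have "periodic (\<lambda>x. ennreal (f x))" using per by (simp add: periodic_def)
  then have "(\<integral>\<^sup>+x\<in>sq s. ennreal (f x) \<partial>lebesgue) = (\<integral>\<^sup>+x\<in>unit_square. ennreal (f x) \<partial>lebesgue)"
    using m s by (intro nn_integral_periodic_sq) auto
  then have eq: "(\<integral>\<^sup>+x. ennreal (f x) \<partial>lebesgue_on (sq s)) = (\<integral>\<^sup>+x. ennreal (f x) \<partial>torus)"
    by (simp add: nn_integral_restrict_space unit_square_eq_sq)
  show "integrable (lebesgue_on (sq s)) f"
    using f nonneg mS eq by (intro integrableI_nonneg) (auto simp: integrable_iff_bounded)
  show "integral\<^sup>L (lebesgue_on (sq s)) f = integral\<^sup>L torus f"
    using nonneg mS mS[of 0] eq by (simp add: integral_eq_nn_integral unit_square_eq_sq)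
qed

section \<open>Trigonometric polynomials\<close>

definition tp :: "nat \<Rightarrow> (int \<Rightarrow> int \<Rightarrow> complex) \<Rightarrow> real \<times> real \<Rightarrow> complex" where
  "tp N A x = (\<Sum>(j, l)\<in>J N. A j l * ee j l x)"

lemma continuous_on_tp [continuous_intros]: "continuous_on S (tp N A)"
  unfolding tp_def[abs_def] by (rule continuous_on_sum_ee)

lemma periodic_tp: "periodic (tp N A)"
  by (simp add: periodic_def tp_def ee_shift)

lemma tp_add: "tp N (\<lambda>j l. A j l + B j l) x = tp N A x + tp N B x"
  by (simp add: tp_def case_prod_unfold sum.distrib algebra_simps)

lemma tp_deriv1:
  "((\<lambda>t. tp N A (t, y)) has_vector_derivative tp N (\<lambda>j l. (of_real (2 * pi * of_int j) * \<i>) * A j l) (x, y)) (at x)"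
proof -
  have "((\<lambda>t. \<Sum>k\<in>J N. A (fst k) (snd k) * ee (fst k) (snd k) (t, y)) has_vector_derivative
     (\<Sum>k\<in>J N. A (fst k) (snd k) * ((of_real (2 * pi * of_int (fst k)) * \<i>) * ee (fst k) (snd k) (x, y)))) (at x)"
    by (intro has_vector_derivative_sum has_vector_derivative_mult_right ee_deriv1)
  then show ?thesis by (simp add: tp_def case_prod_unfold algebra_simps)
qed

lemma tp_deriv2:
  "((\<lambda>t. tp N A (x, t)) has_vector_derivative tp N (\<lambda>j l. (of_real (2 * pi * of_int l) * \<i>) * A j l) (x, y)) (at y)"
proof -
  have "((\<lambda>t. \<Sum>k\<in>J N. A (fst k) (snd k) * ee (fst k) (snd k) (x, t)) has_vector_derivative
     (\<Sum>k\<in>J N. A (fst k) (snd k) * ((of_real (2 * pi * of_int (snd k)) * \<i>) * ee (fst k) (snd k) (x, y)))) (at y)"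
    by (intro has_vector_derivative_sum has_vector_derivative_mult_right ee_deriv2)
  then show ?thesis by (simp add: tp_def case_prod_unfold algebra_simps)
qed

lemma Re_tp_deriv1:
  "((\<lambda>t. Re (tp N A (t, y))) has_real_derivative Re (tp N (\<lambda>j l. (of_real (2 * pi * of_int j) * \<i>) * A j l) (x, y))) (at x)"
  using tp_deriv1[of N A y x] by (simp add: has_vector_derivative_complex_iff)

lemma Re_tp_deriv2:
  "((\<lambda>t. Re (tp N A (x, t))) has_real_derivative Re (tp N (\<lambda>j l. (of_real (2 * pi * of_int l) * \<i>) * A j l) (x, y))) (at y)"
  using tp_deriv2[of N A x y] by (simp add: has_vector_derivative_complex_iff)

lemma PN_eq_tp:
  assumes "integrable torus f" "N > 0"
  shows "PN N f x = Re (tp N (\<lambda>j l. of_real (cN N j l) * fc f j l) x)"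
  using PN_sum[OF assms, of x] unfolding tp_def by (metis Re_complex_of_real)

lemma of_real_PN_eq_tp:
  assumes "integrable torus f" "N > 0"
  shows "complex_of_real (PN N f x) = tp N (\<lambda>j l. of_real (cN N j l) * fc f j l) x"
  using PN_sum[OF assms, of x] unfolding tp_def by simp

text \<open>Parseval's identity for finite sums: in the double sum only the diagonal survives the
  orthogonality of the characters.\<close>

lemma integral_norm_tp_square:
  "(\<integral>x. (cmod (tp N A x))\<^sup>2 \<partial>torus) = (\<Sum>(j, l)\<in>J N. (cmod (A j l))\<^sup>2)"
proof -
  have eq: "complex_of_real ((cmod (tp N A x))\<^sup>2) = (\<Sum>k\<in>J N. \<Sum>k'\<in>J N. (A (fst k) (snd k) * cnj (A (fst k') (snd k'))) * ee (fst k - fst k') (snd k - snd k') x)" for x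
  proof -
    have e: "ee (a - c) (b - d) x = ee a b x * ee (-c) (-d) x" for a b c d
      using ee_add[of a "-c" b "-d" x] by simp
    show ?thesis
      unfolding complex_norm_square tp_def case_prod_unfold cnj_sum complex_cnj_mult cnj_ee sum_product e
      by (simp add: algebra_simps)
  qed
  have "complex_of_real (\<integral>x. (cmod (tp N A x))\<^sup>2 \<partial>torus) = (\<integral>x. complex_of_real ((cmod (tp N A x))\<^sup>2) \<partial>torus)"
    by (simp del: of_real_power)
  also have "\<dots> = (\<Sum>k\<in>J N. \<Sum>k'\<in>J N. (A (fst k) (snd k) * cnj (A (fst k') (snd k'))) * (\<integral>x. ee (fst k - fst k') (snd k - snd k') x \<partial>torus))"
    unfolding eq by (subst Bochner_Integration.integral_sum, (auto intro!: integrable_PN_test)[1])+ simp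
  also have "\<dots> = (\<Sum>k\<in>J N. \<Sum>k'\<in>J N. if k' = k then complex_of_real ((cmod (A (fst k) (snd k)))\<^sup>2) else 0)"
    unfolding unit_square_eq_sq integral_ee complex_norm_square
    by (intro sum.cong refl) (auto simp: prod_eq_iff)
  also have "\<dots> = complex_of_real (\<Sum>(j, l)\<in>J N. (cmod (A j l))\<^sup>2)"
    by (simp add: case_prod_unfold)
  finally show ?thesis by (simp only: of_real_eq_iff)
qed

text \<open>Turns a bound on a Fourier multiplier into a bound in L^2; it is applied to the Hilbert
  transform.\<close>

lemma integral_Re_tp_square_le:
  assumes "\<And>j l. cmod (A j l) \<le> cmod (B j l)"
  shows "(\<integral>x. (Re (tp N A x))\<^sup>2 \<partial>torus) \<le> (\<integral>x. (cmod (tp N B x))\<^sup>2 \<partial>torus)"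
proof -
  have "(\<integral>x. (Re (tp N A x))\<^sup>2 \<partial>torus) \<le> (\<integral>x. (cmod (tp N A x))\<^sup>2 \<partial>torus)"
    unfolding unit_square_eq_sq
    by (intro integral_mono continuous_integrable_sq continuous_intros)
      (metis abs_Re_le_cmod abs_ge_zero power2_abs power_mono)
  also have "\<dots> \<le> (\<integral>x. (cmod (tp N B x))\<^sup>2 \<partial>torus)"
    unfolding integral_norm_tp_square by (intro sum_mono) (auto intro!: power_mono assms)
  finally show ?thesis .
qed

section \<open>Approximate solutions of Burgers' equation\<close>

lemma Lp2_square: "Lp_torus 2 f \<Longrightarrow> integrable torus (\<lambda>x. (f x)\<^sup>2)"
  by (simp add: Lp_torus_def)

lemma Lp2_integrable: "Lp_torus 2 f \<Longrightarrow> integrable torus f"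
  by (rule integrable_of_Lp[where p=2]) (auto simp: Lp_torus_def)

lemma integrable_mult_L2:
  fixes f g :: "'a \<Rightarrow> real"
  assumes [measurable]: "f \<in> borel_measurable M" "g \<in> borel_measurable M"
    and "integrable M (\<lambda>x. (f x)\<^sup>2)" "integrable M (\<lambda>x. (g x)\<^sup>2)"
  shows "integrable M (\<lambda>x. f x * g x)"
proof (rule Bochner_Integration.integrable_bound[of _ "\<lambda>x. (f x)\<^sup>2 + (g x)\<^sup>2"])
  show "AE x in M. norm (f x * g x) \<le> norm ((f x)\<^sup>2 + (g x)\<^sup>2)"
  proof (rule AE_I2)
    fix x
    have "2 * (\<bar>f x\<bar> * \<bar>g x\<bar>) \<le> (f x)\<^sup>2 + (g x)\<^sup>2"
      using sum_squares_bound[of "\<bar>f x\<bar>" "\<bar>g x\<bar>"] by simp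
    moreover have "0 \<le> \<bar>f x\<bar> * \<bar>g x\<bar>" by simp
    ultimately show "norm (f x * g x) \<le> norm ((f x)\<^sup>2 + (g x)\<^sup>2)"
      unfolding real_norm_def abs_mult by linarith
  qed
qed (use assms in auto)

lemma integrable_diff_square:
  fixes f g :: "'a \<Rightarrow> real"
  assumes [measurable]: "f \<in> borel_measurable M" "g \<in> borel_measurable M"
    and "integrable M (\<lambda>x. (f x)\<^sup>2)" "integrable M (\<lambda>x. (g x)\<^sup>2)"
  shows "integrable M (\<lambda>x. (f x - g x)\<^sup>2)"
proof -
  have "(\<lambda>x. (f x - g x)\<^sup>2) = (\<lambda>x. (f x)\<^sup>2 + (g x)\<^sup>2 - 2 * (f x * g x))"
    by (auto simp: power2_diff)
  then show ?thesis using integrable_mult_L2[OF assms] assms(3,4) by simp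
qed

lemma abs_mult_le_weighted: "d > 0 \<Longrightarrow> \<bar>a\<bar> * \<bar>b\<bar> \<le> d * a\<^sup>2 + b\<^sup>2 / (d :: real)"
proof -
  assume d: "d > 0"
  have "2 * (d * \<bar>a\<bar>) * \<bar>b\<bar> \<le> (d * \<bar>a\<bar>)\<^sup>2 + \<bar>b\<bar>\<^sup>2" by (rule sum_squares_bound)
  then have "d * (2 * (\<bar>a\<bar> * \<bar>b\<bar>)) \<le> d * (d * a\<^sup>2 + b\<^sup>2 / d)"
    using d by (simp add: power_mult_distrib power2_eq_square algebra_simps)
  then have "2 * (\<bar>a\<bar> * \<bar>b\<bar>) \<le> d * a\<^sup>2 + b\<^sup>2 / d" using d by simp
  moreover have "0 \<le> \<bar>a\<bar> * \<bar>b\<bar>" by simp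
  ultimately show ?thesis by linarith
qed

lemma abs_le_weighted: "d > 0 \<Longrightarrow> \<bar>b\<bar> \<le> d + b\<^sup>2 / (d :: real)"
  using abs_mult_le_weighted[of d 1 b] by simp

text \<open>Young's inequality with a free parameter replaces the Cauchy--Schwarz inequality.\<close>

lemma L1_product_tendsto:
  fixes a b c e :: "nat \<Rightarrow> 'a \<Rightarrow> real"
  assumes a: "\<And>n. integrable M (\<lambda>x. (a n x)\<^sup>2)" "(\<lambda>n. \<integral>x. (a n x)\<^sup>2 \<partial>M) \<longlonglongrightarrow> 0"
    and b: "\<And>n. integrable M (\<lambda>x. (b n x)\<^sup>2)" "\<And>n. (\<integral>x. (b n x)\<^sup>2 \<partial>M) \<le> B"
    and [measurable]: "\<And>n. a n \<in> borel_measurable M" "\<And>n. b n \<in> borel_measurable M"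
  shows "(\<lambda>n. \<integral>x. \<bar>a n x * b n x\<bar> \<partial>M) \<longlonglongrightarrow> 0"
proof (rule LIMSEQ_I)
  fix r :: real assume r: "r > 0"
  have B0: "B \<ge> 0" by (rule order_trans[OF _ b(2)[of 0]]) (simp add: integral_nonneg)
  \<comment> \<open>Makes \<open>d * B\<close> at most \<open>r / 2\<close>; the added 1 allows
    \<open>B = 0\<close>.\<close>
  define d where "d = r / (2 * (B + 1))"
  have d: "d > 0" using r B0 by (simp add: d_def)
  have dB: "d * B \<le> r / 2"
  proof -
    have "d * B \<le> d * (B + 1)" using d by simp
    also have "\<dots> = r / 2" using B0 by (simp add: d_def field_simps)
    finally show ?thesis .
  qed
  have "\<forall>\<^sub>F n in sequentially. (\<integral>x. (a n x)\<^sup>2 \<partial>M) < d * (r / 2)"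
    using a(2) d r by (intro order_tendstoD) auto
  then obtain n0 where n0: "\<And>n. n \<ge> n0 \<Longrightarrow> (\<integral>x. (a n x)\<^sup>2 \<partial>M) < d * (r / 2)"
    by (auto simp: eventually_sequentially)
  show "\<exists>n0. \<forall>n\<ge>n0. norm ((\<integral>x. \<bar>a n x * b n x\<bar> \<partial>M) - 0) < r"
  proof (intro exI[of _ n0] allI impI)
    fix n assume n: "n \<ge> n0"
    have "(\<integral>x. \<bar>a n x * b n x\<bar> \<partial>M) \<le> (\<integral>x. d * (b n x)\<^sup>2 + (a n x)\<^sup>2 / d \<partial>M)"
    proof (intro integral_mono integrable_abs integrable_mult_L2)
      show "\<bar>a n x * b n x\<bar> \<le> d * (b n x)\<^sup>2 + (a n x)\<^sup>2 / d" for x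
        using abs_mult_le_weighted[OF d, of "b n x" "a n x"] by (simp add: abs_mult mult.commute)
    qed (use a b in auto)
    also have "\<dots> = d * (\<integral>x. (b n x)\<^sup>2 \<partial>M) + (\<integral>x. (a n x)\<^sup>2 \<partial>M) / d"
      using a b by simp
    also have "d * (\<integral>x. (b n x)\<^sup>2 \<partial>M) \<le> d * B" using b(2)[of n] d by simp
    also have "(\<integral>x. (a n x)\<^sup>2 \<partial>M) / d < r / 2" using n0[OF n] d by (simp add: field_simps)
    finally show "norm ((\<integral>x. \<bar>a n x * b n x\<bar> \<partial>M) - 0) < r"
      using dB by (simp add: abs_of_nonneg integral_nonneg)
  qed
qed

text \<open>Here \<open>h\<close> is \<open>\<partial>\<^sub>1 v\<close>, and the two assumptions on
  \<open>h\<close> and \<open>g\<close> together say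
  \<open>\<partial>\<^sub>2 v = v * h + |\<partial>\<^sub>1| g\<close>; the locale derives this
  equation in Fourier coefficients.\<close>

locale burgers_defect =
  fixes v g h :: "real \<times> real \<Rightarrow> real"
  assumes v: "Lp_torus 2 v" and vmean: "vanishing_mean1 (distr_of v)"
    and wh: "weak_pd1_in_L2 v h" and wg: "inv_abs_pd1_eta_in_L2 v g"
begin

lemma Lh: "Lp_torus 2 h" and Lg: "Lp_torus 2 g"
  using wh wg by (simp_all add: weak_pd1_in_L2_def inv_abs_pd1_eta_in_L2_def)

lemma vi: "integrable torus v" and hi: "integrable torus h" and gi: "integrable torus g"
  using v Lh Lg by (simp_all add: Lp2_integrable)

lemma v2i: "integrable torus (\<lambda>x. (v x)\<^sup>2)" and h2i: "integrable torus (\<lambda>x. (h x)\<^sup>2)"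
  and g2i: "integrable torus (\<lambda>x. (g x)\<^sup>2)"
  using v Lh Lg by (simp_all add: Lp2_square)

lemma vhi: "integrable torus (\<lambda>x. v x * h x)"
  using vi hi v2i h2i by (intro integrable_mult_L2) auto

end

lemma pd1_ee: "pd1 (\<lambda>x. c * ee j l x) = (\<lambda>x. ((of_real (2 * pi * of_int j) * \<i>) * c) * ee j l x)"
proof (intro ext)
  fix x :: "real \<times> real"
  obtain a b where x: "x = (a, b)" by (cases x)
  have "((\<lambda>t. c * ee j l (t, b)) has_vector_derivative c * ((of_real (2 * pi * of_int j) * \<i>) * ee j l (a, b))) (at a)"
    by (intro has_vector_derivative_mult_right ee_deriv1)
  then show "pd1 (\<lambda>x. c * ee j l x) x = ((of_real (2 * pi * of_int j) * \<i>) * c) * ee j l x"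
    by (simp add: pd1_def x vector_derivative_at algebra_simps)
qed

lemma pd2_ee: "pd2 (\<lambda>x. c * ee j l x) = (\<lambda>x. ((of_real (2 * pi * of_int l) * \<i>) * c) * ee j l x)"
proof (intro ext)
  fix x :: "real \<times> real"
  obtain a b where x: "x = (a, b)" by (cases x)
  have "((\<lambda>t. c * ee j l (a, t)) has_vector_derivative c * ((of_real (2 * pi * of_int l) * \<i>) * ee j l (a, b))) (at b)"
    by (intro has_vector_derivative_mult_right ee_deriv2)
  then show "pd2 (\<lambda>x. c * ee j l x) x = ((of_real (2 * pi * of_int l) * \<i>) * c) * ee j l x"
    by (simp add: pd2_def x vector_derivative_at algebra_simps)
qed

lemma differentiable_ee: "(\<lambda>x. c * ee j l x) differentiable_on UNIV"
proof -
  have "\<exists>D. ((\<lambda>x. c * ee j l x) has_derivative D) (at x)" for x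
  proof -
    let ?u = "\<lambda>x. \<i> * complex_of_real (2 * pi * (of_int j * fst x + of_int l * snd x))"
    have u: "(?u has_derivative ?u) (at x)"
      by (auto intro!: derivative_eq_intros)
    have "(exp has_derivative (\<lambda>z. exp (?u x) * z)) (at (?u x))"
      using DERIV_exp[of "?u x"] by (simp add: has_field_derivative_def)
    from has_derivative_mult_right[OF has_derivative_compose[OF u this], of c]
    show ?thesis by (auto simp: ee_def cis_conv_exp)
  qed
  then show ?thesis by (auto simp: differentiable_on_def differentiable_def)
qed

lemma distr_of_scaled: "distr_of f (\<lambda>x. c * \<phi> x) = c * distr_of f \<phi>"
  unfolding distr_of_def by (simp only: mult.left_commute[of _ c] integral_mult_right_zero)

lemma Ck_plane_ee: "Ck_plane k (\<lambda>x. c * ee j l x)"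
proof (induction k arbitrary: c)
  case 0
  then show ?case by (auto intro!: continuous_intros)
next
  case (Suc k)
  show ?case unfolding Ck_plane.simps pd1_ee pd2_ee using Suc differentiable_ee by blast
qed

lemma ee_test_function: "ee j l \<in> test_functions"
  using Ck_plane_ee[of _ 1 j l] periodic_ee by (simp add: test_functions_def)

lemma fourier_distr_of: "fourier (distr_of f) (2 * pi * of_int j, 2 * pi * of_int l) = fc f j l"
proof -
  have "(\<lambda>x. cis (- ((2 * pi * of_int j, 2 * pi * of_int l) \<bullet> x))) = ee (-j) (-l)"
    by (auto simp: ee_def inner_prod_def algebra_simps)
  then show ?thesis by (simp add: fourier_def distr_of_def fc_def)
qed

lemma fourier_eta:
  "fourier (eta f) (2 * pi * of_int j, 2 * pi * of_int l) =
    (of_real (2 * pi * of_int l) * \<i>) * fc f j l - (of_real (2 * pi * of_int j) * \<i>) * fc (\<lambda>x. 1/2 * (f x)\<^sup>2) j l"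
proof -
  have "(\<lambda>x. cis (- ((2 * pi * of_int j, 2 * pi * of_int l) \<bullet> x))) = ee (-j) (-l)"
    by (auto simp: ee_def inner_prod_def algebra_simps)
  then have "fourier (eta f) (2 * pi * of_int j, 2 * pi * of_int l) = eta f (ee (-j) (-l))"
    by (simp add: fourier_def)
  also have "\<dots> = - distr_of f (pd2 (\<lambda>x. 1 * ee (-j) (-l) x)) + distr_of (\<lambda>x. 1/2 * (f x)\<^sup>2) (pd1 (\<lambda>x. 1 * ee (-j) (-l) x))"
    by (simp add: eta_def distr_pd1_def distr_pd2_def)
  also have "distr_of f (pd2 (\<lambda>x. 1 * ee (-j) (-l) x)) = - ((of_real (2 * pi * of_int l) * \<i>) * fc f j l)"
    unfolding pd2_ee distr_of_scaled by (simp add: distr_of_def fc_def)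
  also have "distr_of (\<lambda>x. 1/2 * (f x)\<^sup>2) (pd1 (\<lambda>x. 1 * ee (-j) (-l) x)) = - ((of_real (2 * pi * of_int j) * \<i>) * fc (\<lambda>x. 1/2 * (f x)\<^sup>2) j l)"
    unfolding pd1_ee distr_of_scaled by (simp add: distr_of_def fc_def)
  finally show ?thesis by simp
qed

lemma in_freqs: "(2 * pi * of_int j, 2 * pi * of_int l) \<in> freqs"
  by (auto simp: freqs_def)

lemma fc_diff_le:
  assumes "integrable torus f" "integrable torus f'"
  shows "cmod (fc f j l - fc f' j l) \<le> (\<integral>x. \<bar>f x - f' x\<bar> \<partial>torus)"
proof -
  have "fc f j l - fc f' j l = (\<integral>x. of_real (f x - f' x) * ee (-j) (-l) x \<partial>torus)"
    unfolding fc_def of_real_diff left_diff_distrib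
    by (rule Bochner_Integration.integral_diff[symmetric]) (intro integrable_ee_mult assms)+
  also have "cmod \<dots> \<le> (\<integral>x. \<bar>f x - f' x\<bar> \<partial>torus)"
    by (rule order_trans[OF integral_norm_bound]) (simp add: norm_mult flip: of_real_diff)
  finally show ?thesis .
qed

lemma fc_tendsto:
  assumes "\<And>n. integrable torus (F n)" "integrable torus f" "(\<lambda>n. \<integral>x. \<bar>F n x - f x\<bar> \<partial>torus) \<longlonglongrightarrow> 0"
  shows "(\<lambda>n. fc (F n) j l) \<longlonglongrightarrow> fc f j l"
  by (rule LIM_zero_cancel, rule Lim_null_comparison[OF always_eventually assms(3)])
    (use fc_diff_le assms in blast)

context burgers_defect
begin

lemma fc_h: "fc h j l = (of_real (2 * pi * of_int j) * \<i>) * fc v j l"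
proof -
  have "distr_pd1 (distr_of v) (ee (-j) (-l)) = distr_of h (ee (-j) (-l))"
    using wh ee_test_function by (simp add: weak_pd1_in_L2_def is_weak_pd1_def)
  moreover have "distr_of h (ee (-j) (-l)) = fc h j l" by (simp add: distr_of_def fc_def)
  moreover have "distr_pd1 (distr_of v) (ee (-j) (-l)) = - distr_of v (pd1 (\<lambda>x. 1 * ee (-j) (-l) x))"
    by (simp add: distr_pd1_def)
  moreover have "distr_of v (pd1 (\<lambda>x. 1 * ee (-j) (-l) x)) = - ((of_real (2 * pi * of_int j) * \<i>) * fc v j l)"
    unfolding pd1_ee distr_of_scaled by (simp add: distr_of_def fc_def)
  ultimately show ?thesis by simp
qed

lemma PN_v_deriv1:
  assumes "N > 0"
  shows "((\<lambda>t. PN N v (t, y)) has_real_derivative PN N h (x, y)) (at x)"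
proof -
  have "PN N h (x, y) = Re (tp N (\<lambda>j l. (of_real (2 * pi * of_int j) * \<i>) * (of_real (cN N j l) * fc v j l)) (x, y))"
    unfolding PN_eq_tp[OF hi assms] fc_h by (simp add: algebra_simps)
  then show ?thesis
    unfolding PN_eq_tp[OF vi assms] using Re_tp_deriv1[of N _ y x] by simp
qed

abbreviation "VN n \<equiv> PN (Suc n) v"
abbreviation "HN n \<equiv> PN (Suc n) h"

lemma cont_VN [continuous_intros]: "continuous_on S (VN n)"
  and cont_HN [continuous_intros]: "continuous_on S (HN n)"
  by (intro continuous_on_PN vi hi zero_less_Suc)+

lemma integrable_torus_continuous: "continuous_on UNIV (f :: _ \<Rightarrow> real) \<Longrightarrow> integrable torus f"
  by (simp add: unit_square_eq_sq continuous_integrable_sq)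

lemma VN_tendsto: "(\<lambda>n. \<integral>x. (VN n x - v x)\<^sup>2 \<partial>torus) \<longlonglongrightarrow> 0"
  using LIMSEQ_Suc[OF PN_tendsto[of v 2]] vi v2i by simp

lemma HN_tendsto: "(\<lambda>n. \<integral>x. (HN n x - h x)\<^sup>2 \<partial>torus) \<longlonglongrightarrow> 0"
  using LIMSEQ_Suc[OF PN_tendsto[of h 2]] hi h2i by simp

lemma PN_square_integral_le:
  assumes "integrable torus f" "integrable torus (\<lambda>x. (f x)\<^sup>2)" "N > 0"
  shows "(\<integral>x. (PN N f x)\<^sup>2 \<partial>torus) \<le> (\<integral>x. (f x)\<^sup>2 \<partial>torus)"
proof -
  have "(\<integral>x. (PN N f x)\<^sup>2 \<partial>torus) \<le> (\<integral>x. PN N (\<lambda>y. (f y)\<^sup>2) x \<partial>torus)"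
    by (intro integral_mono PN_square_le integrable_PN integrable_torus_continuous continuous_intros continuous_on_PN assms)
  then show ?thesis using integral_PN[OF assms(2,3)] by simp
qed

text \<open>Split the difference as \<open>(VN n - v) * HN n + (HN n - h) * v\<close>: in each
  product one factor tends to zero in L^2, and the other is bounded there because Fejer means are
  contractions.\<close>

lemma VH_tendsto: "(\<lambda>n. \<integral>x. \<bar>VN n x * HN n x - v x * h x\<bar> \<partial>torus) \<longlonglongrightarrow> 0"
proof (rule Lim_null_comparison[OF always_eventually])
  have mV [measurable]: "VN n \<in> borel_measurable torus" and mH [measurable]: "HN n \<in> borel_measurable torus" for n
    by (auto intro!: borel_measurable_integrable integrable_torus_continuous continuous_intros)
  have mv [measurable]: "v \<in> borel_measurable torus" and mh [measurable]: "h \<in> borel_measurable torus"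
    using vi hi by auto
  have V2: "integrable torus (\<lambda>x. (VN n x)\<^sup>2)" "integrable torus (\<lambda>x. (HN n x)\<^sup>2)" for n
    by (intro integrable_torus_continuous continuous_intros)+
  let ?a = "\<lambda>n x. VN n x - v x" and ?b = "\<lambda>n x. HN n x - h x"
  have a2: "integrable torus (\<lambda>x. (?a n x)\<^sup>2)" "integrable torus (\<lambda>x. (?b n x)\<^sup>2)" for n
    by (intro integrable_diff_square V2 v2i h2i mV mv mH mh)+
  show "\<forall>n. norm (\<integral>x. \<bar>VN n x * HN n x - v x * h x\<bar> \<partial>torus) \<le>
      (\<integral>x. \<bar>?a n x * HN n x\<bar> \<partial>torus) + (\<integral>x. \<bar>?b n x * v x\<bar> \<partial>torus)"
  proof
    fix n
    have i: "integrable torus (\<lambda>x. \<bar>?a n x * HN n x\<bar>)" "integrable torus (\<lambda>x. \<bar>?b n x * v x\<bar>)"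
      by (intro integrable_abs integrable_mult_L2 a2 V2 v2i; measurable)+
    have "(\<integral>x. \<bar>VN n x * HN n x - v x * h x\<bar> \<partial>torus) \<le> (\<integral>x. \<bar>?a n x * HN n x\<bar> + \<bar>?b n x * v x\<bar> \<partial>torus)"
    proof (rule integral_mono)
      show "integrable torus (\<lambda>x. \<bar>VN n x * HN n x - v x * h x\<bar>)"
        by (intro integrable_abs Bochner_Integration.integrable_diff vhi integrable_torus_continuous continuous_intros)
      fix x
      have "VN n x * HN n x - v x * h x = ?a n x * HN n x + ?b n x * v x" by (simp add: algebra_simps)
      then show "\<bar>VN n x * HN n x - v x * h x\<bar> \<le> \<bar>?a n x * HN n x\<bar> + \<bar>?b n x * v x\<bar>"
        by (metis abs_triangle_ineq)
    qed (use i in auto)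
    also have "\<dots> = (\<integral>x. \<bar>?a n x * HN n x\<bar> \<partial>torus) + (\<integral>x. \<bar>?b n x * v x\<bar> \<partial>torus)"
      using i by simp
    finally show "norm (\<integral>x. \<bar>VN n x * HN n x - v x * h x\<bar> \<partial>torus) \<le>
      (\<integral>x. \<bar>?a n x * HN n x\<bar> \<partial>torus) + (\<integral>x. \<bar>?b n x * v x\<bar> \<partial>torus)"
      by (simp add: abs_of_nonneg integral_nonneg)
  qed
  have "(\<lambda>n. \<integral>x. \<bar>?a n x * HN n x\<bar> \<partial>torus) \<longlonglongrightarrow> 0"
    by (rule L1_product_tendsto[OF a2(1) VN_tendsto V2(2) PN_square_integral_le[OF hi h2i zero_less_Suc]]) measurable
  moreover have "(\<lambda>n. \<integral>x. \<bar>?b n x * v x\<bar> \<partial>torus) \<longlonglongrightarrow> 0"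
    by (rule L1_product_tendsto[OF a2(2) HN_tendsto v2i order_refl]) measurable
  ultimately show "(\<lambda>n. (\<integral>x. \<bar>?a n x * HN n x\<bar> \<partial>torus) + (\<integral>x. \<bar>?b n x * v x\<bar> \<partial>torus)) \<longlonglongrightarrow> 0"
    by (rule tendsto_add_zero)
qed

lemma VV_tendsto: "(\<lambda>n. \<integral>x. \<bar>1/2 * (VN n x)\<^sup>2 - 1/2 * (v x)\<^sup>2\<bar> \<partial>torus) \<longlonglongrightarrow> 0"
proof (rule Lim_null_comparison[OF always_eventually])
  have mV [measurable]: "VN n \<in> borel_measurable torus" for n
    by (auto intro!: borel_measurable_integrable integrable_torus_continuous continuous_intros)
  have mv [measurable]: "v \<in> borel_measurable torus"
    using vi hi by auto
  have V2: "integrable torus (\<lambda>x. (VN n x)\<^sup>2)" for n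
    by (intro integrable_torus_continuous continuous_intros)+
  let ?a = "\<lambda>n x. VN n x - v x"
  have a2: "integrable torus (\<lambda>x. (?a n x)\<^sup>2)" for n
    by (intro integrable_diff_square V2 v2i mV mv)+
  show "\<forall>n. norm (\<integral>x. \<bar>1/2 * (VN n x)\<^sup>2 - 1/2 * (v x)\<^sup>2\<bar> \<partial>torus) \<le>
      (\<integral>x. \<bar>?a n x * VN n x\<bar> \<partial>torus) + (\<integral>x. \<bar>?a n x * v x\<bar> \<partial>torus)"
  proof
    fix n
    have i: "integrable torus (\<lambda>x. \<bar>?a n x * VN n x\<bar>)" "integrable torus (\<lambda>x. \<bar>?a n x * v x\<bar>)"
      by (intro integrable_abs integrable_mult_L2 a2 V2 v2i; measurable)+
    have "(\<integral>x. \<bar>1/2 * (VN n x)\<^sup>2 - 1/2 * (v x)\<^sup>2\<bar> \<partial>torus) \<le> (\<integral>x. \<bar>?a n x * VN n x\<bar> + \<bar>?a n x * v x\<bar> \<partial>torus)"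
    proof (rule integral_mono)
      show "integrable torus (\<lambda>x. \<bar>1/2 * (VN n x)\<^sup>2 - 1/2 * (v x)\<^sup>2\<bar>)"
        using V2 v2i by (intro integrable_abs Bochner_Integration.integrable_diff) auto
      fix x
      have "1/2 * (VN n x)\<^sup>2 - 1/2 * (v x)\<^sup>2 = 1/2 * (?a n x * VN n x) + 1/2 * (?a n x * v x)"
        by (simp add: power2_eq_square algebra_simps)
      then show "\<bar>1/2 * (VN n x)\<^sup>2 - 1/2 * (v x)\<^sup>2\<bar> \<le> \<bar>?a n x * VN n x\<bar> + \<bar>?a n x * v x\<bar>"
        by linarith
    qed (use i in auto)
    also have "\<dots> = (\<integral>x. \<bar>?a n x * VN n x\<bar> \<partial>torus) + (\<integral>x. \<bar>?a n x * v x\<bar> \<partial>torus)"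
      using i by simp
    finally show "norm (\<integral>x. \<bar>1/2 * (VN n x)\<^sup>2 - 1/2 * (v x)\<^sup>2\<bar> \<partial>torus) \<le>
      (\<integral>x. \<bar>?a n x * VN n x\<bar> \<partial>torus) + (\<integral>x. \<bar>?a n x * v x\<bar> \<partial>torus)"
      by (simp add: abs_of_nonneg integral_nonneg)
  qed
  have "(\<lambda>n. \<integral>x. \<bar>?a n x * VN n x\<bar> \<partial>torus) \<longlonglongrightarrow> 0"
    by (rule L1_product_tendsto[OF a2 VN_tendsto V2 PN_square_integral_le[OF vi v2i zero_less_Suc]]) measurable
  moreover have "(\<lambda>n. \<integral>x. \<bar>?a n x * v x\<bar> \<partial>torus) \<longlonglongrightarrow> 0"
    by (rule L1_product_tendsto[OF a2 VN_tendsto v2i order_refl]) measurable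
  ultimately show "(\<lambda>n. (\<integral>x. \<bar>?a n x * VN n x\<bar> \<partial>torus) + (\<integral>x. \<bar>?a n x * v x\<bar> \<partial>torus)) \<longlonglongrightarrow> 0"
    by (rule tendsto_add_zero)
qed

text \<open>The chain rule \<open>\<partial>\<^sub>1 (v\<^sup>2/2) = v * h\<close> for a function
  with only a weak derivative: it is classical for the Fejer means, and both sides pass to the limit
  in L^1.\<close>

lemma fc_vh: "fc (\<lambda>x. v x * h x) j l = (of_real (2 * pi * of_int j) * \<i>) * fc (\<lambda>x. 1/2 * (v x)\<^sup>2) j l"
proof -
  have eq: "fc (\<lambda>x. VN n x * HN n x) j l = (of_real (2 * pi * of_int j) * \<i>) * fc (\<lambda>x. 1/2 * (VN n x)\<^sup>2) j l" for n
  proof -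
    let ?F = "\<lambda>x. complex_of_real (1/2 * (VN n x)\<^sup>2) * ee (-j) (-l) x"
    let ?F1 = "\<lambda>x. complex_of_real (VN n x * HN n x) * ee (-j) (-l) x - (of_real (2 * pi * of_int j) * \<i>) * ?F x"
    have per: "periodic ?F"
      using periodic_PN[OF vi, of "Suc n"] by (simp add: periodic_def ee_shift)
    have i: "integrable torus (\<lambda>x. VN n x * HN n x)" "integrable torus (\<lambda>x. 1/2 * (VN n x)\<^sup>2)"
      by (intro integrable_torus_continuous continuous_intros)+
    have "integral\<^sup>L (lebesgue_on (sq 0)) ?F1 = 0"
    proof (rule integral_pd1_eq_0[where F="?F"])
      show "continuous_on UNIV ?F1" by (intro continuous_intros)
      fix x y :: real
      have "((\<lambda>t. 1/2 * (VN n (t, y))\<^sup>2) has_real_derivative VN n (x, y) * HN n (x, y)) (at x)"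
        by (auto intro!: derivative_eq_intros PN_v_deriv1)
      then have "((\<lambda>t. complex_of_real (1/2 * (VN n (t, y))\<^sup>2)) has_vector_derivative of_real (VN n (x, y) * HN n (x, y))) (at x)"
        by (intro has_vector_derivative_of_real) (simp add: has_real_derivative_iff_has_vector_derivative)
      from has_vector_derivative_mult[OF this ee_deriv1[of "-j" "-l" y x]]
      show "((\<lambda>t. ?F (t, y)) has_vector_derivative ?F1 (x, y)) (at x)"
        by (simp add: algebra_simps)
    next
      show "?F (1 - 0, y) = ?F (- 0, y)" for y
        using periodic_shift_edge(1)[OF per, of 0 y] by simp
    qed
    then have "integral\<^sup>L torus ?F1 = 0" by (simp only: unit_square_eq_sq)
    moreover have "integral\<^sup>L torus ?F1 = fc (\<lambda>x. VN n x * HN n x) j l -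
        (of_real (2 * pi * of_int j) * \<i>) * fc (\<lambda>x. 1/2 * (VN n x)\<^sup>2) j l"
      unfolding fc_def integral_mult_right_zero[symmetric]
      by (intro Bochner_Integration.integral_diff integrable_mult_right integrable_ee_mult i)
    ultimately show ?thesis by simp
  qed
  have i: "integrable torus (\<lambda>x. VN n x * HN n x)" "integrable torus (\<lambda>x. 1/2 * (VN n x)\<^sup>2)" for n
    by (intro integrable_torus_continuous continuous_intros)+
  have "(\<lambda>n. fc (\<lambda>x. VN n x * HN n x) j l) \<longlonglongrightarrow> fc (\<lambda>x. v x * h x) j l"
    by (rule fc_tendsto[OF i(1) vhi VH_tendsto])
  moreover have "(\<lambda>n. (of_real (2 * pi * of_int j) * \<i>) * fc (\<lambda>x. 1/2 * (VN n x)\<^sup>2) j l) \<longlonglongrightarrow>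
      (of_real (2 * pi * of_int j) * \<i>) * fc (\<lambda>x. 1/2 * (v x)\<^sup>2) j l"
    using v2i by (intro tendsto_mult_left fc_tendsto[OF i(2) _ VV_tendsto]) auto
  ultimately show ?thesis
    unfolding eq by (rule LIMSEQ_unique)
qed

text \<open>The equation \<open>\<partial>\<^sub>2 v = v * h + |\<partial>\<^sub>1| g\<close>,
  frequency by frequency. For \<open>j = 0\<close> the definition of the inverse of
  \<open>|\<partial>\<^sub>1|\<close> does not constrain \<open>eta v\<close>; there the vanishing
  mean of \<open>v\<close> makes both sides 0.\<close>

lemma fc_g: "(of_real (2 * pi * of_int l) * \<i>) * fc v j l =
    fc (\<lambda>x. v x * h x) j l + of_real \<bar>2 * pi * of_int j\<bar> * fc g j l"
proof (cases "j = 0")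
  case True
  have "fourier (distr_of v) (2 * pi * of_int 0, 2 * pi * of_int l) = 0"
    using vmean in_freqs[of 0 l] by (auto simp: vanishing_mean1_def)
  then have "fc v 0 l = 0" unfolding fourier_distr_of .
  then show ?thesis using True by (simp add: fc_vh)
next
  case False
  have "fourier (distr_of g) (2 * pi * of_int j, 2 * pi * of_int l) =
      of_real (inverse \<bar>2 * pi * of_int j\<bar>) * fourier (eta v) (2 * pi * of_int j, 2 * pi * of_int l)"
    using wg in_freqs[of j l] False by (auto simp: inv_abs_pd1_eta_in_L2_def is_inv_abs_pd1_def)
  then have "of_real \<bar>2 * pi * of_int j\<bar> * fc g j l = fourier (eta v) (2 * pi * of_int j, 2 * pi * of_int l)"
    using False unfolding fourier_distr_of by (simp add: of_real_inverse field_simps)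
  then show ?thesis unfolding fourier_eta fc_vh by (simp add: algebra_simps)
qed

text \<open>\<open>GN\<close> is the mollified Hilbert transform of \<open>g\<close> in the first variable, so that \<open>\<partial>\<^sub>1 GN\<close> is the
  mollification of \<open>|\<partial>\<^sub>1| g\<close>.\<close>

definition "GN n x = Re (tp (Suc n) (\<lambda>j l. - \<i> * of_int (sgn j) * (of_real (cN (Suc n) j l) * fc g j l)) x)"

definition "GN1 n x = Re (tp (Suc n) (\<lambda>j l. of_real \<bar>2 * pi * of_int j\<bar> * (of_real (cN (Suc n) j l) * fc g j l)) x)"

lemma cont_GN [continuous_intros]: "continuous_on S (GN n)"
  and cont_GN1 [continuous_intros]: "continuous_on S (GN1 n)"
  unfolding GN_def[abs_def] GN1_def[abs_def] by (intro continuous_intros)+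

lemma periodic_GN: "periodic (GN n)"
  using periodic_tp[of "Suc n"] by (simp add: GN_def periodic_def)

lemma GN_deriv1: "((\<lambda>t. GN n (t, y)) has_real_derivative GN1 n (x, y)) (at x)"
proof -
  have "complex_of_real \<bar>2 * pi * of_int j\<bar> * z = (of_real (2 * pi * of_int j) * \<i>) * (- \<i> * of_int (sgn j) * z)" for j :: int and z
  proof (cases j "0 :: int" rule: linorder_cases)
    case less
    then have "\<bar>2 * pi * real_of_int j\<bar> = - (2 * pi * real_of_int j)" by (simp add: abs_mult)
    then show ?thesis using less by simp
  next
    case greater
    then have "\<bar>2 * pi * real_of_int j\<bar> = 2 * pi * real_of_int j" by (simp add: abs_mult)
    then show ?thesis using greater by simp
  qed simp
  note eq = this
  have "GN1 n (x, y) = Re (tp (Suc n) (\<lambda>j l. (of_real (2 * pi * of_int j) * \<i>) *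
      (- \<i> * of_int (sgn j) * (of_real (cN (Suc n) j l) * fc g j l))) (x, y))"
    unfolding GN1_def eq[symmetric] ..
  then show ?thesis
    unfolding GN_def by (simp only: Re_tp_deriv1)
qed

text \<open>\<open>fc_g\<close> multiplied by the Fejer coefficients. The nonlinearity appears as
  the mean of the product \<open>v * h\<close>, not as the product of the means; the difference is
  the mollification error carried along below.\<close>

lemma VN_deriv2:
  "((\<lambda>t. VN n (x, t)) has_real_derivative PN (Suc n) (\<lambda>z. v z * h z) (x, y) + GN1 n (x, y)) (at y)"
proof -
  have "PN (Suc n) (\<lambda>z. v z * h z) (x, y) + GN1 n (x, y) =
      Re (tp (Suc n) (\<lambda>j l. (of_real (2 * pi * of_int l) * \<i>) * (of_real (cN (Suc n) j l) * fc v j l)) (x, y))"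
    unfolding PN_eq_tp[OF vhi zero_less_Suc] GN1_def plus_complex.simps(1)[symmetric] tp_add[symmetric]
      mult.left_commute[of "of_real (2 * pi * of_int _) * \<i>"] fc_g
    by (simp add: algebra_simps)
  then show ?thesis
    unfolding PN_eq_tp[OF vi zero_less_Suc] using Re_tp_deriv2[of "Suc n" _ x y] by simp
qed

text \<open>The multiplier \<open>- \<i> * sgn j\<close> has modulus at most 1, and the Fejer mean
  is a contraction in L^2.\<close>

lemma integral_GN_square_le: "(\<integral>x. (GN n x)\<^sup>2 \<partial>torus) \<le> (\<integral>x. (g x)\<^sup>2 \<partial>torus)"
proof -
  have "(\<integral>x. (GN n x)\<^sup>2 \<partial>torus) \<le> (\<integral>x. (cmod (tp (Suc n) (\<lambda>j l. of_real (cN (Suc n) j l) * fc g j l) x))\<^sup>2 \<partial>torus)"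
    unfolding GN_def
  proof (rule integral_Re_tp_square_le)
    fix j l
    show "cmod (- \<i> * of_int (sgn j) * (of_real (cN (Suc n) j l) * fc g j l)) \<le> cmod (of_real (cN (Suc n) j l) * fc g j l)"
      by (simp add: norm_mult sgn_if)
  qed
  also have "\<dots> = (\<integral>x. (PN (Suc n) g x)\<^sup>2 \<partial>torus)"
    by (simp flip: of_real_PN_eq_tp[OF gi zero_less_Suc])
  also have "\<dots> \<le> (\<integral>x. (g x)\<^sup>2 \<partial>torus)"
    by (rule PN_square_integral_le[OF gi g2i zero_less_Suc])
  finally show ?thesis .
qed

end

section \<open>Cutoff functions, entropies and their weak production\<close>

locale cutoff =
  fixes s :: real and \<phi> \<phi>1 \<phi>2 :: "real \<times> real \<Rightarrow> real"
  assumes s: "0 \<le> s" "s \<le> 1"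
    and phi_cont: "continuous_on UNIV \<phi>" "continuous_on UNIV \<phi>1" "continuous_on UNIV \<phi>2"
    and phi_deriv1: "\<And>x y. ((\<lambda>t. \<phi> (t, y)) has_real_derivative \<phi>1 (x, y)) (at x)"
    and phi_deriv2: "\<And>x y. ((\<lambda>t. \<phi> (x, t)) has_real_derivative \<phi>2 (x, y)) (at y)"
    and phi_supp: "\<And>x. x \<notin> box (-s, -s) (1 - s, 1 - s) \<Longrightarrow> \<phi> x = 0"
    and phi_le: "\<And>x. \<bar>\<phi> x\<bar> \<le> 1"
begin

lemma phi_edge [simp]: "\<phi> (1 - s, y) = 0" "\<phi> (- s, y) = 0" "\<phi> (x, 1 - s) = 0" "\<phi> (x, - s) = 0"
  by (rule phi_supp; simp add: box_prod)+

lemma integral_pd1_cutoff: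
  fixes F F1 :: "real \<times> real \<Rightarrow> real"
  assumes "continuous_on UNIV F" "continuous_on UNIV F1"
    and "\<And>x y. ((\<lambda>t. F (t, y)) has_real_derivative F1 (x, y)) (at x)"
  shows "(\<integral>x. F1 x * \<phi> x + F x * \<phi>1 x \<partial>lebesgue_on (sq s)) = 0"
proof (rule integral_pd1_eq_0[where F="\<lambda>x. F x * \<phi> x"])
  show "((\<lambda>t. F (t, y) * \<phi> (t, y)) has_vector_derivative F1 (x, y) * \<phi> (x, y) + F (x, y) * \<phi>1 (x, y)) (at x)" for x y
    unfolding has_real_derivative_iff_has_vector_derivative[symmetric]
    by (auto intro!: derivative_eq_intros assms phi_deriv1 simp: algebra_simps)
qed (auto intro!: continuous_intros assms phi_cont)

lemma integral_pd2_cutoff: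
  fixes F F2 :: "real \<times> real \<Rightarrow> real"
  assumes "continuous_on UNIV F" "continuous_on UNIV F2"
    and "\<And>x y. ((\<lambda>t. F (x, t)) has_real_derivative F2 (x, y)) (at y)"
  shows "(\<integral>x. F2 x * \<phi> x + F x * \<phi>2 x \<partial>lebesgue_on (sq s)) = 0"
proof (rule integral_pd2_eq_0[where F="\<lambda>x. F x * \<phi> x"])
  show "((\<lambda>t. F (x, t) * \<phi> (x, t)) has_vector_derivative F2 (x, y) * \<phi> (x, y) + F (x, y) * \<phi>2 (x, y)) (at y)" for x y
    unfolding has_real_derivative_iff_has_vector_derivative[symmetric]
    by (auto intro!: derivative_eq_intros assms phi_deriv2 simp: algebra_simps)
qed (auto intro!: continuous_intros assms phi_cont)

end

text \<open>\<open>Q\<close> is the flux belonging to \<open>q\<close> for the equation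
  \<open>\<partial>\<^sub>2 v = v * \<partial>\<^sub>1 v\<close>. Boundedness of \<open>q'\<close>
  makes \<open>q\<close> Lipschitz and \<open>Q\<close> of quadratic growth, so both can be
  integrated and passed to the limit in L^2. The bound \<open>L\<close> on \<open>q''\<close>
  becomes the factor in front of the energy.\<close>

locale entropy =
  fixes q q' q'' Q :: "real \<Rightarrow> real" and M L :: real
  assumes q: "\<And>t. (q has_real_derivative q' t) (at t)"
    and q': "\<And>t. (q' has_real_derivative q'' t) (at t)"
    and Q: "\<And>t. (Q has_real_derivative t * q' t) (at t)"
    and q''_cont: "continuous_on UNIV q''"
    and M: "\<And>t. \<bar>q' t\<bar> \<le> M" and L: "\<And>t. \<bar>q'' t\<bar> \<le> L"
begin

lemma entropy_cont: "continuous_on S q" "continuous_on S q'" "continuous_on S Q"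
  by (rule DERIV_continuous_on[OF has_field_derivative_at_within], rule q q' Q)+

lemma M_nonneg: "M \<ge> 0" and L_nonneg: "L \<ge> 0"
  using M[of 0] L[of 0] by linarith+

lemma q_Lipschitz: "\<bar>q a - q b\<bar> \<le> M * \<bar>a - b\<bar>"
  using field_differentiable_bound[of UNIV q q' M a b] q M by (auto intro: has_field_derivative_at_within)

lemma Q_Lipschitz: "\<bar>Q a - Q b\<bar> \<le> (\<bar>a\<bar> + \<bar>b\<bar>) * M * \<bar>a - b\<bar>"
proof -
  let ?S = "{- (\<bar>a\<bar> + \<bar>b\<bar>)..\<bar>a\<bar> + \<bar>b\<bar>}"
  have "norm (Q a - Q b) \<le> ((\<bar>a\<bar> + \<bar>b\<bar>) * M) * norm (a - b)"
  proof (rule field_differentiable_bound[where S="?S" and f'="\<lambda>t. t * q' t"])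
    fix z assume "z \<in> ?S"
    show "(Q has_field_derivative z * q' z) (at z within ?S)" by (rule has_field_derivative_at_within[OF Q])
    show "norm (z * q' z) \<le> (\<bar>a\<bar> + \<bar>b\<bar>) * M"
      unfolding real_norm_def abs_mult using \<open>z \<in> ?S\<close> M[of z] by (intro mult_mono) auto
  qed auto
  then show ?thesis by simp
qed

end

lemma bounded_mult_integrable:
  fixes f psi :: "'a \<Rightarrow> real"
  assumes "integrable M f" "psi \<in> borel_measurable M" "\<And>x. x \<in> space M \<Longrightarrow> \<bar>psi x\<bar> \<le> C"
  shows "integrable M (\<lambda>x. f x * psi x)"
proof (rule Bochner_Integration.integrable_bound[of _ "\<lambda>x. C * f x"])
  show "AE x in M. norm (f x * psi x) \<le> norm (C * f x)"
  proof (rule AE_I2)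
    fix x assume "x \<in> space M"
    then have "\<bar>psi x\<bar> \<le> \<bar>C\<bar>" using assms(3)[of x] by linarith
    then have "\<bar>f x\<bar> * \<bar>psi x\<bar> \<le> \<bar>f x\<bar> * \<bar>C\<bar>" by (intro mult_left_mono) auto
    then show "norm (f x * psi x) \<le> norm (C * f x)" by (simp add: abs_mult mult.commute)
  qed
qed (use assms in auto)

lemma abs_diff_products_le: "\<bar>(a * p - b * r) - (c * p - d * r)\<bar> \<le> \<bar>a - c\<bar> * \<bar>p\<bar> + \<bar>b - d\<bar> * \<bar>r :: real\<bar>"
proof -
  have "(a * p - b * r) - (c * p - d * r) = (a - c) * p - (b - d) * r" by (simp add: algebra_simps)
  then show ?thesis by (simp only: abs_mult[symmetric] abs_triangle_ineq4)
qed

text \<open>Replaces \<open>a\<close> by \<open>a - b\<close> and \<open>b\<close>. With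
  \<open>a\<close> running along a sequence that converges to \<open>b\<close> in L^2, what remains
  is a null sequence times a fixed L^2 function, plus its square.\<close>

lemma flux_arith:
  assumes "0 \<le> C1" "0 \<le> C2" "0 \<le> M"
  shows "M * \<bar>a - b\<bar> * C2 + (\<bar>a\<bar> + \<bar>b\<bar>) * M * \<bar>a - b\<bar> * C1
    \<le> M * (C1 + C2) * (\<bar>a - b\<bar> * (1 + 2 * \<bar>b\<bar>) + \<bar>a - b :: real\<bar>\<^sup>2)"
proof -
  let ?s = "1 + (\<bar>a - b\<bar> + 2 * \<bar>b\<bar>)"
  have "M * \<bar>a - b\<bar> * C2 + (\<bar>a\<bar> + \<bar>b\<bar>) * M * \<bar>a - b\<bar> * C1 = M * \<bar>a - b\<bar> * (C2 * 1 + C1 * (\<bar>a\<bar> + \<bar>b\<bar>))"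
    by (simp add: algebra_simps)
  also have "\<dots> \<le> M * \<bar>a - b\<bar> * (C2 * ?s + C1 * ?s)"
  proof -
    have "1 \<le> ?s" "\<bar>a\<bar> + \<bar>b\<bar> \<le> ?s" by linarith+
    then have "C2 * 1 + C1 * (\<bar>a\<bar> + \<bar>b\<bar>) \<le> C2 * ?s + C1 * ?s"
      using assms(1,2) by (blast intro: add_mono mult_left_mono)
    then show ?thesis using assms(3) by (intro mult_left_mono mult_nonneg_nonneg) auto
  qed
  also have "\<dots> = M * (C1 + C2) * (\<bar>a - b\<bar> * (1 + 2 * \<bar>b\<bar>) + \<bar>a - b\<bar>\<^sup>2)"
    unfolding power2_eq_square by algebra
  finally show ?thesis .
qed

locale entropy_cutoff = entropy + cutoff
begin

abbreviation "D \<equiv> lebesgue_on (sq s)"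

lemma bounded_on_D:
  assumes "continuous_on UNIV (psi :: real \<times> real \<Rightarrow> real)"
  obtains C where "C \<ge> 0" "\<And>x. x \<in> space D \<Longrightarrow> \<bar>psi x\<bar> \<le> C"
proof -
  have "compact (psi ` csq s)"
    using assms by (intro compact_continuous_image compact_cbox) (auto intro: continuous_on_subset)
  then obtain B where B: "\<And>x. x \<in> csq s \<Longrightarrow> \<bar>psi x\<bar> \<le> B"
    by (metis bounded_iff compact_imp_bounded imageI real_norm_def)
  show ?thesis
  proof (rule that[of "\<bar>B\<bar>"])
    fix x assume "x \<in> space D"
    then show "\<bar>psi x\<bar> \<le> \<bar>B\<bar>" using B[of x] sq_subset_csq[of s] by fastforce
  qed simp
qed

lemma meas_D [measurable (raw)]:
  "continuous_on UNIV (psi :: real \<times> real \<Rightarrow> real) \<Longrightarrow> psi \<in> borel_measurable D"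
  using continuous_integrable_sq(1)[of psi s] by auto

lemma integrable_q_D:
  assumes f: "f \<in> borel_measurable D" "integrable D (\<lambda>x. (f x)\<^sup>2)"
  shows "integrable D (\<lambda>x. q (f x))" "integrable D (\<lambda>x. Q (f x))"
proof -
  have c: "integrable D (\<lambda>_. c :: real)" for c
    using finite_measure.integrable_const[OF finite_measure_sq] .
  have [measurable]: "q \<in> borel_measurable borel" "Q \<in> borel_measurable borel"
    by (intro borel_measurable_continuous_onI entropy_cont)+
  have f1: "integrable D f"
    by (rule Bochner_Integration.integrable_bound[of _ "\<lambda>x. 1 + (f x)\<^sup>2"])
      (use f c abs_le_weighted[of 1] in auto)
  show "integrable D (\<lambda>x. q (f x))"
  proof (rule Bochner_Integration.integrable_bound[of _ "\<lambda>x. \<bar>q 0\<bar> + M * \<bar>f x\<bar>"])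
    show "AE x in D. norm (q (f x)) \<le> norm (\<bar>q 0\<bar> + M * \<bar>f x\<bar>)"
    proof (rule AE_I2)
      fix x
      have "\<bar>q (f x)\<bar> \<le> \<bar>q 0\<bar> + M * \<bar>f x\<bar>" using q_Lipschitz[of "f x" 0] by simp
      then show "norm (q (f x)) \<le> norm (\<bar>q 0\<bar> + M * \<bar>f x\<bar>)" by simp
    qed
  qed (use f f1 c in auto)
  show "integrable D (\<lambda>x. Q (f x))"
  proof (rule Bochner_Integration.integrable_bound[of _ "\<lambda>x. \<bar>Q 0\<bar> + M * (f x)\<^sup>2"])
    show "AE x in D. norm (Q (f x)) \<le> norm (\<bar>Q 0\<bar> + M * (f x)\<^sup>2)"
    proof (rule AE_I2)
      fix x
      have "\<bar>Q (f x)\<bar> \<le> \<bar>Q 0\<bar> + M * (f x)\<^sup>2" using Q_Lipschitz[of "f x" 0] by (simp add: power2_eq_square algebra_simps abs_mult[symmetric])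
      then show "norm (Q (f x)) \<le> norm (\<bar>Q 0\<bar> + M * (f x)\<^sup>2)" by simp
    qed
  qed (use f c in auto)
qed

text \<open>The distribution \<open>\<partial>\<^sub>2 (q f) - \<partial>\<^sub>1 (Q f)\<close>
  tested with the cutoff, with the opposite sign.\<close>

definition "flux f = (\<integral>x. q (f x) * \<phi>2 x - Q (f x) * \<phi>1 x \<partial>D)"

lemma flux_integrable:
  assumes f: "f \<in> borel_measurable D" "integrable D (\<lambda>x. (f x)\<^sup>2)"
  shows "integrable D (\<lambda>x. q (f x) * \<phi>2 x)" "integrable D (\<lambda>x. Q (f x) * \<phi>1 x)"
proof -
  obtain C1 where C1: "\<And>x. x \<in> space D \<Longrightarrow> \<bar>\<phi>1 x\<bar> \<le> C1"
    using bounded_on_D[OF phi_cont(2)] by blast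
  obtain C2 where C2: "\<And>x. x \<in> space D \<Longrightarrow> \<bar>\<phi>2 x\<bar> \<le> C2"
    using bounded_on_D[OF phi_cont(3)] by blast
  show "integrable D (\<lambda>x. q (f x) * \<phi>2 x)"
    by (rule bounded_mult_integrable[OF integrable_q_D(1)[OF f] meas_D[OF phi_cont(3)] C2])
  show "integrable D (\<lambda>x. Q (f x) * \<phi>1 x)"
    by (rule bounded_mult_integrable[OF integrable_q_D(2)[OF f] meas_D[OF phi_cont(2)] C1])
qed

lemma flux_tendsto:
  assumes F: "\<And>n. F n \<in> borel_measurable D" "\<And>n. integrable D (\<lambda>x. (F n x)\<^sup>2)"
    and f: "f \<in> borel_measurable D" "integrable D (\<lambda>x. (f x)\<^sup>2)"
    and lim: "(\<lambda>n. \<integral>x. (F n x - f x)\<^sup>2 \<partial>D) \<longlonglongrightarrow> 0"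
  shows "(\<lambda>n. flux (F n)) \<longlonglongrightarrow> flux f"
proof -
  obtain C1 where C1: "C1 \<ge> 0" "\<And>x. x \<in> space D \<Longrightarrow> \<bar>\<phi>1 x\<bar> \<le> C1"
    using bounded_on_D[OF phi_cont(2)] by blast
  obtain C2 where C2: "C2 \<ge> 0" "\<And>x. x \<in> space D \<Longrightarrow> \<bar>\<phi>2 x\<bar> \<le> C2"
    using bounded_on_D[OF phi_cont(3)] by blast
  note C = C1 C2
  define C where "C = M * (C1 + C2)"
  have C0: "C \<ge> 0" using C M_nonneg by (simp add: C_def)
  have c: "integrable D (\<lambda>_. c :: real)" for c
    using finite_measure.integrable_const[OF finite_measure_sq] .
  let ?a = "\<lambda>n x. F n x - f x" and ?b = "\<lambda>x. 1 + 2 * \<bar>f x\<bar>"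
  have a2: "integrable D (\<lambda>x. (?a n x)\<^sup>2)" for n
    by (intro integrable_diff_square F f)
  have f1: "integrable D f"
    by (rule Bochner_Integration.integrable_bound[of _ "\<lambda>x. 1 + (f x)\<^sup>2"])
      (use f c abs_le_weighted[of 1] in auto)
  have b2: "integrable D (\<lambda>x. (?b x)\<^sup>2)"
    using f f1 c by (simp add: power2_sum power_mult_distrib)
  have ab: "integrable D (\<lambda>x. ?a n x * ?b x)" for n
    using F f a2 b2 by (intro integrable_mult_L2) auto
  have "(\<lambda>n. \<integral>x. \<bar>?a n x * ?b x\<bar> \<partial>D) \<longlonglongrightarrow> 0"
    by (rule L1_product_tendsto[OF a2 lim b2 order_refl]) (use F f in auto)
  then have "(\<lambda>n. C * ((\<integral>x. \<bar>?a n x * ?b x\<bar> \<partial>D) + (\<integral>x. (?a n x)\<^sup>2 \<partial>D))) \<longlonglongrightarrow> C * (0 + 0)"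
    using lim by (intro tendsto_intros)
  then have lim0: "(\<lambda>n. C * ((\<integral>x. \<bar>?a n x * ?b x\<bar> \<partial>D) + (\<integral>x. (?a n x)\<^sup>2 \<partial>D))) \<longlonglongrightarrow> 0" by simp
  have bound: "norm (flux (F n) - flux f) \<le> C * ((\<integral>x. \<bar>?a n x * ?b x\<bar> \<partial>D) + (\<integral>x. (?a n x)\<^sup>2 \<partial>D))" for n
  proof -
    let ?G = "\<lambda>u x. q (u x) * \<phi>2 x - Q (u x) * \<phi>1 x"
    have i: "integrable D (?G (F n))" "integrable D (?G f)"
      by (intro Bochner_Integration.integrable_diff flux_integrable F f)+
    have "flux (F n) - flux f = (\<integral>x. ?G (F n) x - ?G f x \<partial>D)"
      unfolding flux_def by (rule Bochner_Integration.integral_diff[OF i, symmetric])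
    then have "norm (flux (F n) - flux f) \<le> (\<integral>x. norm (?G (F n) x - ?G f x) \<partial>D)"
      by (simp only: integral_norm_bound)
    also have "\<dots> \<le> (\<integral>x. C * (\<bar>?a n x * ?b x\<bar> + (?a n x)\<^sup>2) \<partial>D)"
    proof (rule integral_mono)
      fix x assume x: "x \<in> space D"
      let ?A = "F n x" and ?B = "f x"
      have "norm (?G (F n) x - ?G f x) \<le> \<bar>q ?A - q ?B\<bar> * \<bar>\<phi>2 x\<bar> + \<bar>Q ?A - Q ?B\<bar> * \<bar>\<phi>1 x\<bar>"
        unfolding real_norm_def by (rule abs_diff_products_le)
      also have "\<dots> \<le> (M * \<bar>?A - ?B\<bar>) * C2 + ((\<bar>?A\<bar> + \<bar>?B\<bar>) * M * \<bar>?A - ?B\<bar>) * C1"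
      proof (intro add_mono mult_mono)
        show "\<bar>\<phi>1 x\<bar> \<le> C1" "\<bar>\<phi>2 x\<bar> \<le> C2" using C x by auto
      qed (use C M_nonneg in \<open>simp_all add: q_Lipschitz Q_Lipschitz\<close>)
      also have "\<dots> \<le> C * (\<bar>?a n x\<bar> * (1 + 2 * \<bar>?B\<bar>) + \<bar>?a n x\<bar>\<^sup>2)"
        unfolding C_def by (rule flux_arith[OF C(1,3) M_nonneg])
      finally show "norm (?G (F n) x - ?G f x) \<le> C * (\<bar>?a n x * ?b x\<bar> + (?a n x)\<^sup>2)"
        by (simp add: abs_mult)
    qed (use i a2 ab in auto)
    also have "\<dots> = C * ((\<integral>x. \<bar>?a n x * ?b x\<bar> \<partial>D) + (\<integral>x. (?a n x)\<^sup>2 \<partial>D))"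
      using a2 ab by simp
    finally show ?thesis .
  qed
  show ?thesis
    by (rule LIM_zero_cancel, rule Lim_null_comparison[OF always_eventually lim0]) (use bound in blast)
qed

end

declare continuous_on_PN [continuous_intros del]
locale burgers_entropy = burgers_defect + entropy_cutoff
begin

abbreviation "WN n \<equiv> PN (Suc n) (\<lambda>z. v z * h z)"

lemma cont_WN [continuous_intros]: "continuous_on S (WN n)"
  by (intro continuous_on_PN vhi zero_less_Suc)

lemma cont_comp [continuous_intros]:
  assumes "continuous_on S f"
  shows "continuous_on S (\<lambda>x. q (f x))" "continuous_on S (\<lambda>x. q' (f x))"
    "continuous_on S (\<lambda>x. Q (f x))" "continuous_on S (\<lambda>x. q'' (f x))"
proof -
  note * = continuous_on_compose2[OF _ assms]
  show "continuous_on S (\<lambda>x. q (f x))" "continuous_on S (\<lambda>x. q' (f x))"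
    "continuous_on S (\<lambda>x. Q (f x))" "continuous_on S (\<lambda>x. q'' (f x))"
    by (rule *[of UNIV], rule entropy_cont q''_cont, simp)+
qed

text \<open>The entropy balance of the mollified solution, obtained by testing
  \<open>\<partial>\<^sub>2 V = W + \<partial>\<^sub>1 G\<close> with \<open>q'(V) \<phi>\<close>; no derivative falls on \<open>W - V H\<close>.\<close>

lemma flux_VN:
  "flux (VN n) = (\<integral>x. q'' (VN n x) * HN n x * \<phi> x * GN n x + q' (VN n x) * \<phi>1 x * GN n x
      + q' (VN n x) * \<phi> x * (VN n x * HN n x - WN n x) \<partial>D)"
proof -
  \<comment> \<open>\<open>?A1\<close>, \<open>?A2\<close> and \<open>?A3\<close> are the full
    derivatives \<open>\<partial>\<^sub>2 (q(V) \<phi>)\<close>,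
    \<open>\<partial>\<^sub>1 (q'(V) G \<phi>)\<close> and
    \<open>\<partial>\<^sub>1 (Q(V) \<phi>)\<close>, so each integrates to zero. The flux integrand
    is \<open>?A1 - ?A2 - ?A3 + ?R\<close>, where the terms with \<open>GN1\<close> cancel.\<close>
  let ?A1 = "\<lambda>x. (q' (VN n x) * (WN n x + GN1 n x)) * \<phi> x + q (VN n x) * \<phi>2 x"
  let ?A2 = "\<lambda>x. (q'' (VN n x) * HN n x * GN n x + q' (VN n x) * GN1 n x) * \<phi> x + (q' (VN n x) * GN n x) * \<phi>1 x"
  let ?A3 = "\<lambda>x. (VN n x * q' (VN n x) * HN n x) * \<phi> x + Q (VN n x) * \<phi>1 x"
  let ?R = "\<lambda>x. q'' (VN n x) * HN n x * \<phi> x * GN n x + q' (VN n x) * \<phi>1 x * GN n x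
      + q' (VN n x) * \<phi> x * (VN n x * HN n x - WN n x)"
  have z1: "integral\<^sup>L D ?A1 = 0"
  proof (rule integral_pd2_cutoff)
    fix x y :: real
    show "((\<lambda>t. q (VN n (x, t))) has_real_derivative q' (VN n (x, y)) * (WN n (x, y) + GN1 n (x, y))) (at y)"
      by (rule DERIV_chain2[OF q VN_deriv2])
  qed (intro continuous_intros)+
  have z2: "integral\<^sup>L D ?A2 = 0"
  proof (rule integral_pd1_cutoff)
    fix x y :: real
    have "((\<lambda>t. q' (VN n (t, y))) has_real_derivative q'' (VN n (x, y)) * HN n (x, y)) (at x)"
      by (rule DERIV_chain2[OF q' PN_v_deriv1[OF zero_less_Suc]])
    from DERIV_mult[OF this GN_deriv1]
    show "((\<lambda>t. q' (VN n (t, y)) * GN n (t, y)) has_real_derivative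
       q'' (VN n (x, y)) * HN n (x, y) * GN n (x, y) + q' (VN n (x, y)) * GN1 n (x, y)) (at x)"
      by (simp add: mult.commute add.commute)
  qed (intro continuous_intros)+
  have z3: "integral\<^sup>L D ?A3 = 0"
  proof (rule integral_pd1_cutoff)
    fix x y :: real
    show "((\<lambda>t. Q (VN n (t, y))) has_real_derivative VN n (x, y) * q' (VN n (x, y)) * HN n (x, y)) (at x)"
      by (rule DERIV_chain2[OF Q PN_v_deriv1[OF zero_less_Suc]])
  qed (intro continuous_intros)+
  have iA: "integrable D ?A1" "integrable D ?A2" "integrable D ?A3" "integrable D ?R"
    by (intro continuous_integrable_sq continuous_intros phi_cont)+
  have "flux (VN n) = (\<integral>x. (?A1 x - ?A2 x) - ?A3 x + ?R x \<partial>D)"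
    unfolding flux_def by (intro Bochner_Integration.integral_cong) (auto simp: algebra_simps)
  also have "\<dots> = integral\<^sup>L D ?R"
    by (simp only: Bochner_Integration.integral_add Bochner_Integration.integral_diff
      Bochner_Integration.integrable_diff iA z1 z2 z3 diff_self add_0_left)
  finally show ?thesis .
qed

text \<open>Of the three terms in \<open>flux_VN\<close>, the first contains both \<open>h\<close>
  and \<open>g\<close> and gives the energy, the second contains \<open>g\<close> without
  \<open>h\<close> and is estimated with a free parameter \<open>d\<close>, and the third is the
  mollification error.\<close>

lemma flux_VN_le:
  assumes "e > 0" "d > 0" and B: "\<And>x. x \<in> sq s \<Longrightarrow> \<bar>\<phi>1 x\<bar> \<le> B"
  shows "\<bar>flux (VN n)\<bar> \<le> L * (1/2 * (\<integral>x. 1/e * (g x)\<^sup>2 + e * (h x)\<^sup>2 \<partial>torus))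
     + M * B * (d + (\<integral>x. (g x)\<^sup>2 \<partial>torus) / d) + M * (\<integral>x. \<bar>VN n x * HN n x - WN n x\<bar> \<partial>torus)"
proof -
  have B0: "B \<ge> 0" using B[of "(-s, -s)"] by (simp add: sq_def)
  let ?E = "\<lambda>x. e * (HN n x)\<^sup>2 + 1/e * (GN n x)\<^sup>2" and ?W = "\<lambda>x. \<bar>VN n x * HN n x - WN n x\<bar>" and ?G = "\<lambda>x. (GN n x)\<^sup>2"
  have perV: "periodic (VN n)" "periodic (HN n)" "periodic (WN n)"
    by (intro periodic_PN vi hi vhi zero_less_Suc)+
  have per: "periodic ?E" "periodic ?W" "periodic ?G"
    using perV periodic_GN[of n] by (simp_all add: periodic_def)
  have it: "integrable torus ?E" "integrable torus ?W" "integrable torus ?G"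
    by (intro integrable_torus_continuous continuous_intros)+
  have iD: "integrable D ?E" "integrable D ?W" "integrable D ?G"
    by (intro continuous_integrable_sq continuous_intros)+
  have c: "integrable D (\<lambda>_. c :: real)" for c
    using finite_measure.integrable_const[OF finite_measure_sq] .
  let ?R = "\<lambda>x. q'' (VN n x) * HN n x * \<phi> x * GN n x + q' (VN n x) * \<phi>1 x * GN n x
      + q' (VN n x) * \<phi> x * (VN n x * HN n x - WN n x)"
  let ?S = "\<lambda>x. L/2 * ?E x + (M * B * (d + ?G x / d) + M * ?W x)"
  have le1: "\<bar>flux (VN n)\<bar> \<le> (\<integral>x. \<bar>?R x\<bar> \<partial>D)"
    unfolding flux_VN by (rule integral_abs_bound)
  have le2: "(\<integral>x. \<bar>?R x\<bar> \<partial>D) \<le> (\<integral>x. ?S x \<partial>D)"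
  proof (rule integral_mono)
    show "integrable D (\<lambda>x. \<bar>?R x\<bar>)"
      by (intro continuous_integrable_sq continuous_intros phi_cont)
    show "integrable D ?S"
      by (intro continuous_integrable_sq continuous_intros) (use assms in auto)
    fix x assume "x \<in> space D"
    have t1: "\<bar>q'' (VN n x) * HN n x * \<phi> x * GN n x\<bar> \<le> L/2 * ?E x"
    proof -
      have "\<bar>q'' (VN n x) * HN n x * \<phi> x * GN n x\<bar> = (\<bar>q'' (VN n x)\<bar> * \<bar>\<phi> x\<bar>) * (\<bar>HN n x\<bar> * \<bar>GN n x\<bar>)"
        by (simp add: abs_mult)
      also have "\<dots> \<le> (L * 1) * (1/2 * ?E x)"
      proof (rule mult_mono)
        show "\<bar>q'' (VN n x)\<bar> * \<bar>\<phi> x\<bar> \<le> L * 1"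
          using L phi_le L_nonneg by (intro mult_mono) auto
        \<comment> \<open>This is \<open>|H| |G| \<le> 1/2 * (e H^2 + G^2/e)\<close> multiplied by
          \<open>e\<close>; the factor 1/2 is the one in the definition of the energy.\<close>
        have "2 * (e * \<bar>HN n x\<bar>) * \<bar>GN n x\<bar> \<le> (e * \<bar>HN n x\<bar>)\<^sup>2 + \<bar>GN n x\<bar>\<^sup>2" by (rule sum_squares_bound)
        then have "e * (2 * (\<bar>HN n x\<bar> * \<bar>GN n x\<bar>)) \<le> e * ?E x"
          using \<open>e > 0\<close> by (simp add: power_mult_distrib power2_eq_square algebra_simps)
        then show "\<bar>HN n x\<bar> * \<bar>GN n x\<bar> \<le> 1/2 * ?E x" using \<open>e > 0\<close> by simp
      qed (use L_nonneg in auto)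
      finally show ?thesis by simp
    qed
    have t2: "\<bar>q' (VN n x) * \<phi>1 x * GN n x\<bar> \<le> M * B * (d + ?G x / d)"
      unfolding abs_mult using M B \<open>x \<in> space D\<close> M_nonneg B0 abs_le_weighted[OF \<open>d > 0\<close>] by (intro mult_mono) auto
    have t3: "\<bar>q' (VN n x) * \<phi> x * (VN n x * HN n x - WN n x)\<bar> \<le> M * 1 * ?W x"
      unfolding abs_mult using M phi_le M_nonneg by (intro mult_mono) auto
    have "\<bar>?R x\<bar> \<le> \<bar>q'' (VN n x) * HN n x * \<phi> x * GN n x\<bar> + \<bar>q' (VN n x) * \<phi>1 x * GN n x\<bar>
        + \<bar>q' (VN n x) * \<phi> x * (VN n x * HN n x - WN n x)\<bar>"
      by (rule order_trans[OF abs_triangle_ineq add_right_mono[OF abs_triangle_ineq]])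
    also have "\<dots> \<le> L/2 * ?E x + M * B * (d + ?G x / d) + M * 1 * ?W x"
      by (intro add_mono t1 t2 t3)
    finally show "\<bar>?R x\<bar> \<le> ?S x" by (simp only: add.assoc mult_1_right)
  qed
  have le3: "(\<integral>x. ?S x \<partial>D) = L/2 * (\<integral>x. ?E x \<partial>D) + (M * B * (d + (\<integral>x. ?G x \<partial>D) / d) + M * (\<integral>x. ?W x \<partial>D))"
  proof -
    have "(\<integral>x. d + ?G x / d \<partial>D) = d + (\<integral>x. ?G x \<partial>D) / d"
      using iD(3) c by (subst Bochner_Integration.integral_add) auto
    moreover have "integrable D (\<lambda>x. M * B * (d + ?G x / d))"
      using iD(3) c by auto
    ultimately show ?thesis
      using iD(1,2) by (simp only: Bochner_Integration.integral_add Bochner_Integration.integrable_add integrable_mult_right integral_mult_right_zero)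
  qed
  \<comment> \<open>Once the cutoff has been estimated away, all integrands are periodic and the
    shifted square may be exchanged for the torus.\<close>
  have eE: "(\<integral>x. ?E x \<partial>D) = (\<integral>x. ?E x \<partial>torus)"
    using \<open>e > 0\<close> by (intro periodic_integral_sq(2) per it s) auto
  have eG: "(\<integral>x. ?G x \<partial>D) = (\<integral>x. ?G x \<partial>torus)"
    by (intro periodic_integral_sq(2) per it s) auto
  have eW: "(\<integral>x. ?W x \<partial>D) = (\<integral>x. ?W x \<partial>torus)"
    by (intro periodic_integral_sq(2) per it s) auto
  have lE: "(\<integral>x. ?E x \<partial>torus) \<le> (\<integral>x. 1/e * (g x)\<^sup>2 + e * (h x)\<^sup>2 \<partial>torus)"
  proof -
    have iH: "integrable torus (\<lambda>x. (HN n x)\<^sup>2)"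
      by (intro integrable_torus_continuous continuous_intros)
    have "(\<integral>x. ?E x \<partial>torus) = e * (\<integral>x. (HN n x)\<^sup>2 \<partial>torus) + 1/e * (\<integral>x. ?G x \<partial>torus)"
      using iH it(3) by simp
    moreover have "e * (\<integral>x. (HN n x)\<^sup>2 \<partial>torus) + 1/e * (\<integral>x. ?G x \<partial>torus) \<le> e * (\<integral>x. (h x)\<^sup>2 \<partial>torus) + 1/e * (\<integral>x. (g x)\<^sup>2 \<partial>torus)"
      using \<open>e > 0\<close>
      by (intro add_mono mult_left_mono PN_square_integral_le[OF hi h2i zero_less_Suc] integral_GN_square_le) auto
    moreover have "(\<integral>x. 1/e * (g x)\<^sup>2 + e * (h x)\<^sup>2 \<partial>torus) = e * (\<integral>x. (h x)\<^sup>2 \<partial>torus) + 1/e * (\<integral>x. (g x)\<^sup>2 \<partial>torus)"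
      using h2i g2i by simp
    ultimately show ?thesis by (simp only:)
  qed
  have "L/2 * (\<integral>x. ?E x \<partial>torus) + (M * B * (d + (\<integral>x. ?G x \<partial>torus) / d) + M * (\<integral>x. ?W x \<partial>torus))
    \<le> L/2 * (\<integral>x. 1/e * (g x)\<^sup>2 + e * (h x)\<^sup>2 \<partial>torus) + (M * B * (d + (\<integral>x. (g x)\<^sup>2 \<partial>torus) / d) + M * (\<integral>x. ?W x \<partial>torus))"
    using L_nonneg M_nonneg B0 \<open>d > 0\<close>
    by (intro add_right_mono add_mono[OF mult_left_mono[OF lE]] mult_left_mono add_left_mono divide_right_mono integral_GN_square_le) auto
  with order_trans[OF le1 le2] show ?thesis unfolding le3 eE eG eW by simp
qed

text \<open>Sending \<open>n\<close> to infinity removes the mollification error, since both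
  \<open>VN n * HN n\<close> and \<open>WN n\<close> tend to \<open>v * h\<close> in L^1. The
  parameter \<open>d\<close> stays free.\<close>

lemma flux_le:
  assumes "e > 0" "d > 0" and B: "\<And>x. x \<in> sq s \<Longrightarrow> \<bar>\<phi>1 x\<bar> \<le> B"
  shows "\<bar>flux v\<bar> \<le> L * (1/2 * (\<integral>x. 1/e * (g x)\<^sup>2 + e * (h x)\<^sup>2 \<partial>torus))
     + M * B * (d + (\<integral>x. (g x)\<^sup>2 \<partial>torus) / d)"
proof -
  have perv: "periodic v" using v by (simp add: Lp_torus_def)
  have mv: "v \<in> borel_measurable D"
    by (rule measurable_restrict_space1[OF periodic_borel_measurable_lebesgue[OF perv borel_measurable_integrable[OF vi]]])
  have mV: "VN n \<in> borel_measurable torus" "VN n \<in> borel_measurable D" for n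
    by (rule borel_measurable_integrable[OF integrable_torus_continuous[OF cont_VN]], rule meas_D[OF cont_VN])
  have v2D: "integrable D (\<lambda>x. (v x)\<^sup>2)"
    using perv by (intro periodic_integral_sq(1) v2i s) (simp_all add: periodic_def)
  have V2: "integrable D (\<lambda>x. (VN n x)\<^sup>2)" "integrable torus (\<lambda>x. (VN n x)\<^sup>2)" for n
    by (intro continuous_integrable_sq integrable_torus_continuous continuous_intros)+
  have "(\<integral>x. (VN n x - v x)\<^sup>2 \<partial>D) = (\<integral>x. (VN n x - v x)\<^sup>2 \<partial>torus)" for n
  proof (rule periodic_integral_sq(2))
    show "periodic (\<lambda>x. (VN n x - v x)\<^sup>2)"
      using perv periodic_PN[OF vi, of "Suc n"] by (simp add: periodic_def)
    show "integrable torus (\<lambda>x. (VN n x - v x)\<^sup>2)"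
      by (intro integrable_diff_square V2 v2i mV borel_measurable_integrable[OF vi])
  qed (use s in auto)
  then have limV: "(\<lambda>n. \<integral>x. (VN n x - v x)\<^sup>2 \<partial>D) \<longlonglongrightarrow> 0"
    using VN_tendsto by simp
  have lim1: "(\<lambda>n. \<bar>flux (VN n)\<bar>) \<longlonglongrightarrow> \<bar>flux v\<bar>"
    by (intro tendsto_rabs flux_tendsto mV mv v2D V2 limV)
  have limW: "(\<lambda>n. \<integral>x. \<bar>VN n x * HN n x - WN n x\<bar> \<partial>torus) \<longlonglongrightarrow> 0"
  proof (rule Lim_null_comparison[OF always_eventually])
    have iV: "integrable torus (\<lambda>x. VN n x * HN n x)" "integrable torus (WN n)" for n
      by (intro integrable_torus_continuous continuous_intros)+
    show "\<forall>n. norm (\<integral>x. \<bar>VN n x * HN n x - WN n x\<bar> \<partial>torus) \<le>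
        (\<integral>x. \<bar>VN n x * HN n x - v x * h x\<bar> \<partial>torus) + (\<integral>x. \<bar>WN n x - v x * h x\<bar> \<partial>torus)"
    proof
      fix n
      have "(\<integral>x. \<bar>VN n x * HN n x - WN n x\<bar> \<partial>torus) \<le> (\<integral>x. \<bar>VN n x * HN n x - v x * h x\<bar> + \<bar>WN n x - v x * h x\<bar> \<partial>torus)"
        using iV vhi by (intro integral_mono) auto
      moreover have "(\<integral>x. \<bar>VN n x * HN n x - v x * h x\<bar> + \<bar>WN n x - v x * h x\<bar> \<partial>torus) =
          (\<integral>x. \<bar>VN n x * HN n x - v x * h x\<bar> \<partial>torus) + (\<integral>x. \<bar>WN n x - v x * h x\<bar> \<partial>torus)"
        using iV vhi by (intro Bochner_Integration.integral_add) auto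
      ultimately show "norm (\<integral>x. \<bar>VN n x * HN n x - WN n x\<bar> \<partial>torus) \<le>
        (\<integral>x. \<bar>VN n x * HN n x - v x * h x\<bar> \<partial>torus) + (\<integral>x. \<bar>WN n x - v x * h x\<bar> \<partial>torus)"
        by (simp add: abs_of_nonneg integral_nonneg)
    qed
    have "(\<lambda>n. \<integral>x. \<bar>WN n x - v x * h x\<bar> \<partial>torus) \<longlonglongrightarrow> 0"
      using LIMSEQ_Suc[OF PN_tendsto[of "\<lambda>x. v x * h x" 1]] vhi by simp
    with VH_tendsto show "(\<lambda>n. (\<integral>x. \<bar>VN n x * HN n x - v x * h x\<bar> \<partial>torus) + (\<integral>x. \<bar>WN n x - v x * h x\<bar> \<partial>torus)) \<longlonglongrightarrow> 0"
      by (rule tendsto_add_zero)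
  qed
  let ?K = "L * (1/2 * (\<integral>x. 1/e * (g x)\<^sup>2 + e * (h x)\<^sup>2 \<partial>torus)) + M * B * (d + (\<integral>x. (g x)\<^sup>2 \<partial>torus) / d)"
  have "(\<lambda>n. ?K + M * (\<integral>x. \<bar>VN n x * HN n x - WN n x\<bar> \<partial>torus)) \<longlonglongrightarrow> ?K + M * 0"
    by (intro tendsto_add tendsto_const tendsto_mult limW)
  then have "\<bar>flux v\<bar> \<le> ?K + M * 0"
    by (rule LIMSEQ_le[OF lim1]) (use flux_VN_le[OF assms] in blast)
  then show ?thesis by simp
qed

end

section \<open>The limit of low-energy solutions\<close>

lemma ex_antiderivative:
  assumes "continuous_on UNIV (f :: real \<Rightarrow> real)"
  obtains F where "\<And>t. (F has_real_derivative f t) (at t)" "F 0 = 0"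
proof -
  have "\<exists>F. \<forall>x::real. -\<infinity> < ereal x \<longrightarrow> ereal x < \<infinity> \<longrightarrow> (F has_vector_derivative f x) (at x)"
    using assms by (intro einterval_antiderivative) (auto simp: continuous_on_eq_continuous_at)
  then obtain F where F: "\<And>x. (F has_real_derivative f x) (at x)"
    by (auto simp: has_real_derivative_iff_has_vector_derivative)
  show ?thesis
    by (rule that[of "\<lambda>t. F t - F 0"]) (auto intro!: derivative_eq_intros F)
qed

lemma antiderivative_eq_on:
  assumes F: "\<And>t. t \<in> S \<Longrightarrow> (F has_real_derivative f t) (at t)" and G: "\<And>t. t \<in> S \<Longrightarrow> (G has_real_derivative f t) (at t)"
    and S: "convex S" "a \<in> S" "F a = G a" and t: "t \<in> S"
  shows "F t = G t"
proof -
  have "\<exists>c. \<forall>x\<in>S. F x - G x = c"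
    using S(1)
  proof (rule has_field_derivative_zero_constant)
    fix x assume "x \<in> S"
    then show "((\<lambda>x. F x - G x) has_field_derivative 0) (at x within S)"
      using DERIV_diff[OF F G, of x] by (auto intro: has_field_derivative_at_within)
  qed
  then obtain c where "\<And>x. x \<in> S \<Longrightarrow> F x - G x = c" by blast
  from this[OF S(2)] this[OF t] S(3) show ?thesis by simp
qed

text \<open>The entropy \<open>t\<^sup>2/2\<close> is modified outside \<open>[-R, R]\<close> so that its derivative becomes bounded while
  its second derivative stays at most 1.\<close>

lemma ex_truncated_entropy:
  assumes "R \<ge> 0"
  obtains q q' q'' Q where "entropy q q' q'' Q (R + 1) 1"
    "\<And>t. \<bar>t\<bar> \<le> R \<Longrightarrow> q t = t\<^sup>2 / 2" "\<And>t. \<bar>t\<bar> \<le> R \<Longrightarrow> Q t = t ^ 3 / 3"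
proof -
  define c where "c t = max (- R) (min R t)" for t
  \<comment> \<open>The cosine is bounded by 1 everywhere and equals 1 on \<open>[-R, R]\<close>.
    Outside, its integral is a sine, so \<open>q'\<close> never leaves
    \<open>[-(R + 1), R + 1]\<close>.\<close>
  define q'' where "q'' t = cos (t - c t)" for t
  have cq'': "continuous_on UNIV q''" unfolding q''_def c_def by (intro continuous_intros)
  obtain q' where q': "\<And>t. (q' has_real_derivative q'' t) (at t)" "q' 0 = 0"
    using ex_antiderivative[OF cq''] by blast
  have cq': "continuous_on UNIV q'"
    by (rule DERIV_continuous_on[OF has_field_derivative_at_within[OF q'(1)]])
  obtain q where q: "\<And>t. (q has_real_derivative q' t) (at t)" "q 0 = 0"
    using ex_antiderivative[OF cq'] by blast
  have "continuous_on UNIV (\<lambda>t. t * q' t)" by (intro continuous_intros cq')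
  then obtain Q where Q: "\<And>t. (Q has_real_derivative t * q' t) (at t)" "Q 0 = 0"
    using ex_antiderivative by blast
  let ?S = "{-R..R}"
  have S: "convex ?S" "0 \<in> ?S" using assms by auto
  have eq': "q' t = t" if "t \<in> ?S" for t
  proof (rule antiderivative_eq_on[OF _ _ S _ that])
    fix t assume "t \<in> ?S"
    then have "q'' t = 1" by (auto simp: q''_def c_def)
    then show "(q' has_real_derivative 1) (at t)" using q'(1)[of t] by simp
  qed (use q' in \<open>auto intro!: derivative_eq_intros\<close>)
  have eq: "q t = t\<^sup>2 / 2" if "t \<in> ?S" for t
  proof (rule antiderivative_eq_on[OF _ _ S _ that])
    fix t assume "t \<in> ?S"
    then show "(q has_real_derivative t) (at t)" using q(1)[of t] eq' by simp
  qed (use q in \<open>auto intro!: derivative_eq_intros\<close>)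
  have eQ: "Q t = t ^ 3 / 3" if "t \<in> ?S" for t
  proof (rule antiderivative_eq_on[OF _ _ S _ that])
    fix t assume "t \<in> ?S"
    then show "(Q has_real_derivative t\<^sup>2) (at t)" using Q(1)[of t] eq' by (simp add: power2_eq_square)
  qed (use Q in \<open>auto intro!: derivative_eq_intros simp: power2_eq_square\<close>)
  have eplus: "q' t = R + sin (t - R)" if "t \<in> {R..}" for t
  proof (rule antiderivative_eq_on[where a=R and f=q'', OF _ _ _ _ _ that])
    fix t assume "t \<in> {R..}"
    then show "((\<lambda>t. R + sin (t - R)) has_real_derivative q'' t) (at t)"
      using assms by (auto intro!: derivative_eq_intros simp: q''_def c_def)
  qed (use q' eq'[of R] assms in auto)
  have eminus: "q' t = - R + sin (t + R)" if "t \<in> {..-R}" for t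
  proof (rule antiderivative_eq_on[where a="-R" and f=q'', OF _ _ _ _ _ that])
    fix t assume "t \<in> {..-R}"
    then show "((\<lambda>t. - R + sin (t + R)) has_real_derivative q'' t) (at t)"
      using assms by (auto intro!: derivative_eq_intros simp: q''_def c_def)
  qed (use q' eq'[of "-R"] assms in auto)
  have M: "\<bar>q' t\<bar> \<le> R + 1" for t
  proof -
    consider "t \<in> ?S" | "t \<in> {R..}" | "t \<in> {..-R}" by fastforce
    then show ?thesis
    proof cases
      case 1 then show ?thesis using eq' by auto
    next
      case 2 then show ?thesis using eplus[OF 2] abs_sin_le_one[of "t - R"] assms by linarith
    next
      case 3 then show ?thesis using eminus[OF 3] abs_sin_le_one[of "t + R"] assms by linarith
    qed
  qed
  have "entropy q q' q'' Q (R + 1) 1"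
    by unfold_locales (rule q q' Q cq'' M | simp add: q''_def)+
  moreover have "q t = t\<^sup>2 / 2" "Q t = t ^ 3 / 3" if "\<bar>t\<bar> \<le> R" for t
    using eq[of t] eQ[of t] that by (simp_all add: abs_le_iff)
  ultimately show ?thesis by (rule that)
qed

text \<open>The integral of the indicator of the exceptional set does not depend on the fundamental
  domain.\<close>

lemma AE_periodic_sq:
  assumes per: "periodic f" and f: "f \<in> borel_measurable torus" and ae: "AE x in torus. \<bar>f x\<bar> \<le> (R::real)"
    and s: "0 \<le> s" "s \<le> 1"
  shows "AE x in lebesgue_on (sq s). \<bar>f x\<bar> \<le> R"
proof -
  let ?u = "\<lambda>x. if \<bar>f x\<bar> \<le> R then 0 else 1 :: ennreal"
  have m: "f \<in> borel_measurable lebesgue" by (rule periodic_borel_measurable_lebesgue[OF per f])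
  then have mu: "?u \<in> borel_measurable lebesgue" by measurable
  have muS: "?u \<in> borel_measurable (lebesgue_on (sq r))" for r by (rule measurable_restrict_space1[OF mu])
  have "(\<integral>\<^sup>+x. ?u x \<partial>torus) = (\<integral>\<^sup>+x. 0 \<partial>torus)"
    using ae by (intro nn_integral_cong_AE) auto
  moreover have "periodic ?u" using per by (simp add: periodic_def)
  then have "(\<integral>\<^sup>+x\<in>sq s. ?u x \<partial>lebesgue) = (\<integral>\<^sup>+x\<in>unit_square. ?u x \<partial>lebesgue)"
    using mu s by (rule nn_integral_periodic_sq)
  ultimately have "(\<integral>\<^sup>+x. ?u x \<partial>lebesgue_on (sq s)) = 0"
    by (simp add: nn_integral_restrict_space unit_square_eq_sq)
  then have "AE x in lebesgue_on (sq s). ?u x = 0"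
    using muS by (subst (asm) nn_integral_0_iff_AE)
  then show ?thesis by eventually_elim (auto split: if_splits)
qed

text \<open>Takes the place of Hoelder's inequality in passing from L^3 to L^2: values up to
  \<open>d\<close> contribute at most \<open>d\<^sup>2\<close>, and for larger values one factor
  \<open>|t|/d\<close> is at least 1.\<close>

lemma square_le_cube: "d > 0 \<Longrightarrow> t\<^sup>2 \<le> d\<^sup>2 + \<bar>t\<bar> ^ 3 / (d :: real)"
proof (cases "\<bar>t\<bar> \<le> d")
  case True
  assume "d > 0"
  then have "\<bar>t\<bar>\<^sup>2 \<le> d\<^sup>2" using True by (intro power_mono) auto
  then show ?thesis using \<open>d > 0\<close> by (simp add: add_increasing2)
next
  case False
  assume "d > 0"
  then have "d * t\<^sup>2 \<le> \<bar>t\<bar> * \<bar>t\<bar>\<^sup>2" using False by (simp add: mult_right_mono)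
  then have "t\<^sup>2 \<le> \<bar>t\<bar> ^ 3 / d" using \<open>d > 0\<close> by (simp add: field_simps power3_eq_cube power2_eq_square)
  then show ?thesis using zero_le_power2[of d] by linarith
qed

lemma Lp3_imp_Lp2:
  assumes "Lp_torus 3 f" shows "Lp_torus 2 f"
proof -
  have f: "f \<in> borel_measurable torus" "integrable torus (\<lambda>x. \<bar>f x\<bar> ^ 3)"
    using assms by (auto simp: Lp_torus_def)
  have "integrable torus (\<lambda>x. (f x)\<^sup>2)"
  proof (rule Bochner_Integration.integrable_bound[of _ "\<lambda>x. 1\<^sup>2 + \<bar>f x\<bar> ^ 3 / 1"])
    show "AE x in torus. norm ((f x)\<^sup>2) \<le> norm (1\<^sup>2 + \<bar>f x\<bar> ^ 3 / 1)"
      using square_le_cube[of 1] by (intro AE_I2) simp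
  qed (use f in auto)
  then show ?thesis using assms by (simp add: Lp_torus_def)
qed

lemma tendsto_Lp3_imp_L2:
  assumes "tendsto_Lp_torus 3 F f"
  shows "(\<lambda>n. \<integral>x. (F n x - f x)\<^sup>2 \<partial>torus) \<longlonglongrightarrow> 0"
proof (rule LIMSEQ_I)
  fix r :: real assume r: "r > 0"
  have F: "Lp_torus 3 (F n)" "Lp_torus 3 f" and lim: "(\<lambda>n. \<integral>x. \<bar>F n x - f x\<bar> ^ 3 \<partial>torus) \<longlonglongrightarrow> 0" for n
    using assms by (auto simp: tendsto_Lp_torus_def)
  have m [measurable]: "F n \<in> borel_measurable torus" "f \<in> borel_measurable torus" for n
    using F by (auto simp: Lp_torus_def)
  have i3: "integrable torus (\<lambda>x. \<bar>F n x - f x\<bar> ^ 3)" for n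
  proof (rule Bochner_Integration.integrable_bound[of _ "\<lambda>x. 8 * (\<bar>F n x\<bar> ^ 3 + \<bar>f x\<bar> ^ 3)"])
    show "AE x in torus. norm (\<bar>F n x - f x\<bar> ^ 3) \<le> norm (8 * (\<bar>F n x\<bar> ^ 3 + \<bar>f x\<bar> ^ 3))"
    proof (rule AE_I2)
      fix x
      let ?m = "max \<bar>F n x\<bar> \<bar>f x\<bar>"
      have "\<bar>F n x - f x\<bar> ^ 3 \<le> (2 * ?m) ^ 3" by (intro power_mono) auto
      also have "\<dots> = 8 * ?m ^ 3" by (simp add: power_mult_distrib)
      also have "?m ^ 3 \<le> \<bar>F n x\<bar> ^ 3 + \<bar>f x\<bar> ^ 3" by (auto simp: max_def)
      finally show "norm (\<bar>F n x - f x\<bar> ^ 3) \<le> norm (8 * (\<bar>F n x\<bar> ^ 3 + \<bar>f x\<bar> ^ 3))" by simp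
    qed
  qed (use F in \<open>auto simp: Lp_torus_def\<close>)
  have L2: "Lp_torus 2 (F n)" "Lp_torus 2 f" for n
    using F by (auto intro: Lp3_imp_Lp2)
  have i2: "integrable torus (\<lambda>x. (F n x - f x)\<^sup>2)" for n
    by (intro integrable_diff_square m Lp2_square L2)
  define d where "d = min 1 (r / 2)"
  have d: "d > 0" "d \<le> 1" "d \<le> r / 2" using r by (auto simp: d_def)
  have d2: "d\<^sup>2 \<le> r / 2" using d power_decreasing[of 1 2 d] by simp
  have "\<forall>\<^sub>F n in sequentially. (\<integral>x. \<bar>F n x - f x\<bar> ^ 3 \<partial>torus) < d * (r / 2)"
    using lim d r by (intro order_tendstoD) auto
  then obtain n0 where n0: "\<And>n. n \<ge> n0 \<Longrightarrow> (\<integral>x. \<bar>F n x - f x\<bar> ^ 3 \<partial>torus) < d * (r / 2)"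
    by (auto simp: eventually_sequentially)
  show "\<exists>n0. \<forall>n\<ge>n0. norm ((\<integral>x. (F n x - f x)\<^sup>2 \<partial>torus) - 0) < r"
  proof (intro exI[of _ n0] allI impI)
    fix n assume n: "n \<ge> n0"
    have "(\<integral>x. (F n x - f x)\<^sup>2 \<partial>torus) \<le> (\<integral>x. d\<^sup>2 + \<bar>F n x - f x\<bar> ^ 3 / d \<partial>torus)"
      using i2 i3 square_le_cube[OF d(1)] by (intro integral_mono) auto
    moreover have "(\<integral>x. d\<^sup>2 + \<bar>F n x - f x\<bar> ^ 3 / d \<partial>torus) = d\<^sup>2 + (\<integral>x. \<bar>F n x - f x\<bar> ^ 3 \<partial>torus) / d"
      using i3 measure_lebesgue_on_sq[of 0] by (subst Bochner_Integration.integral_add) (auto simp: unit_square_eq_sq[symmetric])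
    moreover have "(\<integral>x. \<bar>F n x - f x\<bar> ^ 3 \<partial>torus) / d < r / 2"
      using n0[OF n] d by (simp add: field_simps)
    ultimately have "(\<integral>x. (F n x - f x)\<^sup>2 \<partial>torus) < r" using d2 by linarith
    then show "norm ((\<integral>x. (F n x - f x)\<^sup>2 \<partial>torus) - 0) < r"
      by (simp add: abs_of_nonneg integral_nonneg)
  qed
qed

text \<open>The situation along a subsequence whose energies stay below \<open>\<Lambda>\<close>.
  The bound \<open>R\<close> concerns the limit alone.\<close>

locale low_energy_limit =
  fixes e :: "nat \<Rightarrow> real" and wn g h :: "nat \<Rightarrow> real \<times> real \<Rightarrow> real" and w :: "real \<times> real \<Rightarrow> real" and \<Lambda> R :: real
  assumes defect: "\<And>n. burgers_defect (wn n) (g n) (h n)"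
    and e_pos: "\<And>n. e n > 0" and e_lim: "e \<longlonglongrightarrow> 0"
    and energy_le: "\<And>n. 1/2 * (\<integral>x. 1/e n * (g n x)\<^sup>2 + e n * (h n x)\<^sup>2 \<partial>torus) \<le> \<Lambda>"
    and wn_lim: "tendsto_Lp_torus 3 wn w"
    and w_bound: "AE x in torus. \<bar>w x\<bar> \<le> R" and R_nonneg: "R \<ge> 0"
begin

lemma \<Lambda>_nonneg: "\<Lambda> \<ge> 0"
proof -
  have "0 \<le> (\<integral>x. 1/e 0 * (g 0 x)\<^sup>2 + e 0 * (h 0 x)\<^sup>2 \<partial>torus)"
    using e_pos[of 0] by (intro integral_nonneg_AE AE_I2) auto
  then show ?thesis using energy_le[of 0] by linarith
qed

text \<open>The weight \<open>1/e n\<close> forces \<open>g n\<close> to zero in L^2; this is what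
  removes the term with \<open>\<phi>1\<close>.\<close>

lemma g_le: "(\<integral>x. (g n x)\<^sup>2 \<partial>torus) \<le> 2 * e n * \<Lambda>"
proof -
  interpret burgers_defect "wn n" "g n" "h n" by (rule defect)
  have "(\<integral>x. 1/e n * (g n x)\<^sup>2 + e n * (h n x)\<^sup>2 \<partial>torus) = 1/e n * (\<integral>x. (g n x)\<^sup>2 \<partial>torus) + e n * (\<integral>x. (h n x)\<^sup>2 \<partial>torus)"
    using g2i h2i by simp
  moreover have "0 \<le> e n * (\<integral>x. (h n x)\<^sup>2 \<partial>torus)" using e_pos[of n] by (simp add: integral_nonneg)
  ultimately have "1/e n * (\<integral>x. (g n x)\<^sup>2 \<partial>torus) \<le> 2 * \<Lambda>" using energy_le[of n] by linarith
  then show ?thesis using e_pos[of n] by (simp add: field_simps)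
qed

lemma w_props: "periodic w" "w \<in> borel_measurable torus" "Lp_torus 2 w" "Lp_torus 2 (wn n)"
  using wn_lim Lp3_imp_Lp2 by (auto simp: tendsto_Lp_torus_def Lp_torus_def)

lemma square_integrable_sq:
  assumes "Lp_torus 2 f" "0 \<le> s" "s \<le> 1"
  shows "f \<in> borel_measurable (lebesgue_on (sq s))" "integrable (lebesgue_on (sq s)) (\<lambda>x. (f x)\<^sup>2)"
proof -
  have per: "periodic f" and m: "f \<in> borel_measurable torus"
    using assms by (auto simp: Lp_torus_def)
  show "f \<in> borel_measurable (lebesgue_on (sq s))"
    by (rule measurable_restrict_space1[OF periodic_borel_measurable_lebesgue[OF per m]])
  show "integrable (lebesgue_on (sq s)) (\<lambda>x. (f x)\<^sup>2)"
    using per by (intro periodic_integral_sq(1) Lp2_square assms) (simp_all add: periodic_def)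
qed

text \<open>The order of limits matters: for fixed \<open>d\<close> the index \<open>n\<close> goes
  to infinity, which kills \<open>2 * e n * \<Lambda> / d\<close>, and only then is \<open>d\<close>
  made small.\<close>

lemma limit_flux_le:
  assumes "entropy_cutoff q q' q'' Q M L s \<phi> \<phi>1 \<phi>2"
  shows "\<bar>entropy_cutoff.flux q Q s \<phi>1 \<phi>2 w\<bar> \<le> L * \<Lambda>"
proof -
  interpret entropy_cutoff q q' q'' Q M L s \<phi> \<phi>1 \<phi>2 by (rule assms)
  obtain B where B: "B \<ge> 0" "\<And>x. x \<in> sq s \<Longrightarrow> \<bar>\<phi>1 x\<bar> \<le> B"
    using bounded_on_D[OF phi_cont(2)] by (metis space_lebesgue_on)
  have fl: "\<bar>flux (wn n)\<bar> \<le> L * \<Lambda> + M * B * (d + 2 * e n * \<Lambda> / d)" if "d > 0" for n d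
  proof -
    interpret burgers_defect "wn n" "g n" "h n" by (rule defect)
    interpret burgers_entropy "wn n" "g n" "h n" q q' q'' Q M L s \<phi> \<phi>1 \<phi>2 ..
    have "L * (1/2 * (\<integral>x. 1/e n * (g n x)\<^sup>2 + e n * (h n x)\<^sup>2 \<partial>torus)) \<le> L * \<Lambda>"
      by (rule mult_left_mono[OF energy_le L_nonneg])
    moreover have "M * B * (d + (\<integral>x. (g n x)\<^sup>2 \<partial>torus) / d) \<le> M * B * (d + 2 * e n * \<Lambda> / d)"
      using g_le[of n] M_nonneg B that by (intro mult_left_mono add_left_mono divide_right_mono) auto
    ultimately show ?thesis
      using flux_le[OF e_pos[of n] that B(2)] by linarith
  qed
  have eqD: "(\<integral>x. (wn n x - w x)\<^sup>2 \<partial>lebesgue_on (sq s)) = (\<integral>x. (wn n x - w x)\<^sup>2 \<partial>torus)" for n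
  proof (rule periodic_integral_sq(2))
    show "periodic (\<lambda>x. (wn n x - w x)\<^sup>2)"
      using w_props(1) w_props(4)[of n] by (simp add: periodic_def Lp_torus_def)
    show "integrable torus (\<lambda>x. (wn n x - w x)\<^sup>2)"
      using w_props w_props(4)[of n] by (intro integrable_diff_square Lp2_square) (simp_all add: Lp_torus_def)
  qed (use s in auto)
  have "(\<lambda>n. \<integral>x. (wn n x - w x)\<^sup>2 \<partial>lebesgue_on (sq s)) \<longlonglongrightarrow> 0"
    unfolding eqD by (rule tendsto_Lp3_imp_L2[OF wn_lim])
  then have lim: "(\<lambda>n. \<bar>flux (wn n)\<bar>) \<longlonglongrightarrow> \<bar>flux w\<bar>"
    by (intro tendsto_rabs flux_tendsto square_integrable_sq w_props s)
  have le: "\<bar>flux w\<bar> \<le> L * \<Lambda> + M * B * d" if "d > 0" for d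
  proof -
    have "(\<lambda>n. L * \<Lambda> + M * B * (d + 2 * e n * \<Lambda> / d)) \<longlonglongrightarrow> L * \<Lambda> + M * B * (d + 2 * 0 * \<Lambda> / d)"
      using that by (intro tendsto_intros e_lim) auto
    then have "\<bar>flux w\<bar> \<le> L * \<Lambda> + M * B * (d + 2 * 0 * \<Lambda> / d)"
      by (rule LIMSEQ_le[OF lim]) (use fl[OF that] in blast)
    then show ?thesis by simp
  qed
  have MB: "M * B \<ge> 0" using M_nonneg B by simp
  show ?thesis
  proof (rule field_le_epsilon)
    fix r :: real assume "r > 0"
    then have "\<bar>flux w\<bar> \<le> L * \<Lambda> + M * B * (r / (M * B + 1))"
      using MB by (intro le) (simp add: add_nonneg_pos)
    also have "M * B * (r / (M * B + 1)) \<le> r"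
      using MB \<open>r > 0\<close> by (simp add: field_simps)
    finally show "\<bar>flux w\<bar> \<le> L * \<Lambda> + r" by simp
  qed
qed

text \<open>For the linear entropy the second derivative vanishes, so \<open>L = 0\<close> and the
  energy bound degenerates to an identity.\<close>

lemma limit_burgers:
  assumes "cutoff s \<phi> \<phi>1 \<phi>2"
  shows "(\<integral>x. w x * \<phi>2 x - (w x)\<^sup>2 / 2 * \<phi>1 x \<partial>lebesgue_on (sq s)) = 0"
proof -
  have ent: "entropy (\<lambda>t. t) (\<lambda>t. 1) (\<lambda>t. 0) (\<lambda>t. t\<^sup>2 / 2) 1 0"
    by unfold_locales (auto intro!: derivative_eq_intros)
  have ec: "entropy_cutoff (\<lambda>t. t) (\<lambda>t. 1) (\<lambda>t. 0) (\<lambda>t. t\<^sup>2 / 2) 1 0 s \<phi> \<phi>1 \<phi>2"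
    by (rule entropy_cutoff.intro[OF ent assms])
  show ?thesis
    using limit_flux_le[OF ec] by (simp add: entropy_cutoff.flux_def[OF ec])
qed

text \<open>The truncated entropy is used along the sequence; almost every value of the limit lies
  in \<open>[-R, R]\<close>, where truncation changes nothing, and \<open>L = 1\<close> leaves the
  bound \<open>\<Lambda>\<close> sharp.\<close>

lemma limit_entropy_le:
  assumes "cutoff s \<phi> \<phi>1 \<phi>2"
  shows "\<bar>\<integral>x. (w x)\<^sup>2 / 2 * \<phi>2 x - (w x) ^ 3 / 3 * \<phi>1 x \<partial>lebesgue_on (sq s)\<bar> \<le> \<Lambda>"
proof -
  interpret cutoff s \<phi> \<phi>1 \<phi>2 by (rule assms)
  obtain q q' q'' Q where ent: "entropy q q' q'' Q (R + 1) 1"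
    and qR: "\<And>t. \<bar>t\<bar> \<le> R \<Longrightarrow> q t = t\<^sup>2 / 2" and QR: "\<And>t. \<bar>t\<bar> \<le> R \<Longrightarrow> Q t = t ^ 3 / 3"
    using ex_truncated_entropy[OF R_nonneg] by blast
  have ec: "entropy_cutoff q q' q'' Q (R + 1) 1 s \<phi> \<phi>1 \<phi>2"
    by (rule entropy_cutoff.intro[OF ent assms])
  interpret entropy_cutoff q q' q'' Q "R + 1" 1 s \<phi> \<phi>1 \<phi>2 by (rule ec)
  have ae: "AE x in lebesgue_on (sq s). \<bar>w x\<bar> \<le> R"
    by (rule AE_periodic_sq[OF w_props(1,2) w_bound s])
  have [measurable]: "w \<in> borel_measurable (lebesgue_on (sq s))" "\<phi>1 \<in> borel_measurable (lebesgue_on (sq s))" 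
    "\<phi>2 \<in> borel_measurable (lebesgue_on (sq s))" "q \<in> borel_measurable borel" "Q \<in> borel_measurable borel"
    by (intro square_integrable_sq w_props s meas_D phi_cont borel_measurable_continuous_onI entropy_cont)+
  have "flux w = (\<integral>x. (w x)\<^sup>2 / 2 * \<phi>2 x - (w x) ^ 3 / 3 * \<phi>1 x \<partial>lebesgue_on (sq s))"
    unfolding flux_def
  proof (rule integral_cong_AE)
    show "AE x in lebesgue_on (sq s). q (w x) * \<phi>2 x - Q (w x) * \<phi>1 x = (w x)\<^sup>2 / 2 * \<phi>2 x - (w x) ^ 3 / 3 * \<phi>1 x"
      using ae by eventually_elim (simp add: qR QR)
  qed measurable
  then show ?thesis using limit_flux_le[OF ec] by simp
qed

end

section \<open>Blow-up at jump points\<close>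

text \<open>Recognised as an antiderivative of the continuous function \<open>2 * max 0 t\<close>,
  which settles the point 0 together with all others.\<close>

lemma DERIV_max0_square: "((\<lambda>t. (max 0 t)\<^sup>2) has_real_derivative 2 * max 0 t) (at (t :: real))"
proof -
  have "continuous_on UNIV (\<lambda>t :: real. 2 * max 0 t)" by (intro continuous_intros)
  then obtain F where F: "\<And>t. (F has_real_derivative 2 * max 0 t) (at t)" "F 0 = 0"
    using ex_antiderivative by blast
  have "F u = u\<^sup>2" if "u \<in> {0..}" for u
    by (rule antiderivative_eq_on[where f="\<lambda>t. 2 * max 0 t" and a=0, OF F(1) _ _ _ _ that])
      (use F in \<open>auto intro!: derivative_eq_intros\<close>)
  moreover have "F u = 0" if "u \<in> {..0}" for u
    by (rule antiderivative_eq_on[where f="\<lambda>t. 2 * max 0 t" and a=0, OF F(1) _ _ _ _ that])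
      (use F in \<open>auto intro!: derivative_eq_intros\<close>)
  ultimately have "F u = (max 0 u)\<^sup>2" for u by (cases "u \<ge> 0") auto
  then have "F = (\<lambda>t. (max 0 t)\<^sup>2)" by blast
  with F(1)[of t] show ?thesis by simp
qed

text \<open>A radial profile in the squared relative distance \<open>s\<close>. The square makes it
  continuously differentiable at \<open>s = 1\<close>, and as \<open>m\<close> grows it increases to
  1 for \<open>0 \<le> s < 1\<close>, so the bumps approach indicators of balls.\<close>

definition chi :: "nat \<Rightarrow> real \<Rightarrow> real" where
  "chi m s = (max 0 (1 - s ^ Suc m))\<^sup>2"

definition chi' :: "nat \<Rightarrow> real \<Rightarrow> real" where
  "chi' m s = 2 * max 0 (1 - s ^ Suc m) * (- (real (Suc m) * s ^ m))"

lemma chi_deriv: "(chi m has_real_derivative chi' m s) (at s)"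
proof -
  have "((\<lambda>s. 1 - s ^ Suc m) has_real_derivative - (real (Suc m) * s ^ m)) (at s)"
    by (auto intro!: derivative_eq_intros simp del: power_Suc)
  from DERIV_chain2[OF DERIV_max0_square this]
  show ?thesis by (simp add: chi_def[abs_def] chi'_def)
qed

lemma chi_bounds: "0 \<le> chi m s" "0 \<le> s \<Longrightarrow> chi m s \<le> 1" "1 \<le> s \<Longrightarrow> chi m s = 0" "1 \<le> s \<Longrightarrow> chi' m s = 0"
proof -
  show "0 \<le> chi m s" by (simp add: chi_def)
  show "chi m s \<le> 1" if "0 \<le> s"
    unfolding chi_def by (rule power_le_one) (use that in \<open>auto simp del: power_Suc\<close>)
  have "max 0 (1 - s ^ Suc m) = 0" if "1 \<le> s"
    using one_le_power[OF that, of "Suc m"] by (simp only: max_absorb1 diff_le_0_iff_le)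
  then show "chi m s = 0" "chi' m s = 0" if "1 \<le> s"
    using that by (simp_all only: chi_def chi'_def) simp_all
qed

lemma abs_chi'_le: "0 \<le> s \<Longrightarrow> s \<le> 1 \<Longrightarrow> \<bar>chi' m s\<bar> \<le> 2 * real (Suc m)"
proof -
  assume s: "0 \<le> s" "s \<le> 1"
  have "max 0 (1 - s ^ Suc m) \<le> 1" using s by (simp del: power_Suc)
  moreover have "real (Suc m) * s ^ m \<le> real (Suc m) * 1"
    using s by (intro mult_left_mono power_le_one) auto
  moreover have eq: "\<bar>chi' m s\<bar> = 2 * (max 0 (1 - s ^ Suc m) * (real (Suc m) * s ^ m))"
    using s by (simp add: chi'_def abs_mult del: power_Suc)
  ultimately have "max 0 (1 - s ^ Suc m) * (real (Suc m) * s ^ m) \<le> 1 * (real (Suc m) * 1)"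
    using s by (intro mult_mono[of "max 0 _"]) auto
  then show ?thesis
    unfolding eq by linarith
qed

lemma continuous_on_chi: "continuous_on S (chi m)" "continuous_on S (chi' m)"
  unfolding chi_def[abs_def] chi'_def[abs_def] by (intro continuous_intros)+

definition rsq :: "real \<Rightarrow> real \<times> real \<Rightarrow> real \<times> real \<Rightarrow> real" where
  "rsq r x y = ((fst y - fst x)\<^sup>2 + (snd y - snd x)\<^sup>2) / r\<^sup>2"

definition bump :: "nat \<Rightarrow> real \<Rightarrow> real \<times> real \<Rightarrow> real \<times> real \<Rightarrow> real" where
  "bump m r x y = chi m (rsq r x y)"

definition bump1 :: "nat \<Rightarrow> real \<Rightarrow> real \<times> real \<Rightarrow> real \<times> real \<Rightarrow> real" where
  "bump1 m r x y = chi' m (rsq r x y) * (2 * (fst y - fst x) / r\<^sup>2)"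

definition bump2 :: "nat \<Rightarrow> real \<Rightarrow> real \<times> real \<Rightarrow> real \<times> real \<Rightarrow> real" where
  "bump2 m r x y = chi' m (rsq r x y) * (2 * (snd y - snd x) / r\<^sup>2)"

lemma rsq_dist: "rsq r x y = (dist x y)\<^sup>2 / r\<^sup>2"
  by (simp add: rsq_def dist_prod_def dist_real_def power2_commute)

lemma rsq_ge_1: "r > 0 \<Longrightarrow> y \<notin> ball x r \<Longrightarrow> rsq r x y \<ge> 1"
  unfolding rsq_dist by (simp add: power_mono)

lemma rsq_le_1: "r > 0 \<Longrightarrow> y \<in> ball x r \<Longrightarrow> rsq r x y \<le> 1"
  unfolding rsq_dist by (simp add: power_mono)

lemma rsq_nonneg: "rsq r x y \<ge> 0"
  by (simp add: rsq_def)

lemma bump_nonneg: "0 \<le> bump m r x y" and bump_le_1: "bump m r x y \<le> 1"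
  by (simp_all add: bump_def chi_bounds rsq_nonneg)

lemma bump_eq_0:
  assumes "r > 0" "y \<notin> ball x r"
  shows "bump m r x y = 0" "bump1 m r x y = 0" "bump2 m r x y = 0"
  using rsq_ge_1[OF assms] by (simp_all add: bump_def bump1_def bump2_def chi_bounds)

lemma continuous_on_bump [continuous_intros]:
  "continuous_on S (bump m r x)" "continuous_on S (bump1 m r x)" "continuous_on S (bump2 m r x)"
  unfolding bump_def[abs_def] bump1_def[abs_def] bump2_def[abs_def] rsq_def divide_inverse
  by (intro continuous_intros continuous_on_compose2[OF continuous_on_chi(1)[of UNIV]]
      continuous_on_compose2[OF continuous_on_chi(2)[of UNIV]]; simp)+

lemma bump_has_derivative:
  "(bump m r x has_derivative (\<lambda>d. fst d * bump1 m r x y + snd d * bump2 m r x y)) (at y)"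
proof -
  have "(rsq r x has_derivative (\<lambda>d. (2 * (fst y - fst x) * fst d + 2 * (snd y - snd x) * snd d) / r\<^sup>2)) (at y)"
    unfolding rsq_def[abs_def] divide_inverse by (auto intro!: derivative_eq_intros simp: algebra_simps)
  from has_derivative_compose[OF this chi_deriv[unfolded has_field_derivative_def]]
  show ?thesis
    unfolding bump_def[abs_def]
    by (rule has_derivative_eq_rhs)
      (auto simp: bump1_def bump2_def add_divide_distrib diff_divide_distrib algebra_simps)
qed

lemma bump_deriv1: "((\<lambda>t. bump m r x (t, b)) has_real_derivative bump1 m r x (a, b)) (at a)"
proof -
  have "((\<lambda>t. (t, b)) has_derivative (\<lambda>h. (h, 0))) (at a)" by (auto intro!: derivative_eq_intros)
  from has_derivative_compose[OF this bump_has_derivative] show ?thesis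
    unfolding has_field_derivative_def by (rule has_derivative_eq_rhs) (auto simp: mult.commute)
qed

lemma bump_deriv2: "((\<lambda>t. bump m r x (a, t)) has_real_derivative bump2 m r x (a, b)) (at b)"
proof -
  have "((\<lambda>t. (a, t)) has_derivative (\<lambda>h. (0, h))) (at b)" by (auto intro!: derivative_eq_intros)
  from has_derivative_compose[OF this bump_has_derivative] show ?thesis
    unfolding has_field_derivative_def by (rule has_derivative_eq_rhs) (auto simp: mult.commute)
qed

text \<open>The derivative along the line \<open>y\<^sub>1 + c y\<^sub>2 = u\<close>. Its integral
  over each such line vanishes by compact support, which ties the half plane integrals of
  \<open>bump2\<close> to those of \<open>bump1\<close>.\<close>

lemma bump_deriv_slanted:
  "((\<lambda>t. bump m r x (u - c * t, t)) has_real_derivative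
     bump2 m r x (u - c * t, t) - c * bump1 m r x (u - c * t, t)) (at t)"
proof -
  have "((\<lambda>t. (u - c * t, t)) has_derivative (\<lambda>h. (- (c * h), h))) (at t)" by (auto intro!: derivative_eq_intros)
  from has_derivative_compose[OF this bump_has_derivative[of m r x]] show ?thesis
    unfolding has_field_derivative_def by (rule has_derivative_eq_rhs) (auto simp: algebra_simps)
qed

text \<open>Order \<open>1/r\<close> is what the blow-up can afford: the L^1 error of the trace
  values on a ball of radius \<open>r\<close> is \<open>o(r^2)\<close>, which leaves
  \<open>o(r)\<close>.\<close>

lemma abs_bump_deriv_le:
  assumes "r > 0"
  shows "\<bar>bump1 m r x y\<bar> \<le> 4 * real (Suc m) / r" "\<bar>bump2 m r x y\<bar> \<le> 4 * real (Suc m) / r"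
proof -
  have main: "\<bar>chi' m (rsq r x y) * (2 * d / r\<^sup>2)\<bar> \<le> 4 * real (Suc m) / r" if d: "\<bar>d\<bar> \<le> dist x y" for d
  proof (cases "y \<in> ball x r")
    case True
    have "\<bar>chi' m (rsq r x y)\<bar> \<le> 2 * real (Suc m)"
      by (intro abs_chi'_le rsq_nonneg rsq_le_1 assms True)
    moreover have "\<bar>2 * d / r\<^sup>2\<bar> \<le> 2 / r"
    proof -
      have "\<bar>d\<bar> \<le> r" using d True by simp
      then have "\<bar>2 * d / r\<^sup>2\<bar> \<le> 2 * r / r\<^sup>2"
        using assms by (simp add: abs_mult divide_right_mono)
      then show ?thesis using assms by (simp add: power2_eq_square)
    qed
    ultimately have "\<bar>chi' m (rsq r x y)\<bar> * \<bar>2 * d / r\<^sup>2\<bar> \<le> (2 * real (Suc m)) * (2 / r)"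
      by (intro mult_mono) auto
    then show ?thesis by (simp add: abs_mult)
  next
    case False
    then show ?thesis using rsq_ge_1[OF assms False] assms by (simp add: chi_bounds)
  qed
  have "\<bar>fst y - fst x\<bar> \<le> dist x y" "\<bar>snd y - snd x\<bar> \<le> dist x y"
    using dist_fst_le[of y x] dist_snd_le[of y x] by (simp_all add: dist_real_def dist_commute)
  then show "\<bar>bump1 m r x y\<bar> \<le> 4 * real (Suc m) / r" "\<bar>bump2 m r x y\<bar> \<le> 4 * real (Suc m) / r"
    unfolding bump1_def bump2_def by (intro main; simp)+
qed

section \<open>Integrals of bump derivatives over half planes\<close>

lemma integrable_lborel_compact_support:
  fixes f :: "'a::euclidean_space \<Rightarrow> real"
  assumes "continuous_on UNIV f" "\<And>z. z \<notin> cbox a b \<Longrightarrow> f z = 0"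
  shows "integrable lborel f"
proof -
  have "integrable lborel (\<lambda>z. indicator (cbox a b) z *\<^sub>R f z)"
    using borel_integrable_compact[OF compact_cbox[of a b] continuous_on_subset[OF assms(1)]]
    by (simp add: indicator_scaleR_eq_if)
  also have "(\<lambda>z. indicator (cbox a b) z *\<^sub>R f z) = f"
  proof
    fix z
    show "indicator (cbox a b) z *\<^sub>R f z = f z" by (cases "z \<in> cbox a b") (use assms(2) in auto)
  qed
  finally show ?thesis .
qed

lemma bump_supp_box:
  assumes "r > 0"
  obtains A where "A > 0" "\<And>u v. bump m r x (u, v) \<noteq> 0 \<or> bump1 m r x (u, v) \<noteq> 0 \<or> bump2 m r x (u, v) \<noteq> 0 \<Longrightarrow> \<bar>u\<bar> < A \<and> \<bar>v\<bar> < A"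
proof -
  have *: "\<bar>u\<bar> < norm x + r \<and> \<bar>v\<bar> < norm x + r" if "(u, v) \<in> ball x r" for u v
  proof -
    have "norm (u, v) \<le> norm x + dist x (u, v)"
      by (metis dist_commute dist_norm norm_triangle_sub)
    then have "norm (u, v) < norm x + r" using that by simp
    then show ?thesis using norm_fst_le[of u v] norm_snd_le[of v u] by auto
  qed
  show ?thesis
  proof (intro that[of "norm x + r"])
    fix u v assume nz: "bump m r x (u, v) \<noteq> 0 \<or> bump1 m r x (u, v) \<noteq> 0 \<or> bump2 m r x (u, v) \<noteq> 0"
    have "(u, v) \<in> ball x r"
    proof (rule ccontr)
      assume "(u, v) \<notin> ball x r"
      from bump_eq_0[OF assms this] nz show False by auto
    qed
    then show "\<bar>u\<bar> < norm x + r \<and> \<bar>v\<bar> < norm x + r" by (rule *)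
  qed (use assms in \<open>simp add: add_nonneg_pos\<close>)
qed

text \<open>Integrals over a half plane bounded by the slanted line \<open>y\<^sub>1 + c y\<^sub>2 = k\<close>; the shear
  \<open>(u, t) \<mapsto> (u - c t, t)\<close> turns it into a vertical one.\<close>

definition half_plane :: "real \<Rightarrow> real \<Rightarrow> (real \<times> real) set" where
  "half_plane c k = {y. k \<le> fst y + c * snd y}"

lemma half_plane_borel [measurable]: "half_plane c k \<in> sets borel"
  unfolding half_plane_def by (intro borel_closed closed_Collect_le continuous_intros)

text \<open>After the shear the half plane constrains \<open>u\<close> only. The second part permits
  the order of integration to be exchanged when the derivative is along the boundary line.\<close>

lemma integral_half_plane_shear:
  fixes f :: "real \<times> real \<Rightarrow> real"
  assumes f: "continuous_on UNIV f" and A: "\<And>u v. f (u, v) \<noteq> 0 \<Longrightarrow> \<bar>u\<bar> < A \<and> \<bar>v\<bar> < A"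
  shows "(\<integral>y. indicator (half_plane c k) y * f y \<partial>lborel) =
      (\<integral>t. (\<integral>u. indicator {k..} u * f (u - c * t, t) \<partial>lborel) \<partial>lborel)"
    and "integrable (lborel \<Otimes>\<^sub>M lborel) (\<lambda>(u, t). indicator {k..} u * f (u - c * t, t))"
proof -
  have [measurable]: "f \<in> borel_measurable borel" by (rule borel_measurable_continuous_onI[OF f])
  have f0: "f z = 0" if "z \<notin> cbox (-A, -A) (A, A)" for z
    using that A[of "fst z" "snd z"] by (cases z) (force simp: cbox_Pair_eq)
  have "integrable lborel f" by (rule integrable_lborel_compact_support[OF f f0])
  then have "integrable lborel (\<lambda>y. indicator (half_plane c k) y * f y)"
    by (rule Bochner_Integration.integrable_bound) (auto simp: indicator_def)
  moreover have e: "(\<lambda>(u, t). indicator (half_plane c k) (u, t) * f (u, t)) = (\<lambda>y. indicator (half_plane c k) y * f y)"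
    by auto
  ultimately have i: "integrable (lborel \<Otimes>\<^sub>M lborel) (\<lambda>(u, t). indicator (half_plane c k) (u, t) * f (u, t))"
    unfolding lborel_prod by (simp only:)
  have "(\<integral>y. indicator (half_plane c k) y * f y \<partial>lborel) =
      (\<integral>t. (\<integral>u. indicator (half_plane c k) (u, t) * f (u, t) \<partial>lborel) \<partial>lborel)"
    using lborel_pair.integral_snd[OF i] unfolding lborel_prod e by (simp only:)
  also have "\<dots> = (\<integral>t. (\<integral>u. indicator {k..} u * f (u - c * t, t) \<partial>lborel) \<partial>lborel)"
  proof (rule Bochner_Integration.integral_cong[OF refl])
    fix t
    have "(\<integral>u. indicator (half_plane c k) (u, t) * f (u, t) \<partial>lborel) =
      (\<integral>u. indicator (half_plane c k) (- (c * t) + 1 * u, t) * f (- (c * t) + 1 * u, t) \<partial>lborel)"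
      by (subst lborel_integral_real_affine[where c=1 and t="- (c * t)"]) auto
    then show "(\<integral>u. indicator (half_plane c k) (u, t) * f (u, t) \<partial>lborel) =
      (\<integral>u. indicator {k..} u * f (u - c * t, t) \<partial>lborel)"
      by (simp add: half_plane_def indicator_def)
  qed
  finally show "(\<integral>y. indicator (half_plane c k) y * f y \<partial>lborel) =
      (\<integral>t. (\<integral>u. indicator {k..} u * f (u - c * t, t) \<partial>lborel) \<partial>lborel)" .
  \<comment> \<open>On the support \<open>|u| \<le> |u - c * t| + |c * t|\<close>, which is less
    than \<open>A + |c| * A\<close> as soon as both coordinates of the argument are below
    \<open>A\<close>.\<close>
  let ?B = "A + \<bar>c\<bar> * A"
  have cs: "continuous_on UNIV (\<lambda>z. f (fst z - c * snd z, snd z))"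
    by (intro continuous_on_compose2[OF f] continuous_intros) auto
  have "integrable lborel (\<lambda>z. f (fst z - c * snd z, snd z))"
  proof (rule integrable_lborel_compact_support[OF cs, of "(- ?B, - A)" "(?B, A)"])
    fix z :: "real \<times> real" assume z: "z \<notin> cbox (- ?B, - A) (?B, A)"
    show "f (fst z - c * snd z, snd z) = 0"
    proof (rule ccontr)
      assume "f (fst z - c * snd z, snd z) \<noteq> 0"
      then have b: "\<bar>fst z - c * snd z\<bar> < A" "\<bar>snd z\<bar> < A" using A by blast+
      then have "\<bar>c * snd z\<bar> \<le> \<bar>c\<bar> * A" by (simp add: abs_mult mult_left_mono)
      with b z show False by (cases z) (auto simp: cbox_Pair_eq abs_le_iff)
    qed
  qed
  then have "integrable lborel (\<lambda>z. indicator {k..} (fst z) * f (fst z - c * snd z, snd z))"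
  proof (rule Bochner_Integration.integrable_bound)
    have "(\<lambda>z. f (fst z - c * snd z, snd z)) \<in> borel_measurable borel"
      by (rule borel_measurable_continuous_onI[OF cs])
    moreover have "(\<lambda>z :: real \<times> real. indicator {k..} (fst z) :: real) \<in> borel_measurable borel"
      unfolding borel_prod[symmetric] by measurable
    ultimately show "(\<lambda>z. indicator {k..} (fst z) * f (fst z - c * snd z, snd z)) \<in> borel_measurable lborel"
      by simp
  qed (auto simp: indicator_def)
  then show "integrable (lborel \<Otimes>\<^sub>M lborel) (\<lambda>(u, t). indicator {k..} u * f (u - c * t, t))"
    unfolding lborel_prod by (simp add: case_prod_unfold)
qed

lemma integral_half_line_FTC:
  fixes F f :: "real \<Rightarrow> real"
  assumes "\<And>u. (F has_real_derivative f u) (at u)" "continuous_on UNIV f"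
    and "\<And>u. u \<ge> A \<Longrightarrow> F u = 0 \<and> f u = 0"
  shows "(\<integral>u. indicator {k..} u * f u \<partial>lborel) = - F k"
proof -
  let ?b = "max k A"
  have "(\<integral>u. indicator {k..} u * f u \<partial>lborel) = (\<integral>u. f u * indicator {k..?b} u \<partial>lborel)"
    using assms(3) by (intro Bochner_Integration.integral_cong) (auto simp: indicator_def)
  also have "\<dots> = F ?b - F k"
  proof (rule integral_FTC_Icc_real)
    show "isCont f x" for x using assms(2) by (simp add: continuous_on_eq_continuous_at)
  qed (use assms in auto)
  also have "F ?b = 0" using assms(3) by simp
  finally show ?thesis by simp
qed

lemma integral_line_FTC:
  fixes F f :: "real \<Rightarrow> real"
  assumes "\<And>u. (F has_real_derivative f u) (at u)" "continuous_on UNIV f" "A > 0"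
    and "\<And>u. \<bar>u\<bar> \<ge> A \<Longrightarrow> F u = 0 \<and> f u = 0"
  shows "(\<integral>u. f u \<partial>lborel) = 0"
proof -
  have "(\<integral>u. f u \<partial>lborel) = (\<integral>u. indicator {-A..} u * f u \<partial>lborel)"
    using assms(3,4) by (intro Bochner_Integration.integral_cong) (auto simp: indicator_def)
  also have "\<dots> = - F (-A)"
    by (rule integral_half_line_FTC[where A=A]) (use assms in auto)
  also have "\<dots> = 0" using assms(3) assms(4)[of "-A"] by simp
  finally show ?thesis .
qed

text \<open>The integral along the tangent line with respect to the second coordinate; arc length
  would add the factor \<open>sqrt (1 + c\<^sup>2)\<close>.\<close>

definition line_int :: "nat \<Rightarrow> real \<Rightarrow> real \<times> real \<Rightarrow> real \<Rightarrow> real" where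
  "line_int m r x c = (\<integral>t. bump m r x (fst x + c * snd x - c * t, t) \<partial>lborel)"

text \<open>In sheared coordinates the inner integral runs over a half line in the direction of the
  derivative, and only the value on the boundary line remains.\<close>

lemma bump1_half_plane:
  assumes r: "r > 0"
  shows "(\<integral>y. indicator (half_plane c (fst x + c * snd x)) y * bump1 m r x y \<partial>lborel) = - line_int m r x c"
proof -
  obtain A where A: "A > 0" "\<And>u v. bump m r x (u, v) \<noteq> 0 \<or> bump1 m r x (u, v) \<noteq> 0 \<or> bump2 m r x (u, v) \<noteq> 0 \<Longrightarrow> \<bar>u\<bar> < A \<and> \<bar>v\<bar> < A"
    using bump_supp_box[OF r] by metis
  let ?k = "fst x + c * snd x"
  have "(\<integral>u. indicator {?k..} u * bump1 m r x (u - c * t, t) \<partial>lborel) = - bump m r x (?k - c * t, t)" for t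
  proof (rule integral_half_line_FTC[where A="A + c * t"])
    show "((\<lambda>u. bump m r x (u - c * t, t)) has_real_derivative bump1 m r x (u - c * t, t)) (at u)" for u
    proof -
      have "((\<lambda>u. u - c * t) has_real_derivative 1) (at u)" by (auto intro!: derivative_eq_intros)
      from DERIV_chain2[where f="\<lambda>a. bump m r x (a, t)", OF bump_deriv1 this] show ?thesis by simp
    qed
    show "continuous_on UNIV (\<lambda>u. bump1 m r x (u - c * t, t))"
      by (intro continuous_on_compose2[OF continuous_on_bump(2)[of UNIV]] continuous_intros) auto
    show "bump m r x (u - c * t, t) = 0 \<and> bump1 m r x (u - c * t, t) = 0" if "A + c * t \<le> u" for u
      using A(2)[of "u - c * t" t] that by force
  qed
  then show ?thesis
    by (subst integral_half_plane_shear(1)[where A=A]) (use A in \<open>auto simp: line_int_def intro: continuous_on_bump\<close>)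
qed

text \<open>\<open>bump2 - c * bump1\<close> is a derivative parallel to the boundary of the half
  plane, so its integral vanishes and the claim reduces to \<open>bump1_half_plane\<close>.\<close>

lemma bump2_half_plane:
  assumes r: "r > 0"
  shows "(\<integral>y. indicator (half_plane c (fst x + c * snd x)) y * bump2 m r x y \<partial>lborel) = - c * line_int m r x c"
proof -
  obtain A where A: "A > 0" "\<And>u v. bump m r x (u, v) \<noteq> 0 \<or> bump1 m r x (u, v) \<noteq> 0 \<or> bump2 m r x (u, v) \<noteq> 0 \<Longrightarrow> \<bar>u\<bar> < A \<and> \<bar>v\<bar> < A"
    using bump_supp_box[OF r] by metis
  let ?k = "fst x + c * snd x"
  let ?f = "\<lambda>y. bump2 m r x y - c * bump1 m r x y"
  have cf: "continuous_on UNIV ?f" by (intro continuous_intros)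
  have Af: "\<bar>u\<bar> < A \<and> \<bar>v\<bar> < A" if "?f (u, v) \<noteq> 0" for u v by (rule A(2)) (use that in auto)
  have "(\<integral>t. ?f (u - c * t, t) \<partial>lborel) = 0" for u
  proof (rule integral_line_FTC[OF bump_deriv_slanted _ \<open>A > 0\<close>])
    show "continuous_on UNIV (\<lambda>t. ?f (u - c * t, t))"
      by (intro continuous_on_compose2[OF cf] continuous_intros) auto
    show "bump m r x (u - c * t, t) = 0 \<and> ?f (u - c * t, t) = 0" if "A \<le> \<bar>t\<bar>" for t
      using A(2)[of "u - c * t" t] that by force
  qed
  then have "(\<integral>u. (\<integral>t. indicator {?k..} u * ?f (u - c * t, t) \<partial>lborel) \<partial>lborel) = 0"
    by simp
  moreover have "(\<integral>y. indicator (half_plane c ?k) y * ?f y \<partial>lborel) =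
      (\<integral>t. (\<integral>u. indicator {?k..} u * ?f (u - c * t, t) \<partial>lborel) \<partial>lborel)"
    by (rule integral_half_plane_shear(1)[OF cf Af])
  moreover have "\<dots> = (\<integral>u. (\<integral>t. indicator {?k..} u * ?f (u - c * t, t) \<partial>lborel) \<partial>lborel)"
    by (rule lborel_pair.Fubini_integral[OF integral_half_plane_shear(2)[OF cf Af]])
  ultimately have "(\<integral>y. indicator (half_plane c ?k) y * ?f y \<partial>lborel) = 0" by (simp only:)
  moreover have "integrable lborel (\<lambda>y. indicator (half_plane c ?k) y * b y)"
    if "b = bump1 m r x \<or> b = bump2 m r x" for b
  proof -
    have "integrable lborel b"
      using that A(2) by (intro integrable_lborel_compact_support[of _ "(-A, -A)" "(A, A)"])
        (auto simp: cbox_Pair_eq intro: continuous_on_bump, force+)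
    then show ?thesis
      using integrable_real_mult_indicator[of "half_plane c ?k" lborel b] by (simp add: mult.commute)
  qed
  ultimately show ?thesis
    using bump1_half_plane[OF r, of c x m] by (simp add: right_diff_distrib mult.left_commute)
qed

text \<open>The line meets the ball where the second coordinate is within \<open>\<tau>\<close> of
  \<open>snd x\<close>. There the bump is \<open>(1 - z)\<^sup>2\<close>, at least
  \<open>1 - 2 * z\<close>, with \<open>z = (t\<^sup>2/\<tau>\<^sup>2)^(m+1)\<close>. The integral
  of that lower bound is explicit and approaches the full length \<open>2 * \<tau>\<close> as
  \<open>m\<close> grows.\<close>

lemma line_int_ge:
  assumes r: "r > 0"
  shows "line_int m r x c \<ge> 2 * r / sqrt (1 + c\<^sup>2) * (1 - 2 / (2 * real m + 3))"
proof -
  define \<tau> where "\<tau> = r / sqrt (1 + c\<^sup>2)"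
  have pos: "1 + c\<^sup>2 > 0" by (simp add: add_pos_nonneg)
  then have \<tau>: "\<tau> > 0" "\<tau>\<^sup>2 = r\<^sup>2 / (1 + c\<^sup>2)" using r by (auto simp: \<tau>_def power_divide)
  obtain A where A: "A > 0" "\<And>u v. bump m r x (u, v) \<noteq> 0 \<or> bump1 m r x (u, v) \<noteq> 0 \<or> bump2 m r x (u, v) \<noteq> 0 \<Longrightarrow> \<bar>u\<bar> < A \<and> \<bar>v\<bar> < A"
    using bump_supp_box[OF r] by metis
  let ?b = "\<lambda>t. bump m r x (fst x + c * snd x - c * t, t)"
  let ?p = "\<lambda>t. 1 - 2 * (t\<^sup>2 / \<tau>\<^sup>2) ^ Suc m"
  have cb: "continuous_on UNIV ?b"
    by (intro continuous_on_compose2[OF continuous_on_bump(1)[of UNIV]] continuous_intros) auto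
  have ib: "integrable lborel ?b"
    by (rule integrable_lborel_compact_support[OF cb, of "-A" A]) (use A(2) in force)
  then have ib': "integrable lborel (\<lambda>t. ?b (snd x + 1 * t))"
    by (intro lborel_integrable_real_affine) auto
  have eq: "?b (snd x + t) = chi m (t\<^sup>2 / \<tau>\<^sup>2)" for t
  proof -
    have "rsq r x (fst x + c * snd x - c * (snd x + t), snd x + t) = ((c * t)\<^sup>2 + t\<^sup>2) / r\<^sup>2"
      by (simp add: rsq_def algebra_simps)
    also have "\<dots> = t\<^sup>2 / \<tau>\<^sup>2" unfolding \<tau>(2) by (simp add: power_mult_distrib algebra_simps)
    finally show ?thesis by (simp add: bump_def)
  qed
  have "(\<integral>t. ?p t * indicator {-\<tau>..\<tau>} t \<partial>lborel) =
    (\<tau> - 2 / (2 * real m + 3) * (\<tau> * (\<tau>\<^sup>2 / \<tau>\<^sup>2) ^ Suc m)) - (- \<tau> - 2 / (2 * real m + 3) * (- \<tau> * ((- \<tau>)\<^sup>2 / \<tau>\<^sup>2) ^ Suc m))"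
  proof (rule integral_FTC_Icc_real)
    show "((\<lambda>t. t - 2 / (2 * real m + 3) * (t * (t\<^sup>2 / \<tau>\<^sup>2) ^ Suc m)) has_real_derivative ?p t) (at t)" for t
    proof -
      have "((\<lambda>t. (t\<^sup>2 / \<tau>\<^sup>2) ^ Suc m) has_real_derivative real (Suc m) * (t\<^sup>2 / \<tau>\<^sup>2) ^ m * (2 * t / \<tau>\<^sup>2)) (at t)"
      proof -
        have "((\<lambda>t. t\<^sup>2 / \<tau>\<^sup>2) has_real_derivative 2 * t / \<tau>\<^sup>2) (at t)"
          by (rule DERIV_cdivide) (auto intro!: derivative_eq_intros)
        from DERIV_power[OF this, of "Suc m"] show ?thesis by (rule DERIV_cong) simp
      qed
      then have "((\<lambda>t. t - 2 / (2 * real m + 3) * (t * (t\<^sup>2 / \<tau>\<^sup>2) ^ Suc m)) has_real_derivative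
         1 - 2 / (2 * real m + 3) * (1 * (t\<^sup>2 / \<tau>\<^sup>2) ^ Suc m + real (Suc m) * (t\<^sup>2 / \<tau>\<^sup>2) ^ m * (2 * t / \<tau>\<^sup>2) * t)) (at t)"
        by (intro DERIV_diff DERIV_cmult DERIV_mult DERIV_ident)
      also have "1 - 2 / (2 * real m + 3) * (1 * (t\<^sup>2 / \<tau>\<^sup>2) ^ Suc m + real (Suc m) * (t\<^sup>2 / \<tau>\<^sup>2) ^ m * (2 * t / \<tau>\<^sup>2) * t) = ?p t"
      proof -
        have "1 * (t\<^sup>2 / \<tau>\<^sup>2) ^ Suc m + real (Suc m) * (t\<^sup>2 / \<tau>\<^sup>2) ^ m * (2 * t / \<tau>\<^sup>2) * t = (2 * real m + 3) * (t\<^sup>2 / \<tau>\<^sup>2) ^ Suc m"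
          by (simp add: power2_eq_square add_divide_distrib algebra_simps)
        then show ?thesis by simp
      qed
      finally show ?thesis .
    qed
    show "isCont ?p t" for t by (intro continuous_intros) (use \<tau> in auto)
  qed (use \<tau> in auto)
  also have "\<dots> = 2 * \<tau> * (1 - 2 / (2 * real m + 3))"
    using \<tau>(1) by (simp add: algebra_simps)
  finally have "2 * \<tau> * (1 - 2 / (2 * real m + 3)) = (\<integral>t. ?p t * indicator {-\<tau>..\<tau>} t \<partial>lborel)" by simp
  also have "\<dots> \<le> (\<integral>t. ?b (snd x + 1 * t) \<partial>lborel)"
  proof (rule integral_mono[OF _ ib'])
    have "integrable lborel (\<lambda>t. indicator {-\<tau>..\<tau>} t *\<^sub>R ?p t)"
    proof -
      have "continuous_on {-\<tau>..\<tau>} ?p" using \<tau>(1) by (intro continuous_intros) auto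
      from borel_integrable_atLeastAtMost'[OF this] show ?thesis by (simp only: set_integrable_def)
    qed
    then show "integrable lborel (\<lambda>t. ?p t * indicator {-\<tau>..\<tau>} t)" by (simp add: mult.commute)
    fix t
    show "?p t * indicator {-\<tau>..\<tau>} t \<le> ?b (snd x + 1 * t)"
    proof (cases "t \<in> {-\<tau>..\<tau>}")
      case True
      let ?s = "(t\<^sup>2 / \<tau>\<^sup>2) ^ Suc m"
      have "t\<^sup>2 \<le> \<tau>\<^sup>2" using True by (intro abs_le_square_iff[THEN iffD1]) auto
      then have "?s \<le> 1" using \<tau>(1) by (intro power_le_one) auto
      then have "chi m (t\<^sup>2 / \<tau>\<^sup>2) = (1 - ?s)\<^sup>2" by (simp add: chi_def max_def)
      also have "\<dots> \<ge> 1 - 2 * ?s" by (simp add: power2_diff)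
      finally show ?thesis using True eq[of t] by simp
    qed (simp add: bump_nonneg)
  qed
  also have "\<dots> = line_int m r x c"
    unfolding line_int_def using lborel_integral_real_affine[of 1 ?b "snd x"] by simp
  finally show ?thesis by (simp add: \<tau>_def)
qed

text \<open>A horizontal boundary line is not a graph over the second coordinate, hence is not
  covered by \<open>half_plane\<close>; this serves the case of a vertical normal.\<close>

lemma bump_horizontal_half_plane:
  assumes r: "r > 0"
  shows "(\<integral>y. indicator {y. snd x \<le> snd y} y * bump1 m r x y \<partial>lborel) = 0"
    and "(\<integral>y. indicator {y. snd x \<le> snd y} y * bump2 m r x y \<partial>lborel) = - (\<integral>t. bump m r x (t, snd x) \<partial>lborel)"
proof -
  obtain A where A: "A > 0" "\<And>u v. bump m r x (u, v) \<noteq> 0 \<or> bump1 m r x (u, v) \<noteq> 0 \<or> bump2 m r x (u, v) \<noteq> 0 \<Longrightarrow> \<bar>u\<bar> < A \<and> \<bar>v\<bar> < A"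
    using bump_supp_box[OF r] by metis
  have e: "(\<lambda>(u, v). indicator {y. snd x \<le> snd y} (u, v) * b (u, v)) = (\<lambda>y. indicator {y. snd x \<le> snd y} y * (b y :: real))" for b
    by auto
  have i: "integrable (lborel \<Otimes>\<^sub>M lborel) (\<lambda>(u, v). indicator {y. snd x \<le> snd y} (u, v) * b (u, v))"
    if "b = bump1 m r x \<or> b = bump2 m r x" for b
  proof -
    have "integrable lborel b"
      using that A(2) by (intro integrable_lborel_compact_support[of _ "(-A, -A)" "(A, A)"])
        (auto simp: cbox_Pair_eq intro: continuous_on_bump, force+)
    moreover have "{y :: real \<times> real. snd x \<le> snd y} \<in> sets borel"
      by (intro borel_closed closed_Collect_le continuous_intros)
    ultimately have "integrable lborel (\<lambda>y. indicator {y. snd x \<le> snd y} y * b y)"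
      using integrable_real_mult_indicator[of "{y. snd x \<le> snd y}" lborel b] by (simp add: mult.commute)
    then show ?thesis unfolding lborel_prod e .
  qed
  have "(\<integral>u. bump1 m r x (u, v) \<partial>lborel) = 0" for v
  proof (rule integral_line_FTC[OF bump_deriv1 _ \<open>A > 0\<close>])
    show "continuous_on UNIV (\<lambda>u. bump1 m r x (u, v))"
      by (intro continuous_on_compose2[OF continuous_on_bump(2)[of UNIV]] continuous_intros) auto
    show "bump m r x (u, v) = 0 \<and> bump1 m r x (u, v) = 0" if "A \<le> \<bar>u\<bar>" for u
      using A(2)[of u v] that by force
  qed
  then show "(\<integral>y. indicator {y. snd x \<le> snd y} y * bump1 m r x y \<partial>lborel) = 0"
    using lborel_pair.integral_snd[OF i[of "bump1 m r x"]] unfolding lborel_prod e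
    by (simp add: indicator_def)
  have "(\<integral>v. indicator {snd x..} v * bump2 m r x (u, v) \<partial>lborel) = - bump m r x (u, snd x)" for u
  proof (rule integral_half_line_FTC[OF bump_deriv2])
    show "continuous_on UNIV (\<lambda>v. bump2 m r x (u, v))"
      by (intro continuous_on_compose2[OF continuous_on_bump(3)[of UNIV]] continuous_intros) auto
    show "bump m r x (u, v) = 0 \<and> bump2 m r x (u, v) = 0" if "A \<le> v" for v
      using A(2)[of u v] that by force
  qed
  then show "(\<integral>y. indicator {y. snd x \<le> snd y} y * bump2 m r x y \<partial>lborel) = - (\<integral>t. bump m r x (t, snd x) \<partial>lborel)"
    using lborel_pair.integral_fst'[OF i[of "bump2 m r x"]] unfolding lborel_prod e
    by (simp add: indicator_def)
qed

lemma cutoff_bump: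
  assumes r: "r > 0" and s: "0 \<le> s" "s \<le> 1" and ball: "ball x r \<subseteq> box (-s, -s) (1 - s, 1 - s)"
  shows "cutoff s (bump m r x) (bump1 m r x) (bump2 m r x)"
proof
  show "bump m r x y = 0" if "y \<notin> box (-s, -s) (1 - s, 1 - s)" for y
    using bump_eq_0(1)[OF r] ball that by blast
  show "\<bar>bump m r x y\<bar> \<le> 1" for y
    using bump_nonneg[of m r x y] bump_le_1[of m r x y] by simp
qed (use s in \<open>auto intro: continuous_on_bump bump_deriv1 bump_deriv2\<close>)

lemma box_subset_sq: "box (-s, -s) (1 - s, 1 - s) \<subseteq> sq s"
  by (auto simp: box_prod sq_def)

lemma integral_sq_eq_lebesgue:
  fixes F :: "real \<times> real \<Rightarrow> real"
  assumes "\<And>y. y \<notin> sq s \<Longrightarrow> F y = 0"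
  shows "integral\<^sup>L (lebesgue_on (sq s)) F = integral\<^sup>L lebesgue F"
proof -
  have "integral\<^sup>L (lebesgue_on (sq s)) F = (\<integral>y. indicator (sq s) y *\<^sub>R F y \<partial>lebesgue)"
    by (subst integral_restrict_space) auto
  also have "(\<lambda>y. indicator (sq s) y *\<^sub>R F y) = F"
  proof
    fix y show "indicator (sq s) y *\<^sub>R F y = F y" by (cases "y \<in> sq s") (use assms in auto)
  qed
  finally show ?thesis .
qed

section \<open>One-sided approximate limits and traces\<close>

lemma emeasure_half_ball_le:
  assumes "r > 0"
  shows "emeasure lebesgue (half_ball x r \<nu>) \<le> ennreal (4 * r\<^sup>2)"
proof -
  let ?C = "cbox (fst x - r, snd x - r) (fst x + r, snd x + r)"
  have "half_ball x r \<nu> \<subseteq> ?C"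
  proof
    fix y assume "y \<in> half_ball x r \<nu>"
    then have "dist x y < r" by (simp add: half_ball_def)
    then have "dist (fst x) (fst y) < r" "dist (snd x) (snd y) < r"
      using dist_fst_le[of x y] dist_snd_le[of x y] by linarith+
    then show "y \<in> ?C" by (cases y) (auto simp: cbox_Pair_eq dist_real_def abs_less_iff)
  qed
  then have "emeasure lebesgue (half_ball x r \<nu>) \<le> emeasure lebesgue ?C"
    by (intro emeasure_mono) auto
  also have "\<dots> = ennreal (measure lborel ?C)"
    by (subst emeasure_eq_ennreal_measure) (auto simp: emeasure_lborel_cbox_eq)
  also have "measure lborel ?C = 4 * r\<^sup>2"
    using assms by (simp add: content_Pair power2_eq_square)
  finally show ?thesis .
qed

lemma open_half_ball: "open (half_ball x r \<nu>)"
proof -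
  have "half_ball x r \<nu> = ball x r \<inter> {y. (y - x) \<bullet> \<nu> > 0}" by (auto simp: half_ball_def)
  moreover have "open {y. (y - x) \<bullet> \<nu> > 0}" by (intro open_Collect_less continuous_intros)
  ultimately show ?thesis by auto
qed

lemma half_ball_measurable [measurable]: "half_ball x r \<nu> \<in> sets lebesgue"
  by (simp add: open_half_ball borel_open)

lemma emeasure_half_ball_pos:
  assumes "r > 0" "norm \<nu> = 1"
  shows "emeasure lebesgue (half_ball x r \<nu>) > 0"
proof -
  have "x + (r/2) *\<^sub>R \<nu> \<in> half_ball x r \<nu>"
    using assms by (simp add: half_ball_def dist_norm dot_square_norm)
  then have "half_ball x r \<nu> \<noteq> {}" by blast
  then have "\<not> negligible (half_ball x r \<nu>)"
    using open_not_negligible[OF open_half_ball] by blast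
  then show ?thesis
    by (simp add: negligible_iff_null_sets null_sets_def zero_less_iff_neq_zero)
qed

lemma ennreal_divide_mult_self: "m \<noteq> 0 \<Longrightarrow> m \<noteq> top \<Longrightarrow> a / m * m = (a :: ennreal)"
  by (simp add: ennreal_divide_times ennreal_divide_self less_top)

lemma one_sided_approx_limit_bound:
  assumes lim: "one_sided_approx_limit w x \<nu> a" and \<nu>: "norm \<nu> = 1" and "e > 0"
  shows "\<forall>\<^sub>F r in at_right 0. (\<integral>\<^sup>+y\<in>half_ball x r \<nu>. ennreal \<bar>w y - a\<bar> \<partial>lebesgue) \<le> ennreal (e * r\<^sup>2)"
proof -
  \<comment> \<open>A quarter of \<open>e\<close>, because the half ball has measure at most
    \<open>4 * r\<^sup>2\<close>.\<close>
  have "\<forall>\<^sub>F r in at_right 0. (\<integral>\<^sup>+y\<in>half_ball x r \<nu>. ennreal \<bar>w y - a\<bar> \<partial>lebesgue) / emeasure lebesgue (half_ball x r \<nu>) < ennreal (e/4)"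
    using lim unfolding one_sided_approx_limit_def
    by (rule order_tendstoD(2)) (use \<open>e > 0\<close> in simp)
  moreover have "\<forall>\<^sub>F r in at_right (0::real). 0 < r" by (simp add: eventually_at_right_less)
  ultimately show ?thesis
  proof eventually_elim
    case (elim r)
    let ?I = "\<integral>\<^sup>+y\<in>half_ball x r \<nu>. ennreal \<bar>w y - a\<bar> \<partial>lebesgue" and ?m = "emeasure lebesgue (half_ball x r \<nu>)"
    have m: "?m \<noteq> 0" "?m \<noteq> top" "?m \<le> ennreal (4 * r\<^sup>2)"
      using emeasure_half_ball_pos[OF elim(2) \<nu>] emeasure_half_ball_le[OF elim(2), of x \<nu>]
      by (auto simp: zero_less_iff_neq_zero dest: neq_top_trans[rotated])
    have "?I = ?I / ?m * ?m"
      by (rule ennreal_divide_mult_self[OF m(1,2), symmetric])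
    also have "\<dots> \<le> ennreal (e/4) * ennreal (4 * r\<^sup>2)"
      using elim(1) m by (intro mult_mono) auto
    also have "\<dots> = ennreal (e * r\<^sup>2)" using \<open>e > 0\<close> by (simp flip: ennreal_mult)
    finally show ?case .
  qed
qed

text \<open>With \<open>4 * d\<close> the distance of two candidate limits, the deviations from them
  add up to at least \<open>4 * d\<close> at every point, while on small half balls both averages
  are below \<open>d\<close>.\<close>

lemma one_sided_approx_limit_unique:
  assumes w: "w \<in> borel_measurable lebesgue" and \<nu>: "norm \<nu> = 1"
    and lim: "one_sided_approx_limit w x \<nu> a" "one_sided_approx_limit w x \<nu> a'"
  shows "a = a'"
proof (rule ccontr)
  assume "a \<noteq> a'"
  define d where "d = \<bar>a - a'\<bar> / 4"
  have d: "d > 0" using \<open>a \<noteq> a'\<close> by (simp add: d_def)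
  let ?q = "\<lambda>r a. (\<integral>\<^sup>+y\<in>half_ball x r \<nu>. ennreal \<bar>w y - a\<bar> \<partial>lebesgue) / emeasure lebesgue (half_ball x r \<nu>)"
  have "\<forall>\<^sub>F r in at_right 0. ?q r a < ennreal d" "\<forall>\<^sub>F r in at_right 0. ?q r a' < ennreal d"
    using lim d unfolding one_sided_approx_limit_def by (auto intro: order_tendstoD)
  moreover have "\<forall>\<^sub>F r in at_right (0::real). 0 < r" by (simp add: eventually_at_right_less)
  ultimately have "\<forall>\<^sub>F r in at_right (0::real). False"
  proof eventually_elim
    case (elim r)
    let ?m = "emeasure lebesgue (half_ball x r \<nu>)"
    let ?I = "\<lambda>a. \<integral>\<^sup>+y\<in>half_ball x r \<nu>. ennreal \<bar>w y - a\<bar> \<partial>lebesgue"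
    have m: "?m \<noteq> 0" "?m \<noteq> top"
      using emeasure_half_ball_pos[OF elim(3) \<nu>] emeasure_half_ball_le[OF elim(3), of x \<nu>]
      by (auto simp: zero_less_iff_neq_zero dest: neq_top_trans[rotated])
    have "ennreal (4 * d) * ?m = (\<integral>\<^sup>+y\<in>half_ball x r \<nu>. ennreal (4 * d) \<partial>lebesgue)"
      by (simp add: nn_integral_cmult_indicator)
    also have "\<dots> \<le> (\<integral>\<^sup>+y. ennreal \<bar>w y - a\<bar> * indicator (half_ball x r \<nu>) y + ennreal \<bar>w y - a'\<bar> * indicator (half_ball x r \<nu>) y \<partial>lebesgue)"
    proof (rule nn_integral_mono)
      fix y
      have "4 * d \<le> \<bar>w y - a\<bar> + \<bar>w y - a'\<bar>" 
        using abs_triangle_ineq4[of "w y - a'" "w y - a"] by (simp add: d_def)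
      then have "ennreal (4 * d) \<le> ennreal \<bar>w y - a\<bar> + ennreal \<bar>w y - a'\<bar>"
        by (simp flip: ennreal_plus add: ennreal_leI)
      then show "ennreal (4 * d) * indicator (half_ball x r \<nu>) y \<le>
          ennreal \<bar>w y - a\<bar> * indicator (half_ball x r \<nu>) y + ennreal \<bar>w y - a'\<bar> * indicator (half_ball x r \<nu>) y"
        by (auto simp: indicator_def)
    qed
    also have "\<dots> = ?I a + ?I a'"
      using w by (intro nn_integral_add) auto
    also have "\<dots> \<le> ennreal d * ?m + ennreal d * ?m"
    proof (intro add_mono)
      have *: "?I b \<le> ennreal d * ?m" if "?q r b < ennreal d" for b
      proof -
        have "?I b = ?q r b * ?m"
          by (rule ennreal_divide_mult_self[OF m, symmetric])
        also have "\<dots> \<le> ennreal d * ?m" using that by (intro mult_right_mono) auto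
        finally show ?thesis .
      qed
      show "?I a \<le> ennreal d * ?m" "?I a' \<le> ennreal d * ?m" using * elim by auto
    qed
    also have "\<dots> = ennreal (2 * d) * ?m"
      using d by (simp add: distrib_right[symmetric] flip: ennreal_plus)
    finally have "ennreal (4 * d) * ?m \<le> ennreal (2 * d) * ?m" .
    then have "?m * ennreal (4 * d) \<le> ?m * ennreal (2 * d)"
      by (simp only: mult.commute[of ?m])
    then have "ennreal (4 * d) \<le> ennreal (2 * d)"
      by (simp only: ennreal_mult_le_mult_iff[OF m])
    then show False using d by simp
  qed
  then show False by simp
qed

text \<open>Uniqueness of one-sided limits turns the definite descriptions into the two values that
  accompany the chosen normal.\<close>

lemma traces_eq:
  assumes w: "w \<in> borel_measurable lebesgue" and x: "x \<in> jump_set w"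
  shows "are_traces w x (jump_normal w x) (trace_plus w x) (trace_minus w x)"
proof -
  have "\<exists>\<nu> a b. are_traces w x \<nu> a b" using x by (simp add: jump_set_def)
  then have "\<exists>a b. are_traces w x (jump_normal w x) a b"
    unfolding jump_normal_def by (rule someI_ex)
  then obtain a b where ab: "are_traces w x (jump_normal w x) a b" by blast
  let ?\<nu> = "jump_normal w x"
  have \<nu>: "norm ?\<nu> = 1" "norm (- ?\<nu>) = 1" using ab by (simp_all add: are_traces_def)
  have "trace_plus w x = a"
    unfolding trace_plus_def
    by (rule the_equality) (use ab one_sided_approx_limit_unique[OF w \<nu>(1)] in \<open>auto simp: are_traces_def\<close>)
  moreover have "trace_minus w x = b"
    unfolding trace_minus_def
    by (rule the_equality) (use ab one_sided_approx_limit_unique[OF w \<nu>(2)] in \<open>auto simp: are_traces_def\<close>)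
  ultimately show ?thesis using ab by simp
qed

text \<open>Squares and cubes are Lipschitz only on bounded sets; that is enough because
  \<open>w\<close> and its traces are compared within a fixed bound.\<close>

definition locally_Lipschitz :: "(real \<Rightarrow> real) \<Rightarrow> bool" where
  "locally_Lipschitz P \<longleftrightarrow> (\<forall>K. \<exists>L\<ge>0. \<forall>u v. \<bar>u\<bar> \<le> K \<longrightarrow> \<bar>v\<bar> \<le> K \<longrightarrow> \<bar>P u - P v\<bar> \<le> L * \<bar>u - v\<bar>)"

lemma C1_locally_Lipschitz:
  assumes "\<And>t. (P has_real_derivative P' t) (at t)" "continuous_on UNIV P'"
  shows "locally_Lipschitz P"
  unfolding locally_Lipschitz_def
proof
  fix K :: real
  have "compact (P' ` {-K..K})"
    using assms(2) by (intro compact_continuous_image) (auto intro: continuous_on_subset)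
  then obtain B where B: "\<And>t. t \<in> {-K..K} \<Longrightarrow> \<bar>P' t\<bar> \<le> B"
    by (metis bounded_iff compact_imp_bounded imageI real_norm_def)
  have "\<bar>P u - P v\<bar> \<le> \<bar>B\<bar> * \<bar>u - v\<bar>" if "\<bar>u\<bar> \<le> K" "\<bar>v\<bar> \<le> K" for u v
  proof -
    have "norm (P u - P v) \<le> \<bar>B\<bar> * norm (u - v)"
    proof (rule field_differentiable_bound[where S="{-K..K}" and f'=P'])
      fix t assume "t \<in> {-K..K}"
      show "(P has_field_derivative P' t) (at t within {-K..K})"
        by (rule has_field_derivative_at_within[OF assms(1)])
      show "norm (P' t) \<le> \<bar>B\<bar>" using B[OF \<open>t \<in> _\<close>] by simp
    qed (use that in auto)
    then show ?thesis by simp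
  qed
  then show "\<exists>L\<ge>0. \<forall>u v. \<bar>u\<bar> \<le> K \<longrightarrow> \<bar>v\<bar> \<le> K \<longrightarrow> \<bar>P u - P v\<bar> \<le> L * \<bar>u - v\<bar>"
    by (intro exI[of _ "\<bar>B\<bar>"]) auto
qed

context low_energy_limit
begin

lemma w_lebesgue [measurable]: "w \<in> borel_measurable lebesgue"
  by (rule periodic_borel_measurable_lebesgue[OF w_props(1,2)])

lemma AE_w_bound_sq:
  assumes "0 \<le> s" "s \<le> 1"
  shows "AE y in lebesgue. y \<in> sq s \<longrightarrow> \<bar>w y\<bar> \<le> R"
  using AE_periodic_sq[OF w_props(1,2) w_bound assms] by (simp add: AE_restrict_space_iff)

text \<open>The blow-up at a jump point replaces \<open>w\<close> by the function with the two trace values on the two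
  sides of the tangent line.\<close>

lemma blow_up:
  assumes s: "0 \<le> s" "s \<le> 1" and x: "x \<in> box (-s, -s) (1 - s, 1 - s)"
    and tr: "are_traces w x \<nu> a b"
    and P: "continuous_on UNIV P" "locally_Lipschitz P" and Q: "continuous_on UNIV Q" "locally_Lipschitz Q"
    and H: "H \<in> sets borel" "\<forall>y. (y - x) \<bullet> \<nu> > 0 \<longrightarrow> y \<in> H" "\<forall>y. (y - x) \<bullet> \<nu> < 0 \<longrightarrow> y \<notin> H"
    and eta: "\<eta> > 0"
  shows "\<forall>\<^sub>F r in at_right 0. \<bar>(\<integral>y. P (w y) * bump2 m r x y - Q (w y) * bump1 m r x y \<partial>lebesgue_on (sq s))
      - ((P a - P b) * (\<integral>y. indicator H y * bump2 m r x y \<partial>lborel)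
         - (Q a - Q b) * (\<integral>y. indicator H y * bump1 m r x y \<partial>lborel))\<bar> \<le> \<eta> * r"
proof -
  have \<nu>: "norm \<nu> = 1" "norm (- \<nu>) = 1" and lim: "one_sided_approx_limit w x \<nu> a" "one_sided_approx_limit w x (- \<nu>) b"
    using tr by (simp_all add: are_traces_def)
  define R' where "R' = R + \<bar>a\<bar> + \<bar>b\<bar>"
  have R': "R \<le> R'" "\<bar>a\<bar> \<le> R'" "\<bar>b\<bar> \<le> R'" using R_nonneg by (simp_all add: R'_def)
  obtain L1 where L1: "L1 \<ge> 0" "\<And>u v. \<bar>u\<bar> \<le> R' \<Longrightarrow> \<bar>v\<bar> \<le> R' \<Longrightarrow> \<bar>P u - P v\<bar> \<le> L1 * \<bar>u - v\<bar>"
    using P(2) unfolding locally_Lipschitz_def by blast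
  obtain L2 where L2: "L2 \<ge> 0" "\<And>u v. \<bar>u\<bar> \<le> R' \<Longrightarrow> \<bar>v\<bar> \<le> R' \<Longrightarrow> \<bar>Q u - Q v\<bar> \<le> L2 * \<bar>u - v\<bar>"
    using Q(2) unfolding locally_Lipschitz_def by blast
  \<comment> \<open>Lipschitz constants times the derivative bound of the bump, the 1 keeping
    \<open>C\<close> positive. The error is at most \<open>C / r\<close> times the L^1 distance to
    the traces; with \<open>d * r\<^sup>2\<close> from each of the two half balls,
    \<open>d = \<eta> / (2 * C)\<close> yields \<open>\<eta> * r\<close>.\<close>
  define C where "C = (L1 + L2 + 1) * (4 * real (Suc m))"
  have C: "C > 0" using L1 L2 by (simp add: C_def add_nonneg_pos)
  define d where "d = \<eta> / (2 * C)"
  have d: "d > 0" using eta C by (simp add: d_def)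
  have "open (box (-s, -s) (1 - s, 1 - s))" by (rule open_box)
  then obtain \<rho> where \<rho>: "\<rho> > 0" "ball x \<rho> \<subseteq> box (-s, -s) (1 - s, 1 - s)"
    using x by (meson openE)
  have "\<forall>\<^sub>F r in at_right 0. r \<in> {0<..<\<rho>}"
    using \<rho>(1) by (rule eventually_at_right_real)
  moreover note one_sided_approx_limit_bound[OF lim(1) \<nu>(1) d] one_sided_approx_limit_bound[OF lim(2) \<nu>(2) d]
  ultimately show ?thesis
  proof eventually_elim
    case (elim r)
    have r: "r > 0" "r < \<rho>" using elim(1) by auto
    have ball: "ball x r \<subseteq> box (-s, -s) (1 - s, 1 - s)"
      using \<rho>(2) r subset_ball[of r \<rho> x] by auto
    then have ball_sq: "ball x r \<subseteq> sq s" using box_subset_sq by blast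
    interpret cutoff s "bump m r x" "bump1 m r x" "bump2 m r x"
      by (rule cutoff_bump[OF r(1) s ball])
    let ?j = "\<lambda>y. if y \<in> H then a else b"
    let ?F = "\<lambda>u y. P (u y) * bump2 m r x y - Q (u y) * bump1 m r x y"
    have [measurable]: "P \<in> borel_measurable borel" "Q \<in> borel_measurable borel"
      by (intro borel_measurable_continuous_onI P Q)+
    have mb: "bump1 m r x \<in> borel_measurable borel" "bump2 m r x \<in> borel_measurable borel"
      by (intro borel_measurable_continuous_onI continuous_on_bump)+
    then have [measurable]: "bump1 m r x \<in> borel_measurable lebesgue" "bump2 m r x \<in> borel_measurable lebesgue"
      by (simp_all add: measurable_completion)
    have [measurable]: "H \<in> sets lebesgue" using H(1) by simp
    have zero: "bump1 m r x y = 0" "bump2 m r x y = 0" if "y \<notin> ball x r" for y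
      using bump_eq_0[OF r(1) that] by auto
    have ib: "integrable lborel (bump1 m r x)" "integrable lborel (bump2 m r x)"
    proof -
      have "y \<in> csq s" if "y \<in> ball x r" for y using that ball box_subset_cbox by blast
      then show "integrable lborel (bump1 m r x)" "integrable lborel (bump2 m r x)"
        using zero by (intro integrable_lborel_compact_support[of _ "(-s,-s)" "(1-s,1-s)"] continuous_on_bump; blast)+
    qed
    then have ibH: "integrable lborel (\<lambda>y. indicator H y * bump1 m r x y)" "integrable lborel (\<lambda>y. indicator H y * bump2 m r x y)"
      using integrable_real_mult_indicator[of H lborel "bump1 m r x"] integrable_real_mult_indicator[of H lborel "bump2 m r x"] H(1)
      by (simp_all add: mult.commute)
    \<comment> \<open>The derivatives of the bump have mean zero, so the constant state
      \<open>b\<close> contributes nothing and only the jumps of \<open>P\<close> and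
      \<open>Q\<close> across the line survive.\<close>
    have int0: "(\<integral>y. bump1 m r x y \<partial>lborel) = 0" "(\<integral>y. bump2 m r x y \<partial>lborel) = 0"
    proof -
      have "(\<integral>y. 0 * bump m r x y + 1 * bump1 m r x y \<partial>lebesgue_on (sq s)) = 0"
        by (rule integral_pd1_cutoff) auto
      moreover have "(\<integral>y. bump1 m r x y \<partial>lebesgue_on (sq s)) = integral\<^sup>L lebesgue (bump1 m r x)"
        by (rule integral_sq_eq_lebesgue) (use zero ball_sq in blast)
      ultimately show "(\<integral>y. bump1 m r x y \<partial>lborel) = 0"
        using mb by (simp add: integral_completion)
      have "(\<integral>y. 0 * bump m r x y + 1 * bump2 m r x y \<partial>lebesgue_on (sq s)) = 0"
        by (rule integral_pd2_cutoff) auto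
      moreover have "(\<integral>y. bump2 m r x y \<partial>lebesgue_on (sq s)) = integral\<^sup>L lebesgue (bump2 m r x)"
        by (rule integral_sq_eq_lebesgue) (use zero ball_sq in blast)
      ultimately show "(\<integral>y. bump2 m r x y \<partial>lborel) = 0"
        using mb by (simp add: integral_completion)
    qed
    let ?M = "(P a - P b) * (\<integral>y. indicator H y * bump2 m r x y \<partial>lborel) - (Q a - Q b) * (\<integral>y. indicator H y * bump1 m r x y \<partial>lborel)"
    have Fj_eq: "?F ?j = (\<lambda>y. (P b * bump2 m r x y + (P a - P b) * (indicator H y * bump2 m r x y))
        - (Q b * bump1 m r x y + (Q a - Q b) * (indicator H y * bump1 m r x y)))"
      by (auto simp: algebra_simps indicator_def)
    have iFj': "integrable lborel (?F ?j)" unfolding Fj_eq using ib ibH by simp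
    then have iFj: "integrable lebesgue (?F ?j)" by (simp add: integrable_completion)
    have Fj: "integral\<^sup>L lebesgue (?F ?j) = ?M"
    proof -
      have "integral\<^sup>L lebesgue (?F ?j) = integral\<^sup>L lborel (?F ?j)"
        using iFj' by (intro integral_completion) auto
      also have "\<dots> = ?M" unfolding Fj_eq using ib ibH int0 by simp
      finally show ?thesis .
    qed
    have ae: "AE y in lebesgue. norm (?F w y - ?F ?j y) \<le>
        C / r * (\<bar>w y - a\<bar> * indicator (half_ball x r \<nu>) y + \<bar>w y - b\<bar> * indicator (half_ball x r (- \<nu>)) y)"
    proof -
      \<comment> \<open>Off the tangent line, which is a null set, a point of the ball lies in
        exactly one half ball, where the comparison function is the matching trace.\<close>
      have "negligible {y. \<nu> \<bullet> y = \<nu> \<bullet> x}" using \<nu> by (intro negligible_hyperplane) auto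
      then have "AE y in lebesgue. \<nu> \<bullet> y \<noteq> \<nu> \<bullet> x"
        unfolding negligible_iff_null_sets by (auto dest: AE_not_in)
      then show ?thesis using AE_w_bound_sq[OF s]
      proof eventually_elim
        case (elim y)
        show ?case
        proof (cases "y \<in> ball x r")
          case True
          have wR: "\<bar>w y\<bar> \<le> R'" using elim(2) True ball_sq R'(1) by fastforce
          have jR: "\<bar>?j y\<bar> \<le> R'" using R' by simp
          have "norm (?F w y - ?F ?j y) \<le> \<bar>P (w y) - P (?j y)\<bar> * \<bar>bump2 m r x y\<bar> + \<bar>Q (w y) - Q (?j y)\<bar> * \<bar>bump1 m r x y\<bar>"
            unfolding real_norm_def by (rule abs_diff_products_le)
          also have "\<dots> \<le> (L1 * \<bar>w y - ?j y\<bar>) * (4 * real (Suc m) / r) + (L2 * \<bar>w y - ?j y\<bar>) * (4 * real (Suc m) / r)"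
            by (intro add_mono mult_mono L1(2) L2(2) wR jR abs_bump_deriv_le r(1) mult_nonneg_nonneg L1(1) L2(1)) auto
          also have "\<dots> = (L1 + L2) * (4 * real (Suc m)) / r * \<bar>w y - ?j y\<bar>"
            by (simp add: algebra_simps add_divide_distrib)
          also have "\<dots> \<le> C / r * \<bar>w y - ?j y\<bar>"
            using r unfolding C_def by (intro mult_right_mono divide_right_mono) auto
          also have "\<bar>w y - ?j y\<bar> = \<bar>w y - a\<bar> * indicator (half_ball x r \<nu>) y + \<bar>w y - b\<bar> * indicator (half_ball x r (- \<nu>)) y"
          proof -
            have "(y - x) \<bullet> \<nu> = \<nu> \<bullet> y - \<nu> \<bullet> x" by (simp only: inner_diff_left inner_commute inner_diff_right)
            then have "(y - x) \<bullet> \<nu> \<noteq> 0" using elim(1) by simp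
            then consider "(y - x) \<bullet> \<nu> > 0" | "(y - x) \<bullet> \<nu> < 0" by linarith
            then show ?thesis
              by cases (use True H(2,3)[THEN spec, of y] in \<open>auto simp: half_ball_def\<close>)
          qed
          finally show ?thesis .
        next
          case False
          then show ?thesis using zero[OF False] C r by simp
        qed
      qed
    qed
    have iFw: "integrable lebesgue (?F w)"
    proof -
      have "compact (P ` {-R'..R'})" "compact (Q ` {-R'..R'})"
        using P Q by (auto intro!: compact_continuous_image intro: continuous_on_subset)
      then obtain BP BQ where BP: "\<And>t. t \<in> {-R'..R'} \<Longrightarrow> \<bar>P t\<bar> \<le> BP" and BQ: "\<And>t. t \<in> {-R'..R'} \<Longrightarrow> \<bar>Q t\<bar> \<le> BQ"
        by (metis bounded_iff compact_imp_bounded imageI real_norm_def)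
      show ?thesis
      proof (rule Bochner_Integration.integrable_bound[of _ "\<lambda>y. BP * \<bar>bump2 m r x y\<bar> + BQ * \<bar>bump1 m r x y\<bar>"])
        show "integrable lebesgue (\<lambda>y. BP * \<bar>bump2 m r x y\<bar> + BQ * \<bar>bump1 m r x y\<bar>)"
          using ib by (simp add: integrable_completion)
        show "?F w \<in> borel_measurable lebesgue" by measurable
        show "AE y in lebesgue. norm (?F w y) \<le> norm (BP * \<bar>bump2 m r x y\<bar> + BQ * \<bar>bump1 m r x y\<bar>)"
          using AE_w_bound_sq[OF s]
        proof eventually_elim
          case (elim y)
          show ?case
          proof (cases "y \<in> ball x r")
            case True
            then have wR: "w y \<in> {-R'..R'}" using elim ball_sq R'(1) by fastforce
            have "\<bar>?F w y\<bar> \<le> \<bar>P (w y)\<bar> * \<bar>bump2 m r x y\<bar> + \<bar>Q (w y)\<bar> * \<bar>bump1 m r x y\<bar>"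
              unfolding abs_mult[symmetric] by (rule abs_triangle_ineq4)
            also have "\<dots> \<le> BP * \<bar>bump2 m r x y\<bar> + BQ * \<bar>bump1 m r x y\<bar>"
              by (intro add_mono mult_right_mono BP BQ wR) auto
            finally show ?thesis by simp
          next
            case False
            then show ?thesis using zero[OF False] by simp
          qed
        qed
      qed
    qed
    have "?F w y = 0" if "y \<notin> sq s" for y
    proof -
      have "y \<notin> ball x r" using ball_sq that by blast
      from zero[OF this] show ?thesis by simp
    qed
    then have "(\<integral>y. ?F w y \<partial>lebesgue_on (sq s)) = integral\<^sup>L lebesgue (?F w)"
      by (rule integral_sq_eq_lebesgue)
    then have eq: "(\<integral>y. ?F w y \<partial>lebesgue_on (sq s)) - ?M = (\<integral>y. ?F w y - ?F ?j y \<partial>lebesgue)"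
      using Bochner_Integration.integral_diff[OF iFw iFj] Fj by simp
    have "ennreal (norm (\<integral>y. ?F w y - ?F ?j y \<partial>lebesgue)) \<le> (\<integral>\<^sup>+y. norm (?F w y - ?F ?j y) \<partial>lebesgue)"
      by (intro integral_norm_bound_ennreal Bochner_Integration.integrable_diff iFw iFj)
    also have "\<dots> \<le> (\<integral>\<^sup>+y. ennreal (C / r) * (ennreal \<bar>w y - a\<bar> * indicator (half_ball x r \<nu>) y
        + ennreal \<bar>w y - b\<bar> * indicator (half_ball x r (- \<nu>)) y) \<partial>lebesgue)"
      using ae
    proof (intro nn_integral_mono_AE, eventually_elim)
      case (elim y)
      have "ennreal (norm (?F w y - ?F ?j y)) \<le> ennreal (C / r * (\<bar>w y - a\<bar> * indicator (half_ball x r \<nu>) y + \<bar>w y - b\<bar> * indicator (half_ball x r (- \<nu>)) y))"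
        by (rule ennreal_leI[OF elim(2)])
      also have "\<dots> = ennreal (C / r) * (ennreal \<bar>w y - a\<bar> * indicator (half_ball x r \<nu>) y
        + ennreal \<bar>w y - b\<bar> * indicator (half_ball x r (- \<nu>)) y)"
        using C r by (cases "y \<in> half_ball x r \<nu>"; cases "y \<in> half_ball x r (- \<nu>)")
          (simp_all flip: ennreal_plus ennreal_mult)
      finally show ?case .
    qed
    also have "\<dots> = ennreal (C / r) * ((\<integral>\<^sup>+y\<in>half_ball x r \<nu>. ennreal \<bar>w y - a\<bar> \<partial>lebesgue)
        + (\<integral>\<^sup>+y\<in>half_ball x r (- \<nu>). ennreal \<bar>w y - b\<bar> \<partial>lebesgue))"
      by (simp add: nn_integral_cmult nn_integral_add)
    also have "\<dots> \<le> ennreal (C / r) * (ennreal (d * r\<^sup>2) + ennreal (d * r\<^sup>2))"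
      by (intro mult_left_mono add_mono elim) auto
    also have "\<dots> = ennreal (\<eta> * r)"
    proof -
      have "C / r * (d * r\<^sup>2 + d * r\<^sup>2) = \<eta> * r"
        using C r by (simp add: d_def power2_eq_square field_simps)
      then show ?thesis using C r d by (simp flip: ennreal_plus ennreal_mult)
    qed
    finally have "norm (\<integral>y. ?F w y - ?F ?j y \<partial>lebesgue) \<le> \<eta> * r"
      using eta r by (simp add: ennreal_le_iff)
    then show ?case unfolding eq by simp
  qed
qed

end

definition jump_cost :: "real \<Rightarrow> real \<Rightarrow> real" where
  "jump_cost a b = \<bar>a - b\<bar> ^ 3 / (12 * sqrt (1 + 1/4 * (a + b)\<^sup>2))"

lemma jump_cost_commute: "jump_cost a b = jump_cost b a"
  by (simp add: jump_cost_def abs_minus_commute add.commute)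

lemma jump_cost_nonneg: "jump_cost a b \<ge> 0"
  by (simp add: jump_cost_def)

lemma are_traces_swap: "are_traces w x \<nu> a b \<Longrightarrow> are_traces w x (- \<nu>) b a"
  by (auto simp: are_traces_def)

definition burgers_flux :: "(real \<times> real \<Rightarrow> real) \<Rightarrow> real \<Rightarrow> nat \<Rightarrow> real \<Rightarrow> real \<times> real \<Rightarrow> real" where
  "burgers_flux w s m r x = (\<integral>y. (w y)\<^sup>2 / 2 * bump2 m r x y - (w y) ^ 3 / 3 * bump1 m r x y \<partial>lebesgue_on (sq s))"

text \<open>The factor in \<open>line_int_ge\<close> is smallest for \<open>m = 0\<close>, where it
  equals 1/3.\<close>

lemma line_int_pos: "r > 0 \<Longrightarrow> line_int m r x c \<ge> 2 * r / sqrt (1 + c\<^sup>2) * (1/3)"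
proof -
  assume r: "r > 0"
  have "2 * r / sqrt (1 + c\<^sup>2) * (1/3) \<le> 2 * r / sqrt (1 + c\<^sup>2) * (1 - 2 / (2 * real m + 3))"
    using r by (intro mult_left_mono) (auto simp: field_simps)
  also have "\<dots> \<le> line_int m r x c" by (rule line_int_ge[OF r])
  finally show ?thesis .
qed

text \<open>Bumps are radial, so swapping the coordinates turns the horizontal line into one of
  slope parameter 0.\<close>

lemma horizontal_line_int_ge:
  assumes r: "r > 0"
  shows "(\<integral>t. bump m r x (t, snd x) \<partial>lborel) \<ge> 2 * r * (1/3)"
proof -
  let ?x = "(snd x, fst x)"
  have "bump m r x (t, snd x) = bump m r ?x (fst ?x + 0 * snd ?x - 0 * t, t)" for t
    by (simp add: bump_def rsq_def)
  then have "(\<integral>t. bump m r x (t, snd x) \<partial>lborel) = line_int m r ?x 0"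
    by (simp only: line_int_def)
  then show ?thesis using line_int_pos[OF r, where c=0] by simp
qed

context low_energy_limit
begin

lemma limit_burgers_bump:
  assumes "r > 0" "0 \<le> s" "s \<le> 1" "ball x r \<subseteq> box (-s, -s) (1 - s, 1 - s)"
  shows "(\<integral>y. w y * bump2 m r x y - (w y)\<^sup>2 / 2 * bump1 m r x y \<partial>lebesgue_on (sq s)) = 0"
  by (rule limit_burgers[OF cutoff_bump[OF assms]])

lemma eventually_ball_subset:
  assumes "x \<in> box (-s, -s) (1 - s, 1 - s :: real)"
  shows "\<forall>\<^sub>F r in at_right 0. r > 0 \<and> ball x r \<subseteq> box (-s, -s) (1 - s, 1 - s)"
proof -
  have "open (box (-s, -s) (1 - s, 1 - s))" by (rule open_box)
  then obtain \<rho> where \<rho>: "\<rho> > 0" "ball x \<rho> \<subseteq> box (-s, -s) (1 - s, 1 - s)"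
    using assms by (meson openE)
  have "\<forall>\<^sub>F r in at_right 0. r \<in> {0<..<\<rho>}"
    using \<rho>(1) by (rule eventually_at_right_real)
  then show ?thesis
  proof eventually_elim
    case (elim r)
    then show ?case using \<rho>(2) subset_ball[of r \<rho> x] by auto
  qed
qed

text \<open>At a jump point the limit equation forces the Rankine--Hugoniot condition
  \<open>\<nu>\<^sub>2 / \<nu>\<^sub>1 = (a + b) / 2\<close>.\<close>

lemma balance_at_jump:
  assumes s: "0 \<le> s" "s \<le> 1" and x: "x \<in> box (-s, -s) (1 - s, 1 - s)"
    and tr: "are_traces w x \<nu> a b"
    and H: "H \<in> sets borel" "\<forall>y. (y - x) \<bullet> \<nu> > 0 \<longrightarrow> y \<in> H" "\<forall>y. (y - x) \<bullet> \<nu> < 0 \<longrightarrow> y \<notin> H"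
    and k: "k > 0" "\<And>r. r > 0 \<Longrightarrow> I r \<ge> k * r"
    and D: "\<And>r. r > 0 \<Longrightarrow> (a - b) * (\<integral>y. indicator H y * bump2 0 r x y \<partial>lborel)
         - (a\<^sup>2 / 2 - b\<^sup>2 / 2) * (\<integral>y. indicator H y * bump1 0 r x y \<partial>lborel) = d * I r"
  shows "d = 0"
proof (rule ccontr)
  assume "d \<noteq> 0"
  \<comment> \<open>Half of the leading term: the exact balance then gives
    \<open>|d| * k * r\<close> at most half of itself. Only positivity of the line integral enters,
    so the bump with \<open>m = 0\<close> is good enough.\<close>
  define \<eta> where "\<eta> = \<bar>d\<bar> * k / 2"
  have eta: "\<eta> > 0" using \<open>d \<noteq> 0\<close> k by (simp add: \<eta>_def)
  have P: "continuous_on UNIV (\<lambda>t::real. t)" "locally_Lipschitz (\<lambda>t. t)"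
    by (auto intro!: continuous_intros C1_locally_Lipschitz[where P'="\<lambda>_. 1"] derivative_eq_intros)
  have Q: "continuous_on UNIV (\<lambda>t::real. t\<^sup>2 / 2)" "locally_Lipschitz (\<lambda>t. t\<^sup>2 / 2)"
    by (auto intro!: continuous_intros C1_locally_Lipschitz[where P'="\<lambda>t. t"] derivative_eq_intros)
  have "\<forall>\<^sub>F r in at_right (0::real). False"
    using blow_up[OF s x tr P Q H eta, where m=0] eventually_ball_subset[OF x]
  proof eventually_elim
    case (elim r)
    then have "(\<integral>y. w y * bump2 0 r x y - (w y)\<^sup>2 / 2 * bump1 0 r x y \<partial>lebesgue_on (sq s)) = 0"
      using s by (intro limit_burgers_bump) auto
    then have "\<bar>d * I r\<bar> \<le> \<eta> * r" using elim D[of r] by simp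
    moreover have "\<bar>d\<bar> * (k * r) \<le> \<bar>d\<bar> * I r" using elim k by (intro mult_left_mono) auto
    moreover have "\<bar>d\<bar> * I r \<le> \<bar>d * I r\<bar>" by (simp add: abs_mult mult_left_mono)
    ultimately have "\<bar>d\<bar> * (k * r) \<le> \<eta> * r" by linarith
    then have "\<bar>d\<bar> * k * r \<le> \<bar>d\<bar> * k * r / 2" by (simp add: \<eta>_def)
    moreover have "\<bar>d\<bar> * k * r > 0" using elim k \<open>d \<noteq> 0\<close> by simp
    ultimately show False by linarith
  qed
  then show False by simp
qed

text \<open>Across a horizontal line only \<open>\<partial>\<^sub>2 w\<close> can be singular, so
  the limit equation would force \<open>a = b\<close>.\<close>

lemma jump_normal_not_vertical:
  assumes s: "0 \<le> s" "s \<le> 1" and x: "x \<in> box (-s, -s) (1 - s, 1 - s)" and tr: "are_traces w x \<nu> a b"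
  shows "fst \<nu> \<noteq> 0"
proof
  have main: False if tr: "are_traces w x \<nu> a b" and \<nu>: "fst \<nu> = 0" "snd \<nu> > 0" for \<nu> a b
  proof -
    let ?H = "{y :: real \<times> real. snd x \<le> snd y}"
    have eq: "(y - x) \<bullet> \<nu> = (snd y - snd x) * snd \<nu>" for y using \<nu> by (simp add: inner_prod_def)
    have "- (a - b) = 0"
    proof (rule balance_at_jump[OF s x tr])
      show "?H \<in> sets borel" by (intro borel_closed closed_Collect_le continuous_intros)
      show "\<forall>y. (y - x) \<bullet> \<nu> > 0 \<longrightarrow> y \<in> ?H" using \<nu> by (simp add: eq zero_less_mult_iff)
      show "\<forall>y. (y - x) \<bullet> \<nu> < 0 \<longrightarrow> y \<notin> ?H" using \<nu> by (simp add: eq mult_less_0_iff)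
      show "(\<integral>t. bump 0 r x (t, snd x) \<partial>lborel) \<ge> 2/3 * r" if "r > 0" for r
        using horizontal_line_int_ge[OF that, where m=0] by simp
      show "(a - b) * (\<integral>y. indicator ?H y * bump2 0 r x y \<partial>lborel)
         - (a\<^sup>2 / 2 - b\<^sup>2 / 2) * (\<integral>y. indicator ?H y * bump1 0 r x y \<partial>lborel) = - (a - b) * (\<integral>t. bump 0 r x (t, snd x) \<partial>lborel)" if "r > 0" for r
        by (simp add: bump_horizontal_half_plane[OF that] left_diff_distrib)
    qed simp
    then show False using tr by (simp add: are_traces_def)
  qed
  assume 0: "fst \<nu> = 0"
  have "norm \<nu> = 1" using tr by (simp add: are_traces_def)
  with 0 have "snd \<nu> \<noteq> 0" by (auto simp: norm_prod_def)
  then consider "snd \<nu> > 0" | "snd (- \<nu>) > 0" by fastforce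
  then show False
    using main[OF tr 0] main[OF are_traces_swap[OF tr]] 0 by cases auto
qed

lemma half_plane_of_normal:
  assumes "fst \<nu> > 0" "c = snd \<nu> / fst \<nu>"
  shows "\<forall>y. (y - x) \<bullet> \<nu> > 0 \<longrightarrow> y \<in> half_plane c (fst x + c * snd x)"
    and "\<forall>y. (y - x) \<bullet> \<nu> < 0 \<longrightarrow> y \<notin> half_plane c (fst x + c * snd x)"
proof -
  have eq: "(y - x) \<bullet> \<nu> = fst \<nu> * ((fst y + c * snd y) - (fst x + c * snd x))" for y
    using assms by (simp add: inner_prod_def algebra_simps)
  show "\<forall>y. (y - x) \<bullet> \<nu> > 0 \<longrightarrow> y \<in> half_plane c (fst x + c * snd x)"
    unfolding eq half_plane_def using assms(1) by (simp add: zero_less_mult_iff)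
  show "\<forall>y. (y - x) \<bullet> \<nu> < 0 \<longrightarrow> y \<notin> half_plane c (fst x + c * snd x)"
    unfolding eq half_plane_def using assms(1) by (simp add: mult_less_0_iff)
qed

text \<open>Both half plane integrals are multiples of the same \<open>line_int\<close>, so the
  balance reads \<open>(a\<^sup>2 - b\<^sup>2)/2 = c * (a - b)\<close>, and the factor
  \<open>a - b\<close> is nonzero.\<close>

lemma rankine_hugoniot:
  assumes s: "0 \<le> s" "s \<le> 1" and x: "x \<in> box (-s, -s) (1 - s, 1 - s)" and tr: "are_traces w x \<nu> a b"
    and \<nu>: "fst \<nu> > 0"
  shows "snd \<nu> / fst \<nu> = (a + b) / 2"
proof -
  define c where "c = snd \<nu> / fst \<nu>"
  let ?H = "half_plane c (fst x + c * snd x)"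
  have "(a\<^sup>2 / 2 - b\<^sup>2 / 2) - c * (a - b) = 0"
  proof (rule balance_at_jump[OF s x tr half_plane_borel half_plane_of_normal[OF \<nu> c_def]])
    show "2 / sqrt (1 + c\<^sup>2) * (1/3) > 0" by (simp add: add_pos_nonneg)
    show "line_int 0 r x c \<ge> 2 / sqrt (1 + c\<^sup>2) * (1/3) * r" if "r > 0" for r
      using line_int_pos[OF that, of c 0 x] by (simp add: algebra_simps)
    show "(a - b) * (\<integral>y. indicator ?H y * bump2 0 r x y \<partial>lborel)
         - (a\<^sup>2 / 2 - b\<^sup>2 / 2) * (\<integral>y. indicator ?H y * bump1 0 r x y \<partial>lborel) = ((a\<^sup>2 / 2 - b\<^sup>2 / 2) - c * (a - b)) * line_int 0 r x c" if "r > 0" for r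
      by (simp only: bump1_half_plane[OF that] bump2_half_plane[OF that]) (simp add: algebra_simps)
  qed
  then have "(a - b) * ((a + b) / 2 - c) = 0" by (simp add: power2_eq_square field_simps)
  moreover have "a \<noteq> b" using tr by (simp add: are_traces_def)
  ultimately show ?thesis by (simp add: c_def)
qed

text \<open>The chord through the ball contributes its length over
  \<open>sqrt (1 + c\<^sup>2)\<close>, up to a loss that vanishes as \<open>m\<close> grows; the
  strict inequality for \<open>t\<close> leaves room for this loss and for the blow-up error. A
  normal with negative first component is reversed, which swaps the traces but not the cost.\<close>

lemma entropy_density:
  assumes s: "0 \<le> s" "s \<le> 1" and x: "x \<in> box (-s, -s) (1 - s, 1 - s)" and tr: "are_traces w x \<nu> a b"
    and t: "t < jump_cost a b"
  shows "\<exists>m. \<forall>\<^sub>F r in at_right 0. 2 * r * t \<le> \<bar>burgers_flux w s m r x\<bar>"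
proof -
  have main: ?thesis if tr: "are_traces w x \<nu> a b" and t: "t < jump_cost a b" and \<nu>: "fst \<nu> > 0" for \<nu> a b
  proof -
    define c where "c = snd \<nu> / fst \<nu>"
    have c: "c = (a + b) / 2" using rankine_hugoniot[OF s x tr \<nu>] by (simp add: c_def)
    let ?H = "half_plane c (fst x + c * snd x)"
    let ?f = "jump_cost a b"
    have "(\<lambda>m. 2 / (2 * real m + 3)) \<longlonglongrightarrow> 0"
    proof (rule tendsto_sandwich[OF _ _ tendsto_const])
      show "(\<lambda>m. 1 * inverse (real m)) \<longlonglongrightarrow> 0" using tendsto_mult_left[OF lim_inverse_n, of 1] by simp
      show "\<forall>\<^sub>F m in sequentially. 2 / (2 * real m + 3) \<le> 1 * inverse (real m)"
        using eventually_gt_at_top[of 0] by eventually_elim (simp add: field_simps)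
    qed (auto intro!: always_eventually)
    then have "(\<lambda>m. ?f * (1 - 2 / (2 * real m + 3))) \<longlonglongrightarrow> ?f * (1 - 0)"
      by (intro tendsto_intros)
    then have "\<forall>\<^sub>F m in sequentially. t < ?f * (1 - 2 / (2 * real m + 3))"
      by (rule order_tendstoD(1)) (use t in simp)
    then obtain m where m: "t < ?f * (1 - 2 / (2 * real m + 3))"
      by (auto simp: eventually_sequentially)
    \<comment> \<open>Exactly the slack that remains between the lower bound for the flux and
      \<open>2 * r * t\<close>.\<close>
    define \<eta> where "\<eta> = 2 * (?f * (1 - 2 / (2 * real m + 3)) - t)"
    have eta: "\<eta> > 0" using m by (simp add: \<eta>_def)
    have P: "continuous_on UNIV (\<lambda>t::real. t\<^sup>2 / 2)" "locally_Lipschitz (\<lambda>t. t\<^sup>2 / 2)"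
      by (auto intro!: continuous_intros C1_locally_Lipschitz[where P'="\<lambda>t. t"] derivative_eq_intros)
    have Q: "continuous_on UNIV (\<lambda>t::real. t ^ 3 / 3)" "locally_Lipschitz (\<lambda>t. t ^ 3 / 3)"
      by (auto intro!: continuous_intros C1_locally_Lipschitz[where P'="\<lambda>t. t\<^sup>2"] derivative_eq_intros simp: power2_eq_square)
    have "\<forall>\<^sub>F r in at_right 0. 2 * r * t \<le> \<bar>burgers_flux w s m r x\<bar>"
      using blow_up[OF s x tr P Q half_plane_borel half_plane_of_normal[OF \<nu> c_def] eta, where m=m] eventually_ball_subset[OF x]
    proof eventually_elim
      case (elim r)
      then have r: "r > 0" by simp
      let ?I = "line_int m r x c"
      \<comment> \<open>With the slope \<open>c = (a + b)/2\<close> fixed by Rankine--Hugoniot, the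
        entropy jump becomes a pure cube; this is where the 12 arises.\<close>
      have "(a\<^sup>2 / 2 - b\<^sup>2 / 2) * (- c * ?I) - (a ^ 3 / 3 - b ^ 3 / 3) * - ?I = (a - b) ^ 3 / 12 * ?I"
        unfolding c by (simp add: power2_eq_square power3_eq_cube field_simps)
      with elim have close: "\<bar>burgers_flux w s m r x - (a - b) ^ 3 / 12 * ?I\<bar> \<le> \<eta> * r"
        by (simp only: bump1_half_plane[OF r] bump2_half_plane[OF r] burgers_flux_def)
      have f: "?f = \<bar>a - b\<bar> ^ 3 / 12 / sqrt (1 + c\<^sup>2)"
        unfolding jump_cost_def c by (simp add: power_divide)
      have "2 * r * (?f * (1 - 2 / (2 * real m + 3))) = \<bar>a - b\<bar> ^ 3 / 12 * (2 * r / sqrt (1 + c\<^sup>2) * (1 - 2 / (2 * real m + 3)))"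
        unfolding f by (simp only: divide_inverse mult_ac)
      also have "\<dots> \<le> \<bar>a - b\<bar> ^ 3 / 12 * ?I"
        by (intro mult_left_mono line_int_ge[OF r]) auto
      also have "\<dots> \<le> \<bar>(a - b) ^ 3 / 12 * ?I\<bar>"
        by (simp add: abs_mult power_abs mult_left_mono)
      finally have "2 * r * (?f * (1 - 2 / (2 * real m + 3))) \<le> \<bar>burgers_flux w s m r x\<bar> + \<eta> * r"
        using close by linarith
      then show ?case by (simp add: \<eta>_def algebra_simps)
    qed
    then show ?thesis by blast
  qed
  have "fst \<nu> \<noteq> 0" by (rule jump_normal_not_vertical[OF s x tr])
  then consider "fst \<nu> > 0" | "fst (- \<nu>) > 0" by fastforce
  then show ?thesis
    using main[OF tr t] main[OF are_traces_swap[OF tr]] t by cases (auto simp: jump_cost_commute)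
qed

end

section \<open>Covering the jump set\<close>

text \<open>Coverings in the definition are sequences, whereas Vitali families are countable sets.
  Indices that enumerate nothing receive the empty set, of diameter 0, and bounds on finite partial
  sums suffice.\<close>

lemma hausdorff1_pre_countable_le:
  fixes D :: "'c \<Rightarrow> 'a::metric_space set"
  assumes C: "countable C" and A: "A \<subseteq> (\<Union>c\<in>C. D c)"
    and D: "\<And>c. c \<in> C \<Longrightarrow> bounded (D c) \<and> diameter (D c) \<le> h c \<and> h c \<le> \<delta>"
    and \<delta>: "\<delta> \<ge> 0" and S: "\<And>G. finite G \<Longrightarrow> G \<subseteq> C \<Longrightarrow> sum h G \<le> S"
  shows "hausdorff1_pre \<delta> A \<le> ennreal S"
proof -
  define E where "E n = (if n \<in> to_nat_on C ` C then D (from_nat_into C n) else {})" for n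
  have inC: "from_nat_into C n \<in> C" if "n \<in> to_nat_on C ` C" for n
    using that C by auto
  have "A \<subseteq> (\<Union>n. E n)"
  proof
    fix x assume "x \<in> A"
    then obtain c where c: "c \<in> C" "x \<in> D c" using A by blast
    then have "x \<in> E (to_nat_on C c)" using C by (simp add: E_def)
    then show "x \<in> (\<Union>n. E n)" by blast
  qed
  moreover have "bounded (E n) \<and> diameter (E n) \<le> \<delta>" for n
  proof (cases "n \<in> to_nat_on C ` C")
    case True
    then show ?thesis using D[OF inC[OF True]] by (simp add: E_def)
  qed (use \<delta> in \<open>simp add: E_def\<close>)
  ultimately have "hausdorff1_pre \<delta> A \<le> (\<Sum>n. ennreal (diameter (E n)))"
    by (rule hausdorff1_pre_le)
  also have "\<dots> \<le> ennreal S"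
  proof (rule suminf_le_const[OF summableI])
    fix n
    let ?N = "{..<n} \<inter> to_nat_on C ` C"
    have "(\<Sum>i<n. ennreal (diameter (E i))) = (\<Sum>i\<in>?N. ennreal (diameter (E i)))"
      by (rule sum.mono_neutral_right) (auto simp: E_def)
    also have "\<dots> \<le> (\<Sum>i\<in>?N. ennreal (h (from_nat_into C i)))"
    proof (intro sum_mono ennreal_leI)
      fix i assume "i \<in> ?N"
      then show "diameter (E i) \<le> h (from_nat_into C i)"
        using D[OF inC[of i]] by (auto simp: E_def)
    qed
    also have "\<dots> = ennreal (\<Sum>i\<in>?N. h (from_nat_into C i))"
    proof (rule sum_ennreal)
      fix i assume "i \<in> ?N"
      then have "0 \<le> diameter (D (from_nat_into C i))" "from_nat_into C i \<in> C"
        using D inC by (auto intro!: diameter_ge_0)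
      then show "0 \<le> h (from_nat_into C i)" using D[of "from_nat_into C i"] by linarith
    qed
    also have "(\<Sum>i\<in>?N. h (from_nat_into C i)) = sum h (from_nat_into C ` ?N)"
    proof (rule sum.reindex[symmetric, unfolded o_def])
      show "inj_on (from_nat_into C) ?N" by (rule inj_onI) (use C in auto)
    qed
    also have "ennreal \<dots> \<le> ennreal S"
      using inC by (intro ennreal_leI S) auto
    finally show "(\<Sum>i<n. ennreal (diameter (E i))) \<le> ennreal S" .
  qed
  finally show ?thesis .
qed

text \<open>Choose a finite set whose sum is within \<open>e\<close> of the supremum of all finite
  sums: anything disjoint that is added to it still stays below the supremum.\<close>

lemma finite_sum_almost_sup:
  fixes h :: "'c \<Rightarrow> real"
  assumes nonneg: "\<And>c. c \<in> C \<Longrightarrow> h c \<ge> 0" and bd: "\<And>G. finite G \<Longrightarrow> G \<subseteq> C \<Longrightarrow> sum h G \<le> B" and "e > 0"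
  shows "\<exists>F. finite F \<and> F \<subseteq> C \<and> (\<forall>G. finite G \<and> G \<subseteq> C - F \<longrightarrow> sum h G \<le> e)"
proof -
  let ?X = "{sum h G | G. finite G \<and> G \<subseteq> C}"
  have ne: "?X \<noteq> {}" and ba: "bdd_above ?X" using bd by (auto simp: bdd_above_def)
  have "Sup ?X - e < Sup ?X" using \<open>e > 0\<close> by simp
  then obtain F where F: "finite F" "F \<subseteq> C" "Sup ?X - e < sum h F"
    unfolding less_cSup_iff[OF ne ba] by blast
  have "sum h G \<le> e" if G: "finite G \<and> G \<subseteq> C - F" for G
  proof -
    have "sum h (F \<union> G) \<le> Sup ?X"
      using F G by (intro cSup_upper[OF _ ba]) blast
    moreover have "sum h (F \<union> G) = sum h F + sum h G"
      using F G by (intro sum.union_disjoint) auto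
    ultimately show ?thesis using F(3) by linarith
  qed
  then show ?thesis using F(1,2) by blast
qed

text \<open>The outcome of the Vitali covering lemma for pairs of centre and radius. That each ball
  meets the selected ball whose enlargement contains it is kept, because it tells which selected
  balls are ruled out for a ball avoiding finitely many of them.\<close>

definition vitali_selection :: "('b::euclidean_space \<times> real) set \<Rightarrow> ('b \<times> real) set \<Rightarrow> bool" where
  "vitali_selection B C \<longleftrightarrow> countable C \<and> C \<subseteq> B \<and>
    (\<forall>c\<in>C. \<forall>c'\<in>C. c \<noteq> c' \<longrightarrow> cball (fst c) (snd c) \<inter> cball (fst c') (snd c') = {}) \<and>
    (\<forall>c\<in>B. \<exists>j\<in>C. cball (fst c) (snd c) \<inter> cball (fst j) (snd j) \<noteq> {} \<and>
         cball (fst c) (snd c) \<subseteq> ball (fst j) (5 * snd j))"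

lemma vitali_selection_exists:
  fixes B :: "('b::euclidean_space \<times> real) set"
  assumes B: "\<And>c. c \<in> B \<Longrightarrow> 0 < snd c \<and> snd c \<le> \<delta>"
  shows "\<exists>C. vitali_selection B C"
proof (rule Vitali_covering_lemma_cballs_balls[where K=B and r=snd and a=fst, OF B])
  fix C assume C: "countable C" "C \<subseteq> B"
    "pairwise (\<lambda>c c'. disjnt (cball (fst c) (snd c)) (cball (fst c') (snd c'))) C"
    "\<And>c. c \<in> B \<Longrightarrow> \<exists>j. j \<in> C \<and> \<not> disjnt (cball (fst c) (snd c)) (cball (fst j) (snd j)) \<and>
         cball (fst c) (snd c) \<subseteq> ball (fst j) (5 * snd j)"
  have "vitali_selection B C"
    unfolding vitali_selection_def
  proof (intro conjI ballI impI)
    fix c c' assume "c \<in> C" "c' \<in> C" "c \<noteq> c'"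
    then show "cball (fst c) (snd c) \<inter> cball (fst c') (snd c') = {}"
      by (rule C(3)[unfolded pairwise_def disjnt_def, rule_format])
  next
    fix c assume "c \<in> B"
    from C(4)[OF this] show "\<exists>j\<in>C. cball (fst c) (snd c) \<inter> cball (fst j) (snd j) \<noteq> {} \<and>
         cball (fst c) (snd c) \<subseteq> ball (fst j) (5 * snd j)"
      unfolding disjnt_def Bex_def .
  qed (rule C)+
  then show "\<exists>C. vitali_selection B C" ..
qed

lemma vitali_selectionD:
  assumes "vitali_selection B C"
  shows "countable C" "C \<subseteq> B"
    "c \<in> C \<Longrightarrow> c' \<in> C \<Longrightarrow> c \<noteq> c' \<Longrightarrow> cball (fst c) (snd c) \<inter> cball (fst c') (snd c') = {}"
    "c \<in> B \<Longrightarrow> \<exists>j\<in>C. cball (fst c) (snd c) \<inter> cball (fst j) (snd j) \<noteq> {} \<and>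
         cball (fst c) (snd c) \<subseteq> ball (fst j) (5 * snd j)"
  using assms unfolding vitali_selection_def by blast+

context low_energy_limit
begin

lemma burgers_flux_integrable:
  assumes s: "0 \<le> s" "s \<le> 1" and r: "r > 0"
  shows "integrable (lebesgue_on (sq s)) (\<lambda>y. (w y)\<^sup>2 / 2 * bump2 m r x y - (w y) ^ 3 / 3 * bump1 m r x y)"
proof -
  have m: "w \<in> borel_measurable (lebesgue_on (sq s))" and i2: "integrable (lebesgue_on (sq s)) (\<lambda>y. (w y)\<^sup>2)"
    using square_integrable_sq[OF w_props(3) s] by auto
  have i3: "integrable (lebesgue_on (sq s)) (\<lambda>y. (w y) ^ 3)"
  proof (rule Bochner_Integration.integrable_bound[of _ "\<lambda>y. R * (w y)\<^sup>2"])
    show "AE y in lebesgue_on (sq s). norm ((w y) ^ 3) \<le> norm (R * (w y)\<^sup>2)"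
      using AE_periodic_sq[OF w_props(1,2) w_bound s]
    proof eventually_elim
      case (elim y)
      then have "\<bar>w y\<bar> * (w y)\<^sup>2 \<le> R * (w y)\<^sup>2" by (intro mult_right_mono) auto
      then show ?case using R_nonneg by (simp add: power3_eq_cube power2_eq_square abs_mult)
    qed
  qed (use m i2 in auto)
  have mb: "b \<in> borel_measurable (lebesgue_on (sq s))" if "continuous_on UNIV b" for b :: "real \<times> real \<Rightarrow> real"
    using continuous_integrable_sq(1)[OF that, of s] by auto
  have "integrable (lebesgue_on (sq s)) (\<lambda>y. (w y)\<^sup>2 / 2 * bump2 m r x y)"
    by (rule bounded_mult_integrable[OF _ mb[OF continuous_on_bump(3)] abs_bump_deriv_le(2)[OF r]]) (use i2 in simp)
  moreover have "integrable (lebesgue_on (sq s)) (\<lambda>y. (w y) ^ 3 / 3 * bump1 m r x y)"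
    by (rule bounded_mult_integrable[OF _ mb[OF continuous_on_bump(2)] abs_bump_deriv_le(1)[OF r]]) (use i3 in simp)
  ultimately show ?thesis by (rule Bochner_Integration.integrable_diff)
qed

text \<open>On disjoint balls the bumps, each multiplied by the sign of its own flux, add up to one
  admissible test function bounded by 1, whose flux is the sum of the absolute values.\<close>

lemma sum_burgers_flux_le:
  assumes s: "0 \<le> s" "s \<le> 1" and F: "finite F" "\<And>i. i \<in> F \<Longrightarrow> r i > 0"
    and ball: "\<And>i. i \<in> F \<Longrightarrow> ball (x i) (r i) \<subseteq> box (-s, -s) (1 - s, 1 - s)"
    and disj: "\<And>i j. i \<in> F \<Longrightarrow> j \<in> F \<Longrightarrow> i \<noteq> j \<Longrightarrow> ball (x i) (r i) \<inter> ball (x j) (r j) = {}"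
  shows "(\<Sum>i\<in>F. \<bar>burgers_flux w s (m i) (r i) (x i)\<bar>) \<le> \<Lambda>"
proof -
  define \<sigma> where "\<sigma> i = sgn (burgers_flux w s (m i) (r i) (x i))" for i
  let ?b = "\<lambda>y. \<Sum>i\<in>F. \<sigma> i * bump (m i) (r i) (x i) y"
  let ?b1 = "\<lambda>y. \<Sum>i\<in>F. \<sigma> i * bump1 (m i) (r i) (x i) y"
  let ?b2 = "\<lambda>y. \<Sum>i\<in>F. \<sigma> i * bump2 (m i) (r i) (x i) y"
  have "cutoff s ?b ?b1 ?b2"
  proof
    show "continuous_on UNIV ?b" "continuous_on UNIV ?b1" "continuous_on UNIV ?b2"
      by (intro continuous_intros)+
    show "((\<lambda>t. ?b (t, b)) has_real_derivative ?b1 (a, b)) (at a)" for a b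
      by (intro DERIV_sum DERIV_cmult bump_deriv1)
    show "((\<lambda>t. ?b (a, t)) has_real_derivative ?b2 (a, b)) (at b)" for a b
      by (intro DERIV_sum DERIV_cmult bump_deriv2)
    show "?b y = 0" if "y \<notin> box (-s, -s) (1 - s, 1 - s)" for y
    proof (intro sum.neutral ballI)
      fix i assume i: "i \<in> F"
      then have "y \<notin> ball (x i) (r i)" using ball that by blast
      then show "\<sigma> i * bump (m i) (r i) (x i) y = 0" using bump_eq_0(1)[OF F(2)[OF i]] by simp
    qed
    show "\<bar>?b y\<bar> \<le> 1" for y
    proof (cases "\<exists>j\<in>F. y \<in> ball (x j) (r j)")
      case True
      then obtain j where j: "j \<in> F" "y \<in> ball (x j) (r j)" by blast
      have "?b y = (\<Sum>i\<in>{j}. \<sigma> i * bump (m i) (r i) (x i) y)"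
      proof (rule sum.mono_neutral_right[OF F(1)])
        show "\<forall>i\<in>F - {j}. \<sigma> i * bump (m i) (r i) (x i) y = 0"
        proof
          fix i assume i: "i \<in> F - {j}"
          then have "y \<notin> ball (x i) (r i)" using disj[of i j] j by blast
          then show "\<sigma> i * bump (m i) (r i) (x i) y = 0" using bump_eq_0(1)[OF F(2)[of i]] i by simp
        qed
      qed (use j in auto)
      then have "\<bar>?b y\<bar> = \<bar>\<sigma> j\<bar> * bump (m j) (r j) (x j) y"
        by (simp add: abs_mult bump_nonneg)
      also have "\<dots> \<le> 1 * 1"
        by (intro mult_mono bump_le_1 bump_nonneg) (auto simp: \<sigma>_def sgn_if)
      finally show ?thesis by simp
    next
      case False
      have "?b y = 0"
      proof (intro sum.neutral ballI)
        fix i assume i: "i \<in> F"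
        then show "\<sigma> i * bump (m i) (r i) (x i) y = 0" using bump_eq_0(1)[OF F(2)[OF i]] False by simp
      qed
      then show ?thesis by simp
    qed
  qed (use s in auto)
  then have le: "\<bar>\<integral>y. (w y)\<^sup>2 / 2 * ?b2 y - (w y) ^ 3 / 3 * ?b1 y \<partial>lebesgue_on (sq s)\<bar> \<le> \<Lambda>"
    by (rule limit_entropy_le)
  have "(\<lambda>y. (w y)\<^sup>2 / 2 * ?b2 y - (w y) ^ 3 / 3 * ?b1 y) =
      (\<lambda>y. \<Sum>i\<in>F. \<sigma> i * ((w y)\<^sup>2 / 2 * bump2 (m i) (r i) (x i) y - (w y) ^ 3 / 3 * bump1 (m i) (r i) (x i) y))"
    by (simp add: sum_distrib_left right_diff_distrib sum_subtractf algebra_simps)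
  then have "(\<integral>y. (w y)\<^sup>2 / 2 * ?b2 y - (w y) ^ 3 / 3 * ?b1 y \<partial>lebesgue_on (sq s)) =
      (\<Sum>i\<in>F. \<sigma> i * burgers_flux w s (m i) (r i) (x i))"
    unfolding burgers_flux_def using burgers_flux_integrable[OF s F(2)]
    by (simp only:) (subst Bochner_Integration.integral_sum, auto)
  also have "\<dots> = (\<Sum>i\<in>F. \<bar>burgers_flux w s (m i) (r i) (x i)\<bar>)"
    by (intro sum.cong) (auto simp: \<sigma>_def abs_sgn mult.commute)
  finally show ?thesis using le by linarith
qed

text \<open>Vitali coverings at scale \<open>\<delta>\<close>; the sharp constant survives because all but finitely many of the
  disjoint balls have arbitrarily small total radius.\<close>

lemma sum_hausdorff1_pre_le:
  fixes A U :: "'i \<Rightarrow> (real \<times> real) set" and t :: "'i \<Rightarrow> real"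
  assumes s: "0 \<le> s" "s \<le> 1" and I: "finite I" and \<delta>: "\<delta> > 0"
    and t: "\<And>i. i \<in> I \<Longrightarrow> t i > 0"
    and U: "\<And>i. i \<in> I \<Longrightarrow> open (U i) \<and> A i \<subseteq> U i" "\<And>i j. i \<in> I \<Longrightarrow> j \<in> I \<Longrightarrow> i \<noteq> j \<Longrightarrow> U i \<inter> U j = {}"
    and A: "\<And>i x. i \<in> I \<Longrightarrow> x \<in> A i \<Longrightarrow> x \<in> box (-s, -s) (1 - s, 1 - s) \<and> x \<in> jump_set w \<and>
         t i < jump_cost (trace_plus w x) (trace_minus w x)"
  shows "(\<Sum>i\<in>I. ennreal (t i) * hausdorff1_pre (10 * \<delta>) (A i)) \<le> ennreal \<Lambda>"
proof -
  \<comment> \<open>Good balls: each carries at least its share \<open>2 * r * t i\<close> of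
    entropy production. Lying inside \<open>U i\<close>, balls for different indices are disjoint
    automatically.\<close>
  define K where "K i = {(x, r). x \<in> A i \<and> 0 < r \<and> r \<le> \<delta> \<and> cball x r \<subseteq> U i \<inter> box (-s, -s) (1 - s, 1 - s)
      \<and> (\<exists>m. 2 * r * t i \<le> \<bar>burgers_flux w s m r x\<bar>)}" for i
  have fine: "\<exists>r<\<rho>. (x, r) \<in> K i" if i: "i \<in> I" and x: "x \<in> A i" and "\<rho> > 0" for i x \<rho>
  proof -
    have xs: "x \<in> box (-s, -s) (1 - s, 1 - s)" "x \<in> jump_set w" "t i < jump_cost (trace_plus w x) (trace_minus w x)"
      using A[OF i x] by auto
    obtain m where m: "\<forall>\<^sub>F r in at_right 0. 2 * r * t i \<le> \<bar>burgers_flux w s m r x\<bar>"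
      using entropy_density[OF s xs(1) traces_eq[OF w_lebesgue xs(2)] xs(3)] by blast
    have "open (U i \<inter> box (-s, -s) (1 - s, 1 - s))" using U(1)[OF i] by auto
    then obtain r0 where r0: "r0 > 0" "cball x r0 \<subseteq> U i \<inter> box (-s, -s) (1 - s, 1 - s)"
      using U(1)[OF i] x xs(1) by (meson IntI open_contains_cball subsetD)
    have "\<forall>\<^sub>F r in at_right 0. r \<in> {0<..<min \<rho> (min \<delta> r0)}"
      using \<open>\<rho> > 0\<close> \<delta> r0(1) by (intro eventually_at_right_real) auto
    with m have "\<forall>\<^sub>F r in at_right 0. r < \<rho> \<and> (x, r) \<in> K i"
    proof eventually_elim
      case (elim r)
      then have "cball x r \<subseteq> cball x r0" by (intro subset_cball) auto
      then show ?case using elim r0(2) x by (auto simp: K_def)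
    qed
    then have "\<exists>r. r < \<rho> \<and> (x, r) \<in> K i"
      by (rule eventually_happens'[OF trivial_limit_at_right_real])
    then show ?thesis by blast
  qed
  have K_pos: "0 < snd c \<and> snd c \<le> \<delta>" if "c \<in> K i" for i c
    using that by (auto simp: K_def)
  define C where "C i = (SOME C. vitali_selection (K i) C)" for i
  have VC: "vitali_selection (K i) (C i)" for i
    unfolding C_def by (rule someI_ex[OF vitali_selection_exists[OF K_pos]])
  note C = vitali_selectionD[OF VC]
  \<comment> \<open>The only place where the energy enters. Balls selected for one index are
    disjoint by Vitali's lemma, those for different indices by the \<open>U i\<close>, so all their
    productions are summed at once.\<close>
  have energy: "(\<Sum>i\<in>I. \<Sum>c\<in>F i. 2 * snd c * t i) \<le> \<Lambda>" if F: "\<And>i. i \<in> I \<Longrightarrow> finite (F i) \<and> F i \<subseteq> C i" for F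
  proof -
    have inK: "c \<in> K i" if "i \<in> I" "c \<in> F i" for i c using F that C(2) by blast
    define m where "m i c = (SOME m. 2 * snd c * t i \<le> \<bar>burgers_flux w s m (snd c) (fst c)\<bar>)" for i c
    have m: "2 * snd c * t i \<le> \<bar>burgers_flux w s (m i c) (snd c) (fst c)\<bar>" if "i \<in> I" "c \<in> F i" for i c
    proof -
      have "\<exists>m. 2 * snd c * t i \<le> \<bar>burgers_flux w s m (snd c) (fst c)\<bar>"
        using inK[OF that] by (auto simp: K_def)
      then show ?thesis unfolding m_def by (rule someI_ex)
    qed
    have "(\<Sum>i\<in>I. \<Sum>c\<in>F i. 2 * snd c * t i) \<le> (\<Sum>i\<in>I. \<Sum>c\<in>F i. \<bar>burgers_flux w s (m i c) (snd c) (fst c)\<bar>)"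
      by (intro sum_mono m)
    also have "\<dots> = (\<Sum>p\<in>Sigma I F. \<bar>burgers_flux w s (m (fst p) (snd p)) (snd (snd p)) (fst (snd p))\<bar>)"
      using F I by (subst sum.Sigma) (auto simp: case_prod_unfold)
    also have "\<dots> \<le> \<Lambda>"
    proof (rule sum_burgers_flux_le[OF s])
      have pI: "fst p \<in> I" "snd p \<in> F (fst p)" if "p \<in> Sigma I F" for p
        using that by auto
      have pK: "snd p \<in> K (fst p)" if "p \<in> Sigma I F" for p
        using pI[OF that] by (rule inK)
      show "finite (Sigma I F)" using I F by auto
      show "0 < snd (snd p)" if "p \<in> Sigma I F" for p
        using pK[OF that] K_pos by blast
      show "ball (fst (snd p)) (snd (snd p)) \<subseteq> box (-s, -s) (1 - s, 1 - s)" if "p \<in> Sigma I F" for p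
      proof -
        have "snd p \<in> K (fst p)" using that by (rule pK)
        then have "cball (fst (snd p)) (snd (snd p)) \<subseteq> box (-s, -s) (1 - s, 1 - s)" by (auto simp: K_def)
        then show ?thesis using ball_subset_cball by blast
      qed
      fix p p' assume p: "p \<in> Sigma I F" "p' \<in> Sigma I F" "p \<noteq> p'"
      have sub: "ball (fst (snd p)) (snd (snd p)) \<subseteq> U (fst p)" if "p \<in> Sigma I F" for p
      proof -
        have "snd p \<in> K (fst p)" using that by (rule pK)
        then have "cball (fst (snd p)) (snd (snd p)) \<subseteq> U (fst p)" by (auto simp: K_def)
        then show ?thesis using ball_subset_cball by blast
      qed
      show "ball (fst (snd p)) (snd (snd p)) \<inter> ball (fst (snd p')) (snd (snd p')) = {}"
      proof (cases "fst p = fst p'")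
        case True
        then have "snd p \<noteq> snd p'" using p(3) by (simp add: prod_eq_iff)
        moreover have "snd p \<in> C (fst p)" "snd p' \<in> C (fst p)"
          using pI[OF p(1)] pI[OF p(2)] F[of "fst p"] unfolding True by blast+
        ultimately have "cball (fst (snd p)) (snd (snd p)) \<inter> cball (fst (snd p')) (snd (snd p')) = {}"
          by (intro vitali_selectionD(3)[OF VC[of "fst p"]])
        then show ?thesis
          using ball_subset_cball[of "fst (snd p)" "snd (snd p)"] ball_subset_cball[of "fst (snd p')" "snd (snd p')"]
          by blast
      next
        case False
        then have "U (fst p) \<inter> U (fst p') = {}" using pI p by (intro U(2)) auto
        then show ?thesis using sub[OF p(1)] sub[OF p(2)] by blast
      qed
    qed
    finally show ?thesis .
  qed
  have approx: "\<exists>F. finite F \<and> F \<subseteq> C i \<and> hausdorff1_pre (10 * \<delta>) (A i) \<le> ennreal ((\<Sum>c\<in>F. 2 * snd c) + 5 * \<kappa>)"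
    if i: "i \<in> I" and \<kappa>: "\<kappa> > 0" for i \<kappa>
  proof -
    have r0: "snd c > 0 \<and> snd c \<le> \<delta>" if "c \<in> C i" for c
      using that C(2)[of i] K_pos by blast
    have bd: "(\<Sum>c\<in>G. 2 * snd c) \<le> \<Lambda> / t i" if G: "finite G" "G \<subseteq> C i" for G
    proof -
      \<comment> \<open>\<open>energy\<close> for a family that is empty at every index other than
        \<open>i\<close>.\<close>
      have "(\<Sum>j\<in>I. \<Sum>c\<in>(if j = i then G else {}). 2 * snd c * t j) \<le> \<Lambda>"
        by (rule energy) (use G in auto)
      moreover have "(\<Sum>j\<in>I. \<Sum>c\<in>(if j = i then G else {}). 2 * snd c * t j) = (\<Sum>c\<in>G. 2 * snd c * t i)"
        using I i by (simp add: if_distribR sum.If_cases if_distrib[where f="sum _"] sum.delta cong: if_cong)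
      ultimately have "(\<Sum>c\<in>G. 2 * snd c) * t i \<le> \<Lambda>" by (simp add: sum_distrib_right)
      then show ?thesis using t[OF i] by (simp add: field_simps)
    qed
    have nn: "0 \<le> 2 * snd c" if "c \<in> C i" for c using r0[OF that] by simp
    have "\<exists>F. finite F \<and> F \<subseteq> C i \<and> (\<forall>G. finite G \<and> G \<subseteq> C i - F \<longrightarrow> (\<Sum>c\<in>G. 2 * snd c) \<le> \<kappa>)"
      by (rule finite_sum_almost_sup[of "C i" "\<lambda>c. 2 * snd c", OF nn bd \<kappa>])
    then obtain F where F: "finite F" "F \<subseteq> C i" "\<forall>G. finite G \<and> G \<subseteq> C i - F \<longrightarrow> (\<Sum>c\<in>G. 2 * snd c) \<le> \<kappa>"
      by (elim exE conjE)
    \<comment> \<open>The finitely many balls in \<open>F\<close> keep their size, so they enter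
      with their true diameter. All others are enlarged five times, at a total cost of at most
      \<open>5 * \<kappa>\<close>; their diameters \<open>10 * snd c\<close> explain the scale
      \<open>10 * \<delta>\<close>.\<close>
    let ?D = "\<lambda>c. if c \<in> F then cball (fst c) (snd c) else ball (fst c) (5 * snd c)"
    let ?h = "\<lambda>c. if c \<in> F then 2 * snd c else 10 * snd c"
    have "hausdorff1_pre (10 * \<delta>) (A i) \<le> ennreal ((\<Sum>c\<in>F. 2 * snd c) + 5 * \<kappa>)"
    proof (rule hausdorff1_pre_countable_le[OF C(1)[of i], where D="?D" and h="?h"])
      show "bounded (?D c) \<and> diameter (?D c) \<le> ?h c \<and> ?h c \<le> 10 * \<delta>" if "c \<in> C i" for c
        using r0[OF that] \<delta> by auto
      show "0 \<le> 10 * \<delta>" using \<delta> by simp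
      show "sum ?h G \<le> (\<Sum>c\<in>F. 2 * snd c) + 5 * \<kappa>" if G: "finite G" "G \<subseteq> C i" for G
      proof -
        have "sum ?h G = sum ?h (G \<inter> F) + sum ?h (G - F)"
          using G by (intro sum.Int_Diff)
        moreover have "sum ?h (G \<inter> F) = (\<Sum>c\<in>G \<inter> F. 2 * snd c)" by (rule sum.cong[OF refl]) simp
        moreover have "(\<Sum>c\<in>G \<inter> F. 2 * snd c) \<le> (\<Sum>c\<in>F. 2 * snd c)"
          by (rule sum_mono2[OF F(1)]) (use F(2) nn in blast)+
        moreover have "sum ?h (G - F) = (\<Sum>c\<in>G - F. 5 * (2 * snd c))"
          by (rule sum.cong[OF refl]) simp
        moreover have "(\<Sum>c\<in>G - F. 5 * (2 * snd c)) = 5 * (\<Sum>c\<in>G - F. 2 * snd c)"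
          by (rule sum_distrib_left[symmetric])
        moreover have "(\<Sum>c\<in>G - F. 2 * snd c) \<le> \<kappa>" by (rule F(3)[rule_format]) (use G in auto)
        ultimately show ?thesis by linarith
      qed
      show "A i \<subseteq> (\<Union>c\<in>C i. ?D c)"
      proof
        fix x assume x: "x \<in> A i"
        show "x \<in> (\<Union>c\<in>C i. ?D c)"
        proof (cases "x \<in> (\<Union>c\<in>F. cball (fst c) (snd c))")
          case True
          then show ?thesis using F(2) by force
        next
          case False
          \<comment> \<open>A point outside the finitely many closed balls of \<open>F\<close> has a
            good ball that misses them all. The selected ball meeting it is then not in
            \<open>F\<close>, hence enlarged, and contains the point.\<close>
          let ?W = "- (\<Union>c\<in>F. cball (fst c) (snd c))"
          have "open ?W" using F(1) by (intro open_Compl closed_UN) auto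
          then obtain \<rho> where \<rho>: "\<rho> > 0" "ball x \<rho> \<subseteq> ?W" 
            using False openE[of ?W x] by blast
          obtain r where r: "r < \<rho>" "(x, r) \<in> K i" using fine[OF i x \<rho>(1)] by blast
          obtain j where j: "j \<in> C i" "cball x r \<inter> cball (fst j) (snd j) \<noteq> {}" "cball x r \<subseteq> ball (fst j) (5 * snd j)"
            using C(4)[OF r(2)] by auto
          have "cball x r \<subseteq> ?W" using r(1) \<rho>(2) by (auto simp: subset_iff)
          then have "j \<notin> F" using j(2) by blast
          moreover have "x \<in> ball (fst j) (5 * snd j)"
            using j(3) K_pos[OF r(2)] by (intro subsetD[OF j(3)]) simp
          ultimately have "x \<in> ?D j" by simp
          with j(1) show ?thesis by (rule UN_I)
        qed
      qed
    qed
    then show ?thesis using F(1,2) by blast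
  qed
  define T where "T = (\<Sum>i\<in>I. t i)"
  have T: "T \<ge> 0" unfolding T_def by (intro sum_nonneg) (use t in \<open>auto intro: less_imp_le\<close>)
  show ?thesis
  proof (rule ennreal_le_epsilon)
    fix e :: real assume e: "0 < e"
    define \<kappa> where "\<kappa> = e / (5 * (T + 1))"
    have \<kappa>: "\<kappa> > 0" using e T by (simp add: \<kappa>_def)
    have \<kappa>T: "5 * \<kappa> * T \<le> e"
      using e T by (simp add: \<kappa>_def field_simps)
    define F where "F i = (SOME F. finite F \<and> F \<subseteq> C i \<and>
      hausdorff1_pre (10 * \<delta>) (A i) \<le> ennreal ((\<Sum>c\<in>F. 2 * snd c) + 5 * \<kappa>))" for i
    have F: "finite (F i) \<and> F i \<subseteq> C i \<and> hausdorff1_pre (10 * \<delta>) (A i) \<le> ennreal ((\<Sum>c\<in>F i. 2 * snd c) + 5 * \<kappa>)"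
      if "i \<in> I" for i
      unfolding F_def by (rule someI_ex[OF approx[OF that \<kappa>]])
    have pos: "0 \<le> (\<Sum>c\<in>F i. 2 * snd c)" if "i \<in> I" for i
    proof (rule sum_nonneg)
      fix c assume "c \<in> F i"
      then have "c \<in> K i" using F[OF that] C(2)[of i] by blast
      then show "0 \<le> 2 * snd c" using K_pos[of c i] by simp
    qed
    have "(\<Sum>i\<in>I. ennreal (t i) * hausdorff1_pre (10 * \<delta>) (A i)) \<le> (\<Sum>i\<in>I. ennreal (t i) * ennreal ((\<Sum>c\<in>F i. 2 * snd c) + 5 * \<kappa>))"
      using F by (intro sum_mono mult_left_mono) auto
    also have "\<dots> = (\<Sum>i\<in>I. ennreal (t i * ((\<Sum>c\<in>F i. 2 * snd c) + 5 * \<kappa>)))"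
      using t pos \<kappa> by (intro sum.cong) (auto simp: ennreal_mult less_imp_le add_nonneg_nonneg)
    also have "\<dots> = ennreal (\<Sum>i\<in>I. t i * ((\<Sum>c\<in>F i. 2 * snd c) + 5 * \<kappa>))"
      using t pos \<kappa> by (intro sum_ennreal mult_nonneg_nonneg add_nonneg_nonneg) (auto intro: less_imp_le)
    also have "(\<Sum>i\<in>I. t i * ((\<Sum>c\<in>F i. 2 * snd c) + 5 * \<kappa>)) = (\<Sum>i\<in>I. (\<Sum>c\<in>F i. 2 * snd c * t i) + 5 * \<kappa> * t i)"
      by (rule sum.cong[OF refl]) (simp add: distrib_left sum_distrib_left sum_distrib_right mult.commute)
    also have "\<dots> = (\<Sum>i\<in>I. \<Sum>c\<in>F i. 2 * snd c * t i) + 5 * \<kappa> * T"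
      unfolding T_def sum.distrib sum_distrib_left ..
    also have "ennreal \<dots> \<le> ennreal (\<Lambda> + e)"
      using energy[of F] F \<kappa>T by (intro ennreal_leI add_mono) auto
    also have "\<dots> = ennreal \<Lambda> + ennreal e" using \<Lambda>_nonneg e by (intro ennreal_plus) auto
    finally show "(\<Sum>i\<in>I. ennreal (t i) * hausdorff1_pre (10 * \<delta>) (A i)) \<le> ennreal \<Lambda> + ennreal e" .
  qed
qed

end

section \<open>From coverings at a fixed scale to the integral over the jump set\<close>

lemma hausdorff1_outer_tendsto:
  "(\<lambda>n. hausdorff1_pre (1 / Suc n) A) \<longlonglongrightarrow> hausdorff1_outer A"
proof -
  have "incseq (\<lambda>n. hausdorff1_pre (1 / Suc n) A)"
    by (intro incseq_SucI hausdorff1_pre_antimono) (simp add: frac_le)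
  then have "(\<lambda>n. hausdorff1_pre (1 / Suc n) A) \<longlonglongrightarrow> (SUP n. hausdorff1_pre (1 / Suc n) A)"
    by (rule LIMSEQ_SUP)
  moreover have "(SUP n. hausdorff1_pre (1 / Suc n) A) = hausdorff1_outer A"
    unfolding hausdorff1_outer_def
  proof (rule antisym)
    show "(SUP n. hausdorff1_pre (1 / Suc n) A) \<le> (SUP \<delta>\<in>{0<..}. hausdorff1_pre \<delta> A)"
      by (rule SUP_least, rule SUP_upper) simp
    show "(SUP \<delta>\<in>{0<..}. hausdorff1_pre \<delta> A) \<le> (SUP n. hausdorff1_pre (1 / Suc n) A)"
    proof (rule SUP_least)
      fix \<delta> :: real assume "\<delta> \<in> {0<..}"
      then obtain n where "1 / Suc n < \<delta>" using nat_approx_posE[of \<delta>] by auto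
      then have "hausdorff1_pre \<delta> A \<le> hausdorff1_pre (1 / Suc n) A"
        by (intro hausdorff1_pre_antimono) simp
      also have "\<dots> \<le> (SUP n. hausdorff1_pre (1 / Suc n) A)" by (rule SUP_upper) simp
      finally show "hausdorff1_pre \<delta> A \<le> (SUP n. hausdorff1_pre (1 / Suc n) A)" .
    qed
  qed
  ultimately show ?thesis by simp
qed

text \<open>Voronoi cells: the points nearer to \<open>C i\<close> than to any other set of the
  family. Empty sets are excluded because \<open>infdist\<close> to the empty set is 0.\<close>

lemma disjoint_open_neighbourhoods:
  fixes C :: "'i \<Rightarrow> 'a::metric_space set"
  assumes I: "finite I" and C: "\<And>i. i \<in> I \<Longrightarrow> closed (C i)" "\<And>i. i \<in> I \<Longrightarrow> C i \<noteq> {}"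
    and disj: "\<And>i j. i \<in> I \<Longrightarrow> j \<in> I \<Longrightarrow> i \<noteq> j \<Longrightarrow> C i \<inter> C j = {}"
  shows "\<exists>U. (\<forall>i\<in>I. open (U i) \<and> C i \<subseteq> U i) \<and> (\<forall>i\<in>I. \<forall>j\<in>I. i \<noteq> j \<longrightarrow> U i \<inter> U j = {})"
proof -
  define U where "U i = (\<Inter>j\<in>I - {i}. {x. infdist x (C i) < infdist x (C j)})" for i
  have "open (U i) \<and> C i \<subseteq> U i" if i: "i \<in> I" for i
  proof
    show "open (U i)" unfolding U_def
      using I by (intro open_INT ballI open_Collect_less continuous_intros) auto
    show "C i \<subseteq> U i"
    proof
      fix x assume x: "x \<in> C i"
      have "infdist x (C i) < infdist x (C j)" if "j \<in> I - {i}" for j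
      proof -
        have "x \<notin> C j" using disj[of i j] i that x by blast
        then have "infdist x (C j) \<noteq> 0"
          using in_closed_iff_infdist_zero[of "C j" x] C that by blast
        then show ?thesis using infdist_nonneg[of x "C j"] x by simp
      qed
      then show "x \<in> U i" by (simp add: U_def)
    qed
  qed
  moreover have "U i \<inter> U j = {}" if "i \<in> I" "j \<in> I" "i \<noteq> j" for i j
  proof -
    have False if "x \<in> U i" "x \<in> U j" for x
    proof -
      have "infdist x (C i) < infdist x (C j)" "infdist x (C j) < infdist x (C i)"
        using that \<open>i \<in> I\<close> \<open>j \<in> I\<close> \<open>i \<noteq> j\<close> unfolding U_def by auto
      then show False by simp
    qed
    then show ?thesis by blast
  qed
  ultimately have "(\<forall>i\<in>I. open (U i) \<and> C i \<subseteq> U i) \<and> (\<forall>i\<in>I. \<forall>j\<in>I. i \<noteq> j \<longrightarrow> U i \<inter> U j = {})"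
    by simp
  then show ?thesis by (rule exI[of _ U])
qed

context low_energy_limit
begin

lemma sum_hausdorff1_outer_le:
  fixes A U :: "'i \<Rightarrow> (real \<times> real) set" and t :: "'i \<Rightarrow> real"
  assumes s: "0 \<le> s" "s \<le> 1" and I: "finite I"
    and t: "\<And>i. i \<in> I \<Longrightarrow> t i > 0"
    and U: "\<And>i. i \<in> I \<Longrightarrow> open (U i) \<and> A i \<subseteq> U i" "\<And>i j. i \<in> I \<Longrightarrow> j \<in> I \<Longrightarrow> i \<noteq> j \<Longrightarrow> U i \<inter> U j = {}"
    and A: "\<And>i x. i \<in> I \<Longrightarrow> x \<in> A i \<Longrightarrow> x \<in> box (-s, -s) (1 - s, 1 - s) \<and> x \<in> jump_set w \<and>
         t i < jump_cost (trace_plus w x) (trace_minus w x)"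
  shows "(\<Sum>i\<in>I. ennreal (t i) * hausdorff1_outer (A i)) \<le> ennreal \<Lambda>"
proof (rule LIMSEQ_le_const2)
  show "(\<lambda>n. \<Sum>i\<in>I. ennreal (t i) * hausdorff1_pre (1 / Suc n) (A i)) \<longlonglongrightarrow>
      (\<Sum>i\<in>I. ennreal (t i) * hausdorff1_outer (A i))"
    by (intro tendsto_sum ennreal_tendsto_cmult hausdorff1_outer_tendsto) simp
  have "(\<Sum>i\<in>I. ennreal (t i) * hausdorff1_pre (1 / Suc n) (A i)) \<le> ennreal \<Lambda>" for n
  proof -
    have "(\<Sum>i\<in>I. ennreal (t i) * hausdorff1_pre (10 * (1 / (10 * real (Suc n)))) (A i)) \<le> ennreal \<Lambda>"
    proof (rule sum_hausdorff1_pre_le[where U=U, OF s I])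
      show "0 < 1 / (10 * real (Suc n))" by simp
      show "0 < t i" if "i \<in> I" for i using that by (rule t)
      show "open (U i) \<and> A i \<subseteq> U i" if "i \<in> I" for i using that by (rule U)
      show "U i \<inter> U j = {}" if "i \<in> I" "j \<in> I" "i \<noteq> j" for i j using that by (rule U)
      show "x \<in> box (-s, -s) (1 - s, 1 - s) \<and> x \<in> jump_set w \<and> t i < jump_cost (trace_plus w x) (trace_minus w x)"
        if "i \<in> I" "x \<in> A i" for i x using that by (rule A)
    qed
    moreover have "10 * (1 / (10 * real (Suc n))) = 1 / Suc n" by (simp add: field_simps)
    ultimately show ?thesis by (simp only:)
  qed
  then show "\<exists>N. \<forall>n\<ge>N. (\<Sum>i\<in>I. ennreal (t i) * hausdorff1_pre (1 / Suc n) (A i)) \<le> ennreal \<Lambda>"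
    by blast
qed

text \<open>Disjoint measurable sets need not have disjoint open neighbourhoods, but compact subsets
  of almost full measure do, and the loss is controlled by the sum of the weights.\<close>

lemma sum_hausdorff1_le:
  fixes A :: "'i \<Rightarrow> (real \<times> real) set" and t :: "'i \<Rightarrow> real"
  assumes s: "0 \<le> s" "s \<le> 1" and I: "finite I"
    and t: "\<And>i. i \<in> I \<Longrightarrow> t i > 0"
    and meas: "\<And>i. i \<in> I \<Longrightarrow> A i \<in> sets hausdorff1"
    and disj: "\<And>i j. i \<in> I \<Longrightarrow> j \<in> I \<Longrightarrow> i \<noteq> j \<Longrightarrow> A i \<inter> A j = {}"
    and A: "\<And>i x. i \<in> I \<Longrightarrow> x \<in> A i \<Longrightarrow> x \<in> box (-s, -s) (1 - s, 1 - s) \<and> x \<in> jump_set w \<and>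
         t i < jump_cost (trace_plus w x) (trace_minus w x)"
  shows "(\<Sum>i\<in>I. ennreal (t i) * emeasure hausdorff1 (A i)) \<le> ennreal \<Lambda>"
proof -
  define T where "T = (\<Sum>i\<in>I. t i)"
  have T: "T \<ge> 0" unfolding T_def by (intro sum_nonneg) (use t in \<open>auto intro: less_imp_le\<close>)
  have fin: "emeasure hausdorff1 (A i) < \<infinity>" if i: "i \<in> I" for i
  proof -
    \<comment> \<open>A single set needs no separation, so the whole plane serves as its
      neighbourhood. The resulting finiteness is what inner approximation by compact sets
      requires.\<close>
    have "(\<Sum>j\<in>{i}. ennreal (t j) * hausdorff1_outer (A j)) \<le> ennreal \<Lambda>"
      by (rule sum_hausdorff1_outer_le[OF s, where U="\<lambda>_. UNIV"]) (use t A i in auto)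
    then have "ennreal (t i) * emeasure hausdorff1 (A i) \<le> ennreal \<Lambda>"
      by (simp add: emeasure_hausdorff1[OF meas[OF i]])
    moreover have "ennreal (t i) \<noteq> 0" using t[OF i] by simp
    ultimately have "emeasure hausdorff1 (A i) \<noteq> top"
      by (auto simp: ennreal_mult_top top_unique)
    then show ?thesis by (simp add: less_top)
  qed
  show ?thesis
  proof (rule ennreal_le_epsilon)
    fix \<epsilon> :: real assume \<epsilon>: "0 < \<epsilon>"
    define \<kappa> where "\<kappa> = \<epsilon> / (T + 1)"
    have \<kappa>: "\<kappa> > 0" and \<kappa>T: "T * \<kappa> \<le> \<epsilon>" using \<epsilon> T by (simp_all add: \<kappa>_def field_simps)
    define C where "C i = (SOME C. compact C \<and> C \<subseteq> A i \<and>
        emeasure hausdorff1 (A i) \<le> emeasure hausdorff1 C + ennreal \<kappa>)" for i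
    have C: "compact (C i)" "C i \<subseteq> A i" "emeasure hausdorff1 (A i) \<le> emeasure hausdorff1 (C i) + ennreal \<kappa>"
      if i: "i \<in> I" for i
    proof -
      have "\<exists>C. compact C \<and> C \<subseteq> A i \<and> emeasure hausdorff1 (A i) \<le> emeasure hausdorff1 C + ennreal \<kappa>"
        using hausdorff1_inner_compact[OF meas[OF i] fin[OF i] \<kappa>] by blast
      from someI_ex[OF this] show "compact (C i)" "C i \<subseteq> A i"
        "emeasure hausdorff1 (A i) \<le> emeasure hausdorff1 (C i) + ennreal \<kappa>"
        unfolding C_def by blast+
    qed
    have Cm: "C i \<in> sets hausdorff1" if "i \<in> I" for i
      by (rule subsetD[OF borel_subset_sets_hausdorff1]) (use C(1)[OF that] in \<open>simp add: borel_compact\<close>)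
    \<comment> \<open>Empty compact sets have measure 0 and are dropped, since the separation needs
      nonempty ones.\<close>
    let ?I = "{i\<in>I. C i \<noteq> {}}"
    have fI: "finite ?I" using I by simp
    have cl: "closed (C i)" "C i \<noteq> {}" if "i \<in> ?I" for i
      using that C(1)[of i] by (auto intro: compact_imp_closed)
    have dC: "C i \<inter> C j = {}" if "i \<in> ?I" "j \<in> ?I" "i \<noteq> j" for i j
      using that disj[of i j] C(2)[of i] C(2)[of j] by blast
    have "\<exists>U. (\<forall>i\<in>?I. open (U i) \<and> C i \<subseteq> U i) \<and> (\<forall>i\<in>?I. \<forall>j\<in>?I. i \<noteq> j \<longrightarrow> U i \<inter> U j = {})"
      by (rule disjoint_open_neighbourhoods[OF fI cl dC])
    then obtain U where U: "\<forall>i\<in>?I. open (U i) \<and> C i \<subseteq> U i"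
      "\<forall>i\<in>?I. \<forall>j\<in>?I. i \<noteq> j \<longrightarrow> U i \<inter> U j = {}" by (elim exE conjE)
    have "(\<Sum>i\<in>I. ennreal (t i) * emeasure hausdorff1 (C i)) = (\<Sum>i\<in>?I. ennreal (t i) * emeasure hausdorff1 (C i))"
      using I by (intro sum.mono_neutral_right) auto
    also have "\<dots> = (\<Sum>i\<in>?I. ennreal (t i) * hausdorff1_outer (C i))"
      by (rule sum.cong[OF refl]) (use Cm in \<open>simp add: emeasure_hausdorff1\<close>)
    also have "\<dots> \<le> ennreal \<Lambda>"
    proof (rule sum_hausdorff1_outer_le[OF s fI _ U[rule_format]])
      show "0 < t i" if "i \<in> ?I" for i using that t by blast
      show "x \<in> box (-s, -s) (1 - s, 1 - s) \<and> x \<in> jump_set w \<and> t i < jump_cost (trace_plus w x) (trace_minus w x)"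
        if "i \<in> ?I" "x \<in> C i" for i x
      proof (rule A)
        show "i \<in> I" using that by blast
        then show "x \<in> A i" using that C(2) by blast
      qed
    qed
    finally have le: "(\<Sum>i\<in>I. ennreal (t i) * emeasure hausdorff1 (C i)) \<le> ennreal \<Lambda>" .
    have "(\<Sum>i\<in>I. ennreal (t i) * emeasure hausdorff1 (A i)) \<le>
        (\<Sum>i\<in>I. ennreal (t i) * (emeasure hausdorff1 (C i) + ennreal \<kappa>))"
      using C(3) by (intro sum_mono mult_left_mono) auto
    also have "\<dots> = (\<Sum>i\<in>I. ennreal (t i) * emeasure hausdorff1 (C i)) + (\<Sum>i\<in>I. ennreal (t i)) * ennreal \<kappa>"
      by (simp only: distrib_left sum.distrib sum_distrib_right)
    also have "(\<Sum>i\<in>I. ennreal (t i)) = ennreal T"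
      unfolding T_def by (rule sum_ennreal) (use t in \<open>auto intro: less_imp_le\<close>)
    also have "ennreal T * ennreal \<kappa> = ennreal (T * \<kappa>)"
      using T \<kappa> by (simp add: ennreal_mult)
    also have "(\<Sum>i\<in>I. ennreal (t i) * emeasure hausdorff1 (C i)) + ennreal (T * \<kappa>) \<le> ennreal \<Lambda> + ennreal \<epsilon>"
      by (intro add_mono le ennreal_leI \<kappa>T)
    finally show "(\<Sum>i\<in>I. ennreal (t i) * emeasure hausdorff1 (A i)) \<le> ennreal \<Lambda> + ennreal \<epsilon>" .
  qed
qed

text \<open>Each simple function below the integrand has finitely many level sets, which are
  measurable, disjoint and, for nonzero levels, contained in the jump set with the cost at least
  equal to the level. \<open>sum_hausdorff1_le\<close> bounds the resulting sum.\<close>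

lemma nn_integral_jump_cost_le:
  "(\<integral>\<^sup>+x\<in>jump_set w. ennreal (jump_cost (trace_plus w x) (trace_minus w x)) \<partial>hausdorff1) \<le> ennreal \<Lambda>"
  unfolding nn_integral_def
proof (rule SUP_least)
  fix f :: "real \<times> real \<Rightarrow> ennreal"
  assume f': "f \<in> {f. simple_function hausdorff1 f \<and>
     f \<le> (\<lambda>x. ennreal (jump_cost (trace_plus w x) (trace_minus w x)) * indicator (jump_set w) x)}"
  then have f: "simple_function hausdorff1 f" and
    le: "\<And>x. f x \<le> ennreal (jump_cost (trace_plus w x) (trace_minus w x)) * indicator (jump_set w) x"
    by (auto simp: le_fun_def)
  let ?Y = "range f - {0}"
  have Y: "finite ?Y" using simple_functionD(1)[OF f] by simp
  have pre: "f -` {y} \<in> sets hausdorff1" for y using simple_functionD(2)[OF f, of "{y}"] by simp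
  have top: "f x \<noteq> \<infinity>" for x
    using le[of x] by (cases "x \<in> jump_set w") (auto simp: top_unique)
  have jump: "x \<in> jump_set w \<and> f x \<le> ennreal (jump_cost (trace_plus w x) (trace_minus w x))" if "f x \<noteq> 0" for x
    using le[of x] that by (cases "x \<in> jump_set w") auto
  \<comment> \<open>Edge points of the unit square with a coordinate 0 are interior to the shifted
    squares. Their intersections with the unit square increase to it as the shift decreases, and
    \<open>n + 2\<close> keeps the shift strictly between 0 and 1.\<close>
  define \<sigma> where "\<sigma> n = 1 / real (n + 2)" for n
  have \<sigma>: "0 < \<sigma> n" "\<sigma> n < 1" "\<sigma> (Suc n) \<le> \<sigma> n" "\<sigma> n \<le> 1 / Suc n" for n
    by (simp_all add: \<sigma>_def frac_le)
  define S where "S n = box (- \<sigma> n, - \<sigma> n) (1 - \<sigma> n, 1 - \<sigma> n)" for n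
  have S: "open (S n)" for n unfolding S_def by (rule open_box)
  have Sm: "S n \<in> sets hausdorff1" for n
    using S[of n] by (intro subsetD[OF borel_subset_sets_hausdorff1]) (rule borel_open)
  have unit: "unit_square \<subseteq> (\<Union>n. unit_square \<inter> S n)"
  proof
    fix x :: "real \<times> real" assume x: "x \<in> unit_square"
    then have "0 < min (1 - fst x) (1 - snd x)" by (auto simp: unit_square_def)
    then obtain n where "1 / Suc n < min (1 - fst x) (1 - snd x)" using nat_approx_posE by blast
    then have "x \<in> S n" using x \<sigma>(1)[of n] \<sigma>(4)[of n]
      by (cases x) (simp add: S_def unit_square_def box_prod)
    then show "x \<in> (\<Union>n. unit_square \<inter> S n)" using x by blast
  qed
  have inc: "unit_square \<inter> S n \<subseteq> unit_square \<inter> S (Suc n)" for n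
    using \<sigma>(1)[of "Suc n"] \<sigma>(3)[of n] by (auto simp: S_def unit_square_def box_prod)
  \<comment> \<open>The density estimate needs levels strictly below the cost, while the simple
    function may attain it; the factor \<open>\<theta>\<close> below 1 restores strictness and tends
    to 1 at the end.\<close>
  have key: "(\<Sum>y\<in>?Y. ennreal (\<theta> * enn2real y) * emeasure hausdorff1 (f -` {y} \<inter> S n)) \<le> ennreal \<Lambda>"
    if \<theta>: "0 < \<theta>" "\<theta> < 1" for \<theta> n
  proof (rule sum_hausdorff1_le[OF _ _ Y])
    show "0 \<le> \<sigma> n" "\<sigma> n \<le> 1" using \<sigma>(1,2)[of n] by simp_all
    show pos: "0 < \<theta> * enn2real y" if "y \<in> ?Y" for y
    proof -
      have "0 < y" "y < top" using that top by (auto simp: zero_less_iff_neq_zero less_top)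
      then show ?thesis using \<theta> by (simp add: enn2real_positive_iff)
    qed
    show "f -` {y} \<inter> S n \<in> sets hausdorff1" for y using pre Sm by (rule sets.Int)
    show "f -` {y} \<inter> S n \<inter> (f -` {z} \<inter> S n) = {}" if "y \<noteq> z" for y z using that by auto
    fix y x assume y: "y \<in> ?Y" and x: "x \<in> f -` {y} \<inter> S n"
    have "f x = y" "f x \<noteq> 0" using x y by auto
    have j: "x \<in> jump_set w" "y \<le> ennreal (jump_cost (trace_plus w x) (trace_minus w x))"
      using jump[OF \<open>f x \<noteq> 0\<close>] \<open>f x = y\<close> by auto
    have "enn2real y \<le> jump_cost (trace_plus w x) (trace_minus w x)"
      using enn2real_mono[OF j(2)] jump_cost_nonneg by simp
    moreover have "\<theta> * enn2real y < 1 * enn2real y"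
      using pos[OF y] \<theta> by (intro mult_strict_right_mono) (auto simp: zero_less_mult_iff)
    ultimately show "x \<in> box (- \<sigma> n, - \<sigma> n) (1 - \<sigma> n, 1 - \<sigma> n) \<and>
        x \<in> jump_set w \<and> \<theta> * enn2real y < jump_cost (trace_plus w x) (trace_minus w x)"
      using x j(1) by (simp add: S_def)
  qed
  have all: "(\<Sum>y\<in>?Y. ennreal (\<theta> * enn2real y) * emeasure hausdorff1 (f -` {y})) \<le> ennreal \<Lambda>"
    if \<theta>: "0 < \<theta>" "\<theta> < 1" for \<theta>
  proof (rule LIMSEQ_le_const2)
    have lim: "(\<lambda>n. emeasure hausdorff1 (f -` {y} \<inter> S n)) \<longlonglongrightarrow> emeasure hausdorff1 (f -` {y})" if y: "y \<in> ?Y" for y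
    proof -
      have us: "f -` {y} \<subseteq> unit_square" using y jump by (auto simp: jump_set_def)
      have "(\<lambda>n. emeasure hausdorff1 (f -` {y} \<inter> S n)) \<longlonglongrightarrow> emeasure hausdorff1 (\<Union>n. f -` {y} \<inter> S n)"
      proof (rule Lim_emeasure_incseq)
        show "range (\<lambda>n. f -` {y} \<inter> S n) \<subseteq> sets hausdorff1" using pre Sm by auto
        show "incseq (\<lambda>n. f -` {y} \<inter> S n)"
          by (rule incseq_SucI) (use inc us in blast)
      qed
      moreover have "(\<Union>n. f -` {y} \<inter> S n) = f -` {y}" using us unit by blast
      ultimately show ?thesis by simp
    qed
    show "(\<lambda>n. \<Sum>y\<in>?Y. ennreal (\<theta> * enn2real y) * emeasure hausdorff1 (f -` {y} \<inter> S n)) \<longlonglongrightarrow>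
        (\<Sum>y\<in>?Y. ennreal (\<theta> * enn2real y) * emeasure hausdorff1 (f -` {y}))"
      by (intro tendsto_sum ennreal_tendsto_cmult lim) simp_all
    show "\<exists>N. \<forall>n\<ge>N. (\<Sum>y\<in>?Y. ennreal (\<theta> * enn2real y) * emeasure hausdorff1 (f -` {y} \<inter> S n)) \<le> ennreal \<Lambda>"
      using key[OF \<theta>] by blast
  qed
  have "integral\<^sup>S hausdorff1 f = (\<Sum>y\<in>?Y. y * emeasure hausdorff1 (f -` {y}))"
    unfolding simple_integral_def using simple_functionD(1)[OF f]
    by (simp, intro sum.mono_neutral_right) auto
  also have "\<dots> = (\<Sum>y\<in>?Y. ennreal (enn2real y) * emeasure hausdorff1 (f -` {y}))"
    using top by (intro sum.cong[OF refl]) (auto simp: less_top)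
  finally have eq: "integral\<^sup>S hausdorff1 f = (\<Sum>y\<in>?Y. ennreal (enn2real y) * emeasure hausdorff1 (f -` {y}))" .
  have \<theta>: "ennreal \<theta> * integral\<^sup>S hausdorff1 f \<le> ennreal \<Lambda>" if "0 < \<theta>" "\<theta> < 1" for \<theta> :: real
    using all[OF that] that unfolding eq by (simp add: sum_distrib_left ennreal_mult mult.assoc)
  show "integral\<^sup>S hausdorff1 f \<le> ennreal \<Lambda>"
  proof (rule LIMSEQ_le_const2)
    have "(\<lambda>n. 1 - 1 / real (n + 2)) \<longlonglongrightarrow> 1 - 0"
      by (intro tendsto_intros LIMSEQ_ignore_initial_segment[of "\<lambda>n. 1 / real n"] lim_1_over_n)
    then have "(\<lambda>n. ennreal (1 - 1 / real (n + 2))) \<longlonglongrightarrow> ennreal 1" by (intro tendsto_ennrealI) simp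
    then have "(\<lambda>n. ennreal (1 - 1 / real (n + 2)) * integral\<^sup>S hausdorff1 f) \<longlonglongrightarrow> ennreal 1 * integral\<^sup>S hausdorff1 f"
      by (rule tendsto_mult_ennreal[OF _ tendsto_const]) auto
    then show "(\<lambda>n. ennreal (1 - 1 / real (n + 2)) * integral\<^sup>S hausdorff1 f) \<longlonglongrightarrow> integral\<^sup>S hausdorff1 f"
      by simp
    show "\<exists>N. \<forall>n\<ge>N. ennreal (1 - 1 / real (n + 2)) * integral\<^sup>S hausdorff1 f \<le> ennreal \<Lambda>"
      by (intro exI allI impI \<theta>) auto
  qed
qed

end

lemma energy_le_obtain:
  assumes "energy \<epsilon> v \<le> ennreal \<Lambda>" "0 \<le> \<Lambda>"
  shows "\<exists>g h. inv_abs_pd1_eta_in_L2 v g \<and> weak_pd1_in_L2 v h \<and>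
     1/2 * (\<integral>x. 1/\<epsilon> * (g x)\<^sup>2 + \<epsilon> * (h x)\<^sup>2 \<partial>torus) \<le> \<Lambda>"
proof -
  let ?g = "SOME g. inv_abs_pd1_eta_in_L2 v g" and ?h = "SOME h. weak_pd1_in_L2 v h"
  have ex: "(\<exists>g. inv_abs_pd1_eta_in_L2 v g) \<and> (\<exists>h. weak_pd1_in_L2 v h)"
    using assms(1) unfolding energy_def by (auto simp: top_unique split: if_splits)
  have "inv_abs_pd1_eta_in_L2 v ?g" by (rule someI_ex[OF conjunct1[OF ex]])
  moreover have "weak_pd1_in_L2 v ?h" by (rule someI_ex[OF conjunct2[OF ex]])
  moreover have "1/2 * (\<integral>x. 1/\<epsilon> * (?g x)\<^sup>2 + \<epsilon> * (?h x)\<^sup>2 \<partial>torus) \<le> \<Lambda>"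
    using assms(1) unfolding energy_def if_P[OF ex] Let_def ennreal_le_iff[OF assms(2)] .
  ultimately show ?thesis by blast
qed

theorem theorem3p4:
  fixes \<epsilon> :: "nat \<Rightarrow> real"
    and wn :: "nat \<Rightarrow> real \<times> real \<Rightarrow> real"
    and w :: "real \<times> real \<Rightarrow> real"
  assumes "\<And>n. \<epsilon> n > 0" and "decseq \<epsilon>" and "\<epsilon> \<longlonglongrightarrow> 0"
    and "\<And>n. Lp_torus 2 (wn n)"
    and "\<And>n. vanishing_mean1 (distr_of (wn n))"
    and "\<And>n. \<exists>h. weak_pd1_in_L2 (wn n) h"
    and "BV_torus w" and "Linf_torus w"
    and "tendsto_Lp_torus 3 wn w"
  shows "liminf (\<lambda>n. energy (\<epsilon> n) (wn n)) \<ge>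
    (\<integral>\<^sup>+x\<in>jump_set w. ennreal (\<bar>trace_plus w x - trace_minus w x\<bar> ^ 3 /
        (12 * sqrt (1 + 1/4 * (trace_plus w x + trace_minus w x)\<^sup>2))) \<partial>hausdorff1)"
proof (rule dense_ge)
  fix c assume c: "liminf (\<lambda>n. energy (\<epsilon> n) (wn n)) < c"
  show "(\<integral>\<^sup>+x\<in>jump_set w. ennreal (\<bar>trace_plus w x - trace_minus w x\<bar> ^ 3 /
        (12 * sqrt (1 + 1/4 * (trace_plus w x + trace_minus w x)\<^sup>2))) \<partial>hausdorff1) \<le> c"
  proof (cases c)
    case (real \<Lambda>)
    \<comment> \<open>As \<open>c\<close> exceeds the lower limit, infinitely many energies lie
      below \<open>c\<close>; the corresponding subsequence has the uniform bound
      \<open>\<Lambda>\<close> and the same limit \<open>w\<close>.\<close>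
    have "\<not> (\<forall>\<^sub>F n in sequentially. c \<le> energy (\<epsilon> n) (wn n))"
      using c Liminf_bounded[of c "\<lambda>n. energy (\<epsilon> n) (wn n)" sequentially] by (auto simp: not_le[symmetric])
    then obtain r :: "nat \<Rightarrow> nat" where r: "strict_mono r" "\<And>n. \<not> c \<le> energy (\<epsilon> (r n)) (wn (r n))"
      using not_eventually_sequentiallyD by blast
    let ?P = "\<lambda>n g h. inv_abs_pd1_eta_in_L2 (wn (r n)) g \<and> weak_pd1_in_L2 (wn (r n)) h \<and>
       1/2 * (\<integral>x. 1/\<epsilon> (r n) * (g x)\<^sup>2 + \<epsilon> (r n) * (h x)\<^sup>2 \<partial>torus) \<le> \<Lambda>"
    have "\<exists>g h. ?P n g h" for n
      using r(2)[of n] real by (intro energy_le_obtain) auto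
    then have "\<exists>g. \<forall>n. \<exists>h. ?P n (g n) h" by (intro choice allI)
    then obtain g where "\<forall>n. \<exists>h. ?P n (g n) h" ..
    then have "\<exists>h. \<forall>n. ?P n (g n) (h n)" by (rule choice)
    then obtain h where "\<forall>n. ?P n (g n) (h n)" ..
    then have gh: "inv_abs_pd1_eta_in_L2 (wn (r n)) (g n)" "weak_pd1_in_L2 (wn (r n)) (h n)"
       "1/2 * (\<integral>x. 1/\<epsilon> (r n) * (g n x)\<^sup>2 + \<epsilon> (r n) * (h n x)\<^sup>2 \<partial>torus) \<le> \<Lambda>" for n
      by simp_all
    obtain M where M: "AE x in torus. \<bar>w x\<bar> \<le> M" using assms(8) unfolding Linf_torus_def by blast
    interpret low_energy_limit "\<lambda>n. \<epsilon> (r n)" "\<lambda>n. wn (r n)" g h w \<Lambda> "max M 0"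
    proof (rule low_energy_limit.intro)
      show "burgers_defect (wn (r n)) (g n) (h n)" for n
        by (rule burgers_defect.intro; rule assms gh)
      show "0 < \<epsilon> (r n)" for n by (rule assms)
      show "(\<lambda>n. \<epsilon> (r n)) \<longlonglongrightarrow> 0"
        using LIMSEQ_subseq_LIMSEQ[OF assms(3) r(1)] by (simp add: o_def)
      show "1/2 * (\<integral>x. 1/\<epsilon> (r n) * (g n x)\<^sup>2 + \<epsilon> (r n) * (h n x)\<^sup>2 \<partial>torus) \<le> \<Lambda>" for n by (rule gh)
      show "tendsto_Lp_torus 3 (\<lambda>n. wn (r n)) w"
        using assms(9) LIMSEQ_subseq_LIMSEQ[OF _ r(1), of "\<lambda>n. \<integral>x. \<bar>wn n x - w x\<bar> ^ 3 \<partial>torus" 0]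
        unfolding tendsto_Lp_torus_def o_def by blast
      show "AE x in torus. \<bar>w x\<bar> \<le> max M 0" using M by eventually_elim simp
    qed simp
    show ?thesis
      using nn_integral_jump_cost_le unfolding jump_cost_def real(2) .
  qed simp
qed

end
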